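(* Let $\Omega\subset\mathbb{R}^n$, $n>2$, be a bounded domain and let $\mathbf{O}^{(1)},\dots,\mathbf{O}^{(N)}$ be distinct interior points of $\Omega$ such that the minimum distance between $\mathbf{O}^{(j)}$, $j=1,\dots,N$, and the points of $\partial\Omega$ is equal to $1$. Let $\omega^{(j)}$, $j=1,\dots,N$, be bounded domains in $\mathbb{R}^n$ containing the origin $\mathbf{O}$, such that the distance between $\mathbf{O}$ and the points of $\partial\omega^{(j)}$ does not exceed $1$. For small $\varepsilon>0$ put $\omega^{(j)}_\varepsilon=\{\mathbf{x}:\varepsilon^{-1}(\mathbf{x}-\mathbf{O}^{(j)})\in\omega^{(j)}\}$ and $\Omega_\varepsilon=\Omega\setminus\bigcup_j\overline{\omega}^{(j)}_\varepsilon$. Let $G_\varepsilon$, $G$ and $\mathfrak{G}^{(j)}$ be Green's functions of the Dirichlet problems for the Laplacian in $\Omega_\varepsilon$, $\Omega$ and $\mathbb{R}^n\setminus\overline{\omega}^{(j)}$, respectively. Let $H$ be the regular part of $G$, and $P^{(j)}$ the harmonic capacitary potentials of the sets $\overline{\omega}^{(j)}$. Then, as $\varepsilon\to0$, $$ G_\varepsilon(\mathbf{x},\mathbf{y})=G(\mathbf{x},\mathbf{y})+\varepsilon^{2-n}\sum_{j=1}^N\mathfrak{G}^{(j)}\Big(\frac{\mathbf{x}-\mathbf{O}^{(j)}}{\varepsilon},\frac{\mathbf{y}-\mathbf{O}^{(j)}}{\varepsilon}\Big)-\frac{N}{(n-2)|S^{n-1}||\mathbf{x}-\mathbf{y}|^{n-2}}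 $$ $$ +\sum_{j=1}^N\Big\{H(\mathbf{O}^{(j)},\mathbf{y})P^{(j)}\Big(\frac{\mathbf{x}-\mathbf{O}^{(j)}}{\varepsilon}\Big)+H(\mathbf{x},\mathbf{O}^{(j)})P^{(j)}\Big(\frac{\mathbf{y}-\mathbf{O}^{(j)}}{\varepsilon}\Big) $$ $$ -H(\mathbf{O}^{(j)},\mathbf{O}^{(j)})P^{(j)}\Big(\frac{\mathbf{x}-\mathbf{O}^{(j)}}{\varepsilon}\Big)P^{(j)}\Big(\frac{\mathbf{y}-\mathbf{O}^{(j)}}{\varepsilon}\Big)-\varepsilon^{n-2}\,\mathrm{cap}\,\overline{\omega}^{(j)}\,H(\mathbf{x},\mathbf{O}^{(j)})H(\mathbf{O}^{(j)},\mathbf{y})\Big\} $$ $$ +\sum_{j=1}^N\ \sum_{1\le i\le N,\ i\ne j}G(\mathbf{O}^{(j)},\mathbf{O}^{(i)})P^{(j)}\Big(\frac{\mathbf{x}-\mathbf{O}^{(j)}}{\varepsilon}\Big)P^{(i)}\Big(\frac{\mathbf{y}-\mathbf{O}^{(i)}}{\varepsilon}\Big) $$ $$ +O\!\left(\sum_{j=1}^N\frac{\varepsilon^{n-1}}{(\min\{|\mathbf{x}-\mathbf{O}^{(j)}|,|\mathbf{y}-\mathbf{O}^{(j)}|\})^{n-2}}\right) $$ uniformly with respect to $\mathbf{x}$ and $\mathbf{y}$ in $\Omega_\varepsilon$. (The remainder term is $O(\varepsilon)$ when $\mathbf{x}$ or $\mathbf{y}$ lies on $\partial(\bigcup_j\omega^{(j)}_\varepsilon)$,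 and $O(\varepsilon^{n-1})$ when $\mathbf{x}$ and $\mathbf{y}$ lie on $\partial\Omega$.)
   Context: Green's functions are normalised by $-\Delta_xG(\mathbf{x},\mathbf{y})=\delta(\mathbf{x}-\mathbf{y})$, with zero Dirichlet boundary values, and with decay at infinity in the case of the exterior domains $\mathbb{R}^n\setminus\overline{\omega}^{(j)}$. $|S^{n-1}|$ is the $(n-1)$-dimensional measure of the unit sphere in $\mathbb{R}^n$. The regular part of $G$ is $H(\mathbf{x},\mathbf{y})=((n-2)|S^{n-1}|)^{-1}|\mathbf{x}-\mathbf{y}|^{2-n}-G(\mathbf{x},\mathbf{y})$. The harmonic capacitary potential $P^{(j)}$ of $\overline{\omega}^{(j)}$ is the function harmonic in $\mathbb{R}^n\setminus\overline{\omega}^{(j)}$, equal to $1$ on $\partial\omega^{(j)}$ and tending to $0$ at infinity; $\mathrm{cap}\,\overline{\omega}^{(j)}=\int_{\mathbb{R}^n\setminus\overline{\omega}^{(j)}}|\nabla P^{(j)}|^2\,d\boldsymbol{\xi}$ is the harmonic capacity. "Uniformly" means that the constant in the $O$-term is independent of $\mathbf{x},\mathbf{y}$ and $\varepsilon$. *)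

theory Defs
  imports "HOL-Analysis.Analysis"
begin

section \<open>Partial derivatives, smoothness, harmonic functions\<close>

definition partial :: "'a::euclidean_space \<Rightarrow> ('a \<Rightarrow> real) \<Rightarrow> 'a \<Rightarrow> real" where
  "partial b f = (\<lambda>x. frechet_derivative f (at x) b)"

fun partials :: "'a::euclidean_space list \<Rightarrow> ('a \<Rightarrow> real) \<Rightarrow> 'a \<Rightarrow> real" where
  "partials [] f = f"
| "partials (b # bs) f = partial b (partials bs f)"

definition gradient :: "('a::euclidean_space \<Rightarrow> real) \<Rightarrow> 'a \<Rightarrow> 'a" where
  "gradient f x = (\<Sum>b\<in>Basis. partial b f x *\<^sub>R b)"

definition laplacian :: "('a::euclidean_space \<Rightarrow> real) \<Rightarrow> 'a \<Rightarrow> real" where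
  "laplacian f x = (\<Sum>b\<in>Basis. partial b (partial b f) x)"

definition C2_on :: "'a::euclidean_space set \<Rightarrow> ('a \<Rightarrow> real) \<Rightarrow> bool" where
  "C2_on D f \<longleftrightarrow>
     (\<forall>x\<in>D. f differentiable (at x)) \<and>
     (\<forall>b\<in>Basis. \<forall>x\<in>D. partial b f differentiable (at x)) \<and>
     (\<forall>b\<in>Basis. \<forall>b'\<in>Basis. continuous_on D (partial b' (partial b f)))"

text \<open>Used for open \<open>D\<close> only.\<close>
definition harmonic_in :: "'a::euclidean_space set \<Rightarrow> ('a \<Rightarrow> real) \<Rightarrow> bool" where
  "harmonic_in D f \<longleftrightarrow> C2_on D f \<and> (\<forall>x\<in>D. laplacian f x = 0)"

text \<open>Infinitely differentiable: every iterated partial derivative is differentiable everywhere.\<close>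
definition smooth :: "('a::euclidean_space \<Rightarrow> real) \<Rightarrow> bool" where
  "smooth f \<longleftrightarrow> (\<forall>bs. set bs \<subseteq> Basis \<longrightarrow> (\<forall>x. partials bs f differentiable (at x)))"

definition test_function_on :: "'a::euclidean_space set \<Rightarrow> ('a \<Rightarrow> real) \<Rightarrow> bool" where
  "test_function_on D \<phi> \<longleftrightarrow>
     smooth \<phi> \<and> compact (closure {x. \<phi> x \<noteq> 0}) \<and> closure {x. \<phi> x \<noteq> 0} \<subseteq> D"

section \<open>Surface measure on the unit sphere and the fundamental solution\<close>

text \<open>The surface measure of a Borel set \<open>A\<close> of unit vectors in dimension \<open>n\<close>, in the normalisation
  of integration in polar coordinates: \<open>n\<close> times the volume of the cone over \<open>A\<close>.\<close>
definition sphere_measure :: "'a::euclidean_space set \<Rightarrow> real" where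
  "sphere_measure A =
     real DIM('a) * measure lebesgue {r *\<^sub>R \<theta> | r \<theta>. 0 < r \<and> r \<le> 1 \<and> \<theta> \<in> A}"

text \<open>Used in dimension greater than 2 only.\<close>
definition fundamental_solution :: "'a::euclidean_space \<Rightarrow> real" where
  "fundamental_solution x =
     1 / (real (DIM('a) - 2) * sphere_measure (sphere (0::'a) 1) * norm x ^ (DIM('a) - 2))"

section \<open>Green's functions\<close>

text \<open>\<open>- \<Delta> u = \<delta>(\<cdot> - y)\<close> in \<open>D\<close> in the sense of distributions, for locally integrable \<open>u\<close>.\<close>
definition neg_laplacian_eq_delta ::
    "'a::euclidean_space set \<Rightarrow> ('a \<Rightarrow> real) \<Rightarrow> 'a \<Rightarrow> bool" where
  "neg_laplacian_eq_delta D u y \<longleftrightarrow>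
     (\<forall>K. compact K \<and> K \<subseteq> D \<longrightarrow> set_integrable lborel K u) \<and>
     (\<forall>\<phi>. test_function_on D \<phi> \<longrightarrow> (LINT x:D|lborel. u x * (- laplacian \<phi> x)) = \<phi> y)"

text \<open>The distributional equation determines \<open>G(\<cdot>,y)\<close> only almost everywhere; harmonicity away from
  the pole selects the representative for which pointwise values make sense. Values on the diagonal
  and outside \<open>D\<close> are irrelevant. The condition at infinity is void when \<open>D\<close> is bounded, since
  then the filter is trivial.\<close>
definition green_function ::
    "'a::euclidean_space set \<Rightarrow> ('a \<Rightarrow> 'a \<Rightarrow> real) \<Rightarrow> bool" where
  "green_function D G \<longleftrightarrow>
     (\<forall>y\<in>D.
        neg_laplacian_eq_delta D (\<lambda>x. G x y) y \<and>
        harmonic_in (D - {y}) (\<lambda>x. G x y) \<and>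
        (\<forall>z\<in>frontier D. ((\<lambda>x. G x y) \<longlongrightarrow> 0) (at z within D)) \<and>
        ((\<lambda>x. G x y) \<longlongrightarrow> 0) (inf at_infinity (principal D)))"

text \<open>On the diagonal the singularities cancel and the value is the one given by continuity.\<close>
definition regular_part ::
    "('a::euclidean_space \<Rightarrow> 'a \<Rightarrow> real) \<Rightarrow> 'a \<Rightarrow> 'a \<Rightarrow> real" where
  "regular_part G x y =
     (if x = y then Lim (at y) (\<lambda>x'. fundamental_solution (x' - y) - G x' y)
      else fundamental_solution (x - y) - G x y)"

section \<open>Capacitary potentials and capacity\<close>

definition capacitary_potential ::
    "'a::euclidean_space set \<Rightarrow> ('a \<Rightarrow> real) \<Rightarrow> bool" where
  "capacitary_potential \<omega> P \<longleftrightarrow>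
     harmonic_in (- closure \<omega>) P \<and>
     (\<forall>z\<in>frontier \<omega>. (P \<longlongrightarrow> 1) (at z within (- closure \<omega>))) \<and>
     (P \<longlongrightarrow> 0) at_infinity"

text \<open>The Dirichlet integral over the exterior; it is the harmonic capacity of the closure of
  \<open>\<omega>\<close> when \<open>P\<close> is the capacitary potential.\<close>
definition capacity_integral ::
    "'a::euclidean_space set \<Rightarrow> ('a \<Rightarrow> real) \<Rightarrow> real" where
  "capacity_integral \<omega> P = (LINT \<xi>:(- closure \<omega>)|lborel. (norm (gradient P \<xi>))\<^sup>2)"

end

theory Submission
  imports Defs "HOL-Computational_Algebra.Polynomial"
begin

text \<open>Fix \<open>y\<close> and let \<open>R(x)\<close> be the difference of \<open>G\<^sub>\<epsilon>(x,y)\<close> and the asymptotic formula. The fundamental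
  solutions \<open>F\<close> contained in \<open>G\<^sub>\<epsilon>\<close>, in \<open>G\<close> and in the \<open>N\<close> exterior Green's functions cancel against the
  term with the factor \<open>N\<close>, so \<open>R\<close> is harmonic in \<open>\<Omega>\<^sub>\<epsilon>\<close> off \<open>y\<close> and bounded near \<open>y\<close>; a bounded pole does
  not disturb the maximum principle (\<open>maximum_principle_pole\<close>). It therefore suffices to estimate \<open>R\<close> on
  the boundary of \<open>\<Omega>\<^sub>\<epsilon>\<close>, against the barrier \<open>T(x) = \<Sum> \<epsilon>^(n-1) |x - O\<^sub>j|^(2-n)\<close>, which is harmonic too:
  on \<open>\<partial>\<Omega>\<close> one has \<open>|R(x)| \<le> C T(y)\<close>, on the boundaries of the holes \<open>|R(x)| \<le> C T(x)\<close>. Hence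
  \<open>|R(x)| \<le> C (T(x) + T(y))\<close> everywhere (\<open>perforated_green_estimate\<close>).

  The boundary estimates rest on three facts. Seen from a distance, a hole of size \<open>\<epsilon>\<close> changes the free
  Green's function by \<open>F(x - O\<^sub>j) P\<^sub>j(y)\<close> up to a relative error \<open>\<epsilon>\<close> (\<open>exterior_green_function_far\<close>); this is
  the maximum principle in the second variable, and so it uses the symmetry of Green's functions. The
  capacitary potential behaves at infinity like the capacity times \<open>F\<close>
  (\<open>capacitary_potential_expansion\<close>). Finally, near \<open>O\<^sub>j\<close> the regular part \<open>H(\<cdot>,y)\<close> is bounded and
  Lipschitz uniformly in \<open>y\<close> (\<open>regular_part_lipschitz\<close>). With these, the terms of the formula cancel
  pairwise: on \<open>\<partial>\<Omega>\<close>, where \<open>G\<close> vanishes and \<open>H = F\<close>, the terms \<open>H P\<^sub>j\<close> offset the effect of the holes and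
  the capacity term; on the boundary of the hole \<open>k\<close>, where \<open>P\<^sub>k = 1\<close> and \<open>g\<^sub>k = 0\<close>, the values of \<open>H\<close> at the
  centres replace those at \<open>x\<close>, and the double sum offsets the terms \<open>G(x,O\<^sub>j) P\<^sub>j(y)\<close> of the other holes.

  No regularity of the boundaries is available, and Green's functions solve their equation only in the
  distributional sense. Both difficulties are met by testing the equation with \<open>C\<^sup>2\<close> functions of compact
  support (\<open>weak_pole\<close>). Cutoffs of the fundamental solution give a representation formula
  (\<open>weak_pole_representation\<close>) with an explicit kernel, which yields the interior estimates and
  the expansion at infinity; truncations of the solutions themselves, which vanish near the
  boundary, give the symmetry (\<open>green_function_symmetric\<close>) and identify the Dirichlet integral with the
  flux at infinity (\<open>capacity_integral_eq_flux\<close>).\<close>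

section \<open>Second-order calculus\<close>

text \<open>\<open>g\<close> is the gradient of \<open>f\<close> and \<open>k b\<close> the gradient of the partial derivative of \<open>f\<close> along \<open>b\<close>.
  Carrying these vectors along turns the rules for sums, products and compositions into
  applications of the usual rules for \<open>has_derivative\<close>.\<close>
definition C2_data ::
    "'a::euclidean_space set \<Rightarrow> ('a \<Rightarrow> real) \<Rightarrow> ('a \<Rightarrow> 'a) \<Rightarrow> ('a \<Rightarrow> 'a \<Rightarrow> 'a) \<Rightarrow> bool" where
  "C2_data D f g k \<longleftrightarrow>
     (\<forall>x\<in>D. (f has_derivative (\<lambda>h. g x \<bullet> h)) (at x)) \<and>
     (\<forall>b\<in>Basis. \<forall>x\<in>D. ((\<lambda>x. g x \<bullet> b) has_derivative (\<lambda>h. k b x \<bullet> h)) (at x)) \<and>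
     (\<forall>b\<in>Basis. continuous_on D (k b))"

lemma gradient_inner_Basis: "b \<in> Basis \<Longrightarrow> gradient f x \<bullet> b = partial b f x"
  by (simp add: gradient_def inner_sum_left inner_Basis if_distrib cong: if_cong)

lemma gradient_eq:
  assumes "(f has_derivative (\<lambda>h. g \<bullet> h)) (at x)"
  shows "gradient f x = g"
proof -
  have "frechet_derivative f (at x) = (\<lambda>h. g \<bullet> h)"
    using assms by (rule frechet_derivative_at[symmetric])
  then show ?thesis
    by (simp add: gradient_def partial_def euclidean_representation)
qed

lemma has_derivative_gradient:
  assumes "f differentiable (at x)"
  shows "(f has_derivative (\<lambda>h. gradient f x \<bullet> h)) (at x)"
proof -
  have d: "(f has_derivative frechet_derivative f (at x)) (at x)"
    using assms frechet_derivative_works by blast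
  then have lin: "linear (frechet_derivative f (at x))"
    by (rule has_derivative_linear)
  have "frechet_derivative f (at x) h = gradient f x \<bullet> h" for h
  proof -
    have "frechet_derivative f (at x) (\<Sum>b\<in>Basis. (h \<bullet> b) *\<^sub>R b)
        = (\<Sum>b\<in>Basis. (h \<bullet> b) *\<^sub>R frechet_derivative f (at x) b)"
      by (simp add: linear_sum[OF lin] linear_scale[OF lin])
    then have "frechet_derivative f (at x) h
        = (\<Sum>b\<in>Basis. (h \<bullet> b) *\<^sub>R frechet_derivative f (at x) b)"
      by (simp only: euclidean_representation)
    then show ?thesis
      by (subst inner_commute)
        (simp add: gradient_def partial_def inner_sum_right mult.commute)
  qed
  then show ?thesis using d by (metis (no_types, lifting) ext)
qed

lemma C2_data_gradient:
  assumes "C2_data D f g k" "x \<in> D"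
  shows "gradient f x = g x"
  using assms gradient_eq unfolding C2_data_def by blast

lemma C2_data_partial_derivative:
  assumes D: "open D" and d: "C2_data D f g k" and x: "x \<in> D" and b: "b \<in> Basis"
  shows "(partial b f has_derivative (\<lambda>h. k b x \<bullet> h)) (at x)"
proof -
  have "((\<lambda>x. g x \<bullet> b) has_derivative (\<lambda>h. k b x \<bullet> h)) (at x)"
    using d x b unfolding C2_data_def by blast
  then show ?thesis
  proof (rule has_derivative_transform_within_open[OF _ D x])
    show "g y \<bullet> b = partial b f y" if "y \<in> D" for y
      using C2_data_gradient[OF d that] gradient_inner_Basis[OF b, of f y] by simp
  qed
qed

lemma C2_data_laplacian:
  assumes D: "open D" and d: "C2_data D f g k" and x: "x \<in> D"
  shows "laplacian f x = (\<Sum>b\<in>Basis. k b x \<bullet> b)"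
proof -
  have "partial b (partial b f) x = k b x \<bullet> b" if "b \<in> Basis" for b
    using gradient_eq[OF C2_data_partial_derivative[OF D d x that]]
      gradient_inner_Basis[OF that, of "partial b f" x] by simp
  then show ?thesis unfolding laplacian_def by simp
qed

lemma C2_data_imp_C2_on:
  assumes D: "open D" and d: "C2_data D f g k"
  shows "C2_on D f"
  unfolding C2_on_def
proof (intro conjI ballI)
  show "f differentiable (at x)" if "x \<in> D" for x
    using d that unfolding C2_data_def differentiable_def by blast
  show "partial b f differentiable (at x)" if "b \<in> Basis" "x \<in> D" for b x
    using C2_data_partial_derivative[OF D d that(2,1)] unfolding differentiable_def by blast
  show "continuous_on D (partial b' (partial b f))" if b: "b \<in> Basis" and b': "b' \<in> Basis" for b b'
  proof -
    have "partial b' (partial b f) x = k b x \<bullet> b'" if "x \<in> D" for x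
      using gradient_eq[OF C2_data_partial_derivative[OF D d that b]]
        gradient_inner_Basis[OF b', of "partial b f" x] by simp
    moreover have "continuous_on D (\<lambda>x. k b x \<bullet> b')"
      using d b unfolding C2_data_def by (intro continuous_intros) auto
    ultimately show ?thesis by (simp cong: continuous_on_cong)
  qed
qed

lemma C2_on_imp_C2_data:
  assumes f: "C2_on D f"
  shows "C2_data D f (gradient f) (\<lambda>b. gradient (partial b f))"
  unfolding C2_data_def
proof (intro conjI ballI)
  show "(f has_derivative (\<lambda>h. gradient f x \<bullet> h)) (at x)" if "x \<in> D" for x
    using f that unfolding C2_on_def by (blast intro: has_derivative_gradient)
  show "((\<lambda>x. gradient f x \<bullet> b) has_derivative (\<lambda>h. gradient (partial b f) x \<bullet> h)) (at x)"
    if "b \<in> Basis" "x \<in> D" for b x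
    using has_derivative_gradient[of "partial b f" x] f that
    by (simp add: gradient_inner_Basis C2_on_def)
  show "continuous_on D (gradient (partial b f))" if "b \<in> Basis" for b
    using f that unfolding C2_on_def gradient_def by (intro continuous_intros) auto
qed

lemma C2_on_cong:
  assumes D: "open D" and f: "C2_on D f" and eq: "\<And>x. x \<in> D \<Longrightarrow> f x = h x"
  shows "C2_on D h" "\<And>x. x \<in> D \<Longrightarrow> gradient h x = gradient f x"
    "\<And>x. x \<in> D \<Longrightarrow> laplacian h x = laplacian f x"
proof -
  have "C2_data D h (gradient f) (\<lambda>b. gradient (partial b f))"
    using C2_on_imp_C2_data[OF f] unfolding C2_data_def
    by (auto intro: has_derivative_transform_within_open[OF _ D _ eq])
  note d = this
  show "C2_on D h" by (rule C2_data_imp_C2_on[OF D d])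
  show "gradient h x = gradient f x" if "x \<in> D" for x
    using C2_data_gradient[OF d that] .
  show "laplacian h x = laplacian f x" if "x \<in> D" for x
    using C2_data_laplacian[OF D d that] C2_data_laplacian[OF D C2_on_imp_C2_data[OF f] that] by simp
qed

lemma C2_on_subset: "C2_on D f \<Longrightarrow> E \<subseteq> D \<Longrightarrow> C2_on E f"
  unfolding C2_on_def by (meson continuous_on_subset subsetD)

lemma C2_on_Un:
  assumes "open D" "open E" "C2_on D f" "C2_on E f"
  shows "C2_on (D \<union> E) f"
  using assms unfolding C2_on_def by (auto intro!: continuous_on_open_Un)

lemma C2_on_continuous:
  assumes "C2_on D f" shows "continuous_on D f"
  using assms unfolding C2_on_def
  by (meson differentiable_at_withinI differentiable_imp_continuous_on differentiable_on_def)

lemma C2_on_continuous_gradient: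
  assumes "C2_on D f" shows "continuous_on D (gradient f)"
proof -
  have "continuous_on D (partial b f)" if "b \<in> Basis" for b
    using assms that unfolding C2_on_def
    by (meson differentiable_at_withinI differentiable_imp_continuous_on differentiable_on_def)
  then show ?thesis unfolding gradient_def by (intro continuous_intros) auto
qed

lemma C2_on_continuous_laplacian:
  assumes "C2_on D f" shows "continuous_on D (laplacian f)"
  using assms unfolding C2_on_def laplacian_def[abs_def] by (intro continuous_intros) auto

lemma C2_on_const: "C2_on D (\<lambda>_. c)" "gradient (\<lambda>_. c) x = 0" "laplacian (\<lambda>_. c) x = 0"
proof -
  have d: "C2_data UNIV (\<lambda>_. c) (\<lambda>_. 0) (\<lambda>_ _. 0)"
    unfolding C2_data_def by (auto intro!: has_derivative_eq_rhs[OF has_derivative_const])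
  show "C2_on D (\<lambda>_. c)"
    using C2_data_imp_C2_on[OF _ d] C2_on_subset by blast
  show "gradient (\<lambda>_. c) x = 0" using C2_data_gradient[OF d] by simp
  show "laplacian (\<lambda>_. c) x = 0" using C2_data_laplacian[OF _ d] by simp
qed

lemma C2_on_add:
  assumes D: "open D" and f: "C2_on D f" and h: "C2_on D h"
  shows "C2_on D (\<lambda>x. f x + h x)"
    "\<And>x. x \<in> D \<Longrightarrow> gradient (\<lambda>x. f x + h x) x = gradient f x + gradient h x"
    "\<And>x. x \<in> D \<Longrightarrow> laplacian (\<lambda>x. f x + h x) x = laplacian f x + laplacian h x"
proof -
  note df = C2_on_imp_C2_data[OF f] and dh = C2_on_imp_C2_data[OF h]
  have d: "C2_data D (\<lambda>x. f x + h x) (\<lambda>x. gradient f x + gradient h x)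
      (\<lambda>b x. gradient (partial b f) x + gradient (partial b h) x)"
    using df dh unfolding C2_data_def
    by (auto simp: inner_add_left fun_eq_iff
        intro!: has_derivative_eq_rhs[OF has_derivative_add] continuous_intros)
  show "C2_on D (\<lambda>x. f x + h x)" by (rule C2_data_imp_C2_on[OF D d])
  show "gradient (\<lambda>x. f x + h x) x = gradient f x + gradient h x" if "x \<in> D" for x
    using C2_data_gradient[OF d that] .
  show "laplacian (\<lambda>x. f x + h x) x = laplacian f x + laplacian h x" if "x \<in> D" for x
    using C2_data_laplacian[OF D d that] C2_data_laplacian[OF D df that]
      C2_data_laplacian[OF D dh that]
    by (simp add: inner_add_left sum.distrib)
qed

lemma C2_on_cmult:
  assumes D: "open D" and f: "C2_on D f"
  shows "C2_on D (\<lambda>x. c * f x)"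
    "\<And>x. x \<in> D \<Longrightarrow> gradient (\<lambda>x. c * f x) x = c *\<^sub>R gradient f x"
    "\<And>x. x \<in> D \<Longrightarrow> laplacian (\<lambda>x. c * f x) x = c * laplacian f x"
proof -
  note df = C2_on_imp_C2_data[OF f]
  have d: "C2_data D (\<lambda>x. c * f x) (\<lambda>x. c *\<^sub>R gradient f x)
      (\<lambda>b x. c *\<^sub>R gradient (partial b f) x)"
    using df unfolding C2_data_def
    by (auto simp: fun_eq_iff
        intro!: has_derivative_eq_rhs[OF has_derivative_mult_right] continuous_intros)
  show "C2_on D (\<lambda>x. c * f x)" by (rule C2_data_imp_C2_on[OF D d])
  show "gradient (\<lambda>x. c * f x) x = c *\<^sub>R gradient f x" if "x \<in> D" for x
    using C2_data_gradient[OF d that] .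
  show "laplacian (\<lambda>x. c * f x) x = c * laplacian f x" if "x \<in> D" for x
    using C2_data_laplacian[OF D d that] C2_data_laplacian[OF D df that]
    by (simp add: sum_distrib_left)
qed

lemma C2_on_mult:
  assumes D: "open D" and f: "C2_on D f" and h: "C2_on D h"
  shows "C2_on D (\<lambda>x. f x * h x)"
    "\<And>x. x \<in> D \<Longrightarrow> gradient (\<lambda>x. f x * h x) x = f x *\<^sub>R gradient h x + h x *\<^sub>R gradient f x"
    "\<And>x. x \<in> D \<Longrightarrow> laplacian (\<lambda>x. f x * h x) x
        = f x * laplacian h x + 2 * (gradient f x \<bullet> gradient h x) + h x * laplacian f x"
proof -
  note df = C2_on_imp_C2_data[OF f] and dh = C2_on_imp_C2_data[OF h]
  let ?g = "\<lambda>x. f x *\<^sub>R gradient h x + h x *\<^sub>R gradient f x"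
  let ?k = "\<lambda>b x. (gradient h x \<bullet> b) *\<^sub>R gradient f x + f x *\<^sub>R gradient (partial b h) x
      + ((gradient f x \<bullet> b) *\<^sub>R gradient h x + h x *\<^sub>R gradient (partial b f) x)"
  have d: "C2_data D (\<lambda>x. f x * h x) ?g ?k"
    unfolding C2_data_def
  proof (intro conjI ballI)
    fix x assume x: "x \<in> D"
    have 1: "(f has_derivative (\<lambda>v. gradient f x \<bullet> v)) (at x)"
      "(h has_derivative (\<lambda>v. gradient h x \<bullet> v)) (at x)"
      using df dh x unfolding C2_data_def by auto
    show "((\<lambda>x. f x * h x) has_derivative (\<lambda>v. ?g x \<bullet> v)) (at x)"
      by (rule has_derivative_eq_rhs[OF has_derivative_mult[OF 1]])
        (simp add: inner_add_left algebra_simps)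
    fix b :: 'a assume b: "b \<in> Basis"
    have 2: "((\<lambda>x. gradient f x \<bullet> b) has_derivative (\<lambda>v. gradient (partial b f) x \<bullet> v)) (at x)"
      "((\<lambda>x. gradient h x \<bullet> b) has_derivative (\<lambda>v. gradient (partial b h) x \<bullet> v)) (at x)"
      using df dh x b unfolding C2_data_def by auto
    have "((\<lambda>x. f x * (gradient h x \<bullet> b) + h x * (gradient f x \<bullet> b)) has_derivative
        (\<lambda>v. ?k b x \<bullet> v)) (at x)"
      by (rule has_derivative_eq_rhs[OF has_derivative_add[OF has_derivative_mult[OF 1(1) 2(2)]
              has_derivative_mult[OF 1(2) 2(1)]]])
        (simp add: inner_add_left algebra_simps)
    then show "((\<lambda>x. ?g x \<bullet> b) has_derivative (\<lambda>v. ?k b x \<bullet> v)) (at x)"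
      by (simp add: inner_add_left)
  next
    fix b :: 'a assume b: "b \<in> Basis"
    show "continuous_on D (?k b)"
      using df dh b C2_on_continuous[OF f] C2_on_continuous[OF h] C2_on_continuous_gradient[OF f]
        C2_on_continuous_gradient[OF h] unfolding C2_data_def
      by (intro continuous_intros) auto
  qed
  show "C2_on D (\<lambda>x. f x * h x)" by (rule C2_data_imp_C2_on[OF D d])
  show "gradient (\<lambda>x. f x * h x) x = ?g x" if "x \<in> D" for x
    using C2_data_gradient[OF d that] .
  show "laplacian (\<lambda>x. f x * h x) x
        = f x * laplacian h x + 2 * (gradient f x \<bullet> gradient h x) + h x * laplacian f x"
    if "x \<in> D" for x
  proof -
    have "gradient f x \<bullet> gradient h x = (\<Sum>b\<in>Basis. (gradient h x \<bullet> b) * (gradient f x \<bullet> b))"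
      by (subst euclidean_inner) (simp add: mult.commute)
    then show ?thesis
      using C2_data_laplacian[OF D d that] C2_data_laplacian[OF D df that]
        C2_data_laplacian[OF D dh that]
      by (simp add: inner_add_left sum.distrib sum_distrib_left mult.commute)
  qed
qed

lemma C2_on_compose:
  fixes f :: "'a::euclidean_space \<Rightarrow> real"
  assumes D: "open D" and f: "C2_on D f"
    and p1: "\<And>x. x \<in> D \<Longrightarrow> (p has_real_derivative p1 (f x)) (at (f x))"
    and p2: "\<And>x. x \<in> D \<Longrightarrow> (p1 has_real_derivative p2 (f x)) (at (f x))"
    and p2_cont: "continuous_on (f ` D) p2"
  shows "C2_on D (\<lambda>x. p (f x))"
    "\<And>x. x \<in> D \<Longrightarrow> gradient (\<lambda>x. p (f x)) x = p1 (f x) *\<^sub>R gradient f x"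
    "\<And>x. x \<in> D \<Longrightarrow> laplacian (\<lambda>x. p (f x)) x
        = p1 (f x) * laplacian f x + p2 (f x) * (norm (gradient f x))\<^sup>2"
proof -
  note df = C2_on_imp_C2_data[OF f]
  let ?g = "\<lambda>x. p1 (f x) *\<^sub>R gradient f x"
  let ?k = "\<lambda>b x. (p2 (f x) * (gradient f x \<bullet> b)) *\<^sub>R gradient f x
      + p1 (f x) *\<^sub>R gradient (partial b f) x"
  have d: "C2_data D (\<lambda>x. p (f x)) ?g ?k"
    unfolding C2_data_def
  proof (intro conjI ballI)
    fix x assume x: "x \<in> D"
    have 1: "(f has_derivative (\<lambda>v. gradient f x \<bullet> v)) (at x)"
      using df x unfolding C2_data_def by auto
    show "((\<lambda>x. p (f x)) has_derivative (\<lambda>v. ?g x \<bullet> v)) (at x)"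
      using has_derivative_compose[OF 1, of p "\<lambda>t. p1 (f x) * t"] p1[OF x]
      by (simp add: has_field_derivative_def)
    have 3: "((\<lambda>x. p1 (f x)) has_derivative (\<lambda>v. p2 (f x) * (gradient f x \<bullet> v))) (at x)"
      using has_derivative_compose[OF 1, of p1 "\<lambda>t. p2 (f x) * t"] p2[OF x]
      by (simp add: has_field_derivative_def)
    fix b :: 'a assume b: "b \<in> Basis"
    have 2: "((\<lambda>x. gradient f x \<bullet> b) has_derivative (\<lambda>v. gradient (partial b f) x \<bullet> v)) (at x)"
      using df x b unfolding C2_data_def by auto
    have "((\<lambda>x. p1 (f x) * (gradient f x \<bullet> b)) has_derivative (\<lambda>v. ?k b x \<bullet> v)) (at x)"
      by (rule has_derivative_eq_rhs[OF has_derivative_mult[OF 3 2]])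
        (simp add: inner_add_left algebra_simps)
    then show "((\<lambda>x. ?g x \<bullet> b) has_derivative (\<lambda>v. ?k b x \<bullet> v)) (at x)"
      by simp
  next
    fix b :: 'a assume b: "b \<in> Basis"
    have "continuous_on D (\<lambda>x. p2 (f x))"
      by (rule continuous_on_compose2[OF p2_cont C2_on_continuous[OF f]]) auto
    moreover have "continuous_on D (\<lambda>x. p1 (f x))"
    proof (rule continuous_on_compose2[OF _ C2_on_continuous[OF f]])
      show "continuous_on (f ` D) p1"
        using p2 DERIV_isCont by (fastforce intro: continuous_at_imp_continuous_on)
    qed auto
    ultimately show "continuous_on D (?k b)"
      using df b C2_on_continuous_gradient[OF f] unfolding C2_data_def
      by (intro continuous_intros) auto
  qed
  show "C2_on D (\<lambda>x. p (f x))" by (rule C2_data_imp_C2_on[OF D d])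
  show "gradient (\<lambda>x. p (f x)) x = ?g x" if "x \<in> D" for x
    using C2_data_gradient[OF d that] .
  show "laplacian (\<lambda>x. p (f x)) x
        = p1 (f x) * laplacian f x + p2 (f x) * (norm (gradient f x))\<^sup>2"
    if "x \<in> D" for x
  proof -
    have "(norm (gradient f x))\<^sup>2 = (\<Sum>b\<in>Basis. (gradient f x \<bullet> b) * (gradient f x \<bullet> b))"
      unfolding power2_norm_eq_inner by (rule euclidean_inner)
    then show ?thesis
      using C2_data_laplacian[OF D d that] C2_data_laplacian[OF D df that]
      by (simp add: inner_add_left sum.distrib sum_distrib_left mult.assoc)
  qed
qed

lemma C2_on_scale_shift:
  fixes f :: "'a::euclidean_space \<Rightarrow> real"
  assumes D: "open D" and f: "C2_on D f"
  shows "C2_on {x. r *\<^sub>R (x - a) \<in> D} (\<lambda>x. f (r *\<^sub>R (x - a)))"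
    "\<And>x. r *\<^sub>R (x - a) \<in> D \<Longrightarrow>
       gradient (\<lambda>x. f (r *\<^sub>R (x - a))) x = r *\<^sub>R gradient f (r *\<^sub>R (x - a))"
    "\<And>x. r *\<^sub>R (x - a) \<in> D \<Longrightarrow>
       laplacian (\<lambda>x. f (r *\<^sub>R (x - a))) x = r\<^sup>2 * laplacian f (r *\<^sub>R (x - a))"
proof -
  note df = C2_on_imp_C2_data[OF f]
  let ?E = "{x. r *\<^sub>R (x - a) \<in> D}"
  have E: "open ?E"
    using open_vimage[OF D, of "\<lambda>x. r *\<^sub>R (x - a)"] by (simp add: vimage_def continuous_intros)
  have aff: "((\<lambda>x. r *\<^sub>R (x - a)) has_derivative (\<lambda>v. r *\<^sub>R v)) (at x)" for x
    by (auto intro!: derivative_eq_intros)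
  have d: "C2_data ?E (\<lambda>x. f (r *\<^sub>R (x - a))) (\<lambda>x. r *\<^sub>R gradient f (r *\<^sub>R (x - a)))
      (\<lambda>b x. r\<^sup>2 *\<^sub>R gradient (partial b f) (r *\<^sub>R (x - a)))"
    unfolding C2_data_def
  proof (intro conjI ballI)
    fix x assume x: "x \<in> ?E"
    have 1: "(f has_derivative (\<lambda>v. gradient f (r *\<^sub>R (x - a)) \<bullet> v)) (at (r *\<^sub>R (x - a)))"
      using df x unfolding C2_data_def by auto
    show "((\<lambda>x. f (r *\<^sub>R (x - a))) has_derivative (\<lambda>v. (r *\<^sub>R gradient f (r *\<^sub>R (x - a))) \<bullet> v)) (at x)"
      using has_derivative_compose[OF aff 1] by (simp add: algebra_simps)
    fix b :: 'a assume b: "b \<in> Basis"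
    have 2: "((\<lambda>x. gradient f x \<bullet> b) has_derivative
        (\<lambda>v. gradient (partial b f) (r *\<^sub>R (x - a)) \<bullet> v)) (at (r *\<^sub>R (x - a)))"
      using df x b unfolding C2_data_def by auto
    have "((\<lambda>x. r * (gradient f (r *\<^sub>R (x - a)) \<bullet> b)) has_derivative
        (\<lambda>v. r * (gradient (partial b f) (r *\<^sub>R (x - a)) \<bullet> (r *\<^sub>R v)))) (at x)"
      by (intro has_derivative_mult_right has_derivative_compose[OF aff 2])
    then show "((\<lambda>x. (r *\<^sub>R gradient f (r *\<^sub>R (x - a))) \<bullet> b) has_derivative
        (\<lambda>v. (r\<^sup>2 *\<^sub>R gradient (partial b f) (r *\<^sub>R (x - a))) \<bullet> v)) (at x)"
      by (simp add: power2_eq_square algebra_simps)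
  next
    fix b :: 'a assume b: "b \<in> Basis"
    have "continuous_on ?E (\<lambda>x. gradient (partial b f) (r *\<^sub>R (x - a)))"
      by (rule continuous_on_compose2[of D "gradient (partial b f)"])
        (use df b in \<open>auto simp: C2_data_def intro!: continuous_intros\<close>)
    then show "continuous_on ?E (\<lambda>x. r\<^sup>2 *\<^sub>R gradient (partial b f) (r *\<^sub>R (x - a)))"
      by (intro continuous_intros)
  qed
  show "C2_on ?E (\<lambda>x. f (r *\<^sub>R (x - a)))" by (rule C2_data_imp_C2_on[OF E d])
  show "gradient (\<lambda>x. f (r *\<^sub>R (x - a))) x = r *\<^sub>R gradient f (r *\<^sub>R (x - a))"
    if "r *\<^sub>R (x - a) \<in> D" for x
    using C2_data_gradient[OF d] that by simp
  show "laplacian (\<lambda>x. f (r *\<^sub>R (x - a))) x = r\<^sup>2 * laplacian f (r *\<^sub>R (x - a))"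
    if "r *\<^sub>R (x - a) \<in> D" for x
    using C2_data_laplacian[OF E d] C2_data_laplacian[OF D df that] that
    by (simp add: sum_distrib_left)
qed

lemma C2_on_norm_square:
  fixes a :: "'a::euclidean_space"
  shows "C2_on D (\<lambda>x. (norm (x - a))\<^sup>2)"
    "gradient (\<lambda>x. (norm (x - a))\<^sup>2) x = 2 *\<^sub>R (x - a)"
    "laplacian (\<lambda>x. (norm (x - a))\<^sup>2) x = 2 * real DIM('a)"
proof -
  have d: "C2_data UNIV (\<lambda>x. (norm (x - a))\<^sup>2) (\<lambda>x. 2 *\<^sub>R (x - a)) (\<lambda>b x. 2 *\<^sub>R b)"
    unfolding C2_data_def power2_norm_eq_inner
    by (auto intro!: derivative_eq_intros continuous_intros simp: inner_commute algebra_simps)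
  show "C2_on D (\<lambda>x. (norm (x - a))\<^sup>2)"
    using C2_data_imp_C2_on[OF _ d] C2_on_subset by blast
  show "gradient (\<lambda>x. (norm (x - a))\<^sup>2) x = 2 *\<^sub>R (x - a)" using C2_data_gradient[OF d] by simp
  show "laplacian (\<lambda>x. (norm (x - a))\<^sup>2) x = 2 * real DIM('a)"
    using C2_data_laplacian[OF _ d] by simp
qed

lemma C2_on_sum:
  assumes D: "open D" and fin: "finite I" and f: "\<And>i. i \<in> I \<Longrightarrow> C2_on D (f i)"
  shows "C2_on D (\<lambda>x. \<Sum>i\<in>I. f i x)"
    "\<And>x. x \<in> D \<Longrightarrow> laplacian (\<lambda>x. \<Sum>i\<in>I. f i x) x = (\<Sum>i\<in>I. laplacian (f i) x)"
proof -
  have "C2_on D (\<lambda>x. \<Sum>i\<in>I. f i x) \<and>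
      (\<forall>x\<in>D. laplacian (\<lambda>x. \<Sum>i\<in>I. f i x) x = (\<Sum>i\<in>I. laplacian (f i) x))"
    using fin f
  proof (induction I rule: finite_induct)
    case empty
    then show ?case by (simp add: C2_on_const)
  next
    case (insert i I)
    then have "C2_on D (f i)" "C2_on D (\<lambda>x. \<Sum>i\<in>I. f i x)" by auto
    from C2_on_add[OF D this] insert show ?case by simp
  qed
  then show "C2_on D (\<lambda>x. \<Sum>i\<in>I. f i x)"
    "\<And>x. x \<in> D \<Longrightarrow> laplacian (\<lambda>x. \<Sum>i\<in>I. f i x) x = (\<Sum>i\<in>I. laplacian (f i) x)" by auto
qed

text \<open>The open sets \<open>D\<close> and \<open>- K\<close> cover the space, and on the second one \<open>f\<close> is constant.\<close>
lemma C2_on_extend_zero: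
  fixes f :: "'a::euclidean_space \<Rightarrow> real"
  assumes D: "open D" and f: "C2_on D f" and K: "closed K" "K \<subseteq> D"
    and zero: "\<And>x. x \<notin> K \<Longrightarrow> f x = 0"
  shows "C2_on UNIV f" "\<And>x. x \<notin> K \<Longrightarrow> gradient f x = 0" "\<And>x. x \<notin> K \<Longrightarrow> laplacian f x = 0"
proof -
  have oK: "open (- K)" using K by (simp add: open_Compl)
  note c = C2_on_cong[OF oK C2_on_const(1)[where c=0], of f]
  have "C2_on (- K) f" using c(1) zero by simp
  then have "C2_on (D \<union> - K) f" by (intro C2_on_Un D oK f)
  moreover have "D \<union> - K = UNIV" using K by auto
  ultimately show "C2_on UNIV f" by simp
  show "gradient f x = 0" "laplacian f x = 0" if "x \<notin> K" for x
    using c(2,3)[of x] zero that by (auto simp: C2_on_const)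
qed

section \<open>Integration by parts\<close>

text \<open>Test functions with two derivatives only: the cutoffs and truncations used below are given by
  explicit formulas that are not smoother than that.\<close>
definition C2_test :: "'a::euclidean_space set \<Rightarrow> ('a \<Rightarrow> real) \<Rightarrow> bool" where
  "C2_test D \<phi> \<longleftrightarrow> C2_on UNIV \<phi> \<and> (\<exists>K. compact K \<and> K \<subseteq> D \<and> (\<forall>x. x \<notin> K \<longrightarrow> \<phi> x = 0))"

lemma C2_testE:
  assumes "C2_test D \<phi>"
  obtains K where "C2_on UNIV \<phi>" "compact K" "K \<subseteq> D" "\<And>x. x \<notin> K \<Longrightarrow> \<phi> x = 0"
    "\<And>x. x \<notin> K \<Longrightarrow> gradient \<phi> x = 0" "\<And>x. x \<notin> K \<Longrightarrow> laplacian \<phi> x = 0"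
  using assms C2_on_extend_zero[of UNIV \<phi>] unfolding C2_test_def
  by (metis compact_imp_closed open_UNIV subset_UNIV)

lemma C2_test_mono: "C2_test D \<phi> \<Longrightarrow> D \<subseteq> E \<Longrightarrow> C2_test E \<phi>"
  unfolding C2_test_def by blast

lemma C2_test_extend:
  assumes "open D" "C2_on D \<phi>" "compact K" "K \<subseteq> D" "K \<subseteq> E" "\<And>x. x \<notin> K \<Longrightarrow> \<phi> x = 0"
  shows "C2_test E \<phi>"
  unfolding C2_test_def using C2_on_extend_zero(1)[of D \<phi> K] assms compact_imp_closed by blast

lemma integrable_compact_support:
  fixes f :: "'a::euclidean_space \<Rightarrow> real"
  assumes "compact K" "continuous_on K f" "\<And>x. x \<notin> K \<Longrightarrow> f x = 0"
  shows "integrable lborel f"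
proof -
  have "f = (\<lambda>x. indicator K x *\<^sub>R f x)"
    using assms(3) by (auto simp: indicator_def fun_eq_iff)
  then show ?thesis using borel_integrable_compact[OF assms(1,2)] by simp
qed

lemma integrable_mult_compact_support:
  fixes u g :: "'a::euclidean_space \<Rightarrow> real"
  assumes K: "compact K" and u: "set_integrable lborel K u"
    and g: "continuous_on UNIV g" "\<And>x. x \<notin> K \<Longrightarrow> g x = 0"
  shows "integrable lborel (\<lambda>x. u x * g x)"
proof -
  have um: "(\<lambda>x. indicator K x * u x) \<in> borel_measurable lborel"
    using u unfolding set_integrable_def by simp
  have ui: "integrable lborel (\<lambda>x. indicator K x * \<bar>u x\<bar>)"
    using integrable_abs[OF u[unfolded set_integrable_def]] by (simp add: abs_mult)
  have "bounded (g ` K)"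
    using compact_continuous_image[OF continuous_on_subset[OF g(1)] K] compact_imp_bounded by blast
  then obtain B where B: "\<And>x. x \<in> K \<Longrightarrow> \<bar>g x\<bar> \<le> B" unfolding bounded_iff by auto
  have [measurable]: "g \<in> borel_measurable borel" by (rule borel_measurable_continuous_onI[OF g(1)])
  have e: "u x * g x = (indicator K x * u x) * g x" for x using g(2)[of x] by (cases "x \<in> K") auto
  show ?thesis
  proof (rule Bochner_Integration.integrable_bound)
    show "integrable lborel (\<lambda>x. B * (indicator K x * \<bar>u x\<bar>))" using ui by simp
    show "(\<lambda>x. u x * g x) \<in> borel_measurable lborel" unfolding e using um by measurable
    show "AE x in lborel. norm (u x * g x) \<le> norm (B * (indicator K x * \<bar>u x\<bar>))"
    proof (rule AE_I2)
      show "norm (u x * g x) \<le> norm (B * (indicator K x * \<bar>u x\<bar>))" for x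
        using B[of x] g(2)[of x] order_trans[OF abs_ge_zero B[of x]]
        by (cases "x \<in> K") (auto simp: abs_mult mult.commute[of "\<bar>u x\<bar>"] mult_right_mono)
    qed
  qed
qed

lemma integral_translate:
  fixes f :: "'a::euclidean_space \<Rightarrow> real"
  assumes [measurable]: "f \<in> borel_measurable borel"
  shows "(LINT x|lborel. f (a + x)) = (LINT x|lborel. f x)"
    "integrable lborel (\<lambda>x. f (a + x)) \<longleftrightarrow> integrable lborel f"
proof -
  have d: "lborel = distr lborel borel ((+) a)" by (simp add: lborel_distr_plus)
  show "(LINT x|lborel. f (a + x)) = (LINT x|lborel. f x)"
    by (subst (2) d) (simp add: integral_distr)
  show "integrable lborel (\<lambda>x. f (a + x)) \<longleftrightarrow> integrable lborel f"
    by (subst (2) d) (simp add: integrable_distr_eq)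
qed

lemma has_real_derivative_along_line:
  fixes f :: "'a::real_inner \<Rightarrow> real"
  assumes "(f has_derivative (\<lambda>v. g \<bullet> v)) (at (p + t *\<^sub>R b))"
  shows "((\<lambda>t. f (p + t *\<^sub>R b)) has_real_derivative g \<bullet> b) (at t)"
proof -
  have "((\<lambda>t. p + t *\<^sub>R b) has_derivative (\<lambda>h. h *\<^sub>R b)) (at t)"
    by (auto intro!: derivative_eq_intros)
  from has_derivative_compose[OF this assms] show ?thesis
    unfolding has_field_derivative_def
    by (rule has_derivative_eq_rhs) (simp add: fun_eq_iff)
qed

lemma onorm_inner_le:
  fixes g :: "'a::real_inner"
  assumes "norm g \<le> B"
  shows "onorm (\<lambda>h. g \<bullet> h) \<le> B"
proof (rule onorm_bound)
  show "0 \<le> B" using assms norm_ge_zero[of g] by linarith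
  show "norm (g \<bullet> h) \<le> B * norm h" for h
    using Cauchy_Schwarz_ineq2[of g h] mult_right_mono[OF assms norm_ge_zero[of h]] by simp
qed

text \<open>The integral is translation invariant, so the difference quotients of \<open>w\<close> have integral
  zero; they converge boundedly to the directional derivative.\<close>
lemma integral_directional_derivative_zero:
  fixes w :: "'a::euclidean_space \<Rightarrow> real"
  assumes der: "\<And>x. (w has_derivative (\<lambda>h. g x \<bullet> h)) (at x)"
    and cont: "continuous_on UNIV g"
    and K: "compact K" and zero: "\<And>x. x \<notin> K \<Longrightarrow> w x = 0"
  shows "(LINT x|lborel. g x \<bullet> b) = 0"
proof -
  obtain R where R: "R > 0" "K \<subseteq> cball 0 R"
    using compact_imp_bounded[OF K] unfolding bounded_pos by (auto simp: subset_eq)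
  let ?B = "cball 0 (R + norm b) :: 'a set"
  have gzero: "g x = 0" if "x \<notin> K" for x
  proof -
    have "((\<lambda>_. 0) has_derivative (\<lambda>h. 0)) (at x)" by simp
    then have "(w has_derivative (\<lambda>h. 0)) (at x)"
      by (rule has_derivative_transform_within_open[of _ _ _ _ "- K"])
        (use K zero that in \<open>auto simp: compact_imp_closed open_Compl\<close>)
    with der[of x] have "(\<lambda>h. g x \<bullet> h) = (\<lambda>h. 0)" by (rule has_derivative_unique)
    then show ?thesis by (metis inner_eq_zero_iff)
  qed
  have "compact ?B" by simp
  then have "bounded (g ` K)"
    using compact_continuous_image[OF continuous_on_subset[OF cont] K] compact_imp_bounded by blast
  then obtain M where M: "M > 0" "\<And>x. x \<in> K \<Longrightarrow> norm (g x) \<le> M"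
    unfolding bounded_pos by auto
  have M': "norm (g x) \<le> M" for x
    using M gzero by (cases "x \<in> K") auto
  have wcont: "continuous_on UNIV w"
    using der by (meson continuous_at_imp_continuous_on has_derivative_continuous)
  have wint: "integrable lborel w"
    by (rule integrable_compact_support[OF K continuous_on_subset[OF wcont] zero]) auto
  have wmeas[measurable]: "w \<in> borel_measurable borel"
    using wcont by (rule borel_measurable_continuous_onI)
  define t where "t k = 1 / real (Suc k)" for k
  have t: "0 < t k" "t k \<le> 1" for k unfolding t_def by auto
  define s where "s k x = (w (t k *\<^sub>R b + x) - w x) / t k" for k x
  have "(\<lambda>k. LINT x|lborel. s k x) \<longlonglongrightarrow> (LINT x|lborel. g x \<bullet> b)"
  proof (rule integral_dominated_convergence)
    show "integrable lborel (\<lambda>x. indicator ?B x *\<^sub>R (M * norm b))"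
      by (rule borel_integrable_compact) auto
    show "AE x in lborel. (\<lambda>k. s k x) \<longlonglongrightarrow> g x \<bullet> b"
    proof (rule AE_I2)
      fix x
      have "((\<lambda>r. w (x + r *\<^sub>R b)) has_real_derivative (g x \<bullet> b)) (at 0)"
        using has_real_derivative_along_line[of w "g x" x 0 b] der[of x] by simp
      then have *: "((\<lambda>r. (w (x + r *\<^sub>R b) - w x) / r) \<longlongrightarrow> g x \<bullet> b) (at 0)"
        unfolding DERIV_def by simp
      have "filterlim t (at 0) sequentially"
        unfolding filterlim_at t_def using LIMSEQ_inverse_real_of_nat
        by (auto simp: inverse_eq_divide)
      from filterlim_compose[OF * this] show "(\<lambda>k. s k x) \<longlonglongrightarrow> g x \<bullet> b"
        by (simp add: s_def add.commute)
    qed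
    show "AE x in lborel. norm (s k x) \<le> indicator ?B x *\<^sub>R (M * norm b)" for k
    proof (rule AE_I2)
      fix x
      show "norm (s k x) \<le> indicator ?B x *\<^sub>R (M * norm b)"
      proof (cases "x \<in> ?B")
        case True
        have "onorm (\<lambda>h. g y \<bullet> h) \<le> M" for y by (rule onorm_inner_le[OF M'])
        then have "norm (w (t k *\<^sub>R b + x) - w x) \<le> M * norm ((t k *\<^sub>R b + x) - x)"
          by (intro differentiable_bound[of UNIV w "\<lambda>x h. g x \<bullet> h"]) (use der in auto)
        then show ?thesis using True t[of k] by (simp add: s_def field_simps)
      next
        case False
        have "norm x \<le> norm (t k *\<^sub>R b + x) + norm (t k *\<^sub>R b)"
          using norm_triangle_ineq4[of "t k *\<^sub>R b + x" "t k *\<^sub>R b"] by simp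
        moreover have "norm (t k *\<^sub>R b) \<le> norm b" using t[of k] by (simp add: mult_left_le_one_le)
        moreover have "norm x > R + norm b" using False by simp
        ultimately have "norm x > R" "norm (t k *\<^sub>R b + x) > R"
          using norm_ge_zero[of b] by linarith+
        then have "x \<notin> K" "t k *\<^sub>R b + x \<notin> K"
          using subsetD[OF R(2), of x] subsetD[OF R(2), of "t k *\<^sub>R b + x"] by auto
        then show ?thesis using False zero by (simp add: s_def)
      qed
    qed
    show "(\<lambda>x. g x \<bullet> b) \<in> borel_measurable lborel"
      using borel_measurable_continuous_onI[OF cont] by measurable
    show "s k \<in> borel_measurable lborel" for k unfolding s_def[abs_def] by measurable
  qed
  moreover have "(LINT x|lborel. s k x) = 0" for k
    using wint integral_translate[OF wmeas, of "t k *\<^sub>R b"] unfolding s_def by simp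
  ultimately show ?thesis using LIMSEQ_unique[of "\<lambda>k. 0::real"] by simp
qed

lemma continuous_on_extend_zero:
  fixes f :: "'a::euclidean_space \<Rightarrow> 'b::real_normed_vector"
  assumes "open D" "continuous_on D f" "compact K" "K \<subseteq> D" "\<And>x. x \<notin> K \<Longrightarrow> f x = 0"
  shows "continuous_on UNIV f"
proof -
  have "continuous_on (- K) f"
    using assms(5) continuous_on_cong[of "- K" "- K" f "\<lambda>_. 0"] by auto
  then have "continuous_on (D \<union> - K) f"
    using assms by (intro continuous_on_open_Un) (auto simp: compact_imp_closed open_Compl)
  moreover have "D \<union> - K = UNIV" using assms(4) by auto
  ultimately show ?thesis by simp
qed

text \<open>Green's second identity: the integrand difference is the divergence of
  \<open>f \<nabla>\<phi> - \<phi> \<nabla>f\<close>, which has compact support.\<close>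
lemma integral_laplacian_symmetric:
  fixes f :: "'a::euclidean_space \<Rightarrow> real"
  assumes D: "open D" and f: "C2_on D f" and \<phi>: "C2_test D \<phi>"
  shows "(LINT x|lborel. f x * laplacian \<phi> x) = (LINT x|lborel. \<phi> x * laplacian f x)"
proof -
  obtain K where \<phi>C: "C2_on UNIV \<phi>" and K: "compact K" "K \<subseteq> D"
    and z0: "\<And>x. x \<notin> K \<Longrightarrow> \<phi> x = 0" and z1: "\<And>x. x \<notin> K \<Longrightarrow> gradient \<phi> x = 0"
    and z2: "\<And>x. x \<notin> K \<Longrightarrow> laplacian \<phi> x = 0" using \<phi> by (rule C2_testE) blast
  note df = C2_on_imp_C2_data[OF f] and d\<phi> = C2_on_imp_C2_data[OF \<phi>C]
  define w where "w b x = f x * (gradient \<phi> x \<bullet> b) - \<phi> x * (gradient f x \<bullet> b)" for b x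
  define g where "g b x = (gradient \<phi> x \<bullet> b) *\<^sub>R gradient f x + f x *\<^sub>R gradient (partial b \<phi>) x
     - ((gradient f x \<bullet> b) *\<^sub>R gradient \<phi> x + \<phi> x *\<^sub>R gradient (partial b f) x)" for b x
  have oK: "open (- K)" using K by (simp add: compact_imp_closed open_Compl)
  have z3: "gradient (partial b \<phi>) x = 0" if b: "b \<in> Basis" and x: "x \<notin> K" for b x
  proof -
    have "((\<lambda>_. 0) has_derivative (\<lambda>h. (0::'a) \<bullet> h)) (at x)" by simp
    then have "(partial b \<phi> has_derivative (\<lambda>h. 0 \<bullet> h)) (at x)"
      by (rule has_derivative_transform_within_open[OF _ oK])
        (use x z1 gradient_inner_Basis[OF b, of \<phi>, symmetric] in auto)
    then show ?thesis by (rule gradient_eq)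
  qed
  have g0: "g b x = 0" if "b \<in> Basis" "x \<notin> K" for b x
    using that by (simp add: g_def z0 z1 z3)
  have int0: "(LINT x|lborel. g b x \<bullet> b) = 0" and gcont: "continuous_on UNIV (g b)"
    if b: "b \<in> Basis" for b
  proof -
    have gz: "g b x = 0" if "x \<notin> K" for x
      using g0[OF b that] .
    have gc: "continuous_on D (g b)"
      unfolding g_def
      using df d\<phi> b C2_on_continuous[OF f] C2_on_continuous_gradient[OF f]
        continuous_on_subset[OF C2_on_continuous[OF \<phi>C]]
        continuous_on_subset[OF C2_on_continuous_gradient[OF \<phi>C]]
      unfolding C2_data_def
      by (intro continuous_intros) (auto intro: continuous_on_subset)
    show gcont: "continuous_on UNIV (g b)"
      by (rule continuous_on_extend_zero[OF D gc K gz])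
    show "(LINT x|lborel. g b x \<bullet> b) = 0"
    proof (rule integral_directional_derivative_zero[OF _ gcont K(1), of "w b"])
      show "w b x = 0" if "x \<notin> K" for x using that by (simp add: w_def z0 z1)
      show "(w b has_derivative (\<lambda>h. g b x \<bullet> h)) (at x)" for x
      proof (cases "x \<in> K")
        case True
        then have x: "x \<in> D" using K by auto
        have 1: "(f has_derivative (\<lambda>v. gradient f x \<bullet> v)) (at x)"
          "(\<phi> has_derivative (\<lambda>v. gradient \<phi> x \<bullet> v)) (at x)"
          "((\<lambda>x. gradient f x \<bullet> b) has_derivative (\<lambda>v. gradient (partial b f) x \<bullet> v)) (at x)"
          "((\<lambda>x. gradient \<phi> x \<bullet> b) has_derivative (\<lambda>v. gradient (partial b \<phi>) x \<bullet> v)) (at x)"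
          using df d\<phi> x b unfolding C2_data_def by auto
        show ?thesis unfolding w_def
          by (rule has_derivative_eq_rhs[OF has_derivative_diff[OF has_derivative_mult[OF 1(1) 1(4)]
                has_derivative_mult[OF 1(2) 1(3)]]])
            (simp add: g_def inner_add_left inner_diff_left algebra_simps)
      next
        case False
        have "((\<lambda>_. 0) has_derivative (\<lambda>h. g b x \<bullet> h)) (at x)"
          using gz[OF False] by simp
        then show ?thesis
          by (rule has_derivative_transform_within_open[OF _ oK])
            (use False z0 z1 in \<open>auto simp: w_def\<close>)
      qed
    qed
  qed
  have "f x * laplacian \<phi> x - \<phi> x * laplacian f x = (\<Sum>b\<in>Basis. g b x \<bullet> b)" for x
  proof (cases "x \<in> K")
    case True
    then have x: "x \<in> D" using K by auto
    show ?thesis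
      using C2_data_laplacian[OF D df x] C2_data_laplacian[OF open_UNIV d\<phi>, of x]
      by (simp add: g_def inner_add_left inner_diff_left sum.distrib sum_subtractf
          sum_distrib_left mult.commute)
  next
    case False
    then show ?thesis by (simp add: g_def z0 z1 z2 z3)
  qed
  note eq = this
  have i1: "integrable lborel (\<lambda>x. f x * laplacian \<phi> x)"
    by (rule integrable_compact_support[OF K(1)])
      (use z2 K C2_on_continuous[OF f] C2_on_continuous_laplacian[OF \<phi>C] in
        \<open>auto intro!: continuous_intros intro: continuous_on_subset\<close>)
  have i2: "integrable lborel (\<lambda>x. \<phi> x * laplacian f x)"
    by (rule integrable_compact_support[OF K(1)])
      (use z0 K C2_on_continuous[OF \<phi>C] C2_on_continuous_laplacian[OF f] in
        \<open>auto intro!: continuous_intros intro: continuous_on_subset\<close>)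
  have ig: "integrable lborel (\<lambda>x. g b x \<bullet> b)" if b: "b \<in> Basis" for b
    by (rule integrable_compact_support[OF K(1)])
      (use continuous_on_subset[OF gcont[OF b]] g0[OF b] in \<open>auto intro!: continuous_intros\<close>)
  have "(LINT x|lborel. f x * laplacian \<phi> x) - (LINT x|lborel. \<phi> x * laplacian f x)
      = (LINT x|lborel. (\<Sum>b\<in>Basis. g b x \<bullet> b))"
    unfolding Bochner_Integration.integral_diff[OF i1 i2, symmetric] eq ..
  also have "\<dots> = 0" using ig int0 by (subst Bochner_Integration.integral_sum) auto
  finally show ?thesis by simp
qed

text \<open>\<open>-\<Delta>u = \<mu> \<delta>\<^sub>y\<close> tested against \<open>C\<^sup>2\<close> functions: Green's functions have \<open>\<mu> = 1\<close>,
  harmonic functions \<open>\<mu> = 0\<close>.\<close>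
definition weak_pole :: "'a::euclidean_space set \<Rightarrow> ('a \<Rightarrow> real) \<Rightarrow> real \<Rightarrow> 'a \<Rightarrow> bool" where
  "weak_pole D u \<mu> y \<longleftrightarrow>
     (\<forall>K. compact K \<and> K \<subseteq> D \<longrightarrow> set_integrable lborel K u) \<and>
     (\<forall>\<phi>. C2_test D \<phi> \<longrightarrow> (LINT x|lborel. u x * laplacian \<phi> x) = - \<mu> * \<phi> y)"

lemma harmonic_imp_weak_pole:
  assumes D: "open D" and u: "harmonic_in D u"
  shows "weak_pole D u 0 y"
  unfolding weak_pole_def
proof (intro conjI allI impI)
  have uC: "C2_on D u" and u0: "\<And>x. x \<in> D \<Longrightarrow> laplacian u x = 0"
    using u unfolding harmonic_in_def by auto
  show "set_integrable lborel K u" if "compact K \<and> K \<subseteq> D" for K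
    unfolding set_integrable_def using that C2_on_continuous[OF uC]
    by (intro borel_integrable_compact) (auto intro: continuous_on_subset)
  show "(LINT x|lborel. u x * laplacian \<phi> x) = - 0 * \<phi> y" if \<phi>: "C2_test D \<phi>" for \<phi>
  proof -
    obtain K where "K \<subseteq> D" "\<And>x. x \<notin> K \<Longrightarrow> \<phi> x = 0" using \<phi> by (rule C2_testE) blast
    then have "\<phi> x * laplacian u x = 0" for x using u0 by (cases "x \<in> K") auto
    then have "(LINT x|lborel. \<phi> x * laplacian u x) = 0" by (simp only: integral_zero)
    then show ?thesis using integral_laplacian_symmetric[OF D uC \<phi>] by simp
  qed
qed

section \<open>The maximum principle\<close>

lemma local_max_second_derivative:
  fixes f :: "real \<Rightarrow> real"
  assumes d: "d > 0" and f1: "\<And>t. \<bar>t\<bar> < d \<Longrightarrow> (f has_real_derivative f1 t) (at t)"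
    and f2: "(f1 has_real_derivative f2) (at 0)"
    and max: "\<And>t. \<bar>t\<bar> < d \<Longrightarrow> f t \<le> f 0"
  shows "f2 \<le> 0"
proof (rule ccontr)
  assume "\<not> f2 \<le> 0"
  then have pos: "f2 > 0" by simp
  have "f1 0 = 0"
    using DERIV_local_max[OF f1[of 0] d] d max by auto
  then obtain e where e: "e > 0" "\<And>h. 0 < h \<Longrightarrow> h < e \<Longrightarrow> f1 h > 0"
    using DERIV_pos_inc_right[OF f2 pos] by auto
  define h where "h = min d e / 2"
  have h: "0 < h" "h < d" "h < e" using d e unfolding h_def by auto
  have "f 0 < f h"
  proof (rule DERIV_pos_imp_increasing_open[OF h(1)])
    show "\<exists>y. (f has_real_derivative y) (at x) \<and> 0 < y" if "0 < x" "x < h" for x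
      using f1[of x] e(2)[of x] that h by (intro exI[of _ "f1 x"]) auto
    show "continuous_on {0..h} f"
    proof (rule continuous_at_imp_continuous_on, rule ballI)
      show "isCont f x" if "x \<in> {0..h}" for x
        using DERIV_isCont[OF f1[of x]] that h by auto
    qed
  qed
  then show False using max[of h] h by auto
qed

lemma laplacian_local_max:
  fixes w :: "'a::euclidean_space \<Rightarrow> real"
  assumes D: "open D" and w: "C2_on D w" and p: "p \<in> D" and max: "\<And>x. x \<in> D \<Longrightarrow> w x \<le> w p"
  shows "laplacian w p \<le> 0"
proof -
  note dw = C2_on_imp_C2_data[OF w]
  obtain d where d: "d > 0" "ball p d \<subseteq> D" using D p openE by blast
  have "gradient (partial b w) p \<bullet> b \<le> 0" if b: "b \<in> Basis" for b
  proof (rule local_max_second_derivative[OF d(1), of "\<lambda>t. w (p + t *\<^sub>R b)"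
        "\<lambda>t. gradient w (p + t *\<^sub>R b) \<bullet> b"])
    have in_D: "p + t *\<^sub>R b \<in> D" if "\<bar>t\<bar> < d" for t
      using that d b by (intro subsetD[OF d(2)]) (simp add: dist_norm)
    show "w (p + t *\<^sub>R b) \<le> w (p + 0 *\<^sub>R b)" if "\<bar>t\<bar> < d" for t
      using max[OF in_D[OF that]] by simp
    show "((\<lambda>t. w (p + t *\<^sub>R b)) has_real_derivative gradient w (p + t *\<^sub>R b) \<bullet> b) (at t)"
      if "\<bar>t\<bar> < d" for t
    proof -
      have "(w has_derivative (\<lambda>v. gradient w (p + t *\<^sub>R b) \<bullet> v)) (at (p + t *\<^sub>R b))"
        using dw in_D[OF that] unfolding C2_data_def by blast
      then show ?thesis by (rule has_real_derivative_along_line)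
    qed
    have "((\<lambda>x. gradient w x \<bullet> b) has_derivative (\<lambda>v. gradient (partial b w) p \<bullet> v)) (at (p + 0 *\<^sub>R b))"
      using dw p b unfolding C2_data_def by simp
    then show "((\<lambda>t. gradient w (p + t *\<^sub>R b) \<bullet> b) has_real_derivative gradient (partial b w) p \<bullet> b) (at 0)"
      by (rule has_real_derivative_along_line)
  qed
  then show ?thesis
    using C2_data_laplacian[OF D dw p] by (simp add: sum_nonpos)
qed

lemma superlevel_set_closed:
  fixes f :: "'a::euclidean_space \<Rightarrow> real"
  assumes D: "open D" and f: "continuous_on D f"
    and bdry: "\<And>z. z \<in> frontier D \<Longrightarrow> \<forall>\<^sub>F x in at z within D. f x < m"
  shows "closed {x \<in> D. m \<le> f x}" (is "closed ?K")
  unfolding closed_limpt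
  proof (intro allI impI)
    fix z assume z: "z islimpt ?K"
    have "z \<in> D"
    proof (rule ccontr)
      assume "z \<notin> D"
      have "z islimpt D" using z by (rule islimpt_subset) auto
      then have "z \<in> frontier D"
        using \<open>z \<notin> D\<close> D by (simp add: frontier_def interior_open islimpt_in_closure)
      from bdry[OF this] obtain S where S: "open S" "z \<in> S"
        "\<And>x. x \<in> S \<Longrightarrow> x \<noteq> z \<Longrightarrow> x \<in> D \<Longrightarrow> f x < m"
        unfolding eventually_at_topological by blast
      obtain y where "y \<in> ?K" "y \<in> S" "y \<noteq> z" using z S unfolding islimpt_def by blast
      then show False using S(3)[of y] by auto
    qed
    moreover have "f z \<ge> m"
    proof (rule tendsto_lowerbound)
      show "(f \<longlongrightarrow> f z) (at z within ?K)"
        using f D \<open>z \<in> D\<close>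
        by (meson continuous_on_eq_continuous_at isCont_def tendsto_within_subset subset_UNIV)
      show "\<forall>\<^sub>F x in at z within ?K. m \<le> f x"
        unfolding eventually_at_filter by auto
      show "at z within ?K \<noteq> bot" using z by (simp add: trivial_limit_within)
    qed
    ultimately show "z \<in> ?K" by simp
  qed

lemma superlevel_set_compact:
  fixes f :: "'a::euclidean_space \<Rightarrow> real"
  assumes D: "open D" and f: "continuous_on D f"
    and bdry: "\<And>z. z \<in> frontier D \<Longrightarrow> \<forall>\<^sub>F x in at z within D. f x < m"
    and infty: "\<forall>\<^sub>F x in inf at_infinity (principal D). f x < m"
  shows "compact {x \<in> D. m \<le> f x}"
proof -
  obtain B where B: "\<And>x. x \<in> D \<Longrightarrow> B \<le> norm x \<Longrightarrow> f x < m"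
    using infty unfolding eventually_inf_principal eventually_at_infinity by blast
  have "bounded {x \<in> D. m \<le> f x}"
    unfolding bounded_iff using B by (intro exI[of _ B]) force
  then show ?thesis
    using superlevel_set_closed[OF D f bdry] by (simp add: compact_eq_bounded_closed)
qed

text \<open>A function that stays below \<open>M\<close> near the boundary and at infinity could exceed \<open>M\<close> only on a
  compact set; adding a small multiple of \<open>|x - x\<^sub>0|\<^sup>2\<close> makes the Laplacian strictly positive at
  the maximum, which is impossible.\<close>
theorem maximum_principle:
  fixes u :: "'a::euclidean_space \<Rightarrow> real"
  assumes D: "open D" and u: "C2_on D u" and sub: "\<And>x. x \<in> D \<Longrightarrow> 0 \<le> laplacian u x"
    and bdry: "\<And>z e. z \<in> frontier D \<Longrightarrow> 0 < e \<Longrightarrow> \<forall>\<^sub>F x in at z within D. u x \<le> M + e"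
    and infty: "\<And>e. 0 < e \<Longrightarrow> \<forall>\<^sub>F x in inf at_infinity (principal D). u x \<le> M + e"
    and x0: "x0 \<in> D"
  shows "u x0 \<le> M"
proof (rule ccontr)
  assume "\<not> u x0 \<le> M"
  define e where "e = (u x0 - M) / 3"
  have e: "e > 0" "u x0 = M + 3 * e" using \<open>\<not> u x0 \<le> M\<close> by (auto simp: e_def field_simps)
  define K where "K = {x \<in> D. u x \<ge> M + 2 * e}"
  have K: "compact K"
    unfolding K_def
  proof (rule superlevel_set_compact[OF D C2_on_continuous[OF u]])
    show "\<forall>\<^sub>F x in at z within D. u x < M + 2 * e" if "z \<in> frontier D" for z
      using bdry[OF that e(1)] by eventually_elim (use e in simp)
    show "\<forall>\<^sub>F x in inf at_infinity (principal D). u x < M + 2 * e"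
      using infty[OF e(1)] by eventually_elim (use e in simp)
  qed
  have x0K: "x0 \<in> K" using x0 e by (simp add: K_def)
  obtain R where R: "R > 0" "\<And>x. x \<in> K \<Longrightarrow> norm (x - x0) \<le> R"
    using compact_imp_bounded[OF K] unfolding bounded_any_center[where a=x0] dist_norm
    by (metis abs_ge_self abs_ge_zero add_pos_nonneg less_add_one norm_minus_commute order_trans
        zero_less_one less_imp_le linorder_not_less)
  define \<eta> where "\<eta> = e / (2 * R\<^sup>2)"
  have \<eta>: "\<eta> > 0" using e R by (simp add: \<eta>_def)
  have small: "\<eta> * (norm (x - x0))\<^sup>2 \<le> e / 2" if "x \<in> K" for x
  proof -
    have "(norm (x - x0))\<^sup>2 \<le> R\<^sup>2" using R(2)[OF that] by (intro power_mono) auto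
    then have "\<eta> * (norm (x - x0))\<^sup>2 \<le> \<eta> * R\<^sup>2" using \<eta> by (intro mult_left_mono) auto
    then show ?thesis using R by (simp add: \<eta>_def)
  qed
  define w where "w x = u x + \<eta> * (norm (x - x0))\<^sup>2" for x
  have sq: "C2_on D (\<lambda>x. \<eta> * (norm (x - x0))\<^sup>2)"
    by (rule C2_on_cmult(1)[OF D C2_on_norm_square(1)])
  have wC: "C2_on D w" unfolding w_def by (rule C2_on_add(1)[OF D u sq])
  have wlap: "laplacian w x > 0" if x: "x \<in> D" for x
    using C2_on_add(3)[OF D u sq x] C2_on_cmult(3)[OF D C2_on_norm_square(1) x, of \<eta> x0]
      sub[OF x] \<eta> unfolding w_def
    by (simp add: C2_on_norm_square add_nonneg_pos)
  have "continuous_on K w"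
    using C2_on_continuous[OF wC] by (rule continuous_on_subset) (auto simp: K_def)
  from continuous_attains_sup[OF K _ this] x0K
  obtain p where p: "p \<in> K" "\<And>x. x \<in> K \<Longrightarrow> w x \<le> w p" by blast
  have "w x0 \<le> w p" using p(2) x0K by blast
  then have up: "u p > M + 2 * e" using small[OF p(1)] e by (simp add: w_def)
  have pD: "p \<in> D" using p by (simp add: K_def)
  define V where "V = {x \<in> D. M + 2 * e < u x}"
  have V: "open V"
    using continuous_on_open_vimage[OF D, of u] C2_on_continuous[OF u] open_greaterThan[of "M + 2 * e"]
    by (auto simp: V_def vimage_def Int_def conj_commute dest!: spec[of _ "{M + 2 * e<..}"])
  have "laplacian w p \<le> 0"
    by (rule laplacian_local_max[OF V C2_on_subset[OF wC]])
      (use pD up p in \<open>auto simp: V_def K_def\<close>)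
  with wlap[OF pD] show False by simp
qed

section \<open>The fundamental solution and its regularisation\<close>

definition fund_coeff :: "nat \<Rightarrow> real" where
  "fund_coeff n = 1 / (real (n - 2) * (real n * unit_ball_vol (real n)))"

lemma sphere_measure_unit_sphere:
  "sphere_measure (sphere (0::'a::euclidean_space) 1) = real DIM('a) * unit_ball_vol (real DIM('a))"
proof -
  have "{r *\<^sub>R \<theta> | r \<theta>. 0 < r \<and> r \<le> 1 \<and> \<theta> \<in> sphere (0::'a) 1} = cball 0 1 - {0}"
  proof (intro set_eqI iffI)
    fix x :: 'a assume "x \<in> cball 0 1 - {0}"
    then have "x = norm x *\<^sub>R (x /\<^sub>R norm x)" "0 < norm x" "norm x \<le> 1"
      "x /\<^sub>R norm x \<in> sphere 0 1" by auto
    then show "x \<in> {r *\<^sub>R \<theta> | r \<theta>. 0 < r \<and> r \<le> 1 \<and> \<theta> \<in> sphere 0 1}" by blast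
  qed auto
  moreover have "measure lebesgue (cball (0::'a) 1 - {0}) = measure lebesgue (cball (0::'a) 1)"
    by (rule measure_Diff_null_set) (auto simp: negligible_iff_null_sets[symmetric])
  ultimately show ?thesis
    by (simp add: sphere_measure_def content_cball)
qed

lemma fundamental_solution_eq:
  "fundamental_solution (x::'a::euclidean_space) = fund_coeff DIM('a) / norm x ^ (DIM('a) - 2)"
  by (simp add: fundamental_solution_def fund_coeff_def sphere_measure_unit_sphere)

lemma fund_coeff_pos: "n > 2 \<Longrightarrow> fund_coeff n > 0"
  by (simp add: fund_coeff_def)

lemma has_real_derivative_If_le:
  fixes f g :: "real \<Rightarrow> real"
  assumes f: "\<And>s. s \<le> a \<Longrightarrow> (f has_real_derivative f' s) (at s)"
    and g: "\<And>s. a \<le> s \<Longrightarrow> (g has_real_derivative g' s) (at s)"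
    and eq: "f a = g a" "f' a = g' a"
  shows "((\<lambda>s. if s \<le> a then f s else g s) has_real_derivative (if s \<le> a then f' s else g' s)) (at s)"
proof -
  have "((\<lambda>s. if s \<in> {..a} then f s else g s) has_derivative
      (if s \<in> {..a} then (*) (f' s) else (*) (g' s))) (at s within ({..a} \<union> {a<..}))"
  proof (rule has_derivative_If_within_closures[where f' = "\<lambda>s. (*) (f' s)" and g' = "\<lambda>s. (*) (g' s)"])
    show "(f has_derivative (*) (f' s)) (at s within {..a} \<union> (closure {..a} \<inter> closure {a<..}))"
      if "s \<in> {..a} \<union> (closure {..a} \<inter> closure {a<..})"
      using f[of s] that by (auto simp: has_field_derivative_def intro: has_derivative_at_withinI)
    show "(g has_derivative (*) (g' s)) (at s within {a<..} \<union> (closure {..a} \<inter> closure {a<..}))"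
      if "s \<in> {a<..} \<union> (closure {..a} \<inter> closure {a<..})"
      using g[of s] that by (auto simp: has_field_derivative_def intro: has_derivative_at_withinI)
  qed (use eq in auto)
  moreover have "{..a} \<union> {a<..} = (UNIV :: real set)" by auto
  ultimately show ?thesis by (cases "s \<le> a") (auto simp: has_field_derivative_def)
qed

text \<open>In terms of \<open>s = |z|\<^sup>2\<close> the fundamental solution is \<open>s powr - m\<close> with \<open>m = (n-2)/2\<close>, up to the
  normalising factor. Below \<open>a\<close> this is replaced by its second-order Taylor polynomial at \<open>a\<close>.\<close>
definition capped_powr :: "real \<Rightarrow> real \<Rightarrow> real \<Rightarrow> real" where
  "capped_powr m a s =
     (if s \<le> a then a powr - m * (1 - m * (s / a - 1) + m * (m + 1) / 2 * (s / a - 1)\<^sup>2)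
      else s powr - m)"

definition capped_powr' :: "real \<Rightarrow> real \<Rightarrow> real \<Rightarrow> real" where
  "capped_powr' m a s =
     (if s \<le> a then a powr - m * (- m / a + m * (m + 1) / a * (s / a - 1)) else - m * s powr (- m - 1))"

definition capped_powr'' :: "real \<Rightarrow> real \<Rightarrow> real \<Rightarrow> real" where
  "capped_powr'' m a s =
     (if s \<le> a then a powr - m * (m * (m + 1) / a\<^sup>2) else m * (m + 1) * s powr (- m - 2))"

lemma capped_powr_derivatives:
  assumes a: "a > 0"
  shows "(capped_powr m a has_real_derivative capped_powr' m a s) (at s)"
    "(capped_powr' m a has_real_derivative capped_powr'' m a s) (at s)"
    "continuous_on UNIV (capped_powr'' m a)"
proof -
  have p1: "a powr (- m - 1) = a powr - m / a" using a by (simp add: powr_diff)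
  have p2: "a powr (- m - 2) = a powr - m / a\<^sup>2" using a by (simp add: powr_diff)
  have p3: "a powr (- 1 - m) = a powr - m / a" using a by (simp add: powr_diff powr_minus field_simps)
  show "(capped_powr m a has_real_derivative capped_powr' m a s) (at s)"
    unfolding capped_powr_def capped_powr'_def
    by (rule has_real_derivative_If_le)
      (use a p1 in \<open>auto intro!: derivative_eq_intros simp: field_simps power2_eq_square\<close>)
  show "(capped_powr' m a has_real_derivative capped_powr'' m a s) (at s)"
    unfolding capped_powr'_def capped_powr''_def
  proof (rule has_real_derivative_If_le)
    show "((\<lambda>s. - m * s powr (- m - 1)) has_real_derivative m * (m + 1) * s powr (- m - 2)) (at s)"
      if "a \<le> s" for s
      using a that by (auto intro!: derivative_eq_intros simp: algebra_simps)
  qed (use a in \<open>auto intro!: derivative_eq_intros simp: p1 p2 power2_eq_square\<close>)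
  have "continuous_on ({..a} \<union> {a..}) (\<lambda>s. if s \<le> a then a powr - m * (m * (m + 1) / a\<^sup>2)
      else m * (m + 1) * s powr (- m - 2))"
    by (rule continuous_on_If) (use a p2 in \<open>auto intro!: continuous_intros simp: field_simps\<close>)
  moreover have "{..a} \<union> {a..} = (UNIV :: real set)" by auto
  ultimately show "continuous_on UNIV (capped_powr'' m a)"
    by (simp add: capped_powr''_def[abs_def])
qed

lemma norm_square_powr:
  assumes "z \<noteq> 0"
  shows "((norm z)\<^sup>2) powr - (real k / 2) = 1 / norm z ^ k"
proof -
  have "((norm z)\<^sup>2) powr - (real k / 2) = norm z powr - real k"
    using assms by (simp add: powr_powr flip: powr_numeral)
  then show ?thesis using assms by (simp add: powr_minus powr_realpow inverse_eq_divide)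
qed

text \<open>The fundamental solution with its pole capped inside the ball of radius \<open>\<rho>\<close>; matching two
  derivatives on the sphere makes it \<open>C\<^sup>2\<close>.\<close>
definition fund_reg :: "real \<Rightarrow> 'a::euclidean_space \<Rightarrow> real" where
  "fund_reg \<rho> z = fund_coeff DIM('a) * capped_powr (real (DIM('a) - 2) / 2) (\<rho>\<^sup>2) ((norm z)\<^sup>2)"

text \<open>Minus the Laplacian of the capped fundamental solution: a parabolic bump of mass one on the
  ball of radius \<open>\<rho>\<close>.\<close>
definition ball_bump :: "real \<Rightarrow> 'a::euclidean_space \<Rightarrow> real" where
  "ball_bump \<rho> z = (real DIM('a) + 2) / (2 * unit_ball_vol (real DIM('a)) * \<rho> ^ DIM('a))
      * max 0 (1 - (norm z / \<rho>)\<^sup>2)"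

lemma fund_reg_outside:
  fixes z :: "'a::euclidean_space"
  assumes \<rho>: "\<rho> > 0" and z: "norm z \<ge> \<rho>"
  shows "fund_reg \<rho> z = fundamental_solution z"
proof -
  have "\<rho>\<^sup>2 \<le> (norm z)\<^sup>2" using assms by (intro power_mono) auto
  then have "capped_powr (real (DIM('a) - 2) / 2) (\<rho>\<^sup>2) ((norm z)\<^sup>2)
      = (norm z)\<^sup>2 powr - (real (DIM('a) - 2) / 2)"
    using \<rho> by (cases "\<rho>\<^sup>2 = (norm z)\<^sup>2") (auto simp: capped_powr_def)
  moreover have "z \<noteq> 0" using assms by auto
  ultimately show ?thesis
    unfolding fund_reg_def fundamental_solution_eq using norm_square_powr[of z "DIM('a) - 2"] by simp
qed

text \<open>For a function \<open>p\<close> of \<open>s = |z - x|\<^sup>2\<close> the Laplacian is \<open>2 n p' + 4 s p''\<close>. For \<open>s powr - m\<close> it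
  vanishes, and for the Taylor polynomial it is affine in \<open>s\<close>.\<close>
lemma fund_reg_C2:
  fixes x :: "'a::euclidean_space"
  assumes dim: "DIM('a) > 2" and \<rho>: "\<rho> > 0"
  shows "C2_on UNIV (\<lambda>z. fund_reg \<rho> (z - x))"
    "laplacian (\<lambda>z. fund_reg \<rho> (z - x)) z = - ball_bump \<rho> (z - x)"
proof -
  let ?m = "real (DIM('a) - 2) / 2" and ?a = "\<rho>\<^sup>2"
  define V where "V = unit_ball_vol (real DIM('a))"
  have V: "V > 0" by (simp add: V_def)
  have a: "?a > 0" using \<rho> by simp
  have n: "real (DIM('a) - 2) = real DIM('a) - 2" using dim by simp
  note c = C2_on_compose[OF open_UNIV C2_on_norm_square(1)[of UNIV x] capped_powr_derivatives(1)[OF a, of ?m]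
      capped_powr_derivatives(2)[OF a] continuous_on_subset[OF capped_powr_derivatives(3)[OF a] subset_UNIV]]
  note c2 = C2_on_cmult[OF open_UNIV c(1), where c = "fund_coeff DIM('a)"]
  show "C2_on UNIV (\<lambda>z. fund_reg \<rho> (z - x))" unfolding fund_reg_def by (rule c2(1))
  define s where "s = (norm (z - x))\<^sup>2"
  have lap: "laplacian (\<lambda>z. fund_reg \<rho> (z - x)) z = fund_coeff DIM('a) *
      (capped_powr' ?m ?a s * (2 * real DIM('a)) + capped_powr'' ?m ?a s * (4 * s))"
    unfolding fund_reg_def using c2(3)[of z] c(3)[of z]
    by (simp add: C2_on_norm_square s_def power_mult_distrib)
  have s: "s \<ge> 0" by (simp add: s_def)
  show "laplacian (\<lambda>z. fund_reg \<rho> (z - x)) z = - ball_bump \<rho> (z - x)"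
  proof (cases "s \<le> ?a")
    case True
    have tt: "(norm (z - x) / \<rho>)\<^sup>2 = s / ?a" by (simp add: s_def power_divide)
    have bb: "ball_bump \<rho> (z - x) = (real DIM('a) + 2) / (2 * V * \<rho> ^ DIM('a)) * (1 - s / ?a)"
      using True a unfolding ball_bump_def tt V_def by simp
    have "?a powr - ?m = 1 / \<rho> ^ (DIM('a) - 2)"
      using norm_square_powr[of \<rho> "DIM('a) - 2"] \<rho> by simp
    also have "\<dots> = ?a / \<rho> ^ DIM('a)"
    proof -
      have "\<rho> ^ DIM('a) = \<rho> ^ (DIM('a) - 2) * \<rho>\<^sup>2"
        using dim power_add[of \<rho> "DIM('a) - 2" 2] by (metis le_add_diff_inverse2 less_imp_le)
      then show ?thesis using \<rho> by simp
    qed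
    finally have pw: "?a powr - ?m = ?a / \<rho> ^ DIM('a)" .
    have "capped_powr' ?m ?a s * (2 * real DIM('a)) + capped_powr'' ?m ?a s * (4 * s)
       = - (?m * real DIM('a) * (real DIM('a) + 2) / \<rho> ^ DIM('a) * (1 - s / ?a))"
    proof -
      define A B t M where "A = ?a" and "B = \<rho> ^ DIM('a)" and "t = s / A" and "M = ?m"
      have A: "A > 0" and B: "B > 0" using a \<rho> by (simp_all add: A_def B_def)
      have st: "s = t * A" using A by (simp add: t_def)
      have d: "real DIM('a) = 2 * M + 2" unfolding M_def n by (simp add: field_simps)
      have pw': "A powr - M = A / B" using pw by (simp add: A_def B_def M_def)
      have "s \<le> A" using True by (simp add: A_def)
      then have 1: "capped_powr' M A s = A / B * (- M / A + M * (M + 1) / A * (t - 1))"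
        and 2: "capped_powr'' M A s = A / B * (M * (M + 1) / A\<^sup>2)"
        by (simp_all add: capped_powr'_def capped_powr''_def pw' t_def)
      have "- M / A + M * (M + 1) / A * (t - 1) = (- M + M * (M + 1) * (t - 1)) / A"
        by (simp add: add_divide_distrib diff_divide_distrib)
      then have 3: "capped_powr' M A s = (- M + M * (M + 1) * (t - 1)) / B"
        using A 1 by simp
      have 4: "capped_powr'' M A s * s = M * (M + 1) * t / B"
        using A unfolding 2 by (simp add: st power2_eq_square)
      have "(- M + M * (M + 1) * (t - 1)) * (2 * (2 * M + 2)) + 4 * (M * (M + 1) * t)
         = - (M * (2 * M + 2) * (2 * M + 2 + 2) * (1 - t))"
        by (simp add: algebra_simps)
      then have "((- M + M * (M + 1) * (t - 1)) * (2 * (2 * M + 2)) + 4 * (M * (M + 1) * t)) / B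
         = - (M * (2 * M + 2) * (2 * M + 2 + 2) * (1 - t)) / B"
        by simp
      moreover have "capped_powr'' M A s * (4 * s) = 4 * (M * (M + 1) * t) / B"
        using 4 by simp
      ultimately have "capped_powr' M A s * (2 * (2 * M + 2)) + capped_powr'' M A s * (4 * s)
         = - (M * (2 * M + 2) * (2 * M + 2 + 2) * (1 - t)) / B"
        unfolding 3 by (simp add: add_divide_distrib)
      then have "capped_powr' M A s * (2 * (2 * M + 2)) + capped_powr'' M A s * (4 * s)
         = - (M * (2 * M + 2) * (2 * M + 2 + 2) / B * (1 - t))" by simp
      then show ?thesis unfolding A_def[symmetric] M_def[symmetric] B_def[symmetric] t_def[symmetric] d .
    qed
    then show ?thesis
    proof -
      have "fund_coeff DIM('a) * (?m * real DIM('a) * (real DIM('a) + 2) / \<rho> ^ DIM('a))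
          = (real DIM('a) + 2) / (2 * V * \<rho> ^ DIM('a))"
        using V dim \<rho> by (simp add: fund_coeff_def V_def[symmetric])
      moreover assume "capped_powr' ?m ?a s * (2 * real DIM('a)) + capped_powr'' ?m ?a s * (4 * s)
       = - (?m * real DIM('a) * (real DIM('a) + 2) / \<rho> ^ DIM('a) * (1 - s / ?a))"
      moreover define Q where "Q = ?m * real DIM('a) * (real DIM('a) + 2) / \<rho> ^ DIM('a)"
      ultimately show ?thesis
        unfolding lap bb Q_def[symmetric] by (simp only: mult_minus_right mult.assoc[symmetric])
    qed
  next
    case False
    then have "s > 0" using a by linarith
    have pw: "s powr (- ?m - 1) = s powr (- ?m - 2) * s"
    proof -
      have e: "- ?m - 1 = (- ?m - 2) + 1" by simp
      show ?thesis unfolding e powr_add using \<open>s > 0\<close> by simp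
    qed
    have "laplacian (\<lambda>z. fund_reg \<rho> (z - x)) z = 0"
    proof -
      define M where "M = ?m"
      have d: "real DIM('a) = 2 * M + 2" unfolding M_def n by (simp add: field_simps)
      have "- M * s powr (- M - 1) * (2 * (2 * M + 2)) + M * (M + 1) * s powr (- M - 2) * (4 * s) = 0"
        using pw unfolding M_def[symmetric] by (simp add: algebra_simps)
      then show ?thesis
        using False unfolding lap capped_powr'_def capped_powr''_def M_def[symmetric] d by simp
    qed
    moreover have "1 - (norm (z - x) / \<rho>)\<^sup>2 \<le> 0"
      using False \<rho> by (simp add: power_divide s_def)
    ultimately show ?thesis by (simp add: ball_bump_def max_def)
  qed
qed

lemma ball_bump_nonneg: "\<rho> > 0 \<Longrightarrow> ball_bump \<rho> z \<ge> 0"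
  by (simp add: ball_bump_def)

lemma ball_bump_outside:
  assumes "\<rho> > 0" "norm z \<ge> \<rho>"
  shows "ball_bump \<rho> z = 0"
proof -
  have "1\<^sup>2 \<le> (norm z / \<rho>)\<^sup>2" using assms by (intro power_mono) auto
  then show ?thesis by (simp add: ball_bump_def max_def)
qed

lemma ball_bump_continuous: "continuous_on A (ball_bump \<rho>)"
proof (cases "\<rho> = 0")
  case False
  then show ?thesis unfolding ball_bump_def[abs_def] by (intro continuous_intros) auto
qed (simp add: ball_bump_def[abs_def])

text \<open>Slicing by concentric balls: \<open>1 - |z|\<^sup>2/\<rho>\<^sup>2\<close> is the integral of \<open>2 r\<close> over those \<open>r \<le> 1\<close>
  for which \<open>z\<close> lies in the ball of radius \<open>\<rho> r\<close>.\<close>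
lemma ball_bump_integral:
  assumes \<rho>: "\<rho> > 0"
  shows "integrable lborel (ball_bump \<rho> :: 'a::euclidean_space \<Rightarrow> real)"
    "(LINT z|lborel. ball_bump \<rho> (z::'a)) = 1"
proof -
  define V where "V = unit_ball_vol (real DIM('a))"
  define n where "n = DIM('a)"
  have V: "V > 0" by (simp add: V_def)
  have slice: "(\<integral>\<^sup>+r. ennreal (2 * r) * indicator {0..1} r * indicator {z. norm z \<le> \<rho> * r} z \<partial>lborel)
      = ennreal (max 0 (1 - (norm z / \<rho>)\<^sup>2))" for z :: 'a
  proof -
    have "(\<integral>\<^sup>+r. ennreal (2 * r) * indicator {0..1} r * indicator {z. norm z \<le> \<rho> * r} z \<partial>lborel)
       = (\<integral>\<^sup>+r. ennreal (2 * r) * indicator {norm z / \<rho>..1} r \<partial>lborel)"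
      using \<rho> by (intro nn_integral_cong)
        (auto simp: indicator_def field_simps zero_le_mult_iff dest!: order_trans[OF norm_ge_zero])
    also have "\<dots> = ennreal (max 0 (1 - (norm z / \<rho>)\<^sup>2))"
    proof (cases "norm z / \<rho> \<le> 1")
      case True
      have "(\<integral>\<^sup>+r. ennreal (2 * r) * indicator {norm z / \<rho>..1} r \<partial>lborel)
          = ennreal (1\<^sup>2 - (norm z / \<rho>)\<^sup>2)"
        by (rule nn_integral_FTC_Icc)
          (use True \<rho> in \<open>auto intro!: derivative_eq_intros
            intro: order_trans[of 0 "norm z / \<rho>"]\<close>)
      moreover have "(norm z / \<rho>)\<^sup>2 \<le> 1" using True \<rho> by (intro power_le_one) auto
      ultimately show ?thesis by simp
    next
      case False
      then have "1\<^sup>2 \<le> (norm z / \<rho>)\<^sup>2" by (intro power_mono) auto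
      then have "max 0 (1 - (norm z / \<rho>)\<^sup>2) = 0" by (intro max_absorb1) simp
      with False show ?thesis by simp
    qed
    finally show ?thesis .
  qed
  have [measurable]: "(\<lambda>(z::'a, r). indicator {z. norm z \<le> \<rho> * r} z :: ennreal)
      \<in> borel_measurable (lborel \<Otimes>\<^sub>M lborel)"
    by (simp add: indicator_def case_prod_beta)
  have vol: "emeasure lborel {z::'a. norm z \<le> \<rho> * r} = ennreal (V * (\<rho> * r) ^ n)" if "r \<ge> 0" for r
    using emeasure_cball[of "\<rho> * r" "0::'a"] that \<rho>
    by (simp add: cball_def V_def n_def)
  have "(\<integral>\<^sup>+(z::'a). ennreal (max 0 (1 - (norm z / \<rho>)\<^sup>2)) \<partial>lborel)
     = (\<integral>\<^sup>+r. (\<integral>\<^sup>+(z::'a). ennreal (2 * r) * indicator {0..1} r * indicator {z. norm z \<le> \<rho> * r} z \<partial>lborel) \<partial>lborel)"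
    unfolding slice[symmetric]
    by (rule lborel_pair.Fubini'[symmetric]) measurable
  also have "\<dots> = (\<integral>\<^sup>+r. ennreal (2 * V * \<rho> ^ n * r ^ (n + 1)) * indicator {0..1} r \<partial>lborel)"
  proof (rule nn_integral_cong)
    fix r :: real
    have "(\<integral>\<^sup>+(z::'a). ennreal (2 * r) * indicator {0..1} r * indicator {z. norm z \<le> \<rho> * r} z \<partial>lborel)
       = ennreal (2 * r) * indicator {0..1} r * emeasure lborel {z::'a. norm z \<le> \<rho> * r}"
      by (subst nn_integral_cmult_indicator) auto
    also have "\<dots> = ennreal (2 * V * \<rho> ^ n * r ^ (n + 1)) * indicator {0..1} r"
      using V \<rho> by (auto simp: indicator_def vol ennreal_mult[symmetric] power_mult_distrib
          intro!: arg_cong[of _ _ ennreal])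
    finally show "(\<integral>\<^sup>+(z::'a). ennreal (2 * r) * indicator {0..1} r * indicator {z. norm z \<le> \<rho> * r} z \<partial>lborel)
       = ennreal (2 * V * \<rho> ^ n * r ^ (n + 1)) * indicator {0..1} r" .
  qed
  also have "\<dots> = ennreal (2 * V * \<rho> ^ n * 1 ^ (n + 2) / (real n + 2) - 2 * V * \<rho> ^ n * 0 ^ (n + 2) / (real n + 2))"
  proof (rule nn_integral_FTC_Icc)
    show "((\<lambda>r. 2 * V * \<rho> ^ n * r ^ (n + 2) / (real n + 2)) has_real_derivative
        2 * V * \<rho> ^ n * r ^ (n + 1)) (at r)" for r
      using DERIV_cdivide[OF DERIV_cmult[OF DERIV_pow[of "n + 2" r], of "2 * V * \<rho> ^ n"], of "real n + 2"]
      by (simp add: add.commute mult.assoc)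
  qed (use V \<rho> in auto)
  finally have I: "(\<integral>\<^sup>+(z::'a). ennreal (max 0 (1 - (norm z / \<rho>)\<^sup>2)) \<partial>lborel)
     = ennreal (2 * V * \<rho> ^ n / (real n + 2))" by simp
  have m: "has_bochner_integral lborel (\<lambda>z::'a. max 0 (1 - (norm z / \<rho>)\<^sup>2)) (2 * V * \<rho> ^ n / (real n + 2))"
    by (rule has_bochner_integral_nn_integral[OF _ _ _ I]) (use V \<rho> in auto)
  have "has_bochner_integral lborel (ball_bump \<rho> :: 'a \<Rightarrow> real)
      ((real n + 2) / (2 * V * \<rho> ^ n) * (2 * V * \<rho> ^ n / (real n + 2)))"
    unfolding ball_bump_def[abs_def] n_def[symmetric] V_def[folded n_def, symmetric]
    by (rule has_bochner_integral_mult_right) (rule m)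
  moreover have "(real n + 2) / (2 * V * \<rho> ^ n) * (2 * V * \<rho> ^ n / (real n + 2)) = 1"
  proof -
    have "2 * V * \<rho> ^ n \<noteq> 0" using V \<rho> by simp
    moreover have "real n + 2 \<noteq> 0" by linarith
    ultimately show ?thesis by (simp only: times_divide_times_eq) simp
  qed
  ultimately have "has_bochner_integral lborel (ball_bump \<rho> :: 'a \<Rightarrow> real) 1" by simp
  then show "integrable lborel (ball_bump \<rho> :: 'a \<Rightarrow> real)" "(LINT z|lborel. ball_bump \<rho> (z::'a)) = 1"
    by (auto simp: has_bochner_integral_iff)
qed

text \<open>Averaging against the bumps recovers the value at a point of continuity.\<close>
lemma ball_bump_average_tendsto:
  fixes f :: "'a::euclidean_space \<Rightarrow> real"
  assumes f: "continuous (at x) f" and int: "set_integrable lborel (cball x r) f" and r: "r > 0"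
  shows "((\<lambda>\<rho>. LINT z|lborel. f z * ball_bump \<rho> (z - x)) \<longlongrightarrow> f x) (at_right 0)"
proof (rule tendstoI)
  fix e :: real assume e: "e > 0"
  then obtain d where d: "d > 0" "\<And>z. dist z x < d \<Longrightarrow> dist (f z) (f x) < e / 2"
    using f unfolding continuous_at_eps_delta by (metis half_gt_zero)
  have "\<bar>(LINT z|lborel. f z * ball_bump \<rho> (z - x)) - f x\<bar> < e" if \<rho>: "0 < \<rho>" "\<rho> < min d r" for \<rho>
  proof -
    have bm[measurable]: "(ball_bump \<rho> :: 'a \<Rightarrow> real) \<in> borel_measurable borel"
      by (rule borel_measurable_continuous_onI[OF ball_bump_continuous])
    have trans: "integrable lborel (\<lambda>z. ball_bump \<rho> (z - x))" "(LINT z|lborel. ball_bump \<rho> (z - x)) = 1"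
      using integral_translate[OF bm, of "- x"] ball_bump_integral[OF \<rho>(1)] by auto
    have fm: "(\<lambda>z. indicator (cball x r) z * f z) \<in> borel_measurable lborel"
      using int unfolding set_integrable_def by simp
    have eq: "f z * ball_bump \<rho> (z - x) = (indicator (cball x r) z * f z) * ball_bump \<rho> (z - x)" for z
      using ball_bump_outside[OF \<rho>(1), of "z - x"] \<rho>
      by (cases "z \<in> cball x r") (auto simp: dist_norm norm_minus_commute)
    have bound: "norm (f z * ball_bump \<rho> (z - x) - f x * ball_bump \<rho> (z - x)) \<le> e / 2 * ball_bump \<rho> (z - x)" for z
    proof (cases "dist z x < d")
      case True
      then have "\<bar>f z - f x\<bar> \<le> e / 2" using d(2)[of z] by (simp add: dist_real_def)
      then have "\<bar>f z - f x\<bar> * ball_bump \<rho> (z - x) \<le> e / 2 * ball_bump \<rho> (z - x)"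
        by (intro mult_right_mono ball_bump_nonneg \<rho>)
      then show ?thesis using ball_bump_nonneg[OF \<rho>(1), of "z - x"]
        by (simp add: left_diff_distrib[symmetric] abs_mult)
    next
      case False
      then show ?thesis using ball_bump_outside[OF \<rho>(1), of "z - x"] \<rho> by (simp add: dist_norm)
    qed
    have diff: "integrable lborel (\<lambda>z. f z * ball_bump \<rho> (z - x) - f x * ball_bump \<rho> (z - x))"
    proof (rule Bochner_Integration.integrable_bound)
      show "integrable lborel (\<lambda>z. e / 2 * ball_bump \<rho> (z - x))" using trans by simp
      show "(\<lambda>z. f z * ball_bump \<rho> (z - x) - f x * ball_bump \<rho> (z - x)) \<in> borel_measurable lborel"
        unfolding eq using fm by measurable
      show "AE z in lborel. norm (f z * ball_bump \<rho> (z - x) - f x * ball_bump \<rho> (z - x))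
          \<le> norm (e / 2 * ball_bump \<rho> (z - x))"
        using order_trans[OF bound abs_ge_self] by (intro AE_I2) simp
    qed
    have int2: "integrable lborel (\<lambda>z. f z * ball_bump \<rho> (z - x))"
      using Bochner_Integration.integrable_add[OF diff integrable_mult_right[OF trans(1), of "f x"]] by simp
    have "(LINT z|lborel. f z * ball_bump \<rho> (z - x)) - f x
        = (LINT z|lborel. f z * ball_bump \<rho> (z - x) - f x * ball_bump \<rho> (z - x))"
      using int2 trans by (subst Bochner_Integration.integral_diff) auto
    also have "\<bar>\<dots>\<bar> \<le> (LINT z|lborel. e / 2 * ball_bump \<rho> (z - x))"
      using Bochner_Integration.integral_norm_bound_integral[OF diff integrable_mult_right[OF trans(1), of "e/2"] bound] by simp
    also have "\<dots> = e / 2" using trans by simp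
    finally show ?thesis using e by simp
  qed
  then show "\<forall>\<^sub>F \<rho> in at_right 0. dist (LINT z|lborel. f z * ball_bump \<rho> (z - x)) (f x) < e"
    unfolding eventually_at_right_field dist_real_def using d r by (intro exI[of _ "min d r"]) auto
qed

lemma fundamental_solution_harmonic:
  fixes x :: "'a::euclidean_space"
  assumes dim: "DIM('a) > 2"
  shows "C2_on (- {x}) (\<lambda>z. fundamental_solution (z - x))"
    "z \<noteq> x \<Longrightarrow> laplacian (\<lambda>z. fundamental_solution (z - x)) z = 0"
    "z \<noteq> x \<Longrightarrow> gradient (\<lambda>z. fundamental_solution (z - x)) z
       = (- (real DIM('a) - 2) * fund_coeff DIM('a) / norm (z - x) ^ DIM('a)) *\<^sub>R (z - x)"
proof -
  let ?m = "real (DIM('a) - 2) / 2"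
  have n: "real (DIM('a) - 2) = real DIM('a) - 2" using dim by simp
  have o: "open (- {x})" by auto
  have d1: "((\<lambda>s. s powr - ?m) has_real_derivative - ?m * s powr (- ?m - 1)) (at s)"
    and d2: "((\<lambda>s. - ?m * s powr (- ?m - 1)) has_real_derivative ?m * (?m + 1) * s powr (- ?m - 2)) (at s)"
    if "s > 0" for s
    using that by (auto intro!: derivative_eq_intros simp: field_simps)
  have pos: "(norm (z - x))\<^sup>2 > 0" if "z \<in> - {x}" for z using that by simp
  have cont: "continuous_on ((\<lambda>z. (norm (z - x))\<^sup>2) ` (- {x})) (\<lambda>s. ?m * (?m + 1) * s powr (- ?m - 2))"
    by (auto intro!: continuous_intros)
  note c = C2_on_compose[OF o C2_on_norm_square(1)[of "- {x}" x] d1[OF pos] d2[OF pos] cont]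
  note c2 = C2_on_cmult[OF o c(1), where c = "fund_coeff DIM('a)"]
  have eq: "fund_coeff DIM('a) * (norm (z - x))\<^sup>2 powr - ?m = fundamental_solution (z - x)" if "z \<in> - {x}" for z
    using that norm_square_powr[of "z - x" "DIM('a) - 2"] by (simp add: fundamental_solution_eq)
  note c3 = C2_on_cong[OF o c2(1) eq]
  show "C2_on (- {x}) (\<lambda>z. fundamental_solution (z - x))" by (rule c3(1))
  assume z: "z \<noteq> x"
  define s where "s = (norm (z - x))\<^sup>2"
  have s: "s > 0" using z by (simp add: s_def)
  have pw: "s powr (- ?m - 1) = s powr (- ?m - 2) * s"
  proof -
    have e: "- ?m - 1 = (- ?m - 2) + 1" by simp
    show ?thesis unfolding e powr_add using s by simp
  qed
  have lap: "laplacian (\<lambda>z. fundamental_solution (z - x)) z = fund_coeff DIM('a) *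
     (- ?m * s powr (- ?m - 1) * (2 * real DIM('a)) + ?m * (?m + 1) * s powr (- ?m - 2) * (4 * s))"
    using c3(3)[of z] c2(3)[of z] c(3)[of z] z
    by (simp add: C2_on_norm_square s_def power_mult_distrib)
  show "laplacian (\<lambda>z. fundamental_solution (z - x)) z = 0"
  proof -
    define M where "M = ?m"
    have d: "real DIM('a) = 2 * M + 2" unfolding M_def n by (simp add: field_simps)
    have "- M * s powr (- M - 1) * (2 * (2 * M + 2)) + M * (M + 1) * s powr (- M - 2) * (4 * s) = 0"
      using pw unfolding M_def[symmetric] by (simp add: algebra_simps)
    then show ?thesis
      using lap unfolding M_def[symmetric] d by simp
  qed
  have "s powr (- ?m - 1) = 1 / norm (z - x) ^ DIM('a)"
    using norm_square_powr[of "z - x" "DIM('a)"] z n by (simp add: s_def algebra_simps diff_divide_distrib)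
  then have "gradient (\<lambda>z. fundamental_solution (z - x)) z
     = fund_coeff DIM('a) *\<^sub>R ((- ?m * (1 / norm (z - x) ^ DIM('a))) *\<^sub>R (2 *\<^sub>R (z - x)))"
    using c3(2)[of z] c2(2)[of z] c(2)[of z] z by (simp add: C2_on_norm_square s_def)
  also have "\<dots> = (fund_coeff DIM('a) * (- ?m * (1 / norm (z - x) ^ DIM('a)) * 2)) *\<^sub>R (z - x)"
    by simp
  also have "fund_coeff DIM('a) * (- ?m * (1 / norm (z - x) ^ DIM('a)) * 2)
     = - (real DIM('a) - 2) * fund_coeff DIM('a) / norm (z - x) ^ DIM('a)"
  proof -
    have "f * (- ((d - 2) / 2) * (1 / X) * 2) = - (d - 2) * f / X" for f d X :: real
      by (cases "X = 0") (auto simp: divide_simps algebra_simps)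
    then show ?thesis unfolding n .
  qed
  finally show "gradient (\<lambda>z. fundamental_solution (z - x)) z
       = (- (real DIM('a) - 2) * fund_coeff DIM('a) / norm (z - x) ^ DIM('a)) *\<^sub>R (z - x)" .
qed

lemma fundamental_solution_harmonic_in:
  "DIM('a::euclidean_space) > 2 \<Longrightarrow> x \<notin> D \<Longrightarrow> harmonic_in D (\<lambda>z::'a. fundamental_solution (z - x))"
  using fundamental_solution_harmonic(2)[where x = x]
    C2_on_subset[OF fundamental_solution_harmonic(1)[where x = x], of D]
  unfolding harmonic_in_def by (metis subset_Compl_singleton)

lemma norm_gradient_fundamental_solution:
  fixes x z :: "'a::euclidean_space"
  assumes dim: "DIM('a) > 2" and z: "z \<noteq> x"
  shows "norm (gradient (\<lambda>z. fundamental_solution (z - x)) z)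
     = (real DIM('a) - 2) * fund_coeff DIM('a) / norm (z - x) ^ (DIM('a) - 1)"
proof -
  have "norm (z - x) ^ DIM('a) = norm (z - x) * norm (z - x) ^ (DIM('a) - 1)"
    using dim by (metis power_eq_if less_nat_zero_code not_less_zero)
  then show ?thesis
    using fundamental_solution_harmonic(3)[OF dim z] z dim fund_coeff_pos[OF dim]
    by (simp add: abs_mult)
qed

lemma fundamental_solution_nonneg: "DIM('a) > 2 \<Longrightarrow> fundamental_solution (x::'a::euclidean_space) \<ge> 0"
  using fund_coeff_pos[of "DIM('a)"] by (simp add: fundamental_solution_eq)

lemma fundamental_solution_minus: "fundamental_solution (- x) = fundamental_solution x"
  by (simp add: fundamental_solution_eq)

lemma fundamental_solution_scale:
  "fundamental_solution (r *\<^sub>R x) = fundamental_solution (x::'a::euclidean_space) / \<bar>r\<bar> ^ (DIM('a) - 2)"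
  by (simp add: fundamental_solution_eq power_mult_distrib mult.commute)

lemma fundamental_solution_at_infinity:
  assumes "DIM('a) > 2"
  shows "((fundamental_solution :: 'a::euclidean_space \<Rightarrow> real) \<longlongrightarrow> 0) at_infinity"
  unfolding fundamental_solution_eq[abs_def]
proof (rule tendsto_divide_0[OF tendsto_const])
  have "filterlim (\<lambda>x::'a. norm x ^ (DIM('a) - 2)) at_top at_infinity"
    using assms by (intro filterlim_pow_at_top filterlim_norm_at_top) auto
  then show "filterlim (\<lambda>x::'a. norm x ^ (DIM('a) - 2)) at_infinity at_infinity"
    by (rule filterlim_at_top_imp_at_infinity)
qed

lemma fundamental_solution_pole:
  fixes y :: "'a::euclidean_space"
  assumes dim: "DIM('a) > 2"
  shows "filterlim (\<lambda>x. fundamental_solution (x - y)) at_top (at y)"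
  unfolding fundamental_solution_eq
proof -
  have "((\<lambda>x. norm (x - y) ^ (DIM('a) - 2)) \<longlongrightarrow> norm (y - y) ^ (DIM('a) - 2)) (at y)"
    by (intro tendsto_intros)
  then have "filterlim (\<lambda>x. norm (x - y) ^ (DIM('a) - 2)) (at_right 0) (at y)"
    unfolding filterlim_at using dim by (auto simp: eventually_at_filter power_0_left)
  then have "filterlim (\<lambda>x. inverse (norm (x - y) ^ (DIM('a) - 2))) at_top (at y)"
    by (rule filterlim_compose[OF filterlim_inverse_at_top_right])
  then have "filterlim (\<lambda>x. fund_coeff DIM('a) * inverse (norm (x - y) ^ (DIM('a) - 2))) at_top (at y)"
    by (rule filterlim_tendsto_pos_mult_at_top[OF tendsto_const fund_coeff_pos[OF dim]])
  then show "filterlim (\<lambda>x. fund_coeff DIM('a) / norm (x - y) ^ (DIM('a) - 2)) at_top (at y)"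
    by (simp add: divide_inverse)
qed

lemma fundamental_solution_lipschitz:
  fixes v w :: "'a::euclidean_space"
  assumes dim: "DIM('a) > 2" and r: "r > 0" and seg: "\<And>z. z \<in> closed_segment v w \<Longrightarrow> norm z \<ge> r"
  shows "\<bar>fundamental_solution v - fundamental_solution w\<bar>
     \<le> (real DIM('a) - 2) * fund_coeff DIM('a) / r ^ (DIM('a) - 1) * norm (v - w)"
proof -
  let ?B = "(real DIM('a) - 2) * fund_coeff DIM('a) / r ^ (DIM('a) - 1)"
  let ?g = "gradient (\<lambda>z::'a. fundamental_solution (z - 0))"
  have d: "(fundamental_solution has_derivative (\<lambda>h. ?g z \<bullet> h)) (at z within S)" if "z \<noteq> 0" for z :: 'a and S
    using C2_on_imp_C2_data[OF fundamental_solution_harmonic(1)[OF dim, of 0]] that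
    unfolding C2_data_def by (auto intro: has_derivative_at_withinI)
  have "norm (fundamental_solution v - fundamental_solution w) \<le> ?B * norm (v - w)"
  proof (rule differentiable_bound[of "closed_segment v w"])
    fix z assume z: "z \<in> closed_segment v w"
    then have zr: "norm z \<ge> r" using seg by blast
    then have "z \<noteq> 0" using r by auto
    then show "(fundamental_solution has_derivative (\<lambda>h. ?g z \<bullet> h)) (at z within closed_segment v w)"
      by (rule d)
    have "norm (?g z) \<le> ?B"
      using norm_gradient_fundamental_solution[OF dim \<open>z \<noteq> 0\<close>] zr r dim fund_coeff_pos[OF dim]
      by (auto intro!: divide_left_mono power_mono mult_pos_pos zero_less_power simp: \<open>z \<noteq> 0\<close>)
    then show "onorm (\<lambda>h. ?g z \<bullet> h) \<le> ?B"
      by (rule onorm_inner_le)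
  qed auto
  then show ?thesis by simp
qed

section \<open>Mollification\<close>

text \<open>For \<open>p = 1\<close> this is the function \<open>exp (- 1/t)\<close>, which is flat at the origin; with polynomial
  factors in \<open>1/t\<close> the family becomes closed under differentiation.\<close>
definition flat_exp :: "real poly \<Rightarrow> real \<Rightarrow> real" where
  "flat_exp p t = (if t > 0 then poly p (1 / t) * exp (- (1 / t)) else 0)"

lemma poly_times_exp_minus_tendsto_0:
  "((\<lambda>x. poly p x * exp (- x)) \<longlongrightarrow> (0::real)) at_top"
proof -
  have "((\<lambda>x. \<Sum>i\<le>degree p. coeff p i * (x ^ i / exp x)) \<longlongrightarrow> (\<Sum>i\<le>degree p. coeff p i * 0)) at_top"
    by (intro tendsto_sum tendsto_mult tendsto_const tendsto_power_div_exp_0)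
  then show ?thesis
    by (simp add: poly_altdef exp_minus sum_distrib_right divide_inverse mult.assoc)
qed

lemma flat_exp_tendsto_0: "(flat_exp p \<longlongrightarrow> 0) (at 0)"
proof -
  have "((\<lambda>t. poly p (inverse t) * exp (- inverse t)) \<longlongrightarrow> 0) (at_right 0)"
    by (rule filterlim_compose[OF poly_times_exp_minus_tendsto_0 filterlim_inverse_at_top_right])
  then have "(flat_exp p \<longlongrightarrow> 0) (at_right 0)"
    by (rule Lim_transform_eventually)
      (auto simp: flat_exp_def eventually_at_right_field inverse_eq_divide intro!: exI[of _ 1])
  moreover have "(flat_exp p \<longlongrightarrow> 0) (at_left 0)"
    by (rule Lim_transform_eventually[OF tendsto_const])
      (auto simp: flat_exp_def eventually_at_left_field intro!: exI[of _ "-1"])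
  ultimately show ?thesis by (simp add: filterlim_split_at_real)
qed

lemma flat_exp_derivative:
  "(flat_exp p has_real_derivative flat_exp (pCons 0 (pCons 0 (p - pderiv p))) t) (at t)"
proof -
  consider "t > 0" | "t < 0" | "t = 0" by linarith
  then show ?thesis
  proof cases
    case 1
    have "((\<lambda>t. poly p (1 / t) * exp (- (1 / t))) has_real_derivative
        flat_exp (pCons 0 (pCons 0 (p - pderiv p))) t) (at t)"
      using 1 unfolding flat_exp_def
      by (auto intro!: derivative_eq_intros simp: field_simps power2_eq_square)
    then show ?thesis
      by (rule has_field_derivative_transform_within_open[of _ _ _ "{0<..}"])
        (use 1 in \<open>auto simp: flat_exp_def\<close>)
  next
    case 2
    show ?thesis
      by (rule has_field_derivative_transform_within_open[of "\<lambda>_. 0" _ _ "{..<0}"])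
        (use 2 in \<open>auto simp: flat_exp_def\<close>)
  next
    case 3
    have "((\<lambda>h. flat_exp (pCons 0 p) h) \<longlongrightarrow> 0) (at 0)" by (rule flat_exp_tendsto_0)
    then have "((\<lambda>h. (flat_exp p (0 + h) - flat_exp p 0) / h) \<longlongrightarrow> 0) (at 0)"
      by (rule Lim_transform_eventually)
        (auto simp: flat_exp_def eventually_at_filter)
    then show ?thesis using 3 by (simp add: DERIV_def flat_exp_def)
  qed
qed

text \<open>A class of functions that is closed under differentiation and contains a bump; so its members
  are infinitely differentiable.\<close>
inductive bump_class :: "('a::euclidean_space \<Rightarrow> real) \<Rightarrow> bool" where
  bump_const: "bump_class (\<lambda>_. c)"
| bump_coord: "bump_class (\<lambda>x. x \<bullet> v)"
| bump_exp: "bump_class (\<lambda>x. flat_exp p (1 - r * (x \<bullet> x)))"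
| bump_add: "bump_class f \<Longrightarrow> bump_class g \<Longrightarrow> bump_class (\<lambda>x. f x + g x)"
| bump_mult: "bump_class f \<Longrightarrow> bump_class g \<Longrightarrow> bump_class (\<lambda>x. f x * g x)"

lemma partial_eq:
  assumes "(f has_derivative f') (at x)" shows "partial b f x = f' b"
  unfolding partial_def using frechet_derivative_at[OF assms] by simp

lemma bump_class_derivative:
  "bump_class f \<Longrightarrow> (\<forall>x. f differentiable (at x)) \<and> (\<forall>b. bump_class (partial b f))"
proof (induction rule: bump_class.induct)
  case (bump_const c)
  have "partial b (\<lambda>_. c) = (\<lambda>_::'a. 0)" for b by (rule ext, rule partial_eq) simp
  then show ?case using bump_class.bump_const[of 0] by simp
next
  case (bump_coord v)
  have d: "((\<lambda>x. x \<bullet> v) has_derivative (\<lambda>h. h \<bullet> v)) (at x)" for x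
    by (auto intro!: derivative_eq_intros)
  have "partial b (\<lambda>x. x \<bullet> v) = (\<lambda>_. b \<bullet> v)" for b by (rule ext, rule partial_eq[OF d])
  then show ?case using d bump_class.bump_const by (auto simp: differentiable_def)
next
  case (bump_exp p r)
  let ?q = "pCons 0 (pCons 0 (p - pderiv p))"
  have d: "((\<lambda>x. flat_exp p (1 - r * (x \<bullet> x))) has_derivative
      (\<lambda>h. flat_exp ?q (1 - r * (x \<bullet> x)) * (- 2 * r * (x \<bullet> h)))) (at x)" for x :: 'a
  proof -
    have "((\<lambda>x. 1 - r * (x \<bullet> x)) has_derivative (\<lambda>h. - 2 * r * (x \<bullet> h))) (at x)"
      by (auto intro!: derivative_eq_intros simp: inner_commute)
    from has_derivative_compose[OF this, of "flat_exp p"] flat_exp_derivative[of p "1 - r * (x \<bullet> x)"]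
    show ?thesis unfolding has_field_derivative_def by blast
  qed
  have "partial b (\<lambda>x. flat_exp p (1 - r * (x \<bullet> x)))
      = (\<lambda>x. flat_exp ?q (1 - r * (x \<bullet> x)) * ((- 2 * r) * (x \<bullet> b)))" for b :: 'a
    by (rule ext, subst partial_eq[OF d]) simp
  moreover have "bump_class (\<lambda>x. flat_exp ?q (1 - r * (x \<bullet> x)) * ((- 2 * r) * (x \<bullet> b)))" for b :: 'a
    by (intro bump_class.bump_mult bump_class.bump_exp bump_class.bump_const bump_class.bump_coord)
  ultimately have "bump_class (partial b (\<lambda>x. flat_exp p (1 - r * (x \<bullet> x))))" for b :: 'a by (simp only:)
  moreover have "(\<lambda>x. flat_exp p (1 - r * (x \<bullet> x))) differentiable (at x)" for x :: 'a
    unfolding differentiable_def by (rule exI, rule d)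
  ultimately show ?case by blast
next
  case (bump_add f g)
  have d: "((\<lambda>x. f x + g x) has_derivative
      (\<lambda>h. frechet_derivative f (at x) h + frechet_derivative g (at x) h)) (at x)" for x
    using bump_add.IH by (intro has_derivative_add) (auto simp: frechet_derivative_works[symmetric])
  have "partial b (\<lambda>x. f x + g x) = (\<lambda>x. partial b f x + partial b g x)" for b
    by (rule ext, subst partial_eq[OF d]) (simp add: partial_def)
  then show ?case using d bump_add.IH by (auto simp: differentiable_def intro!: bump_class.intros)
next
  case (bump_mult f g)
  have d: "((\<lambda>x. f x * g x) has_derivative
      (\<lambda>h. f x * frechet_derivative g (at x) h + frechet_derivative f (at x) h * g x)) (at x)" for x
    using bump_mult.IH by (intro has_derivative_mult) (auto simp: frechet_derivative_works[symmetric])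
  have "partial b (\<lambda>x. f x * g x) = (\<lambda>x. f x * partial b g x + partial b f x * g x)" for b
    by (rule ext, subst partial_eq[OF d]) (simp add: partial_def)
  then show ?case
    using d bump_mult.IH bump_mult.hyps by (auto simp: differentiable_def intro!: bump_class.intros)
qed

lemma bump_class_C2: "bump_class f \<Longrightarrow> C2_on D f"
  unfolding C2_on_def using bump_class_derivative
  by (metis differentiable_at_withinI differentiable_imp_continuous_on differentiable_on_def)

definition convolution :: "('a::euclidean_space \<Rightarrow> real) \<Rightarrow> ('a \<Rightarrow> real) \<Rightarrow> 'a \<Rightarrow> real" where
  "convolution \<phi> k x = (LINT z|lborel. \<phi> z * k (x - z))"

text \<open>Differentiation under the integral sign, over a box that contains the support of \<open>\<phi>\<close>. So no
  derivative falls on \<open>\<phi>\<close>, and a convolution with a smooth kernel is smooth.\<close>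
lemma convolution_has_derivative:
  fixes \<phi> :: "'a::euclidean_space \<Rightarrow> real"
  assumes \<phi>: "continuous_on UNIV \<phi>" and K: "compact K" and zero: "\<And>x. x \<notin> K \<Longrightarrow> \<phi> x = 0"
    and k: "bump_class k"
  shows "(convolution \<phi> k has_derivative (\<lambda>h. integral UNIV (\<lambda>z. \<phi> z * (gradient k (x - z) \<bullet> h)))) (at x)"
    "b \<in> Basis \<Longrightarrow> partial b (convolution \<phi> k) x = convolution \<phi> (partial b k) x"
proof -
  obtain a c where ac: "K \<subseteq> cbox a c" using compact_imp_bounded[OF K] bounded_subset_cbox_symmetric by metis
  have kc: "continuous_on UNIV k" "continuous_on UNIV (gradient k)"
    using C2_on_continuous C2_on_continuous_gradient bump_class_C2[OF k] by blast+
  have box: "integral UNIV g = integral (cbox a c) g" "integrable lborel g"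
    if "continuous_on UNIV g" "\<And>z. z \<notin> K \<Longrightarrow> g z = 0" for g :: "'a \<Rightarrow> real"
  proof -
    have "(\<lambda>z. if z \<in> cbox a c then g z else 0) = g" using that(2) ac by (auto simp: fun_eq_iff)
    then show "integral UNIV g = integral (cbox a c) g"
      using integral_restrict_UNIV[of "cbox a c" g] by simp
    show "integrable lborel g"
      by (rule integrable_compact_support[OF K continuous_on_subset[OF that(1)] that(2)]) auto
  qed
  have cc: "continuous_on UNIV (\<lambda>z. \<phi> z * k (x - z))" for x
    by (intro continuous_intros \<phi> continuous_on_compose2[OF kc(1)]) auto
  have conv: "convolution \<phi> k x = integral (cbox a c) (\<lambda>z. \<phi> z * k (x - z))" for x
    unfolding convolution_def using box[OF cc[of x]] zero integral_lborel[OF box(2)[OF cc[of x]]] by simp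
  have gc: "continuous_on UNIV (\<lambda>z. \<phi> z * (gradient k (x - z) \<bullet> h))" for h
    by (intro continuous_intros \<phi> continuous_on_compose2[OF kc(2)]) auto
  let ?D = "\<lambda>x t. blinfun_inner_right (\<phi> t *\<^sub>R gradient k (x - t))"
  have cD: "continuous_on (UNIV \<times> cbox a c) (\<lambda>(x, t). ?D x t)"
    unfolding case_prod_beta
    by (intro bounded_linear.continuous_on[OF bounded_linear_blinfun_inner_right] continuous_intros
        continuous_on_compose2[OF \<phi>] continuous_on_compose2[OF kc(2)]) auto
  have "((\<lambda>x. integral (cbox a c) (\<lambda>z. \<phi> z * k (x - z))) has_derivative
      blinfun_apply (integral (cbox a c) (?D x))) (at x within UNIV)"
  proof (rule leibniz_rule[OF _ _ cD])
    show "((\<lambda>x. \<phi> t * k (x - t)) has_derivative blinfun_apply (?D x t)) (at x within UNIV)" for x t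
    proof -
      have kd: "(k has_derivative (\<lambda>h. gradient k (x - t) \<bullet> h)) (at (x - t))"
        using bump_class_derivative[OF k] by (blast intro: has_derivative_gradient)
      have "((\<lambda>x. x - t) has_derivative (\<lambda>h. h)) (at x)" by (auto intro!: derivative_eq_intros)
      from has_derivative_compose[OF this kd] show ?thesis
        by (rule has_derivative_mult_right[of _ _ _ "\<phi> t", THEN has_derivative_eq_rhs])
          (simp add: fun_eq_iff)
    qed
    show "(\<lambda>z. \<phi> z * k (x - z)) integrable_on cbox a c" for x
      by (rule integrable_continuous[OF continuous_on_subset[OF cc]]) auto
  qed auto
  moreover have "blinfun_apply (integral (cbox a c) (?D x)) h
      = integral UNIV (\<lambda>z. \<phi> z * (gradient k (x - z) \<bullet> h))" for h
  proof -
    have "?D x integrable_on cbox a c"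
      by (rule integrable_continuous)
        (rule continuous_on_compose2[OF cD, of "cbox a c" "\<lambda>t. (x, t)", simplified],
          auto intro!: continuous_intros)
    then have "blinfun_apply (integral (cbox a c) (?D x)) h = integral (cbox a c) (\<lambda>z. \<phi> z * (gradient k (x - z) \<bullet> h))"
      by (subst blinfun_apply_integral) auto
    also have "\<dots> = integral UNIV (\<lambda>z. \<phi> z * (gradient k (x - z) \<bullet> h))"
      using box(1)[OF gc] zero by simp
    finally show ?thesis .
  qed
  ultimately show d: "(convolution \<phi> k has_derivative
      (\<lambda>h. integral UNIV (\<lambda>z. \<phi> z * (gradient k (x - z) \<bullet> h)))) (at x)"
    unfolding conv[abs_def] by (auto intro: has_derivative_eq_rhs)
  show "partial b (convolution \<phi> k) x = convolution \<phi> (partial b k) x" if "b \<in> Basis"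
    using that partial_eq[OF d, of b] integral_lborel[OF box(2)[OF gc[of b]]] zero
    by (auto simp: convolution_def gradient_inner_Basis)
qed

lemma partials_convolution:
  fixes \<phi> :: "'a::euclidean_space \<Rightarrow> real"
  assumes \<phi>: "continuous_on UNIV \<phi>" and K: "compact K" and zero: "\<And>x. x \<notin> K \<Longrightarrow> \<phi> x = 0"
    and k: "bump_class k"
  shows "set bs \<subseteq> Basis \<Longrightarrow>
    partials bs (convolution \<phi> k) = convolution \<phi> (partials bs k) \<and> bump_class (partials bs k)"
proof (induction bs)
  case (Cons b bs)
  then have IH: "partials bs (convolution \<phi> k) = convolution \<phi> (partials bs k)" "bump_class (partials bs k)"
    and b: "b \<in> Basis" by auto
  have "partial b (convolution \<phi> (partials bs k)) = convolution \<phi> (partial b (partials bs k))"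
    using convolution_has_derivative(2)[OF \<phi> K zero IH(2), of b] b by (auto intro!: ext)
  then show ?case
    using IH bump_class_derivative[OF IH(2)] by simp
qed (use k in simp)

lemma smooth_convolution:
  fixes \<phi> :: "'a::euclidean_space \<Rightarrow> real"
  assumes \<phi>: "continuous_on UNIV \<phi>" and K: "compact K" and zero: "\<And>x. x \<notin> K \<Longrightarrow> \<phi> x = 0"
    and k: "bump_class k"
  shows "smooth (convolution \<phi> k)"
  unfolding smooth_def
  using partials_convolution[OF assms] convolution_has_derivative(1)[OF \<phi> K zero]
  by (metis differentiable_def)

text \<open>The Laplacian is first put on the kernel and then moved to \<open>\<phi>\<close> by Green's second identity.\<close>
lemma laplacian_convolution:
  fixes \<phi> :: "'a::euclidean_space \<Rightarrow> real"
  assumes \<phi>: "C2_test D \<phi>" and k: "bump_class k"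
  shows "laplacian (convolution \<phi> k) x = convolution (laplacian \<phi>) k x"
proof -
  obtain K where C: "C2_on UNIV \<phi>" and K: "compact K" and zero: "\<And>x. x \<notin> K \<Longrightarrow> \<phi> x = 0"
    using \<phi> by (rule C2_testE) blast
  note \<phi>c = C2_on_continuous[OF C]
  have kC: "C2_on UNIV k" by (rule bump_class_C2[OF k])
  note s = C2_on_scale_shift[OF open_UNIV kC, where r = "-1" and a = x]
  have sC: "C2_on UNIV (\<lambda>z. k (x - z))" using s(1) by simp
  have sl: "laplacian (\<lambda>z. k (x - z)) z = laplacian k (x - z)" for z using s(3)[of z] by simp
  have int: "integrable lborel (\<lambda>z. \<phi> z * partial b (partial b k) (x - z))" if b: "b \<in> Basis" for b
  proof (rule integrable_compact_support[OF K])
    have pk: "continuous_on UNIV (partial b (partial b k))"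
      using kC b unfolding C2_on_def by blast
    have "continuous_on K (\<lambda>z. partial b (partial b k) (x - z))"
      by (rule continuous_on_compose2[OF pk]) (auto intro!: continuous_intros)
    then show "continuous_on K (\<lambda>z. \<phi> z * partial b (partial b k) (x - z))"
      by (rule continuous_on_mult[OF continuous_on_subset[OF \<phi>c subset_UNIV]])
  qed (simp add: zero)
  have "partial b (partial b (convolution \<phi> k)) x = convolution \<phi> (partial b (partial b k)) x"
    if "b \<in> Basis" for b
    using partials_convolution[OF \<phi>c K zero k, of "[b, b]"] that by simp
  then have "laplacian (convolution \<phi> k) x = (\<Sum>b\<in>Basis. convolution \<phi> (partial b (partial b k)) x)"
    by (simp add: laplacian_def)
  also have "\<dots> = (LINT z|lborel. (\<Sum>b\<in>Basis. \<phi> z * partial b (partial b k) (x - z)))"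
    unfolding convolution_def using int by (subst Bochner_Integration.integral_sum) auto
  also have "\<dots> = (LINT z|lborel. \<phi> z * laplacian (\<lambda>z. k (x - z)) z)"
    unfolding sl by (simp add: laplacian_def sum_distrib_left)
  also have "\<dots> = (LINT z|lborel. k (x - z) * laplacian \<phi> z)"
    by (rule integral_laplacian_symmetric[OF open_UNIV sC, symmetric]) (rule C2_test_mono[OF \<phi>], simp)
  finally show ?thesis by (simp add: convolution_def mult.commute)
qed

lemma mollifier_exists:
  assumes \<delta>: "\<delta> > 0"
  obtains k :: "'a::euclidean_space \<Rightarrow> real" where "bump_class k" "\<And>x. 0 \<le> k x"
    "\<And>x. norm x \<ge> \<delta> \<Longrightarrow> k x = 0" "\<And>x. k (- x) = k x"
    "integrable lborel k" "(LINT x|lborel. k x) = 1"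
proof -
  define k0 :: "'a \<Rightarrow> real" where "k0 x = flat_exp 1 (1 - 1 / \<delta>\<^sup>2 * (x \<bullet> x))" for x
  have k0: "bump_class k0" unfolding k0_def by (rule bump_exp)
  have k0_pos: "k0 x \<ge> 0" for x by (simp add: k0_def flat_exp_def)
  have k0_zero: "k0 x = 0" if "norm x \<ge> \<delta>" for x
  proof -
    have "\<delta>\<^sup>2 \<le> (norm x)\<^sup>2" using that \<delta> by (intro power_mono) auto
    then show ?thesis using \<delta> by (simp add: k0_def flat_exp_def power2_norm_eq_inner field_simps)
  qed
  have k0c: "continuous_on UNIV k0" by (rule C2_on_continuous[OF bump_class_C2[OF k0]])
  have int: "integrable lborel k0"
    by (rule integrable_compact_support[of "cball 0 \<delta>"])
      (use k0_zero continuous_on_subset[OF k0c] in auto)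
  define I where "I = (LINT x|lborel. k0 x)"
  have "I \<noteq> 0"
  proof
    assume "I = 0"
    then have ae: "AE x in lborel. k0 x = 0"
      using integral_nonneg_eq_0_iff_AE[OF int] k0_pos unfolding I_def by simp
    have "k0 x \<noteq> 0" if "x \<in> ball 0 \<delta>" for x
    proof -
      have "(norm x)\<^sup>2 < \<delta>\<^sup>2" using that by (intro power_strict_mono) auto
      then show ?thesis using \<delta> by (simp add: k0_def flat_exp_def power2_norm_eq_inner field_simps)
    qed
    then have "AE x in lborel. x \<notin> ball (0::'a) \<delta>" using ae by (auto elim!: eventually_mono)
    then have "ball (0::'a) \<delta> \<in> null_sets lborel" by (subst (asm) AE_iff_null_sets[symmetric]) auto
    then have "emeasure lborel (ball (0::'a) \<delta>) = 0" by (rule null_setsD1)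
    then have "measure lborel (ball (0::'a) \<delta>) = 0" by (simp add: measure_def)
    then show False using \<delta> by simp
  qed
  then have I: "I > 0" using k0_pos unfolding I_def
    by (metis integral_nonneg_AE AE_I2 order_le_less)
  have even: "k0 (- x) = k0 x" for x by (simp add: k0_def)
  show thesis
  proof (rule that[of "\<lambda>x. 1 / I * k0 x"])
    show "bump_class (\<lambda>x. 1 / I * k0 x)" by (intro bump_mult bump_const k0)
    show "0 \<le> 1 / I * k0 x" for x using I k0_pos[of x] by simp
    show "integrable lborel (\<lambda>x. 1 / I * k0 x)" using int by simp
    show "(LINT x|lborel. 1 / I * k0 x) = 1" using I by (simp add: I_def[symmetric])
  qed (simp_all add: k0_zero even)
qed

lemma convolution_approx:
  fixes g :: "'a::euclidean_space \<Rightarrow> real"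
  assumes g: "continuous_on UNIV g" and K: "compact K" and zero: "\<And>x. x \<notin> K \<Longrightarrow> g x = 0"
    and k: "bump_class k" "\<And>x. 0 \<le> k x" "\<And>x. norm x \<ge> \<delta> \<Longrightarrow> k x = 0" "\<And>x. k (- x) = k x"
      "integrable lborel k" "(LINT x|lborel. k x) = 1"
    and close: "\<And>z. dist z x < \<delta> \<Longrightarrow> \<bar>g z - g x\<bar> \<le> e"
  shows "\<bar>convolution g k x - g x\<bar> \<le> e"
proof -
  have kc: "continuous_on UNIV k" by (rule C2_on_continuous[OF bump_class_C2[OF k(1)]])
  have km[measurable]: "k \<in> borel_measurable borel" by (rule borel_measurable_continuous_onI[OF kc])
  have sym: "k (x - z) = k (- x + z)" for z using k(4)[of "x - z"] by (simp add: algebra_simps)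
  have ik: "integrable lborel (\<lambda>z. k (x - z))" "(LINT z|lborel. k (x - z)) = 1"
    unfolding sym using integral_translate[OF km, of "- x"] k(5,6) by auto
  have ig: "integrable lborel (\<lambda>z. g z * k (x - z))"
    by (rule integrable_compact_support[OF K])
      (auto intro!: continuous_intros continuous_on_subset[OF g] continuous_on_compose2[OF kc] simp: zero)
  have "convolution g k x - g x = (LINT z|lborel. g z * k (x - z) - g x * k (x - z))"
    unfolding convolution_def using ig ik by (subst Bochner_Integration.integral_diff) auto
  also have "\<bar>\<dots>\<bar> \<le> (LINT z|lborel. e * k (x - z))"
  proof -
    have "norm (g z * k (x - z) - g x * k (x - z)) \<le> e * k (x - z)" for z
    proof (cases "dist z x < \<delta>")
      case True
      show ?thesis
        using mult_right_mono[OF close[OF True] k(2)[of "x - z"]] k(2)[of "x - z"]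
        by (simp add: left_diff_distrib[symmetric] abs_mult)
    next
      case False
      then show ?thesis using k(3)[of "x - z"] by (simp add: dist_norm norm_minus_commute)
    qed
    then show ?thesis
      using Bochner_Integration.integral_norm_bound_integral[of lborel
          "\<lambda>z. g z * k (x - z) - g x * k (x - z)" "\<lambda>z. e * k (x - z)"] ig ik by simp
  qed
  also have "\<dots> = e" using ik by simp
  finally show ?thesis .
qed

text \<open>The distributional equation extends from smooth to \<open>C\<^sup>2\<close> test functions, by mollifying the
  test function: both it and its Laplacian converge uniformly.\<close>
theorem neg_laplacian_eq_delta_imp_weak_pole:
  fixes D :: "'a::euclidean_space set"
  assumes D: "open D" and eq: "neg_laplacian_eq_delta D u y"
  shows "weak_pole D u 1 y"
  unfolding weak_pole_def
proof (intro conjI allI impI)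
  show "set_integrable lborel K u" if "compact K \<and> K \<subseteq> D" for K
    using eq that unfolding neg_laplacian_eq_delta_def by blast
  fix \<phi> :: "'a \<Rightarrow> real" assume \<phi>: "C2_test D \<phi>"
  obtain K where C: "C2_on UNIV \<phi>" and K: "compact K" "K \<subseteq> D"
    and z0: "\<And>x. x \<notin> K \<Longrightarrow> \<phi> x = 0" and z2: "\<And>x. x \<notin> K \<Longrightarrow> laplacian \<phi> x = 0"
    using \<phi> by (rule C2_testE) blast
  obtain \<delta>0 where \<delta>0: "\<delta>0 > 0" "(\<Union>x\<in>K. cball x \<delta>0) \<subseteq> D"
    using compact_subset_open_imp_cball_epsilon_subset[OF K(1) D K(2)] by blast
  define K0 where "K0 = (\<Union>x\<in>K. \<Union>w\<in>cball 0 \<delta>0. {x + w})"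
  have K0: "compact K0" unfolding K0_def by (rule compact_sums'[OF K(1) compact_cball])
  have K0D: "K0 \<subseteq> D" using \<delta>0(2) by (force simp: K0_def dist_norm)
  have KK0: "K \<subseteq> K0" using \<delta>0(1) by (force simp: K0_def)
  have near: "x \<in> K0" if "z \<in> K" "norm (x - z) \<le> \<delta>0" for x z
    using that unfolding K0_def by (intro UN_I[of z] UN_I[of "x - z"]) auto
  have uint: "set_integrable lborel K0 u"
    using eq K0 K0D unfolding neg_laplacian_eq_delta_def by blast
  define I where "I = (LINT x:K0|lborel. \<bar>u x\<bar>)"
  have I: "I \<ge> 0" unfolding I_def set_lebesgue_integral_def by (rule integral_nonneg_AE) simp
  have lc: "continuous_on UNIV (laplacian \<phi>)" by (rule C2_on_continuous_laplacian[OF C])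
  have pc: "continuous_on UNIV \<phi>" by (rule C2_on_continuous[OF C])
  have uc: "uniformly_continuous_on UNIV g" if g: "continuous_on UNIV g" "\<And>x. x \<notin> K \<Longrightarrow> g x = 0"
    for g :: "'a \<Rightarrow> real"
  proof -
    have "uniformly_continuous_on K0 g"
      by (rule compact_uniformly_continuous[OF continuous_on_subset[OF g(1)] K0]) auto
    show ?thesis
      unfolding uniformly_continuous_on_def
    proof (intro allI impI)
      fix e :: real assume "e > 0"
      then obtain d where d: "d > 0" "\<And>x x'. x \<in> K0 \<Longrightarrow> x' \<in> K0 \<Longrightarrow> dist x' x < d \<Longrightarrow> dist (g x') (g x) < e"
        using \<open>uniformly_continuous_on K0 g\<close> unfolding uniformly_continuous_on_def by metis
      have "dist (g x') (g x) < e" if "dist x' x < min d \<delta>0" for x x'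
      proof (cases "x \<in> K0 \<and> x' \<in> K0")
        case True
        then show ?thesis using d that by auto
      next
        case False
        then have "x \<notin> K" "x' \<notin> K"
          using that near[of x x'] near[of x' x] KK0 by (auto simp: dist_norm norm_minus_commute)
        then show ?thesis using g(2) \<open>e > 0\<close> by simp
      qed
      then show "\<exists>d>0. \<forall>x\<in>UNIV. \<forall>x'\<in>UNIV. dist x' x < d \<longrightarrow> dist (g x') (g x) < e"
        using d \<delta>0 by (intro exI[of _ "min d \<delta>0"]) auto
    qed
  qed
  let ?L = "LINT x|lborel. u x * laplacian \<phi> x"
  have main: "\<bar>?L + \<phi> y\<bar> \<le> e * (I + 1)" if e: "e > 0" for e
  proof -
    obtain d1 where d1: "d1 > 0" "\<And>x x'. dist x' x < d1 \<Longrightarrow> dist (\<phi> x') (\<phi> x) < e"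
      using uc[OF pc z0] e unfolding uniformly_continuous_on_def by (metis UNIV_I)
    obtain d2 where d2: "d2 > 0" "\<And>x x'. dist x' x < d2 \<Longrightarrow> dist (laplacian \<phi> x') (laplacian \<phi> x) < e"
      using uc[OF lc z2] e unfolding uniformly_continuous_on_def by (metis UNIV_I)
    define \<delta> where "\<delta> = min \<delta>0 (min d1 d2)"
    have \<delta>: "\<delta> > 0" "\<delta> \<le> \<delta>0" "\<delta> \<le> d1" "\<delta> \<le> d2" using \<delta>0 d1 d2 by (auto simp: \<delta>_def)
    obtain k :: "'a \<Rightarrow> real" where k: "bump_class k" "\<And>x. 0 \<le> k x" "\<And>x. norm x \<ge> \<delta> \<Longrightarrow> k x = 0"
      "\<And>x. k (- x) = k x" "integrable lborel k" "(LINT x|lborel. k x) = 1"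
      using mollifier_exists[OF \<delta>(1)] by metis
    define \<psi> where "\<psi> = convolution \<phi> k"
    have conv0: "convolution g k x = 0" if "\<And>x. x \<notin> K \<Longrightarrow> g x = 0" "x \<notin> K0" for g x
    proof -
      have "g z * k (x - z) = 0" for z
      proof (cases "z \<in> K")
        case True
        then have "norm (x - z) \<ge> \<delta>" using that(2) near[of z x] \<delta>(2) by linarith
        then show ?thesis using k(3) by simp
      qed (simp add: that(1))
      then show ?thesis unfolding convolution_def by (simp only: integral_zero)
    qed
    have sub: "closure {x. \<psi> x \<noteq> 0} \<subseteq> K0"
      using conv0[of \<phi>, OF z0] compact_imp_closed[OF K0] by (intro closure_minimal) (auto simp: \<psi>_def)
    have "test_function_on D \<psi>"
      unfolding test_function_on_def
    proof (intro conjI)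
      show "smooth \<psi>" unfolding \<psi>_def by (rule smooth_convolution[OF pc K(1) z0 k(1)])
      show "compact (closure {x. \<psi> x \<noteq> 0})" using sub K0
        by (meson bounded_subset closed_closure compact_eq_bounded_closed)
      show "closure {x. \<psi> x \<noteq> 0} \<subseteq> D" using sub K0D by blast
    qed
    then have "(LINT x:D|lborel. u x * (- laplacian \<psi> x)) = \<psi> y"
      using eq unfolding neg_laplacian_eq_delta_def by blast
    moreover have lap\<psi>: "laplacian \<psi> x = convolution (laplacian \<phi>) k x" for x
      unfolding \<psi>_def by (rule laplacian_convolution[OF \<phi> k(1)])
    have l0: "laplacian \<psi> x = 0" if "x \<notin> K0" for x
      unfolding lap\<psi> using conv0[of "laplacian \<phi>"] z2 that by blast
    have "(LINT x:D|lborel. u x * (- laplacian \<psi> x)) = - (LINT x|lborel. u x * laplacian \<psi> x)"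
    proof -
      have "indicator D x *\<^sub>R (u x * (- laplacian \<psi> x)) = - (u x * laplacian \<psi> x)" for x
        using l0[of x] K0D by (cases "x \<in> K0") (auto simp: indicator_def)
      note eq = this
      show ?thesis unfolding set_lebesgue_integral_def eq by simp
    qed
    ultimately have 1: "(LINT x|lborel. u x * laplacian \<psi> x) = - \<psi> y" by simp
    have 2: "\<bar>\<psi> y - \<phi> y\<bar> \<le> e" unfolding \<psi>_def
      by (rule convolution_approx[OF pc K(1) z0 k])
        (use d1(2) \<delta> in \<open>force simp: dist_real_def less_imp_le\<close>)+
    have 3: "\<bar>laplacian \<psi> x - laplacian \<phi> x\<bar> \<le> e" for x unfolding lap\<psi>
      by (rule convolution_approx[OF lc K(1) z2 k])
        (use d2(2) \<delta> in \<open>force simp: dist_real_def less_imp_le\<close>)+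
    have \<psi>C: "continuous_on UNIV (laplacian \<psi>)"
    proof -
      have "partials [b, b] \<psi> differentiable (at x)" if "b \<in> Basis" for b x
        using smooth_convolution[OF pc K(1) z0 k(1)] that unfolding smooth_def \<psi>_def
        by (metis empty_set list.simps(15) insert_subset empty_subsetI)
      then have "continuous_on UNIV (partial b (partial b \<psi>))" if "b \<in> Basis" for b
        using that by (intro differentiable_imp_continuous_on) (auto simp: differentiable_on_def)
      then show ?thesis unfolding laplacian_def[abs_def] by (intro continuous_intros) auto
    qed
    have ui: "integrable lborel (\<lambda>x. indicator K0 x * \<bar>u x\<bar>)"
      using integrable_abs[OF uint[unfolded set_integrable_def]] by (simp add: abs_mult)
    note prod = integrable_mult_compact_support[OF K0 uint]
    have i1: "integrable lborel (\<lambda>x. u x * laplacian \<psi> x)" by (rule prod[OF \<psi>C l0])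
    have i2: "integrable lborel (\<lambda>x. u x * laplacian \<phi> x)" by (rule prod[OF lc]) (use z2 KK0 in blast)
    have "\<bar>(LINT x|lborel. u x * laplacian \<psi> x) - ?L\<bar>
       = \<bar>LINT x|lborel. u x * laplacian \<psi> x - u x * laplacian \<phi> x\<bar>"
      by (subst Bochner_Integration.integral_diff[OF i1 i2]) simp
    also have "\<dots> \<le> (LINT x|lborel. e * (indicator K0 x * \<bar>u x\<bar>))"
    proof -
      have "norm (u x * laplacian \<psi> x - u x * laplacian \<phi> x) \<le> e * (indicator K0 x * \<bar>u x\<bar>)" for x
      proof (cases "x \<in> K0")
        case True
        then show ?thesis
          using mult_left_mono[OF 3[of x], of "\<bar>u x\<bar>"]
          by (simp add: right_diff_distrib[symmetric] abs_mult mult.commute[of e])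
      next
        case False
        then show ?thesis using l0 z2 KK0 by auto
      qed
      then show ?thesis
        using Bochner_Integration.integral_norm_bound_integral[OF
            Bochner_Integration.integrable_diff[OF i1 i2], of "\<lambda>x. e * (indicator K0 x * \<bar>u x\<bar>)"] ui
        by simp
    qed
    also have "\<dots> = e * I" by (simp add: I_def set_lebesgue_integral_def)
    finally show ?thesis using 1 2 by (simp add: algebra_simps abs_le_iff)
  qed
  have "\<bar>?L + \<phi> y\<bar> \<le> 0"
  proof (rule field_le_epsilon)
    fix e :: real assume "e > 0"
    then show "\<bar>?L + \<phi> y\<bar> \<le> 0 + e" using main[of "e / (I + 1)"] I by simp
  qed
  then show "?L = - 1 * \<phi> y" by simp
qed

section \<open>Harmonic functions with an isolated pole\<close>

lemma harmonic_in_add: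
  "open D \<Longrightarrow> harmonic_in D f \<Longrightarrow> harmonic_in D h \<Longrightarrow> harmonic_in D (\<lambda>x. f x + h x)"
  unfolding harmonic_in_def using C2_on_add[of D f h] by simp

lemma harmonic_in_cmult:
  "open D \<Longrightarrow> harmonic_in D f \<Longrightarrow> harmonic_in D (\<lambda>x. c * f x)"
  unfolding harmonic_in_def using C2_on_cmult[of D f, where c = c] by simp

lemma harmonic_in_diff:
  assumes "open D" "harmonic_in D f" "harmonic_in D h"
  shows "harmonic_in D (\<lambda>x. f x - h x)"
  using harmonic_in_add[OF assms(1,2) harmonic_in_cmult[OF assms(1,3), of "-1"]] by simp

lemma harmonic_in_sum:
  "open D \<Longrightarrow> finite I \<Longrightarrow> (\<And>i. i \<in> I \<Longrightarrow> harmonic_in D (f i)) \<Longrightarrow> harmonic_in D (\<lambda>x. \<Sum>i\<in>I. f i x)"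
  unfolding harmonic_in_def using C2_on_sum[of D I f] by simp

lemma harmonic_in_subset: "harmonic_in D f \<Longrightarrow> E \<subseteq> D \<Longrightarrow> harmonic_in E f"
  unfolding harmonic_in_def using C2_on_subset by blast

lemma harmonic_in_scale_shift:
  assumes "open D" "harmonic_in D f" "E \<subseteq> {x. r *\<^sub>R (x - a) \<in> D}"
  shows "harmonic_in E (\<lambda>x. f (r *\<^sub>R (x - a)))"
proof -
  have f: "C2_on D f" "\<And>x. x \<in> D \<Longrightarrow> laplacian f x = 0" using assms(2) by (auto simp: harmonic_in_def)
  note s = C2_on_scale_shift[OF assms(1) f(1), where r = r and a = a]
  have "laplacian (\<lambda>x. f (r *\<^sub>R (x - a))) x = 0" if "x \<in> E" for x
    using s(3)[of x] f(2) subsetD[OF assms(3) that] by simp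
  then show ?thesis
    unfolding harmonic_in_def using C2_on_subset[OF s(1) assms(3)] by blast
qed

lemma harmonic_in_continuous: "harmonic_in D f \<Longrightarrow> continuous_on D f"
  unfolding harmonic_in_def using C2_on_continuous by blast

text \<open>The fundamental solution \<open>F\<close> with pole \<open>y\<close> is nonnegative and infinite at \<open>y\<close>, where \<open>u\<close> is bounded above;
  so \<open>u - \<delta> F\<close> satisfies the hypotheses of the maximum principle off \<open>y\<close>, and \<open>\<delta>\<close> is arbitrarily small.\<close>
theorem maximum_principle_pole:
  fixes u :: "'a::euclidean_space \<Rightarrow> real"
  assumes dim: "DIM('a) > 2" and D: "open D" and u: "harmonic_in (D - {y}) u"
    and bdry: "\<And>z e. z \<in> frontier D \<Longrightarrow> 0 < e \<Longrightarrow> \<forall>\<^sub>F x in at z within D. u x \<le> M + e"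
    and infty: "\<And>e. 0 < e \<Longrightarrow> \<forall>\<^sub>F x in inf at_infinity (principal D). u x \<le> M + e"
    and pole: "\<forall>\<^sub>F x in at y within D. u x \<le> B"
    and x0: "x0 \<in> D" "x0 \<noteq> y"
  shows "u x0 \<le> M"
proof -
  let ?F = "\<lambda>x. fundamental_solution (x - y)"
  let ?D = "D - {y}"
  have oD: "open ?D" using D by auto
  have F0: "?F x \<ge> 0" for x by (rule fundamental_solution_nonneg[OF dim])
  have main: "u x0 - \<delta> * ?F x0 \<le> M" if \<delta>: "\<delta> > 0" for \<delta>
  proof -
    let ?v = "\<lambda>x. u x - \<delta> * ?F x"
    have le: "?v x \<le> u x" for x using F0[of x] \<delta> by simp
    have v: "harmonic_in ?D ?v"
      by (intro harmonic_in_diff oD u harmonic_in_cmult fundamental_solution_harmonic_in dim) auto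
    show ?thesis
    proof (rule maximum_principle[OF oD, of ?v])
      show "C2_on ?D ?v" "\<And>x. x \<in> ?D \<Longrightarrow> 0 \<le> laplacian ?v x" using v unfolding harmonic_in_def by auto
      show "x0 \<in> ?D" using x0 by simp
      show "\<forall>\<^sub>F x in inf at_infinity (principal ?D). ?v x \<le> M + e" if "0 < e" for e
      proof -
        have "inf at_infinity (principal ?D) \<le> inf at_infinity (principal D)"
          by (intro inf_mono) auto
        from filter_leD[OF this infty[OF that]] show ?thesis
          by eventually_elim (use le order_trans in blast)
      qed
      fix z e assume z: "z \<in> frontier ?D" and e: "(0::real) < e"
      have mono: "at z within ?D \<le> at z within D" by (intro at_le) auto
      show "\<forall>\<^sub>F x in at z within ?D. ?v x \<le> M + e"
      proof (cases "z = y")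
        case True
        have "\<forall>\<^sub>F x in at y. ?F x \<ge> (B - M) / \<delta>"
          using fundamental_solution_pole[OF dim, of y] unfolding filterlim_at_top by blast
        then have "\<forall>\<^sub>F x in at y within ?D. ?F x \<ge> (B - M) / \<delta>"
          by (rule filter_leD[rotated]) (intro at_le, auto)
        moreover have "\<forall>\<^sub>F x in at y within ?D. u x \<le> B"
          using filter_leD[OF mono] pole True by blast
        ultimately show ?thesis unfolding True
        proof eventually_elim
          case (elim x)
          then have "B - M \<le> \<delta> * ?F x" using \<delta> by (simp add: field_simps)
          then show ?case using elim e by linarith
        qed
      next
        case False
        have "z \<in> frontier D"
        proof -
          have "z \<in> closure D" using z closure_mono[of ?D D] unfolding frontier_def by blast
          moreover have "z \<notin> D"
            using z False oD by (auto simp: frontier_def interior_open)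
          ultimately show ?thesis using D by (simp add: frontier_def interior_open)
        qed
        from filter_leD[OF mono bdry[OF this e]] show ?thesis
          by eventually_elim (use le order_trans in blast)
      qed
    qed
  qed
  show ?thesis
  proof (rule field_le_epsilon)
    fix e :: real assume e: "e > 0"
    define \<delta> where "\<delta> = e / (?F x0 + 1)"
    have "\<delta> > 0" "\<delta> * ?F x0 \<le> e" using e F0[of x0] by (auto simp: \<delta>_def field_simps)
    with main[of \<delta>] show "u x0 \<le> M + e" by linarith
  qed
qed

section \<open>The representation formula\<close>

text \<open>The Laplacian of \<open>\<theta> F(\<cdot> - x)\<close> off the pole \<open>x\<close>. As \<open>F\<close> is harmonic, only terms with derivatives of \<open>\<theta>\<close>
  are left.\<close>
definition repr_kernel :: "('a::euclidean_space \<Rightarrow> real) \<Rightarrow> 'a \<Rightarrow> 'a \<Rightarrow> real" where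
  "repr_kernel \<theta> x z = 2 * (gradient \<theta> z \<bullet> gradient (\<lambda>z. fundamental_solution (z - x)) z)
     + laplacian \<theta> z * fundamental_solution (z - x)"

lemma repr_kernel_zero: "gradient \<theta> z = 0 \<Longrightarrow> laplacian \<theta> z = 0 \<Longrightarrow> repr_kernel \<theta> x z = 0"
  by (simp add: repr_kernel_def)

text \<open>The pole of \<open>F\<close> does no harm, because the derivatives of \<open>\<theta>\<close> vanish near it.\<close>
lemma repr_kernel_continuous:
  fixes x :: "'a::euclidean_space"
  assumes dim: "DIM('a) > 2" and \<theta>: "C2_on UNIV \<theta>" and r: "r > 0"
    and const: "\<And>z. z \<in> ball x r \<Longrightarrow> \<theta> z = k"
  shows "continuous_on UNIV (repr_kernel \<theta> x)" "\<And>z. z \<in> ball x r \<Longrightarrow> gradient \<theta> z = 0"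
    "\<And>z. z \<in> ball x r \<Longrightarrow> laplacian \<theta> z = 0"
proof -
  show 0: "gradient \<theta> z = 0" "laplacian \<theta> z = 0" if "z \<in> ball x r" for z
    using C2_on_cong(2,3)[OF open_ball C2_on_const(1)[where c = k], where h = \<theta>] const that
    by (metis C2_on_const(2), metis C2_on_const(3))
  have "continuous_on (ball x r) (repr_kernel \<theta> x)"
    using 0 continuous_on_cong[of "ball x r" "ball x r" "repr_kernel \<theta> x" "\<lambda>_. 0"]
    by (simp add: repr_kernel_zero)
  moreover have "continuous_on (- {x}) (repr_kernel \<theta> x)"
    unfolding repr_kernel_def
    using C2_on_continuous_gradient[OF \<theta>] C2_on_continuous_laplacian[OF \<theta>]
      C2_on_continuous[OF fundamental_solution_harmonic(1)[OF dim]]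
      C2_on_continuous_gradient[OF fundamental_solution_harmonic(1)[OF dim]]
    by (intro continuous_intros) (auto intro: continuous_on_subset)
  ultimately have "continuous_on (ball x r \<union> - {x}) (repr_kernel \<theta> x)"
    by (intro continuous_on_open_Un) auto
  moreover have "ball x r \<union> - {x} = UNIV" using r by auto
  ultimately show "continuous_on UNIV (repr_kernel \<theta> x)" by simp
qed

text \<open>Test the equation against a cutoff times the fundamental solution with pole \<open>x\<close>, regularised
  in a small ball. The regularisation contributes an average of \<open>u\<close> over that ball, hence \<open>u x\<close> in
  the limit; all other terms involve only the region where the cutoff varies.\<close>
theorem weak_pole_representation:
  fixes u :: "'a::euclidean_space \<Rightarrow> real"
  assumes dim: "DIM('a) > 2" and D: "open D" and u: "weak_pole D u \<mu> y" and \<theta>: "C2_test D \<theta>"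
    and r: "r > 0" and one: "\<And>z. z \<in> ball x r \<Longrightarrow> \<theta> z = 1"
    and cont: "continuous (at x) u" and pole: "\<mu> = 0 \<or> x \<noteq> y"
  shows "u x = \<mu> * \<theta> y * fundamental_solution (y - x) + (LINT z|lborel. u z * repr_kernel \<theta> x z)"
    "integrable lborel (\<lambda>z. u z * repr_kernel \<theta> x z)"
proof -
  obtain K where C: "C2_on UNIV \<theta>" and K: "compact K" "K \<subseteq> D"
    and z0: "\<And>z. z \<notin> K \<Longrightarrow> \<theta> z = 0" and z1: "\<And>z. z \<notin> K \<Longrightarrow> gradient \<theta> z = 0"
    and z2: "\<And>z. z \<notin> K \<Longrightarrow> laplacian \<theta> z = 0"
    using \<theta> by (rule C2_testE) blast
  have k: "continuous_on UNIV (repr_kernel \<theta> x)"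
    "\<And>z. z \<in> ball x r \<Longrightarrow> gradient \<theta> z = 0" "\<And>z. z \<in> ball x r \<Longrightarrow> laplacian \<theta> z = 0"
    using repr_kernel_continuous[OF dim C r, of x] one by blast+
  have uK: "set_integrable lborel K u" using u K unfolding weak_pole_def by blast
  show intK: "integrable lborel (\<lambda>z. u z * repr_kernel \<theta> x z)"
    by (rule integrable_mult_compact_support[OF K(1) uK k(1)]) (auto simp: z1 z2 repr_kernel_zero)
  have ballK: "ball x r \<subseteq> K" using one z0 by force
  have cbK: "cball x (r / 2) \<subseteq> K" using ballK r by (auto simp: subset_iff)
  have ucb: "set_integrable lborel (cball x (r / 2)) u"
    by (rule set_integrable_subset[OF uK _ cbK]) auto
  define \<rho>0 where "\<rho>0 = (if x = y then r else min r (dist x y))"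
  have \<rho>0: "\<rho>0 > 0" using r by (auto simp: \<rho>0_def)
  let ?I = "LINT z|lborel. u z * repr_kernel \<theta> x z"
  have eq: "(LINT z|lborel. u z * ball_bump \<rho> (z - x)) = \<mu> * \<theta> y * fundamental_solution (y - x) + ?I"
    if \<rho>: "0 < \<rho>" "\<rho> < \<rho>0" for \<rho>
  proof -
    have \<rho>r: "\<rho> < r" using \<rho> by (auto simp: \<rho>0_def split: if_splits)
    note fr = fund_reg_C2[OF dim \<rho>(1), of x]
    note m = C2_on_mult[OF open_UNIV C fr(1)]
    let ?\<phi> = "\<lambda>z. \<theta> z * fund_reg \<rho> (z - x)"
    have "C2_test D ?\<phi>" unfolding C2_test_def using m(1) K z0 by (metis mult_zero_left)
    then have t: "(LINT z|lborel. u z * laplacian ?\<phi> z) = - \<mu> * ?\<phi> y"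
      using u unfolding weak_pole_def by blast
    have "?\<phi> y * \<mu> = \<mu> * \<theta> y * fundamental_solution (y - x)"
    proof (cases "\<mu> = 0")
      case False
      then have "\<rho> \<le> norm (y - x)" using pole \<rho> by (auto simp: \<rho>0_def dist_norm norm_minus_commute)
      then have "fund_reg \<rho> (y - x) = fundamental_solution (y - x)" by (rule fund_reg_outside[OF \<rho>(1)])
      then show ?thesis by simp
    qed simp
    note p = this
    have lap: "laplacian ?\<phi> z = repr_kernel \<theta> x z - ball_bump \<rho> (z - x)" for z
    proof (cases "z \<in> ball x r")
      case True
      then show ?thesis using m(3)[of z] k(2,3)[OF True] one[OF True] fr(2)[of z]
        by (simp add: repr_kernel_zero)
    next
      case False
      then have far: "norm (z - x) \<ge> r" by (simp add: dist_norm norm_minus_commute)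
      have o: "open {z. \<rho> < norm (z - x)}" by (intro open_Collect_less continuous_intros)
      have "gradient (\<lambda>z. fund_reg \<rho> (z - x)) z = gradient (\<lambda>z. fundamental_solution (z - x)) z"
        by (rule C2_on_cong(2)[OF o C2_on_subset[OF fr(1) subset_UNIV], symmetric])
          (use fund_reg_outside[OF \<rho>(1), where 'a = 'a] far \<rho>r in \<open>auto simp: less_imp_le\<close>)
      moreover have "fund_reg \<rho> (z - x) = fundamental_solution (z - x)"
        using far \<rho>r by (intro fund_reg_outside \<rho>(1)) simp
      moreover have "ball_bump \<rho> (z - x) = 0" using far \<rho>r by (intro ball_bump_outside \<rho>(1)) simp
      ultimately show ?thesis using m(3)[of z] fr(2)[of z] by (simp add: repr_kernel_def mult.commute)
    qed
    have intb: "integrable lborel (\<lambda>z. u z * ball_bump \<rho> (z - x))"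
    proof (rule integrable_mult_compact_support[OF K(1) uK])
      show "continuous_on UNIV (\<lambda>z. ball_bump \<rho> (z - x))"
        by (rule continuous_on_compose2[OF ball_bump_continuous[of UNIV]]) (auto intro!: continuous_intros)
      show "ball_bump \<rho> (z - x) = 0" if "z \<notin> K" for z
        using that ballK \<rho>r by (intro ball_bump_outside \<rho>(1)) (force simp: dist_norm norm_minus_commute)
    qed
    have "(LINT z|lborel. u z * laplacian ?\<phi> z) = ?I - (LINT z|lborel. u z * ball_bump \<rho> (z - x))"
      unfolding lap right_diff_distrib by (rule Bochner_Integration.integral_diff[OF intK intb])
    moreover have "- \<mu> * ?\<phi> y = - (\<mu> * \<theta> y * fundamental_solution (y - x))"
      using p by (metis mult.commute mult_minus_left)
    ultimately show ?thesis using t by linarith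
  qed
  have "((\<lambda>\<rho>. LINT z|lborel. u z * ball_bump \<rho> (z - x)) \<longlongrightarrow>
      \<mu> * \<theta> y * fundamental_solution (y - x) + ?I) (at_right 0)"
    by (rule Lim_transform_eventually[OF tendsto_const])
      (use eq \<rho>0 in \<open>auto simp: eventually_at_right_field intro!: exI[of _ \<rho>0]\<close>)
  moreover have "((\<lambda>\<rho>. LINT z|lborel. u z * ball_bump \<rho> (z - x)) \<longlongrightarrow> u x) (at_right 0)"
    by (rule ball_bump_average_tendsto[OF cont ucb]) (use r in simp)
  ultimately show "u x = \<mu> * \<theta> y * fundamental_solution (y - x) + ?I"
    by (intro tendsto_unique[OF trivial_limit_at_right_real])
qed

lemma pos_part_power_derivative:
  "((\<lambda>t::real. max 0 t ^ Suc (Suc k)) has_real_derivative real (Suc (Suc k)) * max 0 t ^ Suc k) (at t)"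
proof -
  have "((\<lambda>t::real. if t \<le> 0 then 0 else t ^ Suc (Suc k)) has_real_derivative
      (if t \<le> 0 then 0 else real (Suc (Suc k)) * t ^ Suc k)) (at t)"
  proof (rule has_real_derivative_If_le)
    show "((\<lambda>t. t ^ Suc (Suc k)) has_real_derivative real (Suc (Suc k)) * t ^ Suc k) (at t)" for t :: real
      using DERIV_pow[of "Suc (Suc k)" t] by simp
  qed auto
  moreover have "(\<lambda>t::real. if t \<le> 0 then 0 else t ^ Suc (Suc k)) = (\<lambda>t. max 0 t ^ Suc (Suc k))"
    by (auto simp: fun_eq_iff max_def)
  ultimately show ?thesis by (auto simp: max_def split: if_splits)
qed

lemma pos_part_cube:
  "((\<lambda>t::real. max 0 t ^ 3) has_real_derivative 3 * max 0 t ^ 2) (at t)"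
  "((\<lambda>t::real. 3 * max 0 t ^ 2) has_real_derivative 6 * max 0 t) (at t)"
  using pos_part_power_derivative[of 1 t] DERIV_cmult[OF pos_part_power_derivative[of 0 t], of 3]
  by (simp_all add: numeral_3_eq_3 numeral_2_eq_2)

lemma cutoff_exists:
  fixes c :: "'a::euclidean_space"
  assumes ab: "0 < a" "a < b"
  obtains \<theta> :: "'a \<Rightarrow> real" where "C2_on UNIV \<theta>" "\<And>z. z \<in> cball c a \<Longrightarrow> \<theta> z = 1"
    "\<And>z. z \<notin> ball c b \<Longrightarrow> \<theta> z = 0" "\<And>z. 0 \<le> \<theta> z" "\<And>z. \<theta> z \<le> 1"
proof -
  define q :: "real \<Rightarrow> real" where "q t = max 0 t ^ 3" for t
  have qC: "C2_on UNIV (\<lambda>x. q (f x))" if f: "C2_on UNIV f" for f :: "'a \<Rightarrow> real"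
    unfolding q_def
    by (rule C2_on_compose(1)[OF open_UNIV f pos_part_cube(1) pos_part_cube(2)])
      (intro continuous_intros)
  define f where "f z = 1 / (b\<^sup>2 - a\<^sup>2) * ((norm (z - c))\<^sup>2 + - (a\<^sup>2))" for z
  have d: "b\<^sup>2 - a\<^sup>2 > 0" using ab by (simp add: power_strict_mono)
  have fC: "C2_on UNIV f" unfolding f_def
    by (intro C2_on_cmult(1) C2_on_add(1) C2_on_norm_square C2_on_const) auto
  define \<theta> where "\<theta> z = q (1 + (-1) * q (f z))" for z
  show thesis
  proof (rule that)
    show "C2_on UNIV \<theta>" unfolding \<theta>_def
      by (intro qC C2_on_add(1) C2_on_const C2_on_cmult(1) fC) auto
    show "\<theta> z = 1" if "z \<in> cball c a" for z
    proof -
      have "(norm (z - c))\<^sup>2 \<le> a\<^sup>2" using that by (intro power_mono) (auto simp: dist_norm norm_minus_commute)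
      then have "f z \<le> 0" using d by (simp add: f_def divide_simps)
      then show ?thesis by (simp add: \<theta>_def q_def max_def)
    qed
    show "\<theta> z = 0" if "z \<notin> ball c b" for z
    proof -
      have "b\<^sup>2 \<le> (norm (z - c))\<^sup>2"
        using that ab by (intro power_mono) (auto simp: dist_norm norm_minus_commute)
      then have "f z \<ge> 1" using d by (simp add: f_def divide_simps)
      then have "q (f z) \<ge> 1" by (simp add: q_def max_def one_le_power)
      then show ?thesis by (simp add: \<theta>_def q_def max_def)
    qed
    show "0 \<le> \<theta> z" for z by (simp add: \<theta>_def q_def)
    show "\<theta> z \<le> 1" for z
    proof -
      have "q (f z) \<ge> 0" by (simp add: q_def)
      then have "max 0 (1 + (-1) * q (f z)) \<le> 1" by simp
      then show ?thesis unfolding \<theta>_def q_def[of "1 + _"] by (intro power_le_one) auto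
    qed
  qed
qed

lemma gradient_fundamental_solution_shift:
  fixes x z :: "'a::euclidean_space"
  assumes dim: "DIM('a) > 2" and "z \<noteq> x"
  shows "gradient (\<lambda>z. fundamental_solution (z - x)) z = gradient fundamental_solution (z - x)"
  using fundamental_solution_harmonic(3)[OF assms] fundamental_solution_harmonic(3)[OF dim, of "z - x" 0] assms
  by simp

text \<open>The second derivatives of the fundamental solution are bounded on a compact annulus.\<close>
lemma gradient_fundamental_solution_lipschitz:
  assumes dim: "DIM('a::euclidean_space) > 2" and a: "0 < a"
  shows "\<exists>L\<ge>0. \<forall>v w::'a. (\<forall>z\<in>closed_segment v w. a \<le> norm z \<and> norm z \<le> R) \<longrightarrow>
     norm (gradient fundamental_solution v - gradient fundamental_solution w) \<le> L * norm (v - w)"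
proof -
  let ?F = "fundamental_solution :: 'a \<Rightarrow> real"
  let ?S = "{z::'a. a \<le> norm z \<and> norm z \<le> R}"
  have C: "C2_on (- {0}) ?F" using fundamental_solution_harmonic(1)[OF dim, of 0] by simp
  note d = C2_on_imp_C2_data[OF C]
  have "?S = cball 0 R - ball 0 a" by auto
  then have S: "compact ?S" by (simp add: compact_diff)
  have "\<exists>B. \<forall>z\<in>?S. norm (gradient (partial b ?F) z) \<le> B" if b: "b \<in> Basis" for b
  proof -
    have "continuous_on ?S (gradient (partial b ?F))"
      using d b a unfolding C2_data_def by (auto intro: continuous_on_subset)
    from compact_imp_bounded[OF compact_continuous_image[OF this S]]
    show ?thesis unfolding bounded_iff by auto
  qed
  then obtain B where B: "\<And>b z. b \<in> Basis \<Longrightarrow> z \<in> ?S \<Longrightarrow> norm (gradient (partial b ?F) z) \<le> B b" by metis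
  define L where "L = (\<Sum>b\<in>Basis. \<bar>B b\<bar>)"
  have "norm (gradient ?F v - gradient ?F w) \<le> L * norm (v - w)"
    if seg: "\<forall>z\<in>closed_segment v w. a \<le> norm z \<and> norm z \<le> R" for v w
  proof -
    have "\<bar>(gradient ?F v - gradient ?F w) \<bullet> b\<bar> \<le> \<bar>B b\<bar> * norm (v - w)" if b: "b \<in> Basis" for b
    proof -
      have "norm (gradient ?F v \<bullet> b - gradient ?F w \<bullet> b) \<le> \<bar>B b\<bar> * norm (v - w)"
      proof (rule differentiable_bound[of "closed_segment v w"])
        fix z assume "z \<in> closed_segment v w"
        then have z: "z \<in> ?S" using seg by blast
        then have "z \<in> - {0}" using a by auto
        then show "((\<lambda>z. gradient ?F z \<bullet> b) has_derivative (\<lambda>h. gradient (partial b ?F) z \<bullet> h))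
            (at z within closed_segment v w)"
          using d b unfolding C2_data_def by (blast intro: has_derivative_at_withinI)
        show "onorm (\<lambda>h. gradient (partial b ?F) z \<bullet> h) \<le> \<bar>B b\<bar>"
          using B[OF b z] by (intro onorm_inner_le) auto
      qed auto
      then show ?thesis by (simp add: inner_diff_left)
    qed
    then have "(\<Sum>b\<in>Basis. \<bar>(gradient ?F v - gradient ?F w) \<bullet> b\<bar>) \<le> L * norm (v - w)"
      unfolding L_def sum_distrib_right by (rule sum_mono)
    then show ?thesis using norm_le_l1[of "gradient ?F v - gradient ?F w"] by linarith
  qed
  moreover have "L \<ge> 0" by (simp add: L_def sum_nonneg)
  ultimately show ?thesis by blast
qed

text \<open>Where \<open>\<theta>\<close> varies, \<open>z\<close> stays at distance at least \<open>a/2\<close> from \<open>x\<close> and from \<open>x'\<close>, so that \<open>F\<close> and its gradient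
  are bounded and Lipschitz there.\<close>
lemma repr_kernel_bounds:
  fixes c :: "'a::euclidean_space"
  assumes dim: "DIM('a) > 2" and ab: "0 < a" "a < b" and \<theta>: "C2_on UNIV \<theta>"
    and one: "\<And>z. z \<in> ball c a \<Longrightarrow> \<theta> z = 1" and zero: "\<And>z. z \<notin> cball c b \<Longrightarrow> \<theta> z = 0"
  shows "\<exists>L>0. \<forall>x\<in>ball c (a/2). \<forall>x'\<in>ball c (a/2). \<forall>z.
     \<bar>repr_kernel \<theta> x z\<bar> \<le> L * indicator (cball c b) z \<and>
     \<bar>repr_kernel \<theta> x z - repr_kernel \<theta> x' z\<bar> \<le> L * norm (x - x') * indicator (cball c b) z"
proof -
  let ?F = "fundamental_solution :: 'a \<Rightarrow> real"
  let ?g = "gradient ?F"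
  obtain LG where LG: "LG \<ge> 0" "\<And>v w::'a. (\<forall>z\<in>closed_segment v w. a / 2 \<le> norm z \<and> norm z \<le> 2 * b) \<Longrightarrow>
      norm (?g v - ?g w) \<le> LG * norm (v - w)"
    using gradient_fundamental_solution_lipschitz[OF dim, of "a/2" "2*b"] ab by auto
  define LF where "LF = (real DIM('a) - 2) * fund_coeff DIM('a) / (a/2) ^ (DIM('a) - 1)"
  have LF: "LF \<ge> 0" using dim ab fund_coeff_pos[OF dim] by (simp add: LF_def)
  define F0 where "F0 = fund_coeff DIM('a) / (a/2) ^ (DIM('a) - 2)"
  have F0: "F0 \<ge> 0" using ab fund_coeff_pos[OF dim] by (simp add: F0_def)
  have "bounded (gradient \<theta> ` cball c b)" "bounded (laplacian \<theta> ` cball c b)"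
    using C2_on_continuous_gradient[OF \<theta>] C2_on_continuous_laplacian[OF \<theta>]
    by (auto intro!: compact_imp_bounded compact_continuous_image intro: continuous_on_subset)
  then obtain M1 M2 where "\<forall>w\<in>gradient \<theta> ` cball c b. norm w \<le> M1"
    "\<forall>w\<in>laplacian \<theta> ` cball c b. norm w \<le> M2"
    unfolding bounded_iff by blast
  then have M12: "\<And>z. z \<in> cball c b \<Longrightarrow> norm (gradient \<theta> z) \<le> M1"
    "\<And>z. z \<in> cball c b \<Longrightarrow> \<bar>laplacian \<theta> z\<bar> \<le> M2" by auto
  define M where "M = max 0 (max M1 M2)"
  have M: "M \<ge> 0" "\<And>z. z \<in> cball c b \<Longrightarrow> norm (gradient \<theta> z) \<le> M"
    "\<And>z. z \<in> cball c b \<Longrightarrow> \<bar>laplacian \<theta> z\<bar> \<le> M"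
    using M12 by (auto simp: M_def le_max_iff_disj)
  define L where "L = 2 * M * LF + M * F0 + 2 * M * LG + M * LF + 1"
  have L: "L > 0" "2 * M * LF + M * F0 \<le> L" "2 * M * LG + M * LF \<le> L"
    using M(1) LF LG(1) F0 by (auto simp: L_def intro!: add_nonneg_pos add_nonneg_nonneg)
  have out: "gradient \<theta> z = 0 \<and> laplacian \<theta> z = 0" if "z \<notin> cball c b" for z
    using C2_on_extend_zero(2,3)[OF open_UNIV \<theta> closed_cball[of c b], of z] zero that by auto
  have inn: "gradient \<theta> z = 0 \<and> laplacian \<theta> z = 0" if "z \<in> ball c a" for z
    using repr_kernel_continuous(2,3)[OF dim \<theta> ab(1), of c] one that by blast
  have geo: "a / 2 \<le> norm (z - \<xi>) \<and> norm (z - \<xi>) \<le> 2 * b"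
    if "\<xi> \<in> ball c (a/2)" "z \<in> cball c b" "z \<notin> ball c a" for \<xi> z
  proof -
    have "dist c z \<le> dist c \<xi> + dist \<xi> z" "dist \<xi> z \<le> dist c \<xi> + dist c z"
      by (rule dist_triangle) (metis dist_commute dist_triangle)
    then have "a / 2 \<le> dist \<xi> z" "dist \<xi> z \<le> 2 * b" using that ab by auto
    then show ?thesis by (simp add: dist_norm norm_minus_commute)
  qed
  have main: "\<bar>repr_kernel \<theta> x z\<bar> \<le> L * indicator (cball c b) z \<and>
     \<bar>repr_kernel \<theta> x z - repr_kernel \<theta> x' z\<bar> \<le> L * norm (x - x') * indicator (cball c b) z"
    if x: "x \<in> ball c (a/2)" and x': "x' \<in> ball c (a/2)" for x x' z
  proof (cases "z \<in> cball c b \<and> z \<notin> ball c a")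
    case False
    then have "gradient \<theta> z = 0" "laplacian \<theta> z = 0" using out inn by auto
    then show ?thesis using L by (simp add: repr_kernel_zero)
  next
    case True
    then have zb: "z \<in> cball c b" and za: "z \<notin> ball c a" by auto
    have nz: "z \<noteq> x" "z \<noteq> x'" using geo[OF x zb za] geo[OF x' zb za] ab by auto
    note sh = gradient_fundamental_solution_shift[OF dim nz(1)] gradient_fundamental_solution_shift[OF dim nz(2)]
    have seg: "a / 2 \<le> norm w \<and> norm w \<le> 2 * b" if "w \<in> closed_segment (z - x) (z - x')" for w
    proof -
      have "z - w \<in> closed_segment x x'"
        using that unfolding closed_segment_def by (force simp: algebra_simps)
      then have "z - w \<in> ball c (a/2)"
        using x x' convex_ball closed_segment_subset by blast
      from geo[OF this zb za] show ?thesis by simp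
    qed
    have g: "norm (?g (z - x)) \<le> LF"
      using norm_gradient_fundamental_solution[OF dim, of "z - x" 0] geo[OF x zb za] nz ab dim fund_coeff_pos[OF dim]
      unfolding LF_def by (auto intro!: divide_left_mono power_mono mult_pos_pos zero_less_power)
    have f: "\<bar>?F (z - x)\<bar> \<le> F0"
      using geo[OF x zb za] ab fund_coeff_pos[OF dim] fundamental_solution_nonneg[OF dim, of "z - x"] nz
      unfolding F0_def by (auto simp: fundamental_solution_eq intro!: divide_left_mono power_mono mult_pos_pos zero_less_power)
    have "\<bar>gradient \<theta> z \<bullet> ?g (z - x)\<bar> \<le> M * LF"
      using Cauchy_Schwarz_ineq2[of "gradient \<theta> z" "?g (z - x)"] mult_mono[OF M(2)[OF zb] g M(1)] by simp
    moreover have "\<bar>laplacian \<theta> z * ?F (z - x)\<bar> \<le> M * F0"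
      using mult_mono[OF M(3)[OF zb] f M(1)] by (simp add: abs_mult)
    ultimately have 1: "\<bar>repr_kernel \<theta> x z\<bar> \<le> 2 * M * LF + M * F0"
      unfolding repr_kernel_def sh(1) by linarith
    have gd: "norm (?g (z - x) - ?g (z - x')) \<le> LG * norm (x - x')"
      using LG(2)[of "z - x" "z - x'"] seg by (simp add: norm_minus_commute)
    have fd: "\<bar>?F (z - x) - ?F (z - x')\<bar> \<le> LF * norm (x - x')"
      using fundamental_solution_lipschitz[OF dim, of "a/2" "z - x" "z - x'"] seg ab
      by (simp add: LF_def norm_minus_commute)
    have "\<bar>gradient \<theta> z \<bullet> (?g (z - x) - ?g (z - x'))\<bar> \<le> M * (LG * norm (x - x'))"
      using Cauchy_Schwarz_ineq2[of "gradient \<theta> z" "?g (z - x) - ?g (z - x')"]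
        mult_mono[OF M(2)[OF zb] gd M(1)] by simp
    moreover have "\<bar>laplacian \<theta> z * (?F (z - x) - ?F (z - x'))\<bar> \<le> M * (LF * norm (x - x'))"
      using mult_mono[OF M(3)[OF zb] fd M(1)] by (simp add: abs_mult)
    moreover have "repr_kernel \<theta> x z - repr_kernel \<theta> x' z
       = 2 * (gradient \<theta> z \<bullet> (?g (z - x) - ?g (z - x'))) + laplacian \<theta> z * (?F (z - x) - ?F (z - x'))"
      unfolding repr_kernel_def sh by (simp add: algebra_simps inner_diff_right)
    ultimately have "\<bar>repr_kernel \<theta> x z - repr_kernel \<theta> x' z\<bar> \<le> (2 * M * LG + M * LF) * norm (x - x')"
      by (simp add: algebra_simps)
    also have "\<dots> \<le> L * norm (x - x')" by (rule mult_right_mono[OF L(3)]) simp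
    finally show ?thesis using 1 L(2) zb by simp
  qed
  show ?thesis using L(1) main by blast
qed

text \<open>The splitting into singular part and Lipschitz remainder is demanded only at points of continuity
  of \<open>u\<close> off the pole, as a distributional equation does not determine other single values.\<close>
definition locally_regular ::
    "('a::euclidean_space \<Rightarrow> real) \<Rightarrow> real \<Rightarrow> 'a \<Rightarrow> 'a \<Rightarrow> real \<Rightarrow> real \<Rightarrow> bool" where
  "locally_regular u s y c r K \<longleftrightarrow>
     (\<exists>h. (\<forall>x\<in>ball c r. continuous (at x) u \<longrightarrow> s = 0 \<or> x \<noteq> y \<longrightarrow>
              u x = s * fundamental_solution (y - x) + h x) \<and>
          (\<forall>x\<in>ball c r. \<bar>h x\<bar> \<le> K) \<and>
          (\<forall>x\<in>ball c r. \<forall>x'\<in>ball c r. \<bar>h x - h x'\<bar> \<le> K * norm (x - x')))"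

text \<open>The representation formula read as an interior estimate. Boundedness and Lipschitz continuity in
  \<open>x\<close> are inherited from the kernel, whose constant \<open>L\<close> depends on the cutoff alone; so one \<open>L\<close> serves all
  solutions and all positions of the pole, and of \<open>u\<close> only the \<open>L\<^sup>1\<close> norm enters.\<close>
theorem weak_pole_regular_part:
  fixes c :: "'a::euclidean_space"
  assumes dim: "DIM('a) > 2" and ab: "0 < a" "a < b" and \<theta>: "C2_on UNIV \<theta>"
    and one: "\<And>z. z \<in> ball c a \<Longrightarrow> \<theta> z = 1" and zero: "\<And>z. z \<notin> cball c b \<Longrightarrow> \<theta> z = 0"
  shows "\<exists>L>0. \<forall>D u \<mu> y. open D \<longrightarrow> cball c b \<subseteq> D \<longrightarrow> weak_pole D u \<mu> y \<longrightarrow>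
     locally_regular u (\<mu> * \<theta> y) y c (a/2) (L * (LINT z:cball c b|lborel. \<bar>u z\<bar>))"
proof -
  obtain L where L: "L > 0" "\<And>x x' z. x \<in> ball c (a/2) \<Longrightarrow> x' \<in> ball c (a/2) \<Longrightarrow>
     \<bar>repr_kernel \<theta> x z\<bar> \<le> L * indicator (cball c b) z \<and>
     \<bar>repr_kernel \<theta> x z - repr_kernel \<theta> x' z\<bar> \<le> L * norm (x - x') * indicator (cball c b) z"
    using repr_kernel_bounds[OF dim ab \<theta> one zero] by metis
  have "locally_regular u (\<mu> * \<theta> y) y c (a/2) (L * (LINT z:cball c b|lborel. \<bar>u z\<bar>))"
    if D: "open D" "cball c b \<subseteq> D" and u: "weak_pole D u \<mu> y" for D u \<mu> y
  proof -
    define h where "h x = (LINT z|lborel. u z * repr_kernel \<theta> x z)" for x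
    let ?J = "LINT z:cball c b|lborel. \<bar>u z\<bar>"
    have uK: "set_integrable lborel (cball c b) u" using u D unfolding weak_pole_def by auto
    have ui: "integrable lborel (\<lambda>x. indicator (cball c b) x * \<bar>u x\<bar>)"
      using integrable_abs[OF uK[unfolded set_integrable_def]] by (simp add: abs_mult)
    have Jeq: "?J = (LINT x|lborel. indicator (cball c b) x * \<bar>u x\<bar>)"
      by (simp add: set_lebesgue_integral_def)
    have ball: "z \<in> ball x (a/2) \<Longrightarrow> \<theta> z = 1" if "x \<in> ball c (a/2)" for x z
    proof -
      assume "z \<in> ball x (a/2)"
      then have "z \<in> ball c a" using that dist_triangle[of c z x] by simp
      then show ?thesis by (rule one)
    qed
    have test: "C2_test D \<theta>"
      unfolding C2_test_def using \<theta> zero D by (intro conjI exI[of _ "cball c b"]) auto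
    have ki: "integrable lborel (\<lambda>z. u z * repr_kernel \<theta> x z)" if x: "x \<in> ball c (a/2)" for x
    proof (rule integrable_mult_compact_support[OF compact_cball uK])
      show "continuous_on UNIV (repr_kernel \<theta> x)"
        by (rule repr_kernel_continuous(1)[OF dim \<theta> _ ball[OF x], of "a/2"]) (use ab in auto)
      show "repr_kernel \<theta> x z = 0" if "z \<notin> cball c b" for z
        using L(2)[OF x x, of z] that by simp
    qed
    show ?thesis
      unfolding locally_regular_def
    proof (intro exI[of _ h] conjI ballI impI)
      show "u x = \<mu> * \<theta> y * fundamental_solution (y - x) + h x"
        if "x \<in> ball c (a/2)" "continuous (at x) u" "\<mu> * \<theta> y = 0 \<or> x \<noteq> y" for x
      proof -
        have "\<mu> = 0 \<or> x \<noteq> y" using that(1,3) one[of x] ab by auto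
        show ?thesis unfolding h_def
          by (rule weak_pole_representation(1)[OF dim D(1) u test _ ball[OF that(1)], of "a/2"])
            (use that ab \<open>\<mu> = 0 \<or> x \<noteq> y\<close> in auto)
      qed
      show "\<bar>h x\<bar> \<le> L * ?J" if x: "x \<in> ball c (a/2)" for x
      proof -
        have "norm (u z * repr_kernel \<theta> x z) \<le> L * (indicator (cball c b) z * \<bar>u z\<bar>)" for z
          using mult_left_mono[OF conjunct1[OF L(2)[OF x x, of z]], of "\<bar>u z\<bar>"]
          by (simp add: abs_mult mult_ac)
        then have "norm (LINT z|lborel. u z * repr_kernel \<theta> x z)
           \<le> (LINT z|lborel. L * (indicator (cball c b) z * \<bar>u z\<bar>))"
          by (intro Bochner_Integration.integral_norm_bound_integral ki[OF x]) (use ui in auto)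
        then show ?thesis by (simp add: h_def Jeq)
      qed
      show "\<bar>h x - h x'\<bar> \<le> L * ?J * norm (x - x')" if x: "x \<in> ball c (a/2)" "x' \<in> ball c (a/2)" for x x'
      proof -
        have "norm (u z * repr_kernel \<theta> x z - u z * repr_kernel \<theta> x' z)
            \<le> (L * norm (x - x')) * (indicator (cball c b) z * \<bar>u z\<bar>)" for z
          using mult_left_mono[OF conjunct2[OF L(2)[OF x, of z]], of "\<bar>u z\<bar>"]
          by (simp add: abs_mult mult_ac right_diff_distrib[symmetric])
        then have "norm (LINT z|lborel. u z * repr_kernel \<theta> x z - u z * repr_kernel \<theta> x' z)
           \<le> (LINT z|lborel. (L * norm (x - x')) * (indicator (cball c b) z * \<bar>u z\<bar>))"
          using ki x ui by (intro Bochner_Integration.integral_norm_bound_integral) auto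
        then have "norm (h x - h x') \<le> L * norm (x - x') * ?J"
          using ki x by (simp add: h_def Jeq)
        then show ?thesis by (simp add: mult_ac)
      qed
    qed
  qed
  then show ?thesis using L(1) by blast
qed

section \<open>Green's functions\<close>

lemma eventually_le_add:
  fixes u :: "'a \<Rightarrow> real"
  assumes "(u \<longlongrightarrow> l) F" "l \<le> M" "e > 0"
  shows "\<forall>\<^sub>F x in F. u x \<le> M + e"
  using order_tendstoD(2)[OF assms(1), of "M + e"] assms(2,3) by (auto elim: eventually_mono)

text \<open>The singularity is integrable since its order \<open>n - 2\<close> is less than \<open>n\<close>; by translation invariance the
  bound \<open>C\<close> does not depend on \<open>y\<close>.\<close>
lemma fundamental_solution_integrable:
  assumes dim: "DIM('a::euclidean_space) > 2"
  shows "\<exists>C\<ge>0. \<forall>y::'a. set_integrable lborel (cball y R) (\<lambda>z. fundamental_solution (z - y)) \<and>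
     (LINT z:cball y R|lborel. fundamental_solution (z - y)) \<le> C"
proof (cases "R > 0")
  case False
  have "(indicator (cball y R) z * fundamental_solution (z - y) :: real) = 0" for y z :: 'a
  proof (cases "z = y")
    case False
    then have "0 < dist y z" by simp
    then have "z \<notin> cball y R" using \<open>\<not> R > 0\<close> unfolding mem_cball by linarith
    then show ?thesis by simp
  qed (use dim in \<open>simp add: fundamental_solution_eq power_0_left\<close>)
  note eq = this
  have "(LINT z|lborel. indicator (cball y R) z * fundamental_solution (z - y) :: real) = 0"
    "integrable lborel (\<lambda>z. indicator (cball y R) z * fundamental_solution (z - y) :: real)" for y :: 'a
    unfolding eq by simp_all
  then show ?thesis
    by (intro exI[of _ 0]) (simp add: set_integrable_def set_lebesgue_integral_def)
next
  case True
  define n where "n = DIM('a)"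
  define V where "V = unit_ball_vol (real DIM('a))"
  define k where "k = fund_coeff n"
  have V: "V > 0" by (simp add: V_def)
  have k: "k > 0" using fund_coeff_pos[of n] dim by (simp add: k_def n_def)
  have n: "n > 2" using dim by (simp add: n_def)
  let ?w = "\<lambda>r. k * (real n - 2) / r ^ (n - 1)"
  \<comment> \<open>Slicing by concentric balls: \<open>|z|^(2-n) - R^(2-n)\<close> is written as an integral over the radius.\<close>
  have slice: "ennreal (fundamental_solution z) * indicator (cball 0 R) z \<le>
      (\<integral>\<^sup>+r. ennreal (?w r) * indicator {0<..R} r * indicator {z. norm z \<le> r} z \<partial>lborel)
      + ennreal (k / R ^ (n - 2)) * indicator (cball 0 R) z" for z :: 'a
  proof (cases "z \<in> cball 0 R \<and> z \<noteq> 0")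
    case False
    then show ?thesis using n by (auto simp: indicator_def fundamental_solution_eq n_def[symmetric] power_0_left)
  next
    case z: True
    have "(\<integral>\<^sup>+r. ennreal (?w r) * indicator {0<..R} r * indicator {z. norm z \<le> r} z \<partial>lborel)
       = (\<integral>\<^sup>+r. ennreal (?w r) * indicator {norm z..R} r \<partial>lborel)"
    proof (rule nn_integral_cong)
      have "0 < norm z" using z by simp
      then have "r \<in> {0<..R} \<and> norm z \<le> r \<longleftrightarrow> r \<in> {norm z..R}" for r
        using less_le_trans[of 0 "norm z" r] by auto
      then show "ennreal (?w r) * indicator {0<..R} r * indicator {z. norm z \<le> r} z
          = ennreal (?w r) * indicator {norm z..R} r" for r
        by (auto simp: indicator_def)
    qed
    also have "\<dots> = ennreal (- (k / R ^ (n - 2)) - (- (k / norm z ^ (n - 2))))"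
    proof (rule nn_integral_FTC_Icc[where F = "\<lambda>r. - (k / r ^ (n - 2))"])
      fix r assume "r \<in> {norm z..R}"
      then have r0: "r > 0" using z less_le_trans[of 0 "norm z" r] by simp
      have e: "r ^ (n - 1) = r ^ Suc (n - 2)" using n by (intro arg_cong[of _ _ "\<lambda>m. r ^ m"]) simp
      have "((\<lambda>r. - (k * inverse (r ^ (n - 2)))) has_real_derivative
          - (k * - (inverse (r ^ (n - 2)) * (real (n - 2) * r ^ (n - 2 - 1)) * inverse (r ^ (n - 2))))) (at r)"
        using r0 by (auto intro!: derivative_eq_intros simp: power_Suc)
      moreover have "- (k * - (inverse (r ^ (n - 2)) * (real (n - 2) * r ^ (n - 2 - 1)) * inverse (r ^ (n - 2)))) = ?w r"
      proof -
        define X where "X = r ^ (n - 2 - 1)"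
        have X: "X > 0" using r0 by (simp add: X_def)
        have "n - 2 = Suc (n - 2 - 1)" using n by simp
        then have e2: "r ^ (n - 2) = r * X" unfolding X_def by (metis power_Suc)
        have nn: "real (n - 2) = real n - 2" using n by simp
        show ?thesis
          unfolding X_def[symmetric] e power_Suc e2 nn using r0 X by (simp add: field_simps)
      qed
      ultimately have "((\<lambda>r. - (k * inverse (r ^ (n - 2)))) has_real_derivative ?w r) (at r)"
        by (rule DERIV_cong)
      then show "((\<lambda>r. - (k / r ^ (n - 2))) has_real_derivative ?w r) (at r)"
        by (simp only: divide_inverse[of k])
      show "0 \<le> ?w r" using k n r0 by simp
    qed (use z in auto)
    finally have s: "(\<integral>\<^sup>+r. ennreal (?w r) * indicator {0<..R} r * indicator {z. norm z \<le> r} z \<partial>lborel)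
        = ennreal (k / norm z ^ (n - 2) - k / R ^ (n - 2))" by simp
    have "k / R ^ (n - 2) \<le> k / norm z ^ (n - 2)"
      using z k True by (intro divide_left_mono power_mono mult_pos_pos) auto
    then show ?thesis
      unfolding s using z k True
      by (simp add: fundamental_solution_eq n_def[symmetric] k_def[symmetric] ennreal_plus[symmetric] del: ennreal_plus)
  qed
  have [measurable]: "(\<lambda>(z::'a, r). indicator {z. norm z \<le> r} z :: ennreal)
      \<in> borel_measurable (lborel \<Otimes>\<^sub>M lborel)"
    by (simp add: indicator_def case_prod_beta)
  have vol: "emeasure lborel {z::'a. norm z \<le> r} = ennreal (V * r ^ n)" if "r \<ge> 0" for r
    using emeasure_cball[of r "0::'a"] that by (simp add: cball_def V_def n_def)
  have "(\<integral>\<^sup>+(z::'a). (\<integral>\<^sup>+r. ennreal (?w r) * indicator {0<..R} r * indicator {z. norm z \<le> r} z \<partial>lborel) \<partial>lborel)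
     = (\<integral>\<^sup>+r. (\<integral>\<^sup>+(z::'a). ennreal (?w r) * indicator {0<..R} r * indicator {z. norm z \<le> r} z \<partial>lborel) \<partial>lborel)"
    by (rule lborel_pair.Fubini'[symmetric]) measurable
  also have "\<dots> \<le> (\<integral>\<^sup>+r. ennreal (k * (real n - 2) * V * R) * indicator {0..R} r \<partial>lborel)"
  proof (rule nn_integral_mono)
    fix r :: real
    have "(\<integral>\<^sup>+(z::'a). ennreal (?w r) * indicator {0<..R} r * indicator {z. norm z \<le> r} z \<partial>lborel)
       = ennreal (?w r) * indicator {0<..R} r * emeasure lborel {z::'a. norm z \<le> r}"
      by (subst nn_integral_cmult_indicator) auto
    also have "\<dots> \<le> ennreal (k * (real n - 2) * V * R) * indicator {0..R} r"
    proof (cases "r \<in> {0<..R}")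
      case r: True
      have "r ^ n = r * r ^ (n - 1)" using n by (metis power_eq_if not_less_zero)
      then have "?w r * (V * r ^ n) = k * (real n - 2) * V * r" using r by simp
      also have "\<dots> \<le> k * (real n - 2) * V * R" using r k n V by (intro mult_left_mono) auto
      finally have "ennreal (?w r * (V * r ^ n)) \<le> ennreal (k * (real n - 2) * V * R)" by (rule ennreal_leI)
      then show ?thesis using r k n V vol[of r] by (simp add: ennreal_mult[symmetric])
    qed (simp add: indicator_def)
    finally show "(\<integral>\<^sup>+(z::'a). ennreal (?w r) * indicator {0<..R} r * indicator {z. norm z \<le> r} z \<partial>lborel)
      \<le> ennreal (k * (real n - 2) * V * R) * indicator {0..R} r" .
  qed
  also have "\<dots> < \<infinity>"
    using True by (subst nn_integral_cmult_indicator) (auto simp: ennreal_mult_less_top)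
  finally have fin1: "(\<integral>\<^sup>+(z::'a). (\<integral>\<^sup>+r. ennreal (?w r) * indicator {0<..R} r * indicator {z. norm z \<le> r} z \<partial>lborel) \<partial>lborel) < \<infinity>" .
  have fm[measurable]: "(fundamental_solution :: 'a \<Rightarrow> real) \<in> borel_measurable borel"
    unfolding fundamental_solution_eq[abs_def] by measurable
  have "(\<integral>\<^sup>+(z::'a). ennreal (fundamental_solution z) * indicator (cball 0 R) z \<partial>lborel) \<le>
     (\<integral>\<^sup>+(z::'a). (\<integral>\<^sup>+r. ennreal (?w r) * indicator {0<..R} r * indicator {z. norm z \<le> r} z \<partial>lborel)
      + ennreal (k / R ^ (n - 2)) * indicator (cball 0 R) z \<partial>lborel)"
    by (rule nn_integral_mono) (rule slice)
  also have "\<dots> = (\<integral>\<^sup>+(z::'a). (\<integral>\<^sup>+r. ennreal (?w r) * indicator {0<..R} r * indicator {z. norm z \<le> r} z \<partial>lborel) \<partial>lborel)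
      + (\<integral>\<^sup>+(z::'a). ennreal (k / R ^ (n - 2)) * indicator (cball 0 R) z \<partial>lborel)"
  proof (rule nn_integral_add)
    have "(\<lambda>(z::'a, r). ennreal (?w r) * indicator {0<..R} r * indicator {z. norm z \<le> r} z)
        \<in> borel_measurable (lborel \<Otimes>\<^sub>M lborel)" by measurable
    then show "(\<lambda>z::'a. \<integral>\<^sup>+r. ennreal (?w r) * indicator {0<..R} r * indicator {z. norm z \<le> r} z \<partial>lborel)
        \<in> borel_measurable lborel" by (rule lborel.borel_measurable_nn_integral)
    show "(\<lambda>z::'a. ennreal (k / R ^ (n - 2)) * indicator (cball 0 R) z) \<in> borel_measurable lborel"
      by (intro borel_measurable_times_ennreal borel_measurable_const borel_measurable_indicator) auto
  qed
  also have "\<dots> < \<infinity>"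
  proof -
    have "(\<integral>\<^sup>+(z::'a). ennreal (k / R ^ (n - 2)) * indicator (cball 0 R) z \<partial>lborel) < \<infinity>"
      using emeasure_bounded_finite[of "cball (0::'a) R"]
      by (subst nn_integral_cmult_indicator) (auto simp: ennreal_mult_less_top)
    with fin1 show ?thesis by simp
  qed
  finally have fin: "(\<integral>\<^sup>+(z::'a). ennreal (fundamental_solution z) * indicator (cball 0 R) z \<partial>lborel) < \<infinity>" .
  let ?f = "\<lambda>z::'a. indicator (cball 0 R) z * fundamental_solution z"
  have fe: "(\<integral>\<^sup>+(z::'a). ennreal (norm (?f z)) \<partial>lborel)
      = (\<integral>\<^sup>+(z::'a). ennreal (fundamental_solution z) * indicator (cball 0 R) z \<partial>lborel)"
    by (intro nn_integral_cong) (auto simp: indicator_def fundamental_solution_nonneg[OF dim])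
  have fb: "?f \<in> borel_measurable borel"
    by (intro borel_measurable_times borel_measurable_indicator fm) auto
  have int: "integrable lborel ?f"
    by (rule integrableI_bounded) (use fb fin fe in auto)
  have tr: "(\<lambda>z. indicator (cball y R) z *\<^sub>R fundamental_solution (z - y)) = (\<lambda>z. ?f (- y + z))" for y
    by (auto simp: fun_eq_iff indicator_def dist_norm norm_minus_commute)
  show ?thesis
  proof (intro exI[of _ "max 0 (LINT z|lborel. ?f z)"] conjI allI)
    show "set_integrable lborel (cball y R) (\<lambda>z. fundamental_solution (z - y))" for y :: 'a
      unfolding set_integrable_def tr using integral_translate(2)[OF fb] int by blast
    show "(LINT z:cball y R|lborel. fundamental_solution (z - y)) \<le> max 0 (LINT z|lborel. ?f z)" for y :: 'a
      unfolding set_lebesgue_integral_def tr using integral_translate(1)[OF fb, of "- y"] by simp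
  qed simp
qed

lemma green_functionD:
  assumes "green_function D G" "y \<in> D" "open D"
  shows "weak_pole D (\<lambda>x. G x y) 1 y" "harmonic_in (D - {y}) (\<lambda>x. G x y)"
    "\<And>z. z \<in> frontier D \<Longrightarrow> ((\<lambda>x. G x y) \<longlongrightarrow> 0) (at z within D)"
    "((\<lambda>x. G x y) \<longlongrightarrow> 0) (inf at_infinity (principal D))"
  using assms neg_laplacian_eq_delta_imp_weak_pole[OF assms(3)] unfolding green_function_def by blast+

lemma harmonic_in_isCont:
  assumes "open D" "harmonic_in D u" "x \<in> D" shows "continuous (at x) u"
  using harmonic_in_continuous[OF assms(2)] assms continuous_on_eq_continuous_at by blast

text \<open>The representation formula with a cutoff around the pole itself: the singular part is then
  exactly the fundamental solution.\<close>
lemma green_function_near_pole: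
  fixes D :: "'a::euclidean_space set"
  assumes dim: "DIM('a) > 2" and D: "open D" and G: "green_function D G" and y: "y \<in> D"
  shows "\<exists>B. \<forall>\<^sub>F x in at y. \<bar>G x y - fundamental_solution (x - y)\<bar> \<le> B"
proof -
  note g = green_functionD[OF G y D]
  obtain b where b: "b > 0" "cball y b \<subseteq> D" using D y open_contains_cball by blast
  have ab: "0 < b / 2" "b / 2 < b" using b by auto
  obtain \<theta> where \<theta>: "C2_on UNIV \<theta>" "\<And>z. z \<in> cball y (b/2) \<Longrightarrow> \<theta> z = 1" "\<And>z. z \<notin> ball y b \<Longrightarrow> \<theta> z = 0"
    using cutoff_exists[OF ab, of y] by metis
  have "\<exists>L>0. \<forall>D u \<mu> y'. open D \<longrightarrow> cball y b \<subseteq> D \<longrightarrow> weak_pole D u \<mu> y' \<longrightarrow>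
     locally_regular u (\<mu> * \<theta> y') y' y (b/2/2) (L * (LINT z:cball y b|lborel. \<bar>u z\<bar>))"
    by (rule weak_pole_regular_part[OF dim ab \<theta>(1)]) (use \<theta> in auto)
  then obtain L where "locally_regular (\<lambda>x. G x y) (1 * \<theta> y) y y (b/2/2) L"
    using D b(2) g(1) by meson
  then obtain h where h: "\<And>x. x \<in> ball y (b/4) \<Longrightarrow> continuous (at x) (\<lambda>x. G x y) \<Longrightarrow> x \<noteq> y \<Longrightarrow>
      G x y = \<theta> y * fundamental_solution (y - x) + h x"
    "\<And>x. x \<in> ball y (b/4) \<Longrightarrow> \<bar>h x\<bar> \<le> L"
    unfolding locally_regular_def by auto
  have "\<bar>G x y - fundamental_solution (x - y)\<bar> \<le> L" if x: "x \<in> ball y (b/4)" "x \<noteq> y" for x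
  proof -
    have "x \<in> D - {y}" using x b by (auto simp: subset_iff)
    then have "continuous (at x) (\<lambda>x. G x y)"
      using harmonic_in_isCont[OF _ g(2)] D by (simp add: open_delete)
    then show ?thesis
      using h(1)[OF x(1) _ x(2)] h(2)[OF x(1)] \<theta>(2)[of y] b fundamental_solution_minus[of "x - y"] by simp
  qed
  then show ?thesis
    unfolding eventually_at using b by (intro exI[of _ L] exI[of _ "b/4"]) (auto simp: dist_commute)
qed

text \<open>Compare \<open>G(\<cdot>,y)\<close> with \<open>0\<close> and with the fundamental solution by the maximum principle; near the pole
  the difference to the latter is bounded.\<close>
lemma green_function_bounds:
  fixes D :: "'a::euclidean_space set"
  assumes dim: "DIM('a) > 2" and D: "open D" and G: "green_function D G" and y: "y \<in> D"
    and x: "x \<in> D" "x \<noteq> y"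
  shows "0 \<le> G x y" "G x y \<le> fundamental_solution (x - y)"
proof -
  note g = green_functionD[OF G y D]
  have o: "open (D - {y})" using D by (simp add: open_delete)
  obtain B where B: "\<forall>\<^sub>F x in at y. \<bar>G x y - fundamental_solution (x - y)\<bar> \<le> B"
    using green_function_near_pole[OF dim D G y] by blast
  then have B': "\<forall>\<^sub>F x in at y within D. \<bar>G x y - fundamental_solution (x - y)\<bar> \<le> B"
    by (rule filter_leD[rotated]) (intro at_le subset_UNIV)
  have neg: "harmonic_in (D - {y}) (\<lambda>x. - G x y)"
    using harmonic_in_cmult[OF o g(2), of "-1"] by simp
  have "- G x y \<le> 0"
  proof (rule maximum_principle_pole[OF dim D neg])
    show "\<forall>\<^sub>F x in at z within D. - G x y \<le> 0 + e" if "z \<in> frontier D" "0 < e" for z e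
      using tendsto_minus[OF g(3)[OF that(1)]] that(2) by (intro eventually_le_add[of _ 0]) auto
    show "\<forall>\<^sub>F x in inf at_infinity (principal D). - G x y \<le> 0 + e" if "0 < e" for e
      using tendsto_minus[OF g(4)] that by (intro eventually_le_add[of _ 0]) auto
    show "\<forall>\<^sub>F x in at y within D. - G x y \<le> B"
      using B' by eventually_elim (use fundamental_solution_nonneg[OF dim] in \<open>smt (verit)\<close>)
  qed (use x in auto)
  then show "0 \<le> G x y" by simp
  have diff: "harmonic_in (D - {y}) (\<lambda>x. G x y - fundamental_solution (x - y))"
    by (intro harmonic_in_diff o g(2) fundamental_solution_harmonic_in dim) auto
  have "G x y - fundamental_solution (x - y) \<le> 0"
  proof (rule maximum_principle_pole[OF dim D diff])
    have le: "G x y - fundamental_solution (x - y) \<le> G x y" for x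
      using fundamental_solution_nonneg[OF dim] by simp
    show "\<forall>\<^sub>F x in at z within D. G x y - fundamental_solution (x - y) \<le> 0 + e"
      if "z \<in> frontier D" "0 < e" for z e
      using eventually_le_add[OF g(3)[OF that(1)] order_refl that(2)]
      by eventually_elim (rule order_trans[OF le])
    show "\<forall>\<^sub>F x in inf at_infinity (principal D). G x y - fundamental_solution (x - y) \<le> 0 + e" if "0 < e" for e
      using eventually_le_add[OF g(4) order_refl that] by eventually_elim (rule order_trans[OF le])
    show "\<forall>\<^sub>F x in at y within D. G x y - fundamental_solution (x - y) \<le> B"
      using B' by eventually_elim simp
  qed (use x in auto)
  then show "G x y \<le> fundamental_solution (x - y)" by simp
qed

text \<open>The constants do not depend on the pole \<open>y\<close>, because \<open>0 \<le> G \<le> F\<close> bounds the \<open>L\<^sup>1\<close> norm of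
  \<open>G(\<cdot>,y)\<close> uniformly.\<close>
lemma regular_part_lipschitz:
  fixes D :: "'a::euclidean_space set"
  assumes dim: "DIM('a) > 2" and D: "open D" "bounded D" and G: "green_function D G" and c: "c \<in> D"
  shows "\<exists>r>0. \<exists>C>0. \<forall>y\<in>D. \<forall>x\<in>ball c r. \<bar>regular_part G x y\<bar> \<le> C \<and>
     (\<forall>x'\<in>ball c r. \<bar>regular_part G x y - regular_part G x' y\<bar> \<le> C * norm (x - x'))"
proof -
  let ?F = "fundamental_solution :: 'a \<Rightarrow> real"
  obtain b where b: "b > 0" "cball c b \<subseteq> D" using D c open_contains_cball by blast
  define a where "a = b / 2"
  have ab: "0 < a" "a < b" using b by (auto simp: a_def)
  obtain \<theta> where \<theta>: "C2_on UNIV \<theta>" "\<And>z. z \<in> cball c a \<Longrightarrow> \<theta> z = 1" "\<And>z. z \<notin> ball c b \<Longrightarrow> \<theta> z = 0"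
    "\<And>z. 0 \<le> \<theta> z" "\<And>z. \<theta> z \<le> 1"
    using cutoff_exists[OF ab, of c] by metis
  have "\<exists>L>0. \<forall>D u \<mu> y. open D \<longrightarrow> cball c b \<subseteq> D \<longrightarrow> weak_pole D u \<mu> y \<longrightarrow>
     locally_regular u (\<mu> * \<theta> y) y c (a/2) (L * (LINT z:cball c b|lborel. \<bar>u z\<bar>))"
    by (rule weak_pole_regular_part[OF dim ab \<theta>(1)]) (use \<theta> in auto)
  then obtain L where L: "L > 0" "\<And>u y. weak_pole D u 1 y \<Longrightarrow>
     locally_regular u (1 * \<theta> y) y c (a/2) (L * (LINT z:cball c b|lborel. \<bar>u z\<bar>))"
    using D(1) b(2) by meson
  obtain R0 where R0: "\<And>y. y \<in> D \<Longrightarrow> dist c y \<le> R0"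
    using D(2) unfolding bounded_any_center[where a=c] by blast
  define R where "R = R0 + b"
  obtain C0 where C0: "C0 \<ge> 0" "\<And>y::'a. set_integrable lborel (cball y R) (\<lambda>z. ?F (z - y))"
     "\<And>y::'a. (LINT z:cball y R|lborel. ?F (z - y)) \<le> C0"
    using fundamental_solution_integrable[OF dim, of R] by blast
  define LF where "LF = (real DIM('a) - 2) * fund_coeff DIM('a) / (a/2) ^ (DIM('a) - 1)"
  have LF: "LF \<ge> 0" using dim ab fund_coeff_pos[OF dim] by (simp add: LF_def)
  define F0 where "F0 = fund_coeff DIM('a) / (a/2) ^ (DIM('a) - 2)"
  have F0: "F0 \<ge> 0" using ab fund_coeff_pos[OF dim] by (simp add: F0_def)
  define C where "C = L * C0 + LF + F0 + 1"
  have C: "C > 0" "L * C0 + LF \<le> C" "L * C0 + F0 \<le> C" using L C0 LF F0 by (auto simp: C_def intro!: add_nonneg_pos)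
  have main: "\<bar>regular_part G x y\<bar> \<le> C \<and>
     (\<forall>x'\<in>ball c (a/2). \<bar>regular_part G x y - regular_part G x' y\<bar> \<le> C * norm (x - x'))"
    if y: "y \<in> D" and x: "x \<in> ball c (a/2)" for x y
  proof -
    note g = green_functionD[OF G y D(1)]
    have J: "(LINT z:cball c b|lborel. \<bar>G z y\<bar>) \<le> C0"
    proof -
      have sub: "cball c b \<subseteq> cball y R"
      proof
        fix z assume "z \<in> cball c b"
        then show "z \<in> cball y R"
          using R0[OF y] dist_triangle[of y z c] by (simp add: R_def dist_commute)
      qed
      have i1: "set_integrable lborel (cball c b) (\<lambda>z. \<bar>G z y\<bar>)"
        using g(1) b(2) unfolding weak_pole_def by (intro set_integrable_abs) auto
      have "AE z in lborel. z \<noteq> y" by (rule AE_lborel_singleton)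
      then have ae: "AE z in lborel. indicator (cball c b) z *\<^sub>R \<bar>G z y\<bar> \<le> indicator (cball y R) z *\<^sub>R ?F (z - y)"
      proof eventually_elim
        case (elim z)
        show ?case
          using green_function_bounds[OF dim D(1) G y _ elim] b(2) sub fundamental_solution_nonneg[OF dim, of "z - y"]
          by (auto simp: indicator_def subset_iff)
      qed
      have "(LINT z:cball c b|lborel. \<bar>G z y\<bar>) \<le> (LINT z:cball y R|lborel. ?F (z - y))"
        unfolding set_lebesgue_integral_def
        by (rule integral_mono_AE) (use i1 C0(2) ae in \<open>auto simp: set_integrable_def\<close>)
      then show ?thesis using C0(3)[of y] by linarith
    qed
    obtain h where h: "\<And>x. x \<in> ball c (a/2) \<Longrightarrow> continuous (at x) (\<lambda>x. G x y) \<Longrightarrow> x \<noteq> y \<Longrightarrow>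
        G x y = \<theta> y * ?F (y - x) + h x"
      and hb: "\<And>x. x \<in> ball c (a/2) \<Longrightarrow> \<bar>h x\<bar> \<le> L * (LINT z:cball c b|lborel. \<bar>G z y\<bar>)"
      and hl: "\<And>x x'. x \<in> ball c (a/2) \<Longrightarrow> x' \<in> ball c (a/2) \<Longrightarrow>
          \<bar>h x - h x'\<bar> \<le> L * (LINT z:cball c b|lborel. \<bar>G z y\<bar>) * norm (x - x')"
      using L(2)[OF g(1)] unfolding locally_regular_def by auto
    \<comment> \<open>The regular part near \<open>c\<close>. The factor \<open>1 - \<theta> y\<close> vanishes when \<open>y\<close> is near \<open>c\<close>; otherwise \<open>F(y - \<cdot>)\<close> is
      regular near \<open>c\<close>.\<close>
    define k where "k x = (1 - \<theta> y) * ?F (y - x) - h x" for x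
    have LJ: "L * (LINT z:cball c b|lborel. \<bar>G z y\<bar>) \<le> L * C0" using J L(1) by simp
    have far: "\<theta> y = 1 \<or> a \<le> dist c y" using \<theta>(2)[of y] by auto
    have geo: "a / 2 \<le> norm (y - \<xi>)" if "a \<le> dist c y" "\<xi> \<in> ball c (a/2)" for \<xi>
      using that dist_triangle[of c y \<xi>] by (simp add: dist_norm norm_minus_commute)
    have t1: "\<bar>1 - \<theta> y\<bar> \<le> 1" using \<theta>(4,5)[of y] by simp
    have kb: "\<bar>k x\<bar> \<le> C" if x: "x \<in> ball c (a/2)" for x
    proof -
      have "\<bar>(1 - \<theta> y) * ?F (y - x)\<bar> \<le> F0"
      proof (cases "\<theta> y = 1")
        case False
        then have g2: "a / 2 \<le> norm (y - x)" using far geo[OF _ x] by auto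
        then have "0 < norm (y - x)" using ab by linarith
        then have "\<bar>?F (y - x)\<bar> \<le> F0"
          using g2 ab fund_coeff_pos[OF dim] unfolding F0_def
          by (auto simp: fundamental_solution_eq intro!: divide_left_mono power_mono mult_pos_pos zero_less_power)
        with t1 show ?thesis using mult_mono[OF t1 \<open>\<bar>?F (y - x)\<bar> \<le> F0\<close>] by (simp add: abs_mult)
      qed (use F0 in simp)
      then show ?thesis unfolding k_def using hb[OF x] LJ C(3) by linarith
    qed
    have kl: "\<bar>k x - k x'\<bar> \<le> C * norm (x - x')" if x: "x \<in> ball c (a/2)" and x': "x' \<in> ball c (a/2)" for x x'
    proof -
      have "\<bar>(1 - \<theta> y) * (?F (y - x) - ?F (y - x'))\<bar> \<le> LF * norm (x - x')"
      proof (cases "\<theta> y = 1")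
        case False
        have "\<bar>?F (y - x) - ?F (y - x')\<bar> \<le> LF * norm ((y - x) - (y - x'))"
          unfolding LF_def
        proof (rule fundamental_solution_lipschitz[OF dim])
          fix w assume "w \<in> closed_segment (y - x) (y - x')"
          then have "y - w \<in> closed_segment x x'"
            unfolding closed_segment_def by (force simp: algebra_simps)
          then have "y - w \<in> ball c (a/2)" using x x' convex_ball closed_segment_subset by blast
          from geo[OF _ this] far False show "a / 2 \<le> norm w" by simp
        qed (use ab in simp)
        then have "\<bar>?F (y - x) - ?F (y - x')\<bar> \<le> LF * norm (x - x')" by (simp add: norm_minus_commute)
        from mult_mono[OF t1 this] show ?thesis by (simp add: abs_mult)
      qed (use LF in simp)
      moreover have "\<bar>h x - h x'\<bar> \<le> L * C0 * norm (x - x')"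
        using hl[OF x x'] mult_right_mono[OF LJ norm_ge_zero[of "x - x'"]] by linarith
      moreover have "(L * C0 + LF) * norm (x - x') \<le> C * norm (x - x')"
        by (rule mult_right_mono[OF C(2)]) simp
      ultimately show ?thesis unfolding k_def by (simp add: algebra_simps abs_le_iff)
    qed
    have off: "?F (x - y) - G x y = k x" if x: "x \<in> ball c (a/2)" "x \<noteq> y" for x
    proof -
      have "x \<in> D - {y}" using x b ab by (auto simp: subset_iff)
      then have "continuous (at x) (\<lambda>x. G x y)"
        using harmonic_in_isCont[OF _ g(2)] D by (simp add: open_delete)
      from h[OF x(1) this x(2)] show ?thesis
        using fundamental_solution_minus[of "x - y"] by (simp add: k_def algebra_simps)
    qed
    have eq: "regular_part G x y = k x" if x: "x \<in> ball c (a/2)" for x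
    proof (cases "x = y")
      case False
      then show ?thesis using off[OF x] by (simp add: regular_part_def)
    next
      case True
      have "((\<lambda>x'. k x') \<longlongrightarrow> k y) (at y)"
      proof (rule tendsto_dist_iff[THEN iffD2], rule tendsto_sandwich[OF _ _ tendsto_const])
        show "\<forall>\<^sub>F x' in at y. dist (k x') (k y) \<le> C * norm (x' - y)"
          using eventually_at_in_open'[OF open_ball x[unfolded True]]
          by eventually_elim (use kl x True in \<open>simp add: dist_real_def\<close>)
        have "((\<lambda>x'. C * norm (x' - y)) \<longlongrightarrow> C * norm (y - y)) (at y)" by (intro tendsto_intros)
        then show "((\<lambda>x'. C * norm (x' - y)) \<longlongrightarrow> 0) (at y)" by simp
      qed auto
      moreover have "\<forall>\<^sub>F x' in at y. k x' = ?F (x' - y) - G x' y"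
        using eventually_at_in_open[OF open_ball x[unfolded True]]
        by eventually_elim (use off in auto)
      ultimately have "((\<lambda>x'. ?F (x' - y) - G x' y) \<longlongrightarrow> k y) (at y)"
        by (rule Lim_transform_eventually)
      then have "Lim (at y) (\<lambda>x'. ?F (x' - y) - G x' y) = k y"
        by (intro tendsto_Lim) auto
      then show ?thesis using True by (simp add: regular_part_def)
    qed
    show ?thesis using eq x kb kl by simp
  qed
  show ?thesis using main ab C(1) by (intro exI[of _ "a/2"] conjI exI[of _ C]) auto
qed

section \<open>Symmetry of Green's functions\<close>

text \<open>A \<open>C\<^sup>2\<close> convex function that vanishes for \<open>s \<le> 0\<close> and equals \<open>s - 1\<close> for \<open>s \<ge> 2\<close>: the second
  antiderivative of a tent.\<close>
definition ramp :: "real \<Rightarrow> real" where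
  "ramp s = (max 0 s ^ 3 - 2 * max 0 (s - 1) ^ 3 + max 0 (s - 2) ^ 3) / 6"

definition ramp' :: "real \<Rightarrow> real" where
  "ramp' s = (max 0 s ^ 2 - 2 * max 0 (s - 1) ^ 2 + max 0 (s - 2) ^ 2) / 2"

definition ramp'' :: "real \<Rightarrow> real" where
  "ramp'' s = max 0 s - 2 * max 0 (s - 1) + max 0 (s - 2)"

lemma has_real_derivative_shift:
  assumes "(f has_real_derivative D) (at (s - c))"
  shows "((\<lambda>s. f (s - c)) has_real_derivative D) (at s)"
  using assms DERIV_shift[of f D s "- c"] by simp

lemma ramp_derivatives:
  "(ramp has_real_derivative ramp' s) (at s)"
  "(ramp' has_real_derivative ramp'' s) (at s)"
  "continuous_on A ramp''"
proof -
  have d: "((\<lambda>s. max 0 (s - c) ^ 3) has_real_derivative 3 * max 0 (s - c) ^ 2) (at s)"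
    "((\<lambda>s. max 0 (s - c) ^ 2) has_real_derivative 2 * max 0 (s - c)) (at s)" for c s :: real
    using has_real_derivative_shift[OF pos_part_cube(1), where s = s and c = c]
      has_real_derivative_shift[OF pos_part_power_derivative[of 0], where s = s and c = c]
    by (simp_all add: numeral_2_eq_2)
  note d0 = d[where c = 0, simplified]
  have "((\<lambda>s. (max 0 s ^ 3 - 2 * max 0 (s - 1) ^ 3 + max 0 (s - 2) ^ 3) / 6) has_real_derivative
      (3 * max 0 s ^ 2 - 2 * (3 * max 0 (s - 1) ^ 2) + 3 * max 0 (s - 2) ^ 2) / 6) (at s)"
    by (intro DERIV_cdivide DERIV_add DERIV_diff DERIV_cmult d d0)
  moreover have "(3 * max 0 s ^ 2 - 2 * (3 * max 0 (s - 1) ^ 2) + 3 * max 0 (s - 2) ^ 2) / 6 = ramp' s"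
    by (simp add: ramp'_def field_simps)
  ultimately show "(ramp has_real_derivative ramp' s) (at s)" by (simp add: ramp_def[abs_def])
  have "((\<lambda>s. (max 0 s ^ 2 - 2 * max 0 (s - 1) ^ 2 + max 0 (s - 2) ^ 2) / 2) has_real_derivative
      (2 * max 0 s - 2 * (2 * max 0 (s - 1)) + 2 * max 0 (s - 2)) / 2) (at s)"
    by (intro DERIV_cdivide DERIV_add DERIV_diff DERIV_cmult d d0)
  moreover have "(2 * max 0 s - 2 * (2 * max 0 (s - 1)) + 2 * max 0 (s - 2)) / 2 = ramp'' s"
    by (simp add: ramp''_def field_simps)
  ultimately show "(ramp' has_real_derivative ramp'' s) (at s)" by (simp add: ramp'_def[abs_def])
  show "continuous_on A ramp''" unfolding ramp''_def[abs_def] by (intro continuous_intros)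
qed

lemma ramp_simps:
  "s \<le> 0 \<Longrightarrow> ramp s = 0" "s \<le> 0 \<Longrightarrow> ramp' s = 0" "s \<le> 0 \<Longrightarrow> ramp'' s = 0" "s \<ge> 2 \<Longrightarrow> ramp s = s - 1"
  by (simp_all add: ramp_def ramp'_def ramp''_def max_def power3_eq_cube field_simps)

lemma ramp''_nonneg: "0 \<le> ramp'' s"
  by (simp add: ramp''_def max_def)

lemma ramp'_bounds: "0 \<le> ramp' s" "ramp' s \<le> 1"
proof -
  have mono: "ramp' s \<le> ramp' t" if "s \<le> t" for s t
    by (rule DERIV_nonneg_imp_nondecreasing[OF that]) (use ramp_derivatives(2) ramp''_nonneg in blast)
  have "0 = ramp' (min s 0)" by (simp add: ramp_simps)
  also have "\<dots> \<le> ramp' s" by (rule mono) simp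
  finally show "0 \<le> ramp' s" .
  have "ramp' s \<le> ramp' (max s 2)" by (rule mono) simp
  also have "\<dots> = 1" by (simp add: ramp'_def max_def power2_eq_square field_simps)
  finally show "ramp' s \<le> 1" .
qed

lemma ramp_bounds: "0 \<le> ramp s" "s - 1 \<le> ramp s"
proof -
  have mono: "ramp s \<le> ramp t" if "s \<le> t" for s t
    by (rule DERIV_nonneg_imp_nondecreasing[OF that]) (use ramp_derivatives(1) ramp'_bounds in blast)
  have "0 = ramp (min s 0)" by (simp add: ramp_simps)
  also have "\<dots> \<le> ramp s" by (rule mono) simp
  finally show "0 \<le> ramp s" .
  have "ramp (max s 2) - max s 2 \<le> ramp s - s"
  proof (rule DERIV_nonpos_imp_nonincreasing[of s "max s 2" "\<lambda>s. ramp s - s"])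
    show "\<exists>y. ((\<lambda>s. ramp s - s) has_real_derivative y) (at x) \<and> y \<le> 0" for x
      using ramp_derivatives(1) ramp'_bounds(2)
      by (intro exI[of _ "ramp' x - 1"]) (auto intro!: derivative_eq_intros)
  qed simp
  then show "s - 1 \<le> ramp s" by (simp add: ramp_simps)
qed

text \<open>Let \<open>f\<close> be \<open>G(\<cdot>,a)\<close>, smoothly capped at a high level \<open>m\<close>. It is superharmonic, and \<open>-\<Delta>f\<close>
  is a measure of mass one concentrated near \<open>a\<close>. Flattening \<open>f\<close> also at a low level \<open>\<delta>\<close> by a convex
  function gives an admissible test function \<open>\<phi>\<close> with \<open>-\<Delta>\<phi> \<le> -\<Delta>f\<close>. Testing the equation for
  \<open>G(\<cdot>,b)\<close> with \<open>\<phi>\<close> yields \<open>\<phi>(b) \<le> G(a,b)\<close> up to a small error, while \<open>\<phi>(b)\<close> is close to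
  \<open>G(b,a)\<close>. Exchanging the two poles gives the reverse inequality.\<close>
lemma green_function_le_symmetric:
  fixes D :: "'a::euclidean_space set"
  assumes dim: "DIM('a) > 2" and D: "open D" and G: "green_function D G"
    and a: "a \<in> D" and b: "b \<in> D" and ab: "a \<noteq> b"
  shows "G b a \<le> G a b"
proof (rule field_le_epsilon)
  fix \<eta>0 :: real assume \<eta>0: "\<eta>0 > 0"
  define \<eta> where "\<eta> = \<eta>0 / 2"
  have \<eta>: "\<eta> > 0" using \<eta>0 by (simp add: \<eta>_def)
  define u where "u x = G x a" for x
  define v where "v x = G x b" for x
  note gu = green_functionD[OF G a D, folded u_def]
  note gv = green_functionD[OF G b D, folded v_def]
  have u0: "0 \<le> u x" "u x \<le> fundamental_solution (x - a)" if "x \<in> D" "x \<noteq> a" for x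
    using green_function_bounds[OF dim D G a that] by (auto simp: u_def)
  have v0: "0 \<le> v x" if "x \<in> D" "x \<noteq> b" for x
    using green_function_bounds(1)[OF dim D G b that] by (auto simp: v_def)
  have oa: "open (D - {a})" and ob: "open (D - {b})" using D by (auto simp: open_delete)
  have "continuous (at a) v" by (rule harmonic_in_isCont[OF ob gv(2)]) (use a ab in simp)
  then obtain d where d: "d > 0" "\<And>x. dist x a < d \<Longrightarrow> dist (v x) (v a) < \<eta>"
    using \<eta> unfolding continuous_at_eps_delta by blast
  obtain e where e: "e > 0" "cball a e \<subseteq> D" using D a open_contains_cball by blast
  define r where "r = min e (min d (dist a b)) / 2"
  have r: "r > 0" "r < d" "r < dist a b" "cball a r \<subseteq> D"
    using d e ab unfolding r_def by (auto simp: min_def subset_iff split: if_splits)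
  have vr: "v x \<le> v a + \<eta>" if "x \<in> cball a r" for x
    using d(2)[of x] that r by (auto simp: dist_commute dist_real_def)
  define m where "m = fund_coeff DIM('a) / (r/2) ^ (DIM('a) - 2) + 1"
  have m1: "m \<ge> 1" using r fund_coeff_pos[OF dim] by (simp add: m_def)
  have um: "u x \<le> m" if "x \<in> D" "r / 2 \<le> dist x a" for x
  proof -
    have xa: "x \<noteq> a" using that r by auto
    have "fundamental_solution (x - a) \<le> fund_coeff DIM('a) / (r/2) ^ (DIM('a) - 2)"
      using that r fund_coeff_pos[OF dim] xa unfolding fundamental_solution_eq
      by (intro divide_left_mono power_mono mult_pos_pos zero_less_power) (auto simp: dist_norm)
    then show ?thesis using u0(2)[OF that(1) xa] by (simp add: m_def)
  qed
  define cap where "cap t = t - ramp (t - m)" for t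
  have cap1: "(cap has_real_derivative (1 - ramp' (t - m))) (at t)" for t
    unfolding cap_def by (intro DERIV_diff DERIV_ident has_real_derivative_shift ramp_derivatives(1))
  have cap2: "((\<lambda>t. 1 - ramp' (t - m)) has_real_derivative (- ramp'' (t - m))) (at t)" for t
    using DERIV_diff[OF DERIV_const has_real_derivative_shift[OF ramp_derivatives(2)]] by simp
  have cap2c: "continuous_on A (\<lambda>t. - ramp'' (t - m))" for A
    by (intro continuous_intros continuous_on_compose2[OF ramp_derivatives(3)[of UNIV]]) auto
  \<comment> \<open>The value at \<open>a\<close> is the constant value of \<open>cap\<close> above the level \<open>m + 2\<close>, which \<open>u\<close> exceeds near \<open>a\<close>.\<close>
  define f where "f x = (if x = a then m + 1 else cap (u x))" for x
  obtain B where B: "\<forall>\<^sub>F x in at a. \<bar>u x - fundamental_solution (x - a)\<bar> \<le> B"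
    using green_function_near_pole[OF dim D G a] unfolding u_def by blast
  have "\<forall>\<^sub>F x in at a. fundamental_solution (x - a) \<ge> B + (m + 2)"
    using fundamental_solution_pole[OF dim, of a] unfolding filterlim_at_top by blast
  with B have "\<forall>\<^sub>F x in at a. u x \<ge> m + 2" by eventually_elim linarith
  then obtain r1 where r1: "r1 > 0" "\<And>x. x \<noteq> a \<Longrightarrow> dist x a < r1 \<Longrightarrow> u x \<ge> m + 2"
    unfolding eventually_at by auto
  have f_near: "f x = m + 1" if "x \<in> ball a r1" for x
    using r1(2)[of x] that by (auto simp: f_def cap_def ramp_simps dist_commute)
  have uC: "C2_on (D - {a}) u" and ulap: "\<And>x. x \<in> D - {a} \<Longrightarrow> laplacian u x = 0"
    using gu(2) unfolding harmonic_in_def by auto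
  note cc = C2_on_compose[OF oa uC, of cap "\<lambda>t. 1 - ramp' (t - m)" "\<lambda>t. - ramp'' (t - m)",
      OF cap1 cap2 cap2c]
  have eqf: "cap (u x) = f x" if "x \<in> D - {a}" for x using that by (simp add: f_def)
  note cf = C2_on_cong[OF oa cc(1) eqf]
  note cn = C2_on_cong[OF open_ball C2_on_const(1), of a r1 "m + 1" f]
  have nC: "C2_on (ball a r1) f" by (rule cn(1)) (simp add: f_near)
  have nlap: "laplacian f x = 0" if "x \<in> ball a r1" for x
    using cn(3)[of x] f_near that by (simp add: C2_on_const)
  have "C2_on ((D - {a}) \<union> ball a r1) f" by (rule C2_on_Un[OF oa open_ball cf(1) nC])
  then have fC: "C2_on D f" by (rule C2_on_subset) (use r1 in auto)
  have flap: "laplacian f x \<le> 0" if x: "x \<in> D" for x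
  proof (cases "x = a")
    case True
    then show ?thesis using nlap[of a] r1 by simp
  next
    case False
    then show ?thesis
      using cf(3)[of x] cc(3)[of x] x ulap[of x] ramp''_nonneg[of "u x - m"] by simp
  qed
  have flap0: "laplacian f x = 0" if x: "x \<in> D" "r / 2 \<le> dist x a" for x
  proof -
    have xa: "x \<noteq> a" using x r by auto
    have "u x \<le> m" by (rule um[OF x])
    then show ?thesis using cf(3)[of x] cc(3)[of x] x xa ulap[of x] by (simp add: ramp_simps)
  qed
  have f_far: "f x = u x" if "x \<in> D" "r / 2 \<le> dist x a" for x
    using um[OF that] that r by (auto simp: f_def cap_def ramp_simps)
  obtain \<theta> where \<theta>: "C2_on UNIV \<theta>" "\<And>z. z \<in> cball a (r/2) \<Longrightarrow> \<theta> z = 1" "\<And>z. z \<notin> ball a r \<Longrightarrow> \<theta> z = 0"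
    "\<And>z. 0 \<le> \<theta> z" "\<And>z. \<theta> z \<le> 1"
  proof -
    have "0 < r / 2" "r / 2 < r" using r by auto
    from cutoff_exists[OF this, of a] show thesis using that by metis
  qed
  have \<theta>test: "C2_test D \<theta>"
    unfolding C2_test_def using \<theta> r(4) by (intro conjI exI[of _ "cball a r"]) auto
  have \<theta>lap0: "laplacian \<theta> x = 0" if "x \<in> ball a (r/2)" for x
    using C2_on_cong(3)[OF open_ball C2_on_const(1), of a "r/2" 1 \<theta> x] \<theta>(2) that by (simp add: C2_on_const)
  have \<theta>lap1: "laplacian \<theta> x = 0" if "x \<notin> D" for x
    by (rule C2_on_extend_zero(3)[OF open_UNIV \<theta>(1), of "cball a r"]) (use \<theta>(3) r(4) that in auto)
  \<comment> \<open>Since \<open>\<Delta>f\<close> vanishes at the points of \<open>D\<close> with \<open>\<theta> \<noteq> 1\<close>, \<open>F\<close> is \<open>\<Delta>f\<close> extended by zero outside \<open>D\<close>.\<close>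
  define F where "F x = \<theta> x * laplacian f x" for x
  have F_eq: "F x = laplacian f x" if "x \<in> D" for x
    using flap0[OF that] \<theta>(2)[of x] by (cases "r / 2 \<le> dist x a") (auto simp: F_def dist_commute)
  have F_out: "F x = 0" if "x \<notin> cball a r" for x using \<theta>(3)[of x] that by (simp add: F_def)
  have F_cont: "continuous_on UNIV F"
  proof (rule continuous_on_extend_zero[OF D _ compact_cball r(4) F_out])
    show "continuous_on D F"
      unfolding F_def using C2_on_continuous_laplacian[OF fC] continuous_on_subset[OF C2_on_continuous[OF \<theta>(1)]]
      by (intro continuous_intros) auto
  qed
  have F_nonpos: "F x \<le> 0" for x
  proof (cases "x \<in> D")
    case False
    then have "x \<notin> cball a r" using r(4) by blast
    then show ?thesis by (simp add: F_out)
  qed (simp add: F_eq flap)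
  \<comment> \<open>Green's identity moves the Laplacian from \<open>f\<close> to \<open>\<theta>\<close>; where \<open>\<Delta>\<theta>\<close> does not vanish, \<open>f\<close> and \<open>u\<close> agree.\<close>
  have F_int: "(LINT x|lborel. F x) = - 1"
  proof -
    have "(LINT x|lborel. F x) = (LINT x|lborel. f x * laplacian \<theta> x)"
      unfolding F_def by (rule integral_laplacian_symmetric[OF D fC \<theta>test, symmetric])
    also have "(\<lambda>x. f x * laplacian \<theta> x) = (\<lambda>x. u x * laplacian \<theta> x)"
    proof
      fix x show "f x * laplacian \<theta> x = u x * laplacian \<theta> x"
        using \<theta>lap0[of x] \<theta>lap1[of x] f_far[of x]
        by (cases "x \<in> D"; cases "x \<in> ball a (r/2)") (auto simp: dist_commute)
    qed
    also have "(LINT x|lborel. u x * laplacian \<theta> x) = - 1 * \<theta> a"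
      using gu(1) \<theta>test unfolding weak_pole_def by blast
    finally show ?thesis using \<theta>(2)[of a] r by simp
  qed
  define \<delta> where "\<delta> = min \<eta> 1 / 2"
  have \<delta>: "\<delta> > 0" "2 * \<delta> \<le> \<eta>" "\<delta> < 1" using \<eta> by (auto simp: \<delta>_def)
  define flat where "flat t = \<delta> * ramp (t / \<delta> - 1)" for t
  have aff: "((\<lambda>t. t / \<delta> - 1) has_real_derivative 1 / \<delta>) (at t)" for t
    using \<delta> by (auto intro!: derivative_eq_intros)
  have flat1: "(flat has_real_derivative ramp' (t / \<delta> - 1)) (at t)" for t
    using DERIV_cmult[OF DERIV_chain2[OF ramp_derivatives(1) aff[of t]], of \<delta>] \<delta>
    by (simp add: flat_def[abs_def])
  have flat2: "((\<lambda>t. ramp' (t / \<delta> - 1)) has_real_derivative ramp'' (t / \<delta> - 1) * (1 / \<delta>)) (at t)" for t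
    by (rule DERIV_chain2[OF ramp_derivatives(2) aff])
  have flat2c: "continuous_on A (\<lambda>t. ramp'' (t / \<delta> - 1) * (1 / \<delta>))" for A
    by (intro continuous_intros continuous_on_compose2[OF ramp_derivatives(3)[of UNIV]]) (use \<delta> in auto)
  note fl = C2_on_compose[OF D fC, of flat "\<lambda>t. ramp' (t / \<delta> - 1)" "\<lambda>t. ramp'' (t / \<delta> - 1) * (1 / \<delta>)",
      OF flat1 flat2 flat2c]
  define \<phi> where "\<phi> x = (if x \<in> D then flat (f x) else 0)" for x
  have eq\<phi>: "flat (f x) = \<phi> x" if "x \<in> D" for x using that by (simp add: \<phi>_def)
  note c\<phi> = C2_on_cong[OF D fl(1), of \<phi>, OF eq\<phi>]
  define K where "K = {x \<in> D. \<delta> \<le> f x}"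
  have f_le: "f x \<le> u x" if "x \<noteq> a" for x
    using that ramp_bounds(1) by (simp add: f_def cap_def)
  have K: "compact K"
    unfolding K_def
  proof (rule superlevel_set_compact[OF D C2_on_continuous[OF fC]])
    have ft: "\<forall>\<^sub>F x in A. f x < \<delta>" if t: "(u \<longlongrightarrow> 0) A" and na: "\<forall>\<^sub>F x in A. x \<noteq> a" for A
      using order_tendstoD(2)[OF t \<delta>(1)] na by eventually_elim (use f_le in fastforce)
    show "\<forall>\<^sub>F x in at z within D. f x < \<delta>" if z: "z \<in> frontier D" for z
    proof (rule ft[OF gu(3)[OF z]])
      have "z \<noteq> a" using z a D by (auto simp: frontier_def interior_open)
      then show "\<forall>\<^sub>F x in at z within D. x \<noteq> a"
        by (rule tendsto_imp_eventually_ne[OF tendsto_ident_at])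
    qed
    show "\<forall>\<^sub>F x in inf at_infinity (principal D). f x < \<delta>"
    proof (rule ft[OF gu(4)])
      have "\<forall>\<^sub>F x in at_infinity. x \<noteq> a"
        unfolding eventually_at_infinity by (intro exI[of _ "norm a + 1"]) auto
      then show "\<forall>\<^sub>F x in inf at_infinity (principal D). x \<noteq> a"
        by (rule filter_leD[rotated]) simp
    qed
  qed
  have \<phi>0: "\<phi> x = 0" if "x \<notin> K" for x
    using that \<delta> by (auto simp: K_def \<phi>_def flat_def ramp_simps field_simps)
  have \<phi>test: "C2_test D \<phi>"
    by (rule C2_test_extend[OF D c\<phi>(1) K _ _ \<phi>0]) (auto simp: K_def)
  obtain K' where \<phi>C: "C2_on UNIV \<phi>" and K': "compact K'" "K' \<subseteq> D" and \<phi>lap0: "\<And>x. x \<notin> K' \<Longrightarrow> laplacian \<phi> x = 0"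
    using \<phi>test by (rule C2_testE) blast
  have \<phi>F: "F x \<le> laplacian \<phi> x" for x
  proof (cases "x \<in> D")
    case True
    have "laplacian \<phi> x = ramp' (f x / \<delta> - 1) * laplacian f x
        + ramp'' (f x / \<delta> - 1) * (1 / \<delta>) * (norm (gradient f x))\<^sup>2"
      using c\<phi>(3)[of x] fl(3)[of x] True by simp
    moreover have "0 \<le> ramp'' (f x / \<delta> - 1) * (1 / \<delta>) * (norm (gradient f x))\<^sup>2"
      using \<delta> ramp''_nonneg by simp
    moreover have "laplacian f x \<le> ramp' (f x / \<delta> - 1) * laplacian f x"
      using mult_right_mono_neg[OF ramp'_bounds(2)[of "f x / \<delta> - 1"] flap[OF True]] by simp
    ultimately show ?thesis using F_eq[OF True] by linarith
  next
    case False
    then have "laplacian \<phi> x = 0" using \<phi>lap0 K' by blast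
    then show ?thesis using F_nonpos by simp
  qed
  have vK: "set_integrable lborel A v" if "compact A" "A \<subseteq> D" for A
    using gv(1) that unfolding weak_pole_def by blast
  have i1: "integrable lborel (\<lambda>x. v x * laplacian \<phi> x)"
    by (rule integrable_mult_compact_support[OF K'(1) vK[OF K'] C2_on_continuous_laplacian[OF \<phi>C] \<phi>lap0])
  have i2: "integrable lborel F"
    by (rule integrable_compact_support[OF compact_cball continuous_on_subset[OF F_cont] F_out]) auto
  have "AE x in lborel. (v a + \<eta>) * F x \<le> v x * laplacian \<phi> x"
    using AE_lborel_singleton[of b]
  proof eventually_elim
    case (elim x)
    have "(v a + \<eta>) * F x \<le> v x * F x"
    proof (cases "x \<in> cball a r")
      case True
      then show ?thesis using mult_right_mono_neg[OF vr[OF True] F_nonpos[of x]] by simp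
    qed (simp add: F_out)
    also have "\<dots> \<le> v x * laplacian \<phi> x"
    proof (cases "x \<in> D")
      case True
      show ?thesis by (rule mult_left_mono[OF \<phi>F v0[OF True elim]])
    next
      case False
      then have "F x = 0" "laplacian \<phi> x = 0" using F_out r(4) \<phi>lap0 K' by blast+
      then show ?thesis by simp
    qed
    finally show ?case .
  qed
  then have "(LINT x|lborel. (v a + \<eta>) * F x) \<le> (LINT x|lborel. v x * laplacian \<phi> x)"
    by (intro integral_mono_AE) (use i1 i2 in auto)
  moreover have "(LINT x|lborel. v x * laplacian \<phi> x) = - 1 * \<phi> b"
    using gv(1) \<phi>test unfolding weak_pole_def by blast
  ultimately have 1: "\<phi> b \<le> v a + \<eta>" using F_int by simp
  have "f b = u b" by (rule f_far) (use b r in \<open>auto simp: dist_commute\<close>)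
  moreover have "u b - 2 * \<delta> \<le> flat (u b)"
  proof -
    have "\<delta> * (u b / \<delta> - 1 - 1) = u b - 2 * \<delta>" using \<delta> by (simp add: right_diff_distrib)
    then show ?thesis
      using mult_left_mono[OF ramp_bounds(2)[of "u b / \<delta> - 1"], of \<delta>] \<delta> by (simp add: flat_def)
  qed
  ultimately have "u b - 2 * \<delta> \<le> \<phi> b" using b by (simp add: \<phi>_def)
  then show "G b a \<le> G a b + \<eta>0" using 1 \<delta>(2) by (simp add: u_def v_def \<eta>_def)
qed

theorem green_function_symmetric:
  fixes D :: "'a::euclidean_space set"
  assumes "DIM('a) > 2" "open D" "green_function D G" "a \<in> D" "b \<in> D" "a \<noteq> b"
  shows "G a b = G b a"
  using green_function_le_symmetric[OF assms] green_function_le_symmetric[OF assms(1-3) assms(5,4)] assms(6)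
  by (metis order_antisym)

section \<open>Capacitary potentials\<close>

lemma frontier_complement_closure: "frontier (- closure S) \<subseteq> frontier S"
  using interior_mono[OF closure_subset, of S]
  by (auto simp: frontier_def closure_complement interior_complement)

text \<open>All bounds are instances of the maximum principle. The last one holds because \<open>|x|^(2-n)\<close> is
  harmonic outside the origin and at least \<open>1\<close> on \<open>\<partial>\<omega>\<close>.\<close>
lemma capacitary_potential_bounds:
  fixes \<omega> :: "'a::euclidean_space set"
  assumes dim: "DIM('a) > 2" and P: "capacitary_potential \<omega> P"
    and unit: "frontier \<omega> \<subseteq> cball 0 1" and zero: "0 \<in> interior (closure \<omega>)" and x: "x \<notin> closure \<omega>"
  shows "0 \<le> P x" "P x \<le> 1" "P x \<le> 1 / norm x ^ (DIM('a) - 2)"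
proof -
  let ?D = "- closure \<omega>"
  have D: "open ?D" by auto
  have h: "harmonic_in ?D P" and b: "\<And>z. z \<in> frontier \<omega> \<Longrightarrow> (P \<longlongrightarrow> 1) (at z within ?D)"
    and i: "(P \<longlongrightarrow> 0) at_infinity"
    using P unfolding capacitary_potential_def by auto
  have i': "(P \<longlongrightarrow> 0) (inf at_infinity (principal ?D))"
    by (rule tendsto_mono[OF _ i]) simp
  have fr: "frontier ?D \<subseteq> frontier \<omega>"
    by (rule frontier_complement_closure)
  have C: "C2_on ?D P" "\<And>x. x \<in> ?D \<Longrightarrow> laplacian P x = 0" using h unfolding harmonic_in_def by auto
  show "P x \<le> 1"
  proof (rule maximum_principle[OF D C(1)])
    show "\<forall>\<^sub>F x in at z within ?D. P x \<le> 1 + e" if "z \<in> frontier ?D" "0 < e" for z e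
      using b[of z] fr that by (intro eventually_le_add[of _ 1]) auto
    show "\<forall>\<^sub>F x in inf at_infinity (principal ?D). P x \<le> 1 + e" if "0 < e" for e
      by (rule eventually_le_add[OF i' _ that]) simp
  qed (use x C(2) in auto)
  have h': "harmonic_in ?D (\<lambda>x. - P x)" using harmonic_in_cmult[OF D h, of "-1"] by simp
  have "- P x \<le> 0"
  proof (rule maximum_principle[OF D])
    show "C2_on ?D (\<lambda>x. - P x)" "\<And>x. x \<in> ?D \<Longrightarrow> 0 \<le> laplacian (\<lambda>x. - P x) x"
      using h' unfolding harmonic_in_def by auto
    show "\<forall>\<^sub>F x in at z within ?D. - P x \<le> 0 + e" if "z \<in> frontier ?D" "0 < e" for z e
      using tendsto_minus[OF b[of z]] fr that by (intro eventually_le_add[of _ "-1"]) auto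
    show "\<forall>\<^sub>F x in inf at_infinity (principal ?D). - P x \<le> 0 + e" if "0 < e" for e
      using tendsto_minus[OF i'] that by (intro eventually_le_add[of _ 0]) auto
  qed (use x in auto)
  then show "0 \<le> P x" by simp
  define q where "q = 1 / fund_coeff DIM('a)"
  have q: "q > 0" using fund_coeff_pos[OF dim] by (simp add: q_def)
  have qF: "q * fundamental_solution w = 1 / norm w ^ (DIM('a) - 2)" for w :: 'a
    using fund_coeff_pos[OF dim] by (simp add: q_def fundamental_solution_eq)
  have F0: "0 \<le> fundamental_solution w" for w :: 'a by (rule fundamental_solution_nonneg[OF dim])
  have h2: "harmonic_in ?D (\<lambda>x. P x - q * fundamental_solution (x - 0))"
    by (intro harmonic_in_diff D h harmonic_in_cmult fundamental_solution_harmonic_in dim)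
      (use zero interior_subset in auto)
  have "P x - q * fundamental_solution (x - 0) \<le> 0"
  proof (rule maximum_principle[OF D, where u = "\<lambda>x. P x - q * fundamental_solution (x - 0)"])
    show "C2_on ?D (\<lambda>x. P x - q * fundamental_solution (x - 0))"
      "\<And>x. x \<in> ?D \<Longrightarrow> 0 \<le> laplacian (\<lambda>x. P x - q * fundamental_solution (x - 0)) x"
      using h2 unfolding harmonic_in_def by auto
    show "\<forall>\<^sub>F x in at z within ?D. P x - q * fundamental_solution (x - 0) \<le> 0 + e"
      if z: "z \<in> frontier ?D" and e: "0 < e" for z e
    proof -
      have zf: "z \<in> frontier \<omega>" using z fr by blast
      have z0: "z \<noteq> 0" using z zero by (auto simp: frontier_def closure_complement)
      then have "continuous (at z) (\<lambda>x. fundamental_solution (x - 0))"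
        by (intro harmonic_in_isCont[of "- {0}"] fundamental_solution_harmonic_in dim) auto
      then have "((\<lambda>x. fundamental_solution (x - 0)) \<longlongrightarrow> fundamental_solution (z - 0)) (at z within ?D)"
        unfolding continuous_at by (rule tendsto_mono[OF at_le, rotated]) auto
      then have "((\<lambda>x. P x - q * fundamental_solution (x - 0)) \<longlongrightarrow> 1 - q * fundamental_solution (z - 0)) (at z within ?D)"
        by (intro tendsto_intros b zf)
      moreover have "1 - q * fundamental_solution (z - 0) \<le> 0"
      proof -
        have "norm z \<le> 1" using zf unit by auto
        then have "norm z ^ (DIM('a) - 2) \<le> 1" by (intro power_le_one) auto
        then show ?thesis using z0 by (simp add: qF field_simps)
      qed
      ultimately show ?thesis using e by (rule eventually_le_add)
    qed
    show "\<forall>\<^sub>F x in inf at_infinity (principal ?D). P x - q * fundamental_solution (x - 0) \<le> 0 + e" if "0 < e" for e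
      using eventually_le_add[OF i' order_refl that]
      by eventually_elim (use mult_nonneg_nonneg[OF less_imp_le[OF q] F0] in \<open>smt (verit) diff_zero\<close>)
  qed (use x in auto)
  then show "P x \<le> 1 / norm x ^ (DIM('a) - 2)" using qF[of x] by simp
qed

text \<open>As a function of \<open>\<eta>\<close>, which is where the symmetry of \<open>g\<close> enters, the regular part of
  \<open>g(\<xi>,\<cdot>)\<close> is harmonic with boundary values \<open>F(\<xi> - \<eta>) = F(\<xi>) + O(|\<xi>|^(1-n))\<close>. The comparison function
  is \<open>P\<close> itself, and so the error carries a factor \<open>P \<eta>\<close>.\<close>
theorem exterior_green_function_far:
  fixes \<omega> :: "'a::euclidean_space set"
  assumes dim: "DIM('a) > 2" and P: "capacitary_potential \<omega> P" and g: "green_function (- closure \<omega>) g"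
    and unit: "frontier \<omega> \<subseteq> cball 0 1" and zero: "0 \<in> interior (closure \<omega>)"
    and \<xi>: "\<xi> \<notin> closure \<omega>" "2 \<le> norm \<xi>" and \<eta>: "\<eta> \<notin> closure \<omega>" "\<eta> \<noteq> \<xi>"
  shows "\<bar>fundamental_solution (\<xi> - \<eta>) - g \<xi> \<eta> - fundamental_solution \<xi> * P \<eta>\<bar>
    \<le> (real DIM('a) - 2) * fund_coeff DIM('a) * 2 ^ (DIM('a) - 1) / norm \<xi> ^ (DIM('a) - 1) * P \<eta>"
proof -
  let ?D = "- closure \<omega>"
  let ?F = "fundamental_solution :: 'a \<Rightarrow> real"
  define k where "k = (real DIM('a) - 2) * fund_coeff DIM('a) * 2 ^ (DIM('a) - 1) / norm \<xi> ^ (DIM('a) - 1)"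
  have D: "open ?D" by auto
  have \<xi>D: "\<xi> \<in> ?D" using \<xi> by simp
  have o: "open (?D - {\<xi>})" using D by (simp add: open_delete)
  have h: "harmonic_in ?D P" and b: "\<And>z. z \<in> frontier \<omega> \<Longrightarrow> (P \<longlongrightarrow> 1) (at z within ?D)"
    and i: "(P \<longlongrightarrow> 0) at_infinity"
    using P unfolding capacitary_potential_def by auto
  have i': "(P \<longlongrightarrow> 0) (inf at_infinity (principal ?D))" by (rule tendsto_mono[OF _ i]) simp
  have fr: "frontier ?D \<subseteq> frontier \<omega>"
    by (rule frontier_complement_closure)
  note gg = green_functionD[OF g \<xi>D D]
  obtain B where B: "\<forall>\<^sub>F x in at \<xi>. \<bar>g x \<xi> - ?F (x - \<xi>)\<bar> \<le> B"
    using green_function_near_pole[OF dim D g \<xi>D] by blast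
  have B': "\<forall>\<^sub>F x in at \<xi> within ?D. \<bar>g x \<xi> - ?F (x - \<xi>)\<bar> \<le> B"
    by (rule filter_leD[OF _ B]) (intro at_le subset_UNIV)
  have Pb: "0 \<le> P x" "P x \<le> 1" if "x \<in> ?D" for x
    using capacitary_potential_bounds[OF dim P unit zero] that by auto
  have inf0: "((\<lambda>x. ?F (x - \<xi>)) \<longlongrightarrow> 0) (inf at_infinity (principal ?D))"
  proof -
    have "filterlim (\<lambda>x. x - \<xi>) at_infinity at_infinity"
      using tendsto_add_filterlim_at_infinity[OF tendsto_const[of "-\<xi>"] filterlim_ident] by (simp add: add.commute)
    from filterlim_compose[OF fundamental_solution_at_infinity[OF dim] this]
    show ?thesis by (rule tendsto_mono[rotated]) simp
  qed
  have near: "\<bar>?F (z - \<xi>) - ?F \<xi>\<bar> \<le> k" if z: "norm z \<le> 1" for z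
  proof -
    have "\<bar>?F (\<xi> - z) - ?F \<xi>\<bar> \<le> (real DIM('a) - 2) * fund_coeff DIM('a) / (norm \<xi> / 2) ^ (DIM('a) - 1) * norm ((\<xi> - z) - \<xi>)"
    proof (rule fundamental_solution_lipschitz[OF dim])
      show "norm \<xi> / 2 > 0" using \<xi>(2) by linarith
      fix w assume "w \<in> closed_segment (\<xi> - z) \<xi>"
      then have "w \<in> closed_segment \<xi> (\<xi> - z)" by (simp add: closed_segment_commute)
      then have "norm (w - \<xi>) \<le> norm ((\<xi> - z) - \<xi>)" by (rule segment_bound1)
      then have "norm (w - \<xi>) \<le> 1" using z by simp
      then show "norm \<xi> / 2 \<le> norm w" using norm_triangle_ineq2[of \<xi> "\<xi> - w"] \<xi>(2) by (simp add: norm_minus_commute)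
    qed
    also have "\<dots> = k * norm z" using \<xi>(2) by (simp add: k_def power_divide)
    also have "\<dots> \<le> k * 1" using z dim fund_coeff_pos[OF dim] by (intro mult_left_mono) (auto simp: k_def)
    finally show ?thesis using fundamental_solution_minus[of "z - \<xi>"] by simp
  qed
  have main: "s * (?F (\<eta> - \<xi>) - g \<eta> \<xi> - ?F \<xi> * P \<eta>) - k * P \<eta> \<le> 0" if s: "s = 1 \<or> s = -1" for s :: real
  proof (rule maximum_principle_pole[OF dim D, where y = \<xi>
        and u = "\<lambda>\<eta>. s * (?F (\<eta> - \<xi>) - g \<eta> \<xi> - ?F \<xi> * P \<eta>) - k * P \<eta>"])
    show "harmonic_in (?D - {\<xi>}) (\<lambda>\<eta>. s * (?F (\<eta> - \<xi>) - g \<eta> \<xi> - ?F \<xi> * P \<eta>) - k * P \<eta>)"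
      by (intro harmonic_in_diff o harmonic_in_cmult gg(2) fundamental_solution_harmonic_in dim
          harmonic_in_subset[OF h]) auto
    show "\<forall>\<^sub>F \<eta> in at z within ?D. s * (?F (\<eta> - \<xi>) - g \<eta> \<xi> - ?F \<xi> * P \<eta>) - k * P \<eta> \<le> 0 + e"
      if z: "z \<in> frontier ?D" and e: "0 < e" for z e
    proof -
      have zf: "z \<in> frontier \<omega>" using z fr by blast
      then have z1: "norm z \<le> 1" using unit by auto
      then have "z \<noteq> \<xi>" using \<xi> by auto
      then have "continuous (at z) (\<lambda>x. ?F (x - \<xi>))"
        by (intro harmonic_in_isCont[of "- {\<xi>}"] fundamental_solution_harmonic_in dim) auto
      then have "((\<lambda>x. ?F (x - \<xi>)) \<longlongrightarrow> ?F (z - \<xi>)) (at z within ?D)"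
        unfolding continuous_at by (rule tendsto_mono[OF at_le, rotated]) auto
      then have "((\<lambda>\<eta>. s * (?F (\<eta> - \<xi>) - g \<eta> \<xi> - ?F \<xi> * P \<eta>) - k * P \<eta>) \<longlongrightarrow>
          s * (?F (z - \<xi>) - 0 - ?F \<xi> * 1) - k * 1) (at z within ?D)"
        by (intro tendsto_intros b zf gg(3) z)
      moreover have "s * (?F (z - \<xi>) - 0 - ?F \<xi> * 1) - k * 1 \<le> 0"
        using near[OF z1] s by auto
      ultimately show ?thesis using e by (rule eventually_le_add)
    qed
    show "\<forall>\<^sub>F \<eta> in inf at_infinity (principal ?D). s * (?F (\<eta> - \<xi>) - g \<eta> \<xi> - ?F \<xi> * P \<eta>) - k * P \<eta> \<le> 0 + e"
      if e: "0 < e" for e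
    proof -
      have "((\<lambda>\<eta>. s * (?F (\<eta> - \<xi>) - g \<eta> \<xi> - ?F \<xi> * P \<eta>) - k * P \<eta>) \<longlongrightarrow>
          s * (0 - 0 - ?F \<xi> * 0) - k * 0) (inf at_infinity (principal ?D))"
        by (intro tendsto_intros inf0 gg(4) i')
      then show ?thesis using e by (intro eventually_le_add) auto
    qed
    have k0: "k \<ge> 0" using dim fund_coeff_pos[OF dim] by (simp add: k_def)
    have "\<forall>\<^sub>F x in at \<xi> within ?D. x \<in> ?D" by (simp add: eventually_at_filter)
    then show "\<forall>\<^sub>F \<eta> in at \<xi> within ?D. s * (?F (\<eta> - \<xi>) - g \<eta> \<xi> - ?F \<xi> * P \<eta>) - k * P \<eta> \<le> B + ?F \<xi>"
      using B'
    proof eventually_elim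
      case (elim x)
      have "0 \<le> ?F \<xi> * P x" "?F \<xi> * P x \<le> ?F \<xi>"
        using Pb[OF elim(1)] fundamental_solution_nonneg[OF dim, of \<xi>] mult_left_le[of "P x" "?F \<xi>"] by auto
      moreover have "0 \<le> k * P x" using Pb[OF elim(1)] k0 by simp
      ultimately show ?case using elim(2) s by auto
    qed
  qed (use \<eta> in auto)
  have "g \<xi> \<eta> = g \<eta> \<xi>"
    by (rule green_function_symmetric[OF dim D g]) (use \<xi> \<eta> in auto)
  moreover have "?F (\<xi> - \<eta>) = ?F (\<eta> - \<xi>)" using fundamental_solution_minus[of "\<xi> - \<eta>"] by simp
  ultimately show ?thesis using main[of 1] main[of "-1"] unfolding k_def[symmetric] by (simp add: abs_le_iff)
qed

section \<open>Behaviour of potentials at infinity, and the capacity\<close>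

lemma annulus_cutoff_zero:
  fixes \<theta> :: "'a::euclidean_space \<Rightarrow> real"
  assumes \<theta>: "C2_on UNIV \<theta>" "\<And>z. z \<in> cball 0 a \<Longrightarrow> \<theta> z = 1" "\<And>z. z \<notin> ball 0 b \<Longrightarrow> \<theta> z = 0"
    and z: "z \<notin> cball 0 b - ball 0 a"
  shows "gradient \<theta> z = 0" "laplacian \<theta> z = 0"
proof -
  have "gradient \<theta> z = 0 \<and> laplacian \<theta> z = 0"
  proof (cases "z \<in> ball 0 a")
    case True
    then show ?thesis
      using C2_on_cong(2,3)[OF open_ball C2_on_const(1), of 0 a 1 \<theta> z] \<theta>(2) by (simp add: C2_on_const)
  next
    case False
    have "z \<notin> cball 0 b" using False z by simp
    moreover have "\<theta> x = 0" if "x \<notin> cball 0 b" for x using \<theta>(3)[of x] that by auto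
    ultimately show ?thesis
      using C2_on_extend_zero(2,3)[OF open_UNIV \<theta>(1) closed_cball[of 0 b]] by blast
  qed
  then show "gradient \<theta> z = 0" "laplacian \<theta> z = 0" by auto
qed

text \<open>Represent \<open>u\<close> with a cutoff that is one on a large annulus. The outer boundary layer contributes
  a quantity that is scale invariant in \<open>R\<close> times the size of \<open>u\<close> there, so it disappears as
  \<open>R \<rightarrow> \<infinity>\<close>; expanding the kernel of the inner layer at infinity gives the leading coefficient.\<close>
theorem harmonic_expansion_at_infinity:
  fixes u :: "'a::euclidean_space \<Rightarrow> real"
  assumes dim: "DIM('a) > 2" and u: "harmonic_in (- cball 0 1) u" and lim: "(u \<longlongrightarrow> 0) at_infinity"
    and \<theta>: "C2_on UNIV \<theta>" "\<And>z. z \<in> cball 0 2 \<Longrightarrow> \<theta> z = 1" "\<And>z. z \<notin> ball 0 3 \<Longrightarrow> \<theta> z = 0"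
  shows "\<exists>C\<ge>0. \<forall>x. 6 \<le> norm x \<longrightarrow>
    \<bar>u x + (LINT z|lborel. u z * laplacian \<theta> z) * fundamental_solution x\<bar> \<le> C / norm x ^ (DIM('a) - 1)"
proof -
  let ?F = "fundamental_solution :: 'a \<Rightarrow> real"
  let ?U = "- cball (0::'a) 1"
  let ?A = "cball (0::'a) 3 - ball 0 2"
  define n where "n = DIM('a)"
  define k1 where "k1 = (real n - 2) * fund_coeff n"
  have n2: "n > 2" using dim by (simp add: n_def)
  have k1: "k1 > 0" using fund_coeff_pos[of n] n2 by (simp add: k1_def)
  have k0: "fund_coeff n > 0" using fund_coeff_pos[OF n2] .
  have U: "open ?U" by auto
  have uc: "continuous_on ?U u" by (rule harmonic_in_continuous[OF u])
  have A: "compact ?A" "?A \<subseteq> ?U" by (auto simp: compact_diff)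
  have z\<theta>: "gradient \<theta> z = 0" "laplacian \<theta> z = 0" if "z \<notin> ?A" for z
    using annulus_cutoff_zero[of \<theta> 2 3 z] \<theta> that by auto
  have "bounded (gradient \<theta> ` ?A)" "bounded (laplacian \<theta> ` ?A)" "bounded (u ` ?A)"
    using C2_on_continuous_gradient[OF \<theta>(1)] C2_on_continuous_laplacian[OF \<theta>(1)] uc A
    by (auto intro!: compact_imp_bounded compact_continuous_image intro: continuous_on_subset)
  then obtain M1 M2 Mu where "\<forall>w\<in>gradient \<theta> ` ?A. norm w \<le> M1"
    "\<forall>w\<in>laplacian \<theta> ` ?A. norm w \<le> M2" "\<forall>w\<in>u ` ?A. norm w \<le> Mu"
    unfolding bounded_iff by blast
  then have M012: "\<And>z. z \<in> ?A \<Longrightarrow> norm (gradient \<theta> z) \<le> M1" "\<And>z. z \<in> ?A \<Longrightarrow> \<bar>laplacian \<theta> z\<bar> \<le> M2"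
    "\<And>z. z \<in> ?A \<Longrightarrow> \<bar>u z\<bar> \<le> Mu" by auto
  define M where "M = max 0 (max M1 (max M2 Mu))"
  have M: "M \<ge> 0" "\<And>z. norm (gradient \<theta> z) \<le> M" "\<And>z. \<bar>laplacian \<theta> z\<bar> \<le> M" "\<And>z. z \<in> ?A \<Longrightarrow> \<bar>u z\<bar> \<le> M"
  proof -
    show "M \<ge> 0" by (simp add: M_def)
    show "norm (gradient \<theta> z) \<le> M" for z
      using M012(1)[of z] z\<theta>(1)[of z] by (cases "z \<in> ?A") (auto simp: M_def)
    show "\<bar>laplacian \<theta> z\<bar> \<le> M" for z
      using M012(2)[of z] z\<theta>(2)[of z] by (cases "z \<in> ?A") (auto simp: M_def)
    show "z \<in> ?A \<Longrightarrow> \<bar>u z\<bar> \<le> M" for z using M012(3)[of z] by (auto simp: M_def)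
  qed
  have Fb: "?F w \<le> fund_coeff n / r ^ (n - 2)" "norm (gradient (\<lambda>z. ?F (z - x)) (w + x)) \<le> k1 / r ^ (n - 1)"
    if "r > 0" "norm w \<ge> r" for r w x
  proof -
    have w: "norm w > 0" "w + x \<noteq> x" using that by auto
    show "?F w \<le> fund_coeff n / r ^ (n - 2)"
      unfolding fundamental_solution_eq n_def[symmetric] using that w k0
      by (intro divide_left_mono power_mono mult_pos_pos zero_less_power) auto
    have "k1 / norm w ^ (n - 1) \<le> k1 / r ^ (n - 1)"
      using that w k1 by (intro divide_left_mono power_mono mult_pos_pos zero_less_power) auto
    then show "norm (gradient (\<lambda>z. ?F (z - x)) (w + x)) \<le> k1 / r ^ (n - 1)"
      using norm_gradient_fundamental_solution[OF dim w(2)] by (simp add: n_def k1_def)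
  qed
  have F0: "0 \<le> ?F w" for w by (rule fundamental_solution_nonneg[OF dim])
  define \<theta>R where "\<theta>R R z = \<theta> ((1 / R) *\<^sub>R (z - 0))" for R z
  have scaled: "C2_on UNIV (\<theta>R R)" "gradient (\<theta>R R) z = (1 / R) *\<^sub>R gradient \<theta> ((1 / R) *\<^sub>R z)"
    "laplacian (\<theta>R R) z = (1 / R)\<^sup>2 * laplacian \<theta> ((1 / R) *\<^sub>R z)" for R z
    using C2_on_scale_shift[OF open_UNIV \<theta>(1), where r = "1 / R" and a = 0] unfolding \<theta>R_def by simp_all
  have \<theta>R1: "\<theta>R R z = 1" if "R > 0" "z \<in> cball 0 (2 * R)" for R z
    using that unfolding \<theta>R_def by (intro \<theta>(2)) (simp add: field_simps)
  have \<theta>R0: "\<theta>R R z = 0" if "R > 0" "z \<notin> ball 0 (3 * R)" for R z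
    using that unfolding \<theta>R_def by (intro \<theta>(3)) (simp add: field_simps)
  define I where "I x = (LINT z|lborel. u z * repr_kernel \<theta> x z)" for x
  have uA: "set_integrable lborel S u" if "compact S" "S \<subseteq> ?U" for S
    unfolding set_integrable_def using that uc
    by (intro borel_integrable_compact) (auto intro: continuous_on_subset)
  have Icont: "integrable lborel (\<lambda>z. u z * repr_kernel \<theta> x z)" if x: "3 < norm x" for x
  proof (rule integrable_mult_compact_support[OF A(1) uA[OF A]])
    show "continuous_on UNIV (repr_kernel \<theta> x)"
    proof (rule repr_kernel_continuous(1)[OF dim \<theta>(1), of "norm x - 3" x 0])
      show "\<theta> z = 0" if "z \<in> ball x (norm x - 3)" for z
        using that norm_triangle_ineq2[of x z] by (intro \<theta>(3)) (auto simp: dist_norm)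
    qed (use x in auto)
    show "repr_kernel \<theta> x z = 0" if "z \<notin> ?A" for z by (intro repr_kernel_zero z\<theta> that)
  qed
  define V where "V = unit_ball_vol (real n)"
  define C0 where "C0 = (2 * M * k1 + M * fund_coeff n) * (V * 3 ^ n)"
  have C0: "C0 \<ge> 0" using M(1) k1 k0 by (simp add: C0_def V_def)
  \<comment> \<open>The cutoff \<open>\<zeta> = \<theta>R - \<theta>\<close> is one between the two layers; \<open>I\<close> is the contribution of the inner one. On the outer
    layer \<open>|u| \<le> s\<close>, the kernel is of order \<open>R^(-n)\<close>, and the volume is of order \<open>R^n\<close>.\<close>
  have outer: "\<bar>u x + I x\<bar> \<le> s * C0"
    if x: "3 < norm x" and s: "s > 0" for x s
  proof -
    have "\<forall>\<^sub>F z in at_infinity. \<bar>u z\<bar> < s"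
      using tendstoD[OF lim s] by (simp add: dist_real_def)
    then obtain B where B: "\<And>z. B \<le> norm z \<Longrightarrow> \<bar>u z\<bar> < s" unfolding eventually_at_infinity by blast
    define R where "R = max B (norm x)"
    have R: "R > 3" "norm x \<le> R" "B \<le> R" using x by (auto simp: R_def)
    have R0: "R > 0" using R by linarith
    let ?AR = "cball (0::'a) (3 * R) - ball 0 (2 * R)"
    have AR: "compact ?AR" "?AR \<subseteq> ?U" using R by (auto simp: compact_diff)
    have zR: "gradient (\<theta>R R) z = 0" "laplacian (\<theta>R R) z = 0" if "z \<notin> ?AR" for z
      using annulus_cutoff_zero[of "\<theta>R R" "2 * R" "3 * R" z] scaled(1) \<theta>R1[OF R0] \<theta>R0[OF R0] that by auto
    define \<zeta> where "\<zeta> z = \<theta>R R z + (-1) * \<theta> z" for z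
    note m = C2_on_cmult[OF open_UNIV \<theta>(1), where c = "-1"]
    note ad = C2_on_add[OF open_UNIV scaled(1)[of R] m(1)]
    have \<zeta>test: "C2_test ?U \<zeta>"
      unfolding C2_test_def
    proof (intro conjI exI[of _ "cball 0 (3 * R) - ball 0 2"] allI impI)
      show "C2_on UNIV \<zeta>" unfolding \<zeta>_def by (rule ad(1))
      show "\<zeta> z = 0" if "z \<notin> cball 0 (3 * R) - ball 0 2" for z
      proof (cases "z \<in> ball 0 2")
        case True
        then have "norm z \<le> 2 * R" using R by auto
        then show ?thesis using \<theta>(2)[of z] \<theta>R1[OF R0, of z] True by (simp add: \<zeta>_def)
      next
        case False
        then have "norm z > 3 * R" using that by auto
        then show ?thesis using \<theta>(3)[of z] \<theta>R0[OF R0, of z] R by (simp add: \<zeta>_def)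
      qed
    qed (auto simp: compact_diff)
    have kadd: "repr_kernel \<zeta> x z = repr_kernel (\<theta>R R) x z - repr_kernel \<theta> x z" for z
    proof -
      have e: "gradient \<zeta> z = gradient (\<theta>R R) z - gradient \<theta> z" "laplacian \<zeta> z = laplacian (\<theta>R R) z - laplacian \<theta> z"
        using ad(2,3)[of z] m(2,3)[of z] unfolding \<zeta>_def by simp_all
      show ?thesis
        unfolding repr_kernel_def e by (simp add: inner_diff_left algebra_simps)
    qed
    define r where "r = min (norm x - 3) R"
    have near: "\<zeta> z = 1" if "z \<in> ball x r" for z
    proof -
      have "norm x - norm z < r" "norm z - norm x < r"
        using that norm_triangle_ineq2[of x z] norm_triangle_ineq2[of z x]
        by (auto simp: dist_norm norm_minus_commute)
      then have "norm z > 3" "norm z \<le> 2 * R" using R by (auto simp: r_def)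
      then show ?thesis using \<theta>(3)[of z] \<theta>R1[OF R0, of z] by (simp add: \<zeta>_def)
    qed
    have xU: "x \<in> ?U" using x by simp
    have "u x = 0 * \<zeta> 0 * ?F (0 - x) + (LINT z|lborel. u z * repr_kernel \<zeta> x z)"
      by (rule weak_pole_representation(1)[OF dim U harmonic_imp_weak_pole[OF U u] \<zeta>test _ near])
        (use x R harmonic_in_isCont[OF U u xU] in \<open>auto simp: r_def\<close>)
    then have rep: "u x = (LINT z|lborel. u z * repr_kernel (\<theta>R R) x z - u z * repr_kernel \<theta> x z)"
      unfolding kadd right_diff_distrib by simp
    have iR: "integrable lborel (\<lambda>z. u z * repr_kernel (\<theta>R R) x z)"
    proof (rule integrable_mult_compact_support[OF AR(1) uA[OF AR]])
      show "continuous_on UNIV (repr_kernel (\<theta>R R) x)"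
      proof (rule repr_kernel_continuous(1)[OF dim scaled(1) R0, of x R 1])
        show "\<theta>R R z = 1" if "z \<in> ball x R" for z
          using that norm_triangle_ineq2[of z x] R
          by (intro \<theta>R1 R0) (auto simp: dist_norm norm_minus_commute)
      qed
      show "repr_kernel (\<theta>R R) x z = 0" if "z \<notin> ?AR" for z by (intro repr_kernel_zero zR that)
    qed
    have "u x + I x = (LINT z|lborel. u z * repr_kernel (\<theta>R R) x z)"
      unfolding rep I_def using iR Icont[OF x] by simp
    also have "\<bar>\<dots>\<bar> \<le> (LINT z|lborel. s * ((2 * M * k1 + M * fund_coeff n) / R ^ n) * indicator ?AR z)"
    proof -
      have b: "norm (u z * repr_kernel (\<theta>R R) x z) \<le> s * ((2 * M * k1 + M * fund_coeff n) / R ^ n) * indicator ?AR z" for z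
      proof (cases "z \<in> ?AR")
        case False
        then show ?thesis using zR[of z] by (simp add: repr_kernel_zero)
      next
        case True
        then have nz: "2 * R \<le> norm z" by simp
        have nzx: "R \<le> norm (z - x)" using norm_triangle_ineq2[of z x] nz R by linarith
        have us: "\<bar>u z\<bar> \<le> s" using B[of z] nz R by auto
        have g1: "norm (gradient (\<theta>R R) z) \<le> M / R"
          using M(2)[of "(1 / R) *\<^sub>R z"] R0 unfolding scaled(2) by (simp add: divide_right_mono)
        have g2: "norm (gradient (\<lambda>z. ?F (z - x)) z) \<le> k1 / R ^ (n - 1)"
          using Fb(2)[OF R0 nzx, of x] by simp
        have l1: "\<bar>laplacian (\<theta>R R) z\<bar> \<le> M / R\<^sup>2"
          using M(3)[of "(1 / R) *\<^sub>R z"] R0 unfolding scaled(3)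
          by (simp add: abs_mult power_divide divide_right_mono)
        have l2: "\<bar>?F (z - x)\<bar> \<le> fund_coeff n / R ^ (n - 2)"
          using Fb(1)[OF R0 nzx] F0[of "z - x"] by simp
        have "\<bar>gradient (\<theta>R R) z \<bullet> gradient (\<lambda>z. ?F (z - x)) z\<bar> \<le> M / R * (k1 / R ^ (n - 1))"
          by (rule order_trans[OF Cauchy_Schwarz_ineq2 mult_mono[OF g1 g2]]) (use M(1) R0 in auto)
        also have "\<dots> = M * k1 / R ^ n"
        proof -
          have "R ^ n = R * R ^ (n - 1)" using n2 by (metis power_eq_if not_less_zero)
          then show ?thesis by simp
        qed
        finally have 1: "\<bar>gradient (\<theta>R R) z \<bullet> gradient (\<lambda>z. ?F (z - x)) z\<bar> \<le> M * k1 / R ^ n" .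
        have "\<bar>laplacian (\<theta>R R) z * ?F (z - x)\<bar> \<le> M / R\<^sup>2 * (fund_coeff n / R ^ (n - 2))"
          using mult_mono[OF l1 l2] M(1) R0 by (simp add: abs_mult)
        also have "\<dots> = M * fund_coeff n / R ^ n"
        proof -
          have "R ^ n = R\<^sup>2 * R ^ (n - 2)" using n2 by (metis le_add_diff_inverse less_imp_le power_add)
          then show ?thesis by simp
        qed
        finally have 2: "\<bar>laplacian (\<theta>R R) z * ?F (z - x)\<bar> \<le> M * fund_coeff n / R ^ n" .
        have "\<bar>repr_kernel (\<theta>R R) x z\<bar> \<le> 2 * (M * k1 / R ^ n) + M * fund_coeff n / R ^ n"
          using 1 2 unfolding repr_kernel_def by linarith
        also have "\<dots> = (2 * M * k1 + M * fund_coeff n) / R ^ n" by (simp add: add_divide_distrib)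
        finally have "\<bar>repr_kernel (\<theta>R R) x z\<bar> \<le> (2 * M * k1 + M * fund_coeff n) / R ^ n" .
        from mult_mono[OF us this] s show ?thesis using True by (simp add: abs_mult)
      qed
      have ai: "integrable lborel (\<lambda>z. s * ((2 * M * k1 + M * fund_coeff n) / R ^ n) * indicator ?AR z)"
        using emeasure_bounded_finite[OF compact_imp_bounded[OF AR(1)]]
        by (intro integrable_mult_right integrable_real_indicator) auto
      show ?thesis
        using Bochner_Integration.integral_norm_bound_integral[OF iR ai b] by simp
    qed
    also have "\<dots> = s * ((2 * M * k1 + M * fund_coeff n) / R ^ n) * measure lborel ?AR" by simp
    also have "\<dots> \<le> s * ((2 * M * k1 + M * fund_coeff n) / R ^ n) * (V * (3 * R) ^ n)"
    proof (rule mult_left_mono)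
      have "measure lborel ?AR \<le> measure lborel (cball (0::'a) (3 * R))"
        by (rule measure_mono_fmeasurable) (use emeasure_bounded_finite[OF bounded_cball, of "0::'a" "3 * R"] in \<open>auto simp: fmeasurable_def\<close>)
      also have "\<dots> = V * (3 * R) ^ n" using content_cball[of "3 * R" "0::'a"] R0 by (simp add: V_def n_def)
      finally show "measure lborel ?AR \<le> V * (3 * R) ^ n" .
      show "0 \<le> s * ((2 * M * k1 + M * fund_coeff n) / R ^ n)" using s M(1) k1 k0 R0 by simp
    qed
    also have "\<dots> = s * C0" using R0 by (simp add: C0_def power_mult_distrib)
    finally show ?thesis .
  qed
  have uI: "u x = - I x" if x: "3 < norm x" for x
  proof -
    have "\<bar>u x + I x\<bar> \<le> 0"
    proof (rule field_le_epsilon)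
      fix e :: real assume e: "e > 0"
      have "\<bar>u x + I x\<bar> \<le> e / (C0 + 1) * C0" using C0 e by (intro outer x) auto
      also have "\<dots> \<le> e" using C0 e by (simp add: field_simps)
      finally show "\<bar>u x + I x\<bar> \<le> 0 + e" by simp
    qed
    then show ?thesis by simp
  qed
  define q where "q = (LINT z|lborel. u z * laplacian \<theta> z)"
  have qi: "integrable lborel (\<lambda>z. u z * laplacian \<theta> z)"
    by (rule integrable_mult_compact_support[OF A(1) uA[OF A] C2_on_continuous_laplacian[OF \<theta>(1)] z\<theta>(2)])
  define C where "C = M * (2 * (M * (k1 * 2 ^ (n - 1))) + M * (3 * k1 * 2 ^ (n - 1))) * measure lborel ?A"
  have C: "C \<ge> 0" using M(1) k1 by (simp add: C_def)
  have "\<bar>u x + q * ?F x\<bar> \<le> C / norm x ^ (n - 1)" if x: "6 \<le> norm x" for x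
  proof -
    have x3: "3 < norm x" using x by simp
    define N where "N = norm x"
    have N: "N \<ge> 6" using x by (simp add: N_def)
    define E where "E = 2 * (M * (k1 * 2 ^ (n - 1))) + M * (3 * k1 * 2 ^ (n - 1))"
    have E0: "E \<ge> 0" using M(1) k1 by (simp add: E_def)
    have b: "norm (u z * laplacian \<theta> z * ?F x - u z * repr_kernel \<theta> x z) \<le> M * (E / N ^ (n - 1)) * indicator ?A z" for z
    proof (cases "z \<in> ?A")
      case False
      then show ?thesis using z\<theta>[of z] by (simp add: repr_kernel_zero)
    next
      case True
      then have nz: "norm z \<le> 3" by simp
      have half: "N / 2 \<le> norm (w - x)" if "norm w \<le> 3" for w
        using norm_triangle_ineq2[of x w] that N by (simp add: N_def norm_minus_commute)
      have N2: "N / 2 > 0" using N by simp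
      have pw: "c / (N / 2) ^ (n - 1) = c * 2 ^ (n - 1) / N ^ (n - 1)" for c by (simp add: power_divide)
      have g2: "norm (gradient (\<lambda>z. ?F (z - x)) z) \<le> k1 * 2 ^ (n - 1) / N ^ (n - 1)"
        using Fb(2)[OF N2 half[OF nz], of x] unfolding pw by simp
      have f2: "\<bar>?F (z - x) - ?F (0 - x)\<bar> \<le> 3 * k1 * 2 ^ (n - 1) / N ^ (n - 1)"
      proof -
        have "\<bar>?F (z - x) - ?F (0 - x)\<bar> \<le> k1 / (N / 2) ^ (n - 1) * norm ((z - x) - (0 - x))"
          unfolding k1_def n_def
        proof (rule fundamental_solution_lipschitz[OF dim N2])
          fix w assume "w \<in> closed_segment (z - x) (0 - x)"
          then have "w + x \<in> closed_segment z 0"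
            unfolding closed_segment_def by (force simp: algebra_simps)
          then have "w + x \<in> cball 0 3"
            using nz convex_cball[of "0::'a" 3] by (meson centre_in_cball closed_segment_subset mem_cball_0 subsetD zero_le_numeral)
          then have "norm (w + x) \<le> 3" by simp
          from half[OF this] show "N / 2 \<le> norm w" by simp
        qed
        also have "\<dots> \<le> k1 / (N / 2) ^ (n - 1) * 3" using nz k1 N by (intro mult_left_mono) auto
        finally show ?thesis unfolding pw by (simp add: mult_ac)
      qed
      have "\<bar>gradient \<theta> z \<bullet> gradient (\<lambda>z. ?F (z - x)) z\<bar> \<le> M * (k1 * 2 ^ (n - 1) / N ^ (n - 1))"
        by (rule order_trans[OF Cauchy_Schwarz_ineq2 mult_mono[OF M(2) g2 M(1)]]) simp
      moreover have "\<bar>laplacian \<theta> z * (?F (z - x) - ?F (0 - x))\<bar> \<le> M * (3 * k1 * 2 ^ (n - 1) / N ^ (n - 1))"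
        using mult_mono[OF M(3)[of z] f2 M(1)] by (simp add: abs_mult)
      moreover have "laplacian \<theta> z * ?F x - repr_kernel \<theta> x z
        = - (2 * (gradient \<theta> z \<bullet> gradient (\<lambda>z. ?F (z - x)) z)) - laplacian \<theta> z * (?F (z - x) - ?F (0 - x))"
        using fundamental_solution_minus[of x] by (simp add: repr_kernel_def algebra_simps)
      moreover have "\<bar>a\<bar> \<le> A \<Longrightarrow> \<bar>b\<bar> \<le> B \<Longrightarrow> d = - (2 * a) - b \<Longrightarrow> \<bar>d\<bar> \<le> 2 * A + B" for a b d A B :: real
        by linarith
      ultimately have "\<bar>laplacian \<theta> z * ?F x - repr_kernel \<theta> x z\<bar>
        \<le> 2 * (M * (k1 * 2 ^ (n - 1) / N ^ (n - 1))) + M * (3 * k1 * 2 ^ (n - 1) / N ^ (n - 1))"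
        by blast
      also have "\<dots> = E / N ^ (n - 1)" by (simp add: E_def add_divide_distrib)
      finally have "\<bar>laplacian \<theta> z * ?F x - repr_kernel \<theta> x z\<bar> \<le> E / N ^ (n - 1)" .
      from mult_mono[OF M(4)[OF True] this M(1)]
      have "\<bar>u z * (laplacian \<theta> z * ?F x - repr_kernel \<theta> x z)\<bar> \<le> M * (E / N ^ (n - 1))"
        by (simp add: abs_mult)
      moreover have "u z * laplacian \<theta> z * ?F x - u z * repr_kernel \<theta> x z
          = u z * (laplacian \<theta> z * ?F x - repr_kernel \<theta> x z)"
        by (simp only: right_diff_distrib mult.assoc)
      ultimately show ?thesis using True by (simp only: real_norm_def indicator_simps mult_1_right)
    qed
    have ai: "integrable lborel (\<lambda>z. M * (E / N ^ (n - 1)) * indicator ?A z)"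
      using emeasure_bounded_finite[OF compact_imp_bounded[OF A(1)]]
      by (intro integrable_mult_right integrable_real_indicator) auto
    have "u x + q * ?F x = (LINT z|lborel. u z * laplacian \<theta> z * ?F x - u z * repr_kernel \<theta> x z)"
      unfolding uI[OF x3] I_def q_def using qi Icont[OF x3] by simp
    also have "\<bar>\<dots>\<bar> \<le> (LINT z|lborel. M * (E / N ^ (n - 1)) * indicator ?A z)"
      using Bochner_Integration.integral_norm_bound_integral[OF _ ai b] qi Icont[OF x3] by simp
    also have "\<dots> = C / N ^ (n - 1)" by (simp add: C_def E_def)
    finally show ?thesis by (simp add: N_def)
  qed
  then show ?thesis using C unfolding q_def n_def by blast
qed

text \<open>For \<open>0 < \<delta> < 1/4\<close> the second antiderivative of the trapezoid that vanishes outside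
  \<open>(\<delta>, 1-\<delta>)\<close> and equals one on \<open>[2\<delta>, 1-2\<delta>]\<close>.\<close>
definition trap :: "real \<Rightarrow> real \<Rightarrow> real" where
  "trap \<delta> t = (max 0 (t - \<delta>) ^ 3 - max 0 (t - 2 * \<delta>) ^ 3
     - max 0 (t - (1 - 2 * \<delta>)) ^ 3 + max 0 (t - (1 - \<delta>)) ^ 3) / (6 * \<delta>)"

definition trap' :: "real \<Rightarrow> real \<Rightarrow> real" where
  "trap' \<delta> t = (max 0 (t - \<delta>) ^ 2 - max 0 (t - 2 * \<delta>) ^ 2
     - max 0 (t - (1 - 2 * \<delta>)) ^ 2 + max 0 (t - (1 - \<delta>)) ^ 2) / (2 * \<delta>)"

definition trap'' :: "real \<Rightarrow> real \<Rightarrow> real" where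
  "trap'' \<delta> t = (max 0 (t - \<delta>) - max 0 (t - 2 * \<delta>)
     - max 0 (t - (1 - 2 * \<delta>)) + max 0 (t - (1 - \<delta>))) / \<delta>"

lemma trap_derivatives:
  assumes "\<delta> > 0"
  shows "(trap \<delta> has_real_derivative trap' \<delta> t) (at t)"
    "(trap' \<delta> has_real_derivative trap'' \<delta> t) (at t)"
    "continuous_on A (trap'' \<delta>)"
proof -
  have d: "((\<lambda>s. max 0 (s - c) ^ 3) has_real_derivative 3 * max 0 (s - c) ^ 2) (at s)"
    "((\<lambda>s. max 0 (s - c) ^ 2) has_real_derivative 2 * max 0 (s - c)) (at s)" for c s :: real
    using has_real_derivative_shift[OF pos_part_cube(1), where s = s and c = c]
      has_real_derivative_shift[OF pos_part_power_derivative[of 0], where s = s and c = c]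
    by (simp_all add: numeral_2_eq_2)
  show "(trap \<delta> has_real_derivative trap' \<delta> t) (at t)"
    unfolding trap_def[abs_def]
    by (rule DERIV_cong[OF DERIV_cdivide[OF DERIV_add[OF DERIV_diff[OF DERIV_diff[OF d(1) d(1)] d(1)] d(1)]]])
      (use assms in \<open>simp add: trap'_def field_simps\<close>)
  show "(trap' \<delta> has_real_derivative trap'' \<delta> t) (at t)"
    unfolding trap'_def[abs_def]
    by (rule DERIV_cong[OF DERIV_cdivide[OF DERIV_add[OF DERIV_diff[OF DERIV_diff[OF d(2) d(2)] d(2)] d(2)]]])
      (use assms in \<open>simp add: trap''_def field_simps\<close>)
  show "continuous_on A (trap'' \<delta>)"
    unfolding trap''_def[abs_def] using assms by (intro continuous_intros) auto
qed

lemma trap_simps: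
  assumes \<delta>: "0 < \<delta>" "\<delta> < 1/4"
  shows "t \<le> \<delta> \<Longrightarrow> trap \<delta> t = 0" "t \<ge> 1 - \<delta> \<Longrightarrow> trap'' \<delta> t = 0"
    "2 * \<delta> \<le> t \<Longrightarrow> t \<le> 1 - 2 * \<delta> \<Longrightarrow> trap'' \<delta> t = 1" "0 \<le> trap'' \<delta> t" "trap'' \<delta> t \<le> 1"
    "t \<ge> 1 - \<delta> \<Longrightarrow> trap \<delta> t = (1 - 3 * \<delta>) * (t - 1/2)"
proof -
  show "t \<le> \<delta> \<Longrightarrow> trap \<delta> t = 0" using \<delta> by (simp add: trap_def max_def)
  show "t \<ge> 1 - \<delta> \<Longrightarrow> trap'' \<delta> t = 0" using \<delta> by (simp add: trap''_def max_def)
  show "2 * \<delta> \<le> t \<Longrightarrow> t \<le> 1 - 2 * \<delta> \<Longrightarrow> trap'' \<delta> t = 1" using \<delta> by (simp add: trap''_def max_def)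
  show "0 \<le> trap'' \<delta> t" "trap'' \<delta> t \<le> 1" using \<delta> by (auto simp: trap''_def max_def divide_simps)
  assume t: "t \<ge> 1 - \<delta>"
  have "trap \<delta> t = ((t - \<delta>) ^ 3 - (t - 2 * \<delta>) ^ 3 - (t - (1 - 2 * \<delta>)) ^ 3 + (t - (1 - \<delta>)) ^ 3) / (6 * \<delta>)"
    using \<delta> t by (simp add: trap_def max_def)
  also have "(t - \<delta>) ^ 3 - (t - 2 * \<delta>) ^ 3 - (t - (1 - 2 * \<delta>)) ^ 3 + (t - (1 - \<delta>)) ^ 3
      = ((1 - 3 * \<delta>) * (t - 1/2)) * (6 * \<delta>)"
    by (simp add: power3_eq_cube algebra_simps)
  finally show "trap \<delta> t = (1 - 3 * \<delta>) * (t - 1/2)" using \<delta> by simp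
qed

text \<open>The function \<open>trap \<delta> (1 - P)\<close> vanishes near \<open>\<omega>\<close>, so it may be tested on the whole space
  although \<open>\<partial>\<omega>\<close> has no regularity. Far away it is affine in \<open>P\<close>, which produces the flux of \<open>P\<close> at
  infinity; its Laplacian is \<open>trap'' \<delta> (1 - P) |\<nabla>P|\<^sup>2\<close>, which tends to \<open>|\<nabla>P|\<^sup>2\<close> as \<open>\<delta> \<rightarrow> 0\<close>. By Fatou's lemma
  the Dirichlet integral is finite, and dominated convergence then gives its value.\<close>
theorem capacity_integral_eq_flux:
  fixes \<omega> :: "'a::euclidean_space set"
  assumes dim: "DIM('a) > 2" and P: "capacitary_potential \<omega> P"
    and unit: "closure \<omega> \<subseteq> cball 0 1" and zero: "0 \<in> interior (closure \<omega>)"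
    and \<theta>: "C2_on UNIV \<theta>" "\<And>z. z \<in> cball 0 2 \<Longrightarrow> \<theta> z = 1" "\<And>z. z \<notin> ball 0 3 \<Longrightarrow> \<theta> z = 0"
  shows "capacity_integral \<omega> P = - (LINT z|lborel. P z * laplacian \<theta> z)"
proof -
  let ?D = "- closure \<omega>"
  let ?U = "- cball (0::'a) 1"
  have D: "open ?D" by auto
  have U: "open ?U" "?U \<subseteq> ?D" using unit by auto
  have h: "harmonic_in ?D P" and b: "\<And>z. z \<in> frontier \<omega> \<Longrightarrow> (P \<longlongrightarrow> 1) (at z within ?D)"
    and lim: "(P \<longlongrightarrow> 0) at_infinity"
    using P unfolding capacitary_potential_def by auto
  have PC: "C2_on ?D P" and Plap: "\<And>x. x \<in> ?D \<Longrightarrow> laplacian P x = 0" using h unfolding harmonic_in_def by auto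
  have unit': "frontier \<omega> \<subseteq> cball 0 1" using unit unfolding frontier_def by blast
  have Pb: "0 \<le> P x" "P x \<le> 1" if "x \<in> ?D" for x
    using capacitary_potential_bounds[OF dim P unit' zero] that by auto
  define q where "q = - (LINT z|lborel. P z * laplacian \<theta> z)"
  define w where "w \<delta> x = (if x \<in> ?D then trap'' \<delta> (1 - P x) * (norm (gradient P x))\<^sup>2 else 0)" for \<delta> x
  have main: "integrable lborel (w \<delta>) \<and> (LINT x|lborel. w \<delta> x) = (1 - 3 * \<delta>) * q"
    if \<delta>: "0 < \<delta>" "\<delta> < 1/4" for \<delta>
  proof -
    note t = trap_simps[OF \<delta>]
    define f where "f x = (if x \<in> ?D then trap \<delta> (1 + (-1) * P x) else 0)" for x
    define K where "K = {x \<in> ?D. \<delta> \<le> 1 + (-1) * P x}"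
    note mC = C2_on_cmult[OF D PC, where c = "-1"]
    have aC: "C2_on ?D (\<lambda>x. 1 + (-1) * P x)"
      "\<And>x. x \<in> ?D \<Longrightarrow> norm (gradient (\<lambda>x. 1 + (-1) * P x) x) = norm (gradient P x)"
      "\<And>x. x \<in> ?D \<Longrightarrow> laplacian (\<lambda>x. 1 + (-1) * P x) x = 0"
      using C2_on_add[OF D C2_on_const(1)[where c = 1] mC(1)] mC Plap by (simp_all add: C2_on_const)
    note cc = C2_on_compose[OF D aC(1) trap_derivatives(1)[OF \<delta>(1)] trap_derivatives(2)[OF \<delta>(1)]
        trap_derivatives(3)[OF \<delta>(1)]]
    have feq: "trap \<delta> (1 + (-1) * P x) = f x" if "x \<in> ?D" for x using that by (simp add: f_def)
    note cf = C2_on_cong[OF D cc(1), of f, OF feq]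
    have Kc: "closed K"
      unfolding K_def
    proof (rule superlevel_set_closed[OF D C2_on_continuous[OF aC(1)]])
      fix z assume z: "z \<in> frontier ?D"
      then have "z \<in> frontier \<omega>" using frontier_complement_closure by blast
      from order_tendstoD(1)[OF b[OF this], of "1 - \<delta>"] \<delta>
      show "\<forall>\<^sub>F x in at z within ?D. 1 + (-1) * P x < \<delta>" by (auto elim: eventually_mono)
    qed
    have KD: "K \<subseteq> ?D" by (auto simp: K_def)
    have f0: "f x = 0" if "x \<notin> K" for x using that by (auto simp: K_def f_def t(1))
    note ext = C2_on_extend_zero[OF D cf(1) Kc KD f0]
    have flap: "laplacian f x = w \<delta> x" for x
    proof (cases "x \<in> ?D")
      case True
      then show ?thesis using cf(3)[of x] cc(3)[of x] aC(2,3)[of x] by (simp add: w_def)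
    next
      case False
      then have "x \<notin> K" using KD by blast
      then show ?thesis using ext(3) False f0 by (simp add: w_def)
    qed
    have "\<forall>\<^sub>F z in at_infinity. \<bar>P z\<bar> < \<delta>" using tendstoD[OF lim \<delta>(1)] by (simp add: dist_real_def)
    then obtain B where B: "\<And>z. B \<le> norm z \<Longrightarrow> \<bar>P z\<bar> < \<delta>" unfolding eventually_at_infinity by blast
    define R where "R = max B 2"
    have R: "R \<ge> 2" "B \<le> R" by (auto simp: R_def)
    have R0: "R > 0" using R by linarith
    define \<theta>R where "\<theta>R z = \<theta> ((1 / R) *\<^sub>R (z - 0))" for z
    have \<theta>RC: "C2_on UNIV \<theta>R"
      using C2_on_scale_shift(1)[OF open_UNIV \<theta>(1), where r = "1 / R" and a = 0] unfolding \<theta>R_def by simp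
    have \<theta>R1: "\<theta>R z = 1" if "z \<in> cball 0 (2 * R)" for z
      using that R0 unfolding \<theta>R_def by (intro \<theta>(2)) (simp add: field_simps)
    have \<theta>R0: "\<theta>R z = 0" if "z \<notin> ball 0 (3 * R)" for z
      using that R0 unfolding \<theta>R_def by (intro \<theta>(3)) (simp add: field_simps)
    have zR: "gradient \<theta>R z = 0" "laplacian \<theta>R z = 0" if "z \<notin> cball 0 (3 * R) - ball 0 (2 * R)" for z
      using annulus_cutoff_zero[of \<theta>R "2 * R" "3 * R" z] \<theta>RC \<theta>R1 \<theta>R0 that by auto
    have test: "C2_test UNIV \<theta>R"
      unfolding C2_test_def using \<theta>RC \<theta>R0 by (intro conjI exI[of _ "cball 0 (3 * R)"]) auto
    have far: "\<bar>P z\<bar> < \<delta> \<and> z \<in> ?D" if "z \<notin> ball 0 (2 * R)" for z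
    proof -
      have "norm z \<ge> 2 * R" using that by simp
      then have "B \<le> norm z" "1 < norm z" using R R0 by linarith+
      then show ?thesis using B U(2) by auto
    qed
    have weq: "\<theta>R z * w \<delta> z = w \<delta> z" for z
    proof (cases "z \<in> ball 0 (2 * R)")
      case False
      have "trap'' \<delta> (1 - P z) = 0" using far[OF False] by (intro t(2)) auto
      then show ?thesis by (simp add: w_def)
    qed (use \<theta>R1 in auto)
    have "(LINT x|lborel. w \<delta> x) = (LINT x|lborel. \<theta>R x * laplacian f x)"
      unfolding flap weq ..
    also have "\<dots> = (LINT x|lborel. f x * laplacian \<theta>R x)"
      by (rule integral_laplacian_symmetric[OF open_UNIV ext(1) test, symmetric])
    also have "(\<lambda>x. f x * laplacian \<theta>R x) =
        (\<lambda>x. (1 - 3 * \<delta>) / 2 * (1 * laplacian \<theta>R x) - (1 - 3 * \<delta>) * (P x * laplacian \<theta>R x))"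
    proof
      fix x show "f x * laplacian \<theta>R x = (1 - 3 * \<delta>) / 2 * (1 * laplacian \<theta>R x) - (1 - 3 * \<delta>) * (P x * laplacian \<theta>R x)"
      proof (cases "x \<in> ball 0 (2 * R)")
        case True
        then show ?thesis using zR(2)[of x] by simp
      next
        case False
        have "f x = (1 - 3 * \<delta>) * (1 + (-1) * P x - 1/2)"
          using far[OF False] unfolding f_def by (subst t(6)) auto
        also have "\<dots> = (1 - 3 * \<delta>) / 2 - (1 - 3 * \<delta>) * P x" by (simp add: field_simps)
        finally show ?thesis by (simp only: left_diff_distrib mult.assoc mult_1)
      qed
    qed
    also have "(LINT x|lborel. (1 - 3 * \<delta>) / 2 * (1 * laplacian \<theta>R x) - (1 - 3 * \<delta>) * (P x * laplacian \<theta>R x))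
        = (1 - 3 * \<delta>) / 2 * (LINT x|lborel. 1 * laplacian \<theta>R x) - (1 - 3 * \<delta>) * (LINT x|lborel. P x * laplacian \<theta>R x)"
    proof -
      let ?AR = "cball (0::'a) (3 * R) - ball 0 (2 * R)"
      have AR: "compact ?AR" "?AR \<subseteq> ?D" using far by (auto simp: compact_diff)
      have "integrable lborel (laplacian \<theta>R)"
        by (rule integrable_compact_support[OF AR(1) continuous_on_subset[OF C2_on_continuous_laplacian[OF \<theta>RC]] zR(2)]) auto
      moreover have "set_integrable lborel ?AR P"
        unfolding set_integrable_def
        by (rule borel_integrable_compact[OF AR(1) continuous_on_subset[OF C2_on_continuous[OF PC] AR(2)]])
      from integrable_mult_compact_support[OF AR(1) this C2_on_continuous_laplacian[OF \<theta>RC] zR(2)]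
      have "integrable lborel (\<lambda>x. P x * laplacian \<theta>R x)" by simp
      ultimately show ?thesis by simp
    qed
    also have "(LINT x|lborel. 1 * laplacian \<theta>R x) = 0"
      using integral_laplacian_symmetric[OF open_UNIV C2_on_const(1)[where c = 1] test]
      by (simp add: C2_on_const)
    also have "(LINT x|lborel. P x * laplacian \<theta>R x) = - q"
    proof -
      define \<zeta> where "\<zeta> z = \<theta>R z + (-1) * \<theta> z" for z
      note m = C2_on_cmult[OF open_UNIV \<theta>(1), where c = "-1"]
      note ad = C2_on_add[OF open_UNIV \<theta>RC m(1)]
      have "C2_test ?U \<zeta>"
        unfolding C2_test_def
      proof (intro conjI exI[of _ "cball 0 (3 * R) - ball 0 2"] allI impI)
        show "C2_on UNIV \<zeta>" unfolding \<zeta>_def by (rule ad(1))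
        show "\<zeta> z = 0" if "z \<notin> cball 0 (3 * R) - ball 0 2" for z
        proof (cases "z \<in> ball 0 2")
          case True
          then have "norm z \<le> 2 * R" using R by auto
          then show ?thesis using \<theta>(2)[of z] \<theta>R1[of z] True by (simp add: \<zeta>_def)
        next
          case False
          then have "norm z > 3 * R" using that by auto
          then show ?thesis using \<theta>(3)[of z] \<theta>R0[of z] R by (simp add: \<zeta>_def)
        qed
      qed (auto simp: compact_diff)
      then have "(LINT x|lborel. P x * laplacian \<zeta> x) = 0"
        using harmonic_imp_weak_pole[OF U(1) harmonic_in_subset[OF h U(2)], of 0]
        unfolding weak_pole_def by simp
      moreover have "laplacian \<zeta> x = laplacian \<theta>R x - laplacian \<theta> x" for x
        using ad(3)[of x] m(3)[of x] unfolding \<zeta>_def by simp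
      moreover have i: "integrable lborel (\<lambda>x. P x * laplacian \<phi> x)"
        if "compact S" "S \<subseteq> ?D" "C2_on UNIV \<phi>" "\<And>x. x \<notin> S \<Longrightarrow> laplacian \<phi> x = 0" for S \<phi>
      proof -
        have "set_integrable lborel S P"
          unfolding set_integrable_def
          by (rule borel_integrable_compact[OF that(1) continuous_on_subset[OF C2_on_continuous[OF PC] that(2)]])
        from integrable_mult_compact_support[OF that(1) this C2_on_continuous_laplacian[OF that(3)] that(4)]
        show ?thesis by simp
      qed
      have i1: "integrable lborel (\<lambda>x. P x * laplacian \<theta>R x)"
        by (rule i[of "cball 0 (3 * R) - ball 0 (2 * R)"]) (use far \<theta>RC zR in \<open>auto simp: compact_diff\<close>)
      have i2: "integrable lborel (\<lambda>x. P x * laplacian \<theta> x)"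
      proof (rule i[OF _ _ \<theta>(1)])
        show "laplacian \<theta> x = 0" if "x \<notin> cball 0 3 - ball 0 2" for x
          using annulus_cutoff_zero(2)[of \<theta> 2 3 x] \<theta> that by auto
        show "cball 0 3 - ball 0 2 \<subseteq> ?D" using unit by (auto simp: subset_iff)
      qed (auto simp: compact_diff)
      ultimately show ?thesis using i1 i2 by (simp add: q_def right_diff_distrib)
    qed
    finally have val: "(LINT x|lborel. w \<delta> x) = (1 - 3 * \<delta>) * q" by simp
    have wl: "w \<delta> = laplacian f" using flap by (simp add: fun_eq_iff)
    have "integrable lborel (w \<delta>)"
    proof (rule integrable_compact_support[of "cball 0 (3 * R)"])
      show "continuous_on (cball 0 (3 * R)) (w \<delta>)"
        unfolding wl by (rule continuous_on_subset[OF C2_on_continuous_laplacian[OF ext(1)] subset_UNIV])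
      show "w \<delta> x = 0" if "x \<notin> cball 0 (3 * R)" for x
      proof -
        have "x \<notin> ball 0 (3 * R)" using that by auto
        then show ?thesis using weq[of x] \<theta>R0[of x] by simp
      qed
    qed simp
    with val show ?thesis by simp
  qed
  define \<delta> where "\<delta> k = 1 / (real k + 5)" for k
  have \<delta>: "0 < \<delta> k" "\<delta> k < 1/4" for k by (auto simp: \<delta>_def field_simps)
  have \<delta>0: "\<delta> \<longlonglongrightarrow> 0" unfolding \<delta>_def by real_asymp
  define e where "e x = indicator ?D x *\<^sub>R (norm (gradient P x))\<^sup>2" for x
  have e0: "e x \<ge> 0" for x by (simp add: e_def)
  have em: "e \<in> borel_measurable lborel"
    unfolding e_def[abs_def]
    by (simp, rule borel_measurable_continuous_on_indicator[where 'b = real, simplified])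
      (auto intro!: continuous_intros C2_on_continuous_gradient[OF PC])
  \<comment> \<open>Where \<open>P\<close> is \<open>0\<close> or \<open>1\<close>, the factor \<open>trap'' \<delta> (1 - P)\<close> does not tend to one; but there \<open>P\<close> has an
    extremum, and \<open>\<nabla>P\<close> vanishes.\<close>
  have grad0: "gradient P x = 0" if x: "x \<in> ?D" and ext: "P x = 0 \<or> P x = 1" for x
  proof -
    have "(P has_derivative (\<lambda>h. gradient P x \<bullet> h)) (at x)"
      using C2_on_imp_C2_data[OF PC] x unfolding C2_data_def by blast
    then have "(\<lambda>h. gradient P x \<bullet> h) = (\<lambda>h. 0)"
      by (rule differential_zero_maxmin[OF x D]) (use Pb ext in force)
    then show ?thesis by (metis inner_eq_zero_iff)
  qed
  have conv: "(\<lambda>k. w (\<delta> k) x) \<longlonglongrightarrow> e x" for x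
  proof (cases "x \<in> ?D \<and> P x \<noteq> 0 \<and> P x \<noteq> 1")
    case False
    then have "w (\<delta> k) x = e x" for k using grad0[of x] by (auto simp: w_def e_def)
    then show ?thesis by simp
  next
    case True
    then have p: "0 < P x" "P x < 1" using Pb[of x] by auto
    have "\<forall>\<^sub>F k in sequentially. \<delta> k < min (P x) (1 - P x) / 2"
      by (rule order_tendstoD(2)[OF \<delta>0]) (use p in auto)
    then have "\<forall>\<^sub>F k in sequentially. w (\<delta> k) x = e x"
    proof eventually_elim
      case (elim k)
      have "trap'' (\<delta> k) (1 - P x) = 1" using elim by (intro trap_simps(3)[OF \<delta>]) auto
      then show ?case using True by (simp add: w_def e_def)
    qed
    then show ?thesis by (rule tendsto_eventually)
  qed
  have wb: "0 \<le> w (\<delta> k) x" "w (\<delta> k) x \<le> e x" for k x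
    using trap_simps(4,5)[OF \<delta>[of k], of "1 - P x"] by (auto simp: w_def e_def mult_left_le_one_le)
  have wi: "integrable lborel (w (\<delta> k))" "(LINT x|lborel. w (\<delta> k) x) = (1 - 3 * \<delta> k) * q" for k
    using main[OF \<delta>] by auto
  have limq: "(\<lambda>k. (1 - 3 * \<delta> k) * q) \<longlonglongrightarrow> (1 - 3 * 0) * q"
    by (intro tendsto_intros \<delta>0)
  have q0: "q \<ge> 0"
  proof -
    have "0 \<le> (1 - 3 * \<delta> 0) * q" using wi(2)[of 0, symmetric] wb(1) by (simp add: integral_nonneg_AE)
    then show ?thesis using \<delta>[of 0] by (simp add: zero_le_mult_iff)
  qed
  have "(\<integral>\<^sup>+x. ennreal (e x) \<partial>lborel) = (\<integral>\<^sup>+x. liminf (\<lambda>k. ennreal (w (\<delta> k) x)) \<partial>lborel)"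
    using conv by (intro nn_integral_cong) (simp add: lim_imp_Liminf[symmetric] tendsto_ennrealI)
  also have "\<dots> \<le> liminf (\<lambda>k. \<integral>\<^sup>+x. ennreal (w (\<delta> k) x) \<partial>lborel)"
    using wi(1) by (intro nn_integral_liminf) auto
  also have "(\<lambda>k. \<integral>\<^sup>+x. ennreal (w (\<delta> k) x) \<partial>lborel) = (\<lambda>k. ennreal ((1 - 3 * \<delta> k) * q))"
    using wi wb by (simp add: nn_integral_eq_integral)
  also have "liminf \<dots> = ennreal q"
    using limq by (intro lim_imp_Liminf tendsto_ennrealI) auto
  finally have "(\<integral>\<^sup>+x. ennreal (e x) \<partial>lborel) < \<infinity>" by (simp add: le_less_trans)
  then have ei: "integrable lborel e"
    using em e0 by (intro integrableI_bounded) auto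
  have "(\<lambda>k. LINT x|lborel. w (\<delta> k) x) \<longlonglongrightarrow> (LINT x|lborel. e x)"
    by (rule integral_dominated_convergence[OF em _ ei])
      (use wi(1) conv wb in \<open>auto simp: abs_of_nonneg\<close>)
  then have "(LINT x|lborel. e x) = q"
    unfolding wi(2) using LIMSEQ_unique[OF _ limq] by simp
  then show ?thesis
    unfolding capacity_integral_def set_lebesgue_integral_def e_def q_def .
qed

text \<open>The leading coefficient at infinity is the flux, hence the capacity.\<close>
theorem capacitary_potential_expansion:
  fixes \<omega> :: "'a::euclidean_space set"
  assumes dim: "DIM('a) > 2" and P: "capacitary_potential \<omega> P"
    and unit: "closure \<omega> \<subseteq> cball 0 1" and zero: "0 \<in> interior (closure \<omega>)"
  shows "\<exists>C\<ge>0. \<forall>x. 6 \<le> norm x \<longrightarrow>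
    \<bar>P x - capacity_integral \<omega> P * fundamental_solution x\<bar> \<le> C / norm x ^ (DIM('a) - 1)"
proof -
  obtain \<theta> :: "'a \<Rightarrow> real" where \<theta>: "C2_on UNIV \<theta>" "\<And>z. z \<in> cball 0 2 \<Longrightarrow> \<theta> z = 1" "\<And>z. z \<notin> ball 0 3 \<Longrightarrow> \<theta> z = 0"
  proof -
    have "(0::real) < 2" "(2::real) < 3" by auto
    from cutoff_exists[OF this, of "0::'a"] show thesis using that by metis
  qed
  have sub: "- cball 0 1 \<subseteq> - closure \<omega>" using unit by blast
  have "harmonic_in (- cball 0 1) P" "(P \<longlongrightarrow> 0) at_infinity"
    using P harmonic_in_subset[OF _ sub] unfolding capacitary_potential_def by auto
  then have "\<exists>C\<ge>0. \<forall>x. 6 \<le> norm x \<longrightarrow>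
    \<bar>P x + (LINT z|lborel. P z * laplacian \<theta> z) * fundamental_solution x\<bar> \<le> C / norm x ^ (DIM('a) - 1)"
    by (rule harmonic_expansion_at_infinity[OF dim _ _ \<theta>(1)]) (use \<theta> in auto)
  moreover have "capacity_integral \<omega> P = - (LINT z|lborel. P z * laplacian \<theta> z)"
    by (rule capacity_integral_eq_flux[OF dim P unit zero \<theta>(1)]) (use \<theta> in auto)
  ultimately show ?thesis by simp
qed

section \<open>Domains with several small holes\<close>

text \<open>The ray through a point of \<open>S\<close> outside the ball leaves \<open>S\<close> at a frontier point that is even farther
  from the origin.\<close>
lemma bounded_frontier_in_cball:
  fixes S :: "'a::euclidean_space set"
  assumes S: "bounded S" and fr: "frontier S \<subseteq> cball 0 r" and r: "r \<ge> 0"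
  shows "closure S \<subseteq> cball 0 r"
proof -
  have "x \<in> cball 0 r" if x: "x \<in> S" for x
  proof (rule ccontr)
    assume "x \<notin> cball 0 r"
    then have xr: "norm x > r" by simp
    obtain B where B: "B > 0" "\<And>y. y \<in> S \<Longrightarrow> norm y \<le> B" using S unfolding bounded_pos by auto
    define t where "t = 1 + B / norm x"
    have x0: "norm x > 0" using xr r by linarith
    have "norm (t *\<^sub>R x) = norm x + B" using x0 B by (simp add: t_def field_simps)
    then have "t *\<^sub>R x \<notin> S" using B(2)[of "t *\<^sub>R x"] x0 by auto
    moreover have "connected (closed_segment x (t *\<^sub>R x))" by simp
    ultimately have "closed_segment x (t *\<^sub>R x) \<inter> frontier S \<noteq> {}"
      using connected_Int_frontier[of "closed_segment x (t *\<^sub>R x)" S] x by blast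
    then obtain w where w: "w \<in> closed_segment x (t *\<^sub>R x)" "w \<in> frontier S" by blast
    have wr: "norm w \<le> r" using subsetD[OF fr w(2)] by simp
    from w(1) obtain s where s: "0 \<le> s" "s \<le> 1" "w = (1 - s) *\<^sub>R x + s *\<^sub>R (t *\<^sub>R x)"
      unfolding closed_segment_def by auto
    have "w = (1 + s * (t - 1)) *\<^sub>R x" unfolding s(3) by (simp add: algebra_simps)
    moreover have "1 + s * (t - 1) \<ge> 1" using s B x0 by (simp add: t_def)
    ultimately have "norm w \<ge> norm x" using x0 by (simp add: mult_le_cancel_right1)
    then show False using wr xr by linarith
  qed
  then show ?thesis using fr closure_minimal[of S "cball 0 r"] by (simp add: subset_iff)
qed

lemma eventually_bounded_domain:
  fixes D :: "'a::real_normed_vector set"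
  assumes "bounded D" shows "eventually Q (inf at_infinity (principal D))"
proof -
  obtain B where "\<And>x. x \<in> D \<Longrightarrow> norm x \<le> B" using assms unfolding bounded_iff by blast
  then show ?thesis
    unfolding eventually_inf_principal eventually_at_infinity
    by (intro exI[of _ "B + 1"]) force
qed

lemma finite_uniform_bound:
  fixes Q :: "'i \<Rightarrow> real \<Rightarrow> bool"
  assumes "finite J" "\<And>j. j \<in> J \<Longrightarrow> \<exists>K. Q j K"
    and mono: "\<And>j K K'. j \<in> J \<Longrightarrow> Q j K \<Longrightarrow> K \<le> K' \<Longrightarrow> Q j K'"
  shows "\<exists>K. \<forall>j\<in>J. Q j K"
proof -
  obtain k where k: "\<And>j. j \<in> J \<Longrightarrow> Q j (k j)" using assms(2) by metis
  have "k j \<le> (\<Sum>j\<in>J. \<bar>k j\<bar>)" if "j \<in> J" for j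
    using member_le_sum[of j J "\<lambda>j. \<bar>k j\<bar>"] assms(1) that by (simp add: abs_le_iff)
  then show ?thesis using k mono by blast
qed

text \<open>The exterior estimates transferred to a hole of size \<open>\<epsilon>\<close> around \<open>c\<close>. For \<open>\<epsilon> \<le> \<rho>/12\<close> the rescaled point
  \<open>(x - c)/\<epsilon>\<close> has norm at least \<open>6\<close>, where they apply.\<close>
lemma small_hole_far:
  fixes \<omega> :: "'a::euclidean_space set"
  assumes dim: "DIM('a) > 2" and P: "capacitary_potential \<omega> P" and g: "green_function (- closure \<omega>) g"
    and unit: "closure \<omega> \<subseteq> cball 0 1" and zero: "0 \<in> interior (closure \<omega>)" and \<rho>: "\<rho> > 0"
  shows "\<exists>K. \<forall>\<epsilon> c x y. 0 < \<epsilon> \<longrightarrow> \<epsilon> \<le> \<rho> / 12 \<longrightarrow> \<rho> / 2 \<le> norm (x - c) \<longrightarrow> x \<noteq> y \<longrightarrow>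
     (1 / \<epsilon>) *\<^sub>R (x - c) \<notin> closure \<omega> \<longrightarrow> (1 / \<epsilon>) *\<^sub>R (y - c) \<notin> closure \<omega> \<longrightarrow>
     \<bar>fundamental_solution (x - y) - 1 / \<epsilon> ^ (DIM('a) - 2) * g ((1 / \<epsilon>) *\<^sub>R (x - c)) ((1 / \<epsilon>) *\<^sub>R (y - c))
        - fundamental_solution (x - c) * P ((1 / \<epsilon>) *\<^sub>R (y - c))\<bar> \<le> K * \<epsilon> * P ((1 / \<epsilon>) *\<^sub>R (y - c)) \<and>
     \<bar>P ((1 / \<epsilon>) *\<^sub>R (x - c)) - \<epsilon> ^ (DIM('a) - 2) * capacity_integral \<omega> P * fundamental_solution (x - c)\<bar>
        \<le> K * \<epsilon> ^ (DIM('a) - 1) \<and>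
     P ((1 / \<epsilon>) *\<^sub>R (x - c)) \<le> K * \<epsilon> ^ (DIM('a) - 2)"
proof -
  let ?F = "fundamental_solution :: 'a \<Rightarrow> real"
  define n where "n = DIM('a)"
  have n2: "n > 2" using dim by (simp add: n_def)
  define k where "k = (real n - 2) * fund_coeff n * 2 ^ (n - 1)"
  have k: "k \<ge> 0" using fund_coeff_pos[of n] n2 by (simp add: k_def)
  have unit': "frontier \<omega> \<subseteq> cball 0 1" using unit unfolding frontier_def by blast
  obtain C where C: "C \<ge> 0" "\<And>x. 6 \<le> norm x \<Longrightarrow>
    \<bar>P x - capacity_integral \<omega> P * ?F x\<bar> \<le> C / norm x ^ (n - 1)"
    using capacitary_potential_expansion[OF dim P unit zero] unfolding n_def by blast
  define K where "K = k / (\<rho> / 2) ^ (n - 1) + C / (\<rho> / 2) ^ (n - 1) + 1 / (\<rho> / 2) ^ (n - 2)"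
  have Kge: "k / (\<rho> / 2) ^ (n - 1) \<le> K" "C / (\<rho> / 2) ^ (n - 1) \<le> K" "1 / (\<rho> / 2) ^ (n - 2) \<le> K"
    using k C(1) \<rho> by (auto simp: K_def)
  have main: "\<bar>?F (x - y) - 1 / \<epsilon> ^ (n - 2) * g \<xi> \<eta> - ?F (x - c) * P \<eta>\<bar> \<le> K * \<epsilon> * P \<eta> \<and>
     \<bar>P \<xi> - \<epsilon> ^ (n - 2) * capacity_integral \<omega> P * ?F (x - c)\<bar> \<le> K * \<epsilon> ^ (n - 1) \<and> P \<xi> \<le> K * \<epsilon> ^ (n - 2)"
    if \<epsilon>: "0 < \<epsilon>" "\<epsilon> \<le> \<rho> / 12" and far: "\<rho> / 2 \<le> norm (x - c)" and xy: "x \<noteq> y"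
      and \<xi>: "\<xi> = (1 / \<epsilon>) *\<^sub>R (x - c)" "\<xi> \<notin> closure \<omega>" and \<eta>: "\<eta> = (1 / \<epsilon>) *\<^sub>R (y - c)" "\<eta> \<notin> closure \<omega>"
    for \<epsilon> c x y \<xi> \<eta>
  proof -
    have n\<xi>: "norm \<xi> = norm (x - c) / \<epsilon>" using \<epsilon> by (simp add: \<xi>(1))
    have six: "6 \<le> norm \<xi>" using \<epsilon> far unfolding n\<xi> by (simp add: field_simps)
    have scale: "?F ((1 / \<epsilon>) *\<^sub>R w) = \<epsilon> ^ (n - 2) * ?F w" for w
      using \<epsilon> fundamental_solution_scale[of "1 / \<epsilon>" w] by (simp add: n_def power_divide)
    have "\<xi> - \<eta> = (1 / \<epsilon>) *\<^sub>R (x - y)" unfolding \<xi>(1) \<eta>(1) by (simp add: algebra_simps)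
    then have s1: "?F (\<xi> - \<eta>) = \<epsilon> ^ (n - 2) * ?F (x - y)" using scale by simp
    have s2: "?F \<xi> = \<epsilon> ^ (n - 2) * ?F (x - c)" unfolding \<xi>(1) by (rule scale)
    have ne: "\<eta> \<noteq> \<xi>" using xy \<epsilon> unfolding \<xi>(1) \<eta>(1) by simp
    have P0: "0 \<le> P \<eta>" using capacitary_potential_bounds(1)[OF dim P unit' zero \<eta>(2)] .
    have ep: "\<epsilon> ^ (n - 2) > 0" "\<epsilon> ^ (n - 1) > 0" using \<epsilon> by auto
    have en: "\<epsilon> ^ (n - 1) = \<epsilon> * \<epsilon> ^ (n - 2)"
    proof -
      have "n - 1 = Suc (n - 2)" using n2 by simp
      then show ?thesis by simp
    qed
    have pw: "d / norm \<xi> ^ (n - 1) \<le> d / (\<rho> / 2) ^ (n - 1) * \<epsilon> ^ (n - 1)" if d: "d \<ge> 0" for d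
    proof -
      have "d / norm \<xi> ^ (n - 1) = d / norm (x - c) ^ (n - 1) * \<epsilon> ^ (n - 1)"
        unfolding n\<xi> by (simp add: power_divide)
      also have "\<dots> \<le> d / (\<rho> / 2) ^ (n - 1) * \<epsilon> ^ (n - 1)"
        using d far \<rho> \<epsilon> by (intro mult_right_mono divide_left_mono power_mono mult_pos_pos zero_less_power) auto
      finally show ?thesis .
    qed
    have "\<bar>?F (\<xi> - \<eta>) - g \<xi> \<eta> - ?F \<xi> * P \<eta>\<bar> \<le> k / norm \<xi> ^ (n - 1) * P \<eta>"
      using exterior_green_function_far[OF dim P g unit' zero \<xi>(2) _ \<eta>(2) ne] six by (simp add: k_def n_def)
    also have "\<dots> \<le> K * \<epsilon> ^ (n - 1) * P \<eta>"
      by (intro mult_right_mono[OF _ P0] order_trans[OF pw[OF k]] mult_right_mono Kge) (use \<epsilon> in simp)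
    finally have h1: "\<bar>?F (\<xi> - \<eta>) - g \<xi> \<eta> - ?F \<xi> * P \<eta>\<bar> \<le> K * \<epsilon> ^ (n - 1) * P \<eta>" .
    have "?F (x - y) - 1 / \<epsilon> ^ (n - 2) * g \<xi> \<eta> - ?F (x - c) * P \<eta>
        = (?F (\<xi> - \<eta>) - g \<xi> \<eta> - ?F \<xi> * P \<eta>) / \<epsilon> ^ (n - 2)"
      unfolding s1 s2 using ep \<epsilon> by (simp add: diff_divide_distrib)
    then have "\<bar>?F (x - y) - 1 / \<epsilon> ^ (n - 2) * g \<xi> \<eta> - ?F (x - c) * P \<eta>\<bar>
        = \<bar>?F (\<xi> - \<eta>) - g \<xi> \<eta> - ?F \<xi> * P \<eta>\<bar> / \<epsilon> ^ (n - 2)" using ep by simp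
    also have "\<dots> \<le> K * \<epsilon> ^ (n - 1) * P \<eta> / \<epsilon> ^ (n - 2)" using h1 ep by (intro divide_right_mono) auto
    also have "\<dots> = K * \<epsilon> * P \<eta>" using ep unfolding en by simp
    finally have 1: "\<bar>?F (x - y) - 1 / \<epsilon> ^ (n - 2) * g \<xi> \<eta> - ?F (x - c) * P \<eta>\<bar> \<le> K * \<epsilon> * P \<eta>" .
    have "\<bar>P \<xi> - capacity_integral \<omega> P * ?F \<xi>\<bar> \<le> K * \<epsilon> ^ (n - 1)"
      by (rule order_trans[OF C(2)[OF six] order_trans[OF pw[OF C(1)]]])
        (use mult_right_mono[OF Kge(2) less_imp_le[OF ep(2)]] in simp)
    then have 2: "\<bar>P \<xi> - \<epsilon> ^ (n - 2) * capacity_integral \<omega> P * ?F (x - c)\<bar> \<le> K * \<epsilon> ^ (n - 1)"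
      unfolding s2 by (simp add: mult_ac)
    have "P \<xi> \<le> 1 / norm \<xi> ^ (n - 2)"
      using capacitary_potential_bounds(3)[OF dim P unit' zero \<xi>(2)] by (simp add: n_def)
    also have "\<dots> = 1 / norm (x - c) ^ (n - 2) * \<epsilon> ^ (n - 2)" unfolding n\<xi> by (simp add: power_divide)
    also have "\<dots> \<le> 1 / (\<rho> / 2) ^ (n - 2) * \<epsilon> ^ (n - 2)"
      using far \<rho> \<epsilon> by (intro mult_right_mono divide_left_mono power_mono mult_pos_pos zero_less_power) auto
    also have "\<dots> \<le> K * \<epsilon> ^ (n - 2)" using Kge(3) ep by (intro mult_right_mono) auto
    finally have 3: "P \<xi> \<le> K * \<epsilon> ^ (n - 2)" .
    show ?thesis using 1 2 3 by blast
  qed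
  show ?thesis
    unfolding n_def[symmetric] by (rule exI[of _ K]) (use main in blast)
qed

lemma closure_scaled_set:
  fixes S :: "'a::real_normed_vector set"
  assumes "\<epsilon> > 0"
  shows "closure {x. (1 / \<epsilon>) *\<^sub>R (x - c) \<in> S} = {x. (1 / \<epsilon>) *\<^sub>R (x - c) \<in> closure S}"
proof -
  have e: "{x. (1 / \<epsilon>) *\<^sub>R (x - c) \<in> T} = (+) c ` ((*\<^sub>R) \<epsilon> ` T)" for T
  proof (intro set_eqI iffI)
    fix x assume "x \<in> {x. (1 / \<epsilon>) *\<^sub>R (x - c) \<in> T}"
    moreover have "x = c + \<epsilon> *\<^sub>R ((1 / \<epsilon>) *\<^sub>R (x - c))" using assms by simp
    ultimately show "x \<in> (+) c ` ((*\<^sub>R) \<epsilon> ` T)" by blast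
  qed (use assms in auto)
  show ?thesis unfolding e closure_translation closure_scaleR ..
qed

text \<open>The estimate for one \<open>\<epsilon>\<close>, with all constants collected in \<open>K\<close>. For fixed \<open>y\<close> the error \<open>R\<close> is
  harmonic in \<open>x\<close>, the singularities at \<open>y\<close> having cancelled. On each part of the boundary, \<open>R\<close> is the
  sum of a function that tends to zero there and of a remainder, which is bounded by a multiple of
  \<open>T(y)\<close> on \<open>\<partial>\<Omega>\<close> and of \<open>T(x)\<close> on the boundaries of the holes. Since \<open>T\<close> is harmonic as well, the maximum
  principle applies to \<open>\<plusminus>R - C T\<close>.\<close>
lemma perforated_green_estimate:
  fixes \<Omega> :: "'a::euclidean_space set" and c :: "nat \<Rightarrow> 'a" and \<omega> :: "nat \<Rightarrow> 'a set"
    and G Ge :: "'a \<Rightarrow> 'a \<Rightarrow> real" and g :: "nat \<Rightarrow> 'a \<Rightarrow> 'a \<Rightarrow> real" and P :: "nat \<Rightarrow> 'a \<Rightarrow> real"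
  defines "n \<equiv> DIM('a)"
  assumes dim: "DIM('a) > 2"
    and \<Omega>: "open \<Omega>" "bounded \<Omega>" and c: "\<And>j. j \<in> {1..N} \<Longrightarrow> c j \<in> \<Omega>"
    and G: "green_function \<Omega> G"
    and \<omega>: "\<And>j. j \<in> {1..N} \<Longrightarrow> closure (\<omega> j) \<subseteq> cball 0 1" "\<And>j. j \<in> {1..N} \<Longrightarrow> 0 \<in> interior (closure (\<omega> j))"
    and g: "\<And>j. j \<in> {1..N} \<Longrightarrow> green_function (- closure (\<omega> j)) (g j)"
    and P: "\<And>j. j \<in> {1..N} \<Longrightarrow> capacitary_potential (\<omega> j) (P j)"
    and \<epsilon>: "0 < \<epsilon>" "\<epsilon> \<le> 1" "\<epsilon> \<le> \<rho> / 12" "2 * \<epsilon> < 1 / K"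
    and D_def: "D = \<Omega> - (\<Union>j\<in>{1..N}. {x. (1 / \<epsilon>) *\<^sub>R (x - c j) \<in> closure (\<omega> j)})"
    and Ge: "green_function D Ge"
    and K: "K \<ge> 1" and \<rho>: "0 < \<rho>" "\<rho> \<le> 1"
    and sep: "\<And>j k. j \<in> {1..N} \<Longrightarrow> k \<in> {1..N} \<Longrightarrow> j \<noteq> k \<Longrightarrow> \<rho> \<le> norm (c j - c k)"
    and bdry_dist: "\<And>j z. j \<in> {1..N} \<Longrightarrow> z \<in> frontier \<Omega> \<Longrightarrow> 1 \<le> norm (z - c j)"
    and H: "H = regular_part G"
    and H_bound: "\<And>j x y. j \<in> {1..N} \<Longrightarrow> y \<in> \<Omega> \<Longrightarrow> x \<in> ball (c j) (1 / K) \<Longrightarrow> \<bar>H x y\<bar> \<le> K"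
    and H_lip: "\<And>j x y. j \<in> {1..N} \<Longrightarrow> y \<in> \<Omega> \<Longrightarrow> x \<in> ball (c j) (1 / K) \<Longrightarrow>
        \<bar>H x y - H (c j) y\<bar> \<le> K * norm (x - c j)"
    and G_bound: "\<And>j k. j \<in> {1..N} \<Longrightarrow> k \<in> {1..N} \<Longrightarrow> j \<noteq> k \<Longrightarrow> \<bar>G (c j) (c k)\<bar> \<le> K"
    and G_lip: "\<And>j k x. j \<in> {1..N} \<Longrightarrow> k \<in> {1..N} \<Longrightarrow> j \<noteq> k \<Longrightarrow> x \<in> ball (c k) (1 / K) \<Longrightarrow> \<rho> / 2 \<le> norm (x - c j) \<Longrightarrow>
        norm (x - c k) \<le> \<rho> / 2 \<Longrightarrow> \<bar>G (c k) (c j) - G x (c j)\<bar> \<le> K * norm (x - c k)"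
    and cap: "\<And>j. j \<in> {1..N} \<Longrightarrow> \<bar>cap j\<bar> \<le> K"
    and diam: "\<And>j y. j \<in> {1..N} \<Longrightarrow> y \<in> \<Omega> \<Longrightarrow> norm (y - c j) \<le> K"
    and far: "\<And>j x y. j \<in> {1..N} \<Longrightarrow> \<rho> / 2 \<le> norm (x - c j) \<Longrightarrow> x \<noteq> y \<Longrightarrow>
     (1 / \<epsilon>) *\<^sub>R (x - c j) \<notin> closure (\<omega> j) \<Longrightarrow> (1 / \<epsilon>) *\<^sub>R (y - c j) \<notin> closure (\<omega> j) \<Longrightarrow>
     \<bar>fundamental_solution (x - y) - 1 / \<epsilon> ^ (n - 2) * g j ((1 / \<epsilon>) *\<^sub>R (x - c j)) ((1 / \<epsilon>) *\<^sub>R (y - c j))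
        - fundamental_solution (x - c j) * P j ((1 / \<epsilon>) *\<^sub>R (y - c j))\<bar> \<le> K * \<epsilon> * P j ((1 / \<epsilon>) *\<^sub>R (y - c j)) \<and>
     \<bar>P j ((1 / \<epsilon>) *\<^sub>R (x - c j)) - \<epsilon> ^ (n - 2) * cap j * fundamental_solution (x - c j)\<bar> \<le> K * \<epsilon> ^ (n - 1) \<and>
     P j ((1 / \<epsilon>) *\<^sub>R (x - c j)) \<le> K * \<epsilon> ^ (n - 2)"
    and C: "C = real N * (K + K * K * K ^ (n - 2) + 2 * (K * K))
        + (4 * K + K * K * K + real N * (3 * K + K * (2 * K + real N * K) + K * K * K)) * 2 ^ (n - 2)"
    and x0: "x0 \<in> D" and y: "y \<in> D" and xy: "x0 \<noteq> y"
  shows "\<bar>Ge x0 y - (G x0 y + (\<Sum>j=1..N. 1 / \<epsilon> ^ (n - 2) * g j ((1 / \<epsilon>) *\<^sub>R (x0 - c j)) ((1 / \<epsilon>) *\<^sub>R (y - c j))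
       - fundamental_solution (x0 - y)
       + (H (c j) y * P j ((1 / \<epsilon>) *\<^sub>R (x0 - c j))
            + H x0 (c j) * P j ((1 / \<epsilon>) *\<^sub>R (y - c j))
            - H (c j) (c j) * P j ((1 / \<epsilon>) *\<^sub>R (x0 - c j)) * P j ((1 / \<epsilon>) *\<^sub>R (y - c j))
            - \<epsilon> ^ (n - 2) * cap j * H x0 (c j) * H (c j) y)
       + (\<Sum>i\<in>{1..N} - {j}. G (c j) (c i) * P j ((1 / \<epsilon>) *\<^sub>R (x0 - c j)) * P i ((1 / \<epsilon>) *\<^sub>R (y - c i)))))\<bar>
     \<le> 2 * C * (\<Sum>j=1..N. \<epsilon> ^ (n - 1) / (min (norm (x0 - c j)) (norm (y - c j))) ^ (n - 2))"
proof -
  let ?J = "{1..N}"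
  let ?F = "fundamental_solution :: 'a \<Rightarrow> real"
  have n2: "n > 2" using dim by (simp add: n_def)
  have \<kappa>: "fund_coeff n > 0" by (rule fund_coeff_pos[OF n2])
  define \<xi> where "\<xi> j x = (1 / \<epsilon>) *\<^sub>R (x - c j)" for j x
  define p where "p j x = P j (\<xi> j x)" for j x
  define a where "a j = P j (\<xi> j y)" for j
  define gt where "gt j x = 1 / \<epsilon> ^ (n - 2) * g j (\<xi> j x) (\<xi> j y)" for j x
  define S where "S j = (\<Sum>i\<in>?J - {j}. G (c j) (c i) * a i)" for j
  define h where "h j = H (c j) y" for j
  define hh where "hh j = H (c j) (c j)" for j
  \<comment> \<open>The terms of the formula that are regular at \<open>y\<close>; \<open>H(x,O\<^sub>j)\<close> is spelled out, so that harmonicity in \<open>x\<close>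
    can be read off.\<close>
  define q where "q j x = h j * p j x + (?F (x - c j) - G x (c j)) * a j - hh j * p j x * a j
      - \<epsilon> ^ (n - 2) * cap j * (?F (x - c j) - G x (c j)) * h j + p j x * S j" for j x
  define A where "A j x = gt j x - ?F (x - y) + q j x" for j x
  define R where "R x = Ge x y - (G x y + (\<Sum>j\<in>?J. A j x))" for x
  define T where "T x = (\<Sum>j\<in>?J. \<epsilon> ^ (n - 1) / fund_coeff n * ?F (x - c j))" for x
  have T_eq: "T x = (\<Sum>j\<in>?J. \<epsilon> ^ (n - 1) / norm (x - c j) ^ (n - 2))" for x
    unfolding T_def using \<kappa> by (simp add: fundamental_solution_eq n_def)
  have T_term: "\<epsilon> ^ (n - 1) / norm (x - c j) ^ (n - 2) \<le> T x" if "j \<in> ?J" for j x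
    unfolding T_eq using that \<epsilon> by (intro member_le_sum) auto
  have D: "open D"
  proof -
    have "closed {x. (1 / \<epsilon>) *\<^sub>R (x - c j) \<in> closure (\<omega> j)}" for j
      unfolding closure_scaled_set[OF \<epsilon>(1), symmetric] by simp
    then show ?thesis unfolding D_def using \<Omega>(1) by (intro open_Diff closed_UN) auto
  qed
  have D\<Omega>: "D \<subseteq> \<Omega>" by (auto simp: D_def)
  have Db: "bounded D" using bounded_subset[OF \<Omega>(2) D\<Omega>] .
  have \<xi>D: "\<xi> j x \<notin> closure (\<omega> j)" if "j \<in> ?J" "x \<in> D" for j x using that by (auto simp: D_def \<xi>_def)
  have y\<Omega>: "y \<in> \<Omega>" using y D\<Omega> by blast
  have cD: "c j \<notin> D" if "j \<in> ?J" for j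
  proof
    assume "c j \<in> D"
    from \<xi>D[OF that this] have "0 \<notin> closure (\<omega> j)" by (simp add: \<xi>_def)
    then show False using \<omega>(2)[OF that] interior_subset by blast
  qed
  have fr\<omega>: "frontier (\<omega> j) \<subseteq> cball 0 1" if "j \<in> ?J" for j
    using \<omega>(1)[OF that] unfolding frontier_def by blast
  note Pb = capacitary_potential_bounds[OF dim P fr\<omega> \<omega>(2)]
  have pb: "0 \<le> p j x" "p j x \<le> 1" if "j \<in> ?J" "x \<in> D" for j x
    using Pb(1,2)[OF that(1) that(1) that(1) \<xi>D[OF that]] by (simp_all add: p_def)
  have ab: "0 \<le> a j" "a j \<le> 1" "\<epsilon> * a j \<le> \<epsilon> ^ (n - 1) / norm (y - c j) ^ (n - 2)" if "j \<in> ?J" for j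
  proof -
    show "0 \<le> a j" "a j \<le> 1" using Pb(1,2)[OF that that that \<xi>D[OF that y]] by (simp_all add: a_def)
    have "a j \<le> 1 / norm (\<xi> j y) ^ (n - 2)"
      using Pb(3)[OF that that that \<xi>D[OF that y]] by (simp add: a_def n_def)
    also have "\<dots> = \<epsilon> ^ (n - 2) / norm (y - c j) ^ (n - 2)"
      using \<epsilon> by (simp add: \<xi>_def power_divide)
    finally have "\<epsilon> * a j \<le> \<epsilon> * (\<epsilon> ^ (n - 2) / norm (y - c j) ^ (n - 2))"
      using \<epsilon> by (intro mult_left_mono) auto
    also have "\<epsilon> * (\<epsilon> ^ (n - 2) / norm (y - c j) ^ (n - 2)) = \<epsilon> ^ (n - 1) / norm (y - c j) ^ (n - 2)"
    proof -
      have "n - 1 = Suc (n - 2)" using n2 by simp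
      then show ?thesis by simp
    qed
    finally show "\<epsilon> * a j \<le> \<epsilon> ^ (n - 1) / norm (y - c j) ^ (n - 2)" .
  qed
  have \<epsilon>a: "\<epsilon> * a j \<le> T y" if "j \<in> ?J" for j using ab(3)[OF that] T_term[OF that, of y] by linarith
  have \<epsilon>sa: "\<epsilon> * (\<Sum>i\<in>?J. a i) \<le> T y" unfolding T_eq sum_distrib_left by (intro sum_mono ab(3))
  have \<epsilon>n: "\<epsilon> ^ (n - 2) \<le> \<epsilon>"
    using power_decreasing[of 1 "n - 2" \<epsilon>] \<epsilon> n2 by simp
  have cK: "c j \<in> ball (c j) (1 / K)" for j using K by simp
  have hb: "\<bar>h j\<bar> \<le> K" "\<bar>hh j\<bar> \<le> K" if "j \<in> ?J" for j
    using H_bound[OF that _ cK] y\<Omega> c[OF that] by (auto simp: h_def hh_def)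
  have Sb: "\<bar>S j\<bar> \<le> K * (\<Sum>i\<in>?J. a i)" if j: "j \<in> ?J" for j
  proof -
    have "\<bar>S j\<bar> \<le> (\<Sum>i\<in>?J - {j}. \<bar>G (c j) (c i) * a i\<bar>)" unfolding S_def by (rule sum_abs)
    also have "\<dots> \<le> (\<Sum>i\<in>?J - {j}. K * a i)"
      using G_bound[OF j] ab(1) by (intro sum_mono) (auto simp: abs_mult intro!: mult_right_mono)
    also have "\<dots> \<le> (\<Sum>i\<in>?J. K * a i)"
      using K ab(1) by (intro sum_mono2) auto
    finally show ?thesis by (simp add: sum_distrib_left)
  qed
  have Sb': "\<bar>S j\<bar> \<le> K * real N" if j: "j \<in> ?J" for j
  proof -
    have "(\<Sum>i\<in>?J. a i) \<le> real (card ?J) * 1" by (intro sum_bounded_above ab(2))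
    then have "K * (\<Sum>i\<in>?J. a i) \<le> K * real N" using K by simp
    then show ?thesis using Sb[OF j] by linarith
  qed
  have far': "\<bar>?F (x - y) - gt j x - ?F (x - c j) * a j\<bar> \<le> K * \<epsilon> * a j"
      "\<bar>p j x - \<epsilon> ^ (n - 2) * cap j * ?F (x - c j)\<bar> \<le> K * \<epsilon> ^ (n - 1)" "p j x \<le> K * \<epsilon>"
    if "j \<in> ?J" "x \<in> D" "x \<noteq> y" "\<rho> / 2 \<le> norm (x - c j)" for j x
  proof -
    note f = far[OF that(1,4,3) \<xi>D[OF that(1,2), unfolded \<xi>_def] \<xi>D[OF that(1) y, unfolded \<xi>_def]]
    show "\<bar>?F (x - y) - gt j x - ?F (x - c j) * a j\<bar> \<le> K * \<epsilon> * a j"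
      "\<bar>p j x - \<epsilon> ^ (n - 2) * cap j * ?F (x - c j)\<bar> \<le> K * \<epsilon> ^ (n - 1)"
      using f by (simp_all add: gt_def a_def p_def \<xi>_def)
    have "p j x \<le> K * \<epsilon> ^ (n - 2)" using f by (simp add: p_def \<xi>_def)
    also have "\<dots> \<le> K * \<epsilon>" using \<epsilon>n K by simp
    finally show "p j x \<le> K * \<epsilon>" .
  qed
  have Hoff: "H x w = ?F (x - w) - G x w" if "x \<noteq> w" for x w using that by (simp add: H regular_part_def)
  define C1 where "C1 = real N * (K + K * K * K ^ (n - 2) + 2 * (K * K))"
  define C2 where "C2 = 4 * K + K * K * K + real N * (3 * K + K * (2 * K + real N * K) + K * K * K)"
  have CC: "C = C1 + C2 * 2 ^ (n - 2)" "C1 \<ge> 0" "C2 \<ge> 0" unfolding C C1_def C2_def using K by auto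
  have T0: "T x \<ge> 0" for x unfolding T_eq using \<epsilon> by (intro sum_nonneg) auto
  \<comment> \<open>The part of \<open>R\<close> that vanishes on \<open>\<partial>\<Omega>\<close>.\<close>
  define w1 where "w1 x = Ge x y - G x y + (\<Sum>j\<in>?J. G x (c j) * a j - \<epsilon> ^ (n - 2) * cap j * G x (c j) * h j)" for x
  have outer: "\<bar>R x - w1 x\<bar> \<le> C1 * T y"
    if x: "x \<in> D" "x \<noteq> y" and xf: "\<And>j. j \<in> ?J \<Longrightarrow> \<rho> / 2 \<le> norm (x - c j)" for x
  proof -
    define E where "E j = A j x + (G x (c j) * a j - \<epsilon> ^ (n - 2) * cap j * G x (c j) * h j)" for j
    have "R x - w1 x = - (\<Sum>j\<in>?J. E j)"
      unfolding R_def w1_def E_def sum.distrib by simp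
    moreover have "\<bar>\<Sum>j\<in>?J. E j\<bar> \<le> (\<Sum>j\<in>?J. (K + K * K * K ^ (n - 2) + 2 * (K * K)) * T y)"
    proof (rule order_trans[OF sum_abs sum_mono])
      fix j assume j: "j \<in> ?J"
      note f = far'[OF j x xf[OF j]]
      have e: "E j = - (?F (x - y) - gt j x - ?F (x - c j) * a j)
          + h j * (p j x - \<epsilon> ^ (n - 2) * cap j * ?F (x - c j)) + p j x * (S j - hh j * a j)"
        unfolding E_def A_def q_def by (simp add: algebra_simps)
      have 1: "\<bar>?F (x - y) - gt j x - ?F (x - c j) * a j\<bar> \<le> K * T y"
      proof -
        have "K * (\<epsilon> * a j) \<le> K * T y" using \<epsilon>a[OF j] K by (intro mult_left_mono) auto
        then show ?thesis using f(1) unfolding mult.assoc by linarith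
      qed
      have "\<bar>h j * (p j x - \<epsilon> ^ (n - 2) * cap j * ?F (x - c j))\<bar> \<le> K * (K * \<epsilon> ^ (n - 1))"
        unfolding abs_mult using hb(1)[OF j] f(2) K by (intro mult_mono) auto
      also have "\<dots> \<le> K * (K * (K ^ (n - 2) * T y))"
      proof -
        have yc: "norm (y - c j) > 0" using y cD[OF j] by auto
        have "norm (y - c j) ^ (n - 2) \<le> K ^ (n - 2)" using diam[OF j y\<Omega>] by (intro power_mono) auto
        then have "\<epsilon> ^ (n - 1) \<le> K ^ (n - 2) * (\<epsilon> ^ (n - 1) / norm (y - c j) ^ (n - 2))"
          using yc \<epsilon> by (simp add: field_simps mult_right_mono)
        also have "\<dots> \<le> K ^ (n - 2) * T y" using T_term[OF j, of y] K by (intro mult_left_mono) auto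
        finally show ?thesis using K by (intro mult_left_mono) auto
      qed
      finally have 2: "\<bar>h j * (p j x - \<epsilon> ^ (n - 2) * cap j * ?F (x - c j))\<bar> \<le> K * K * K ^ (n - 2) * T y"
        by (simp add: mult_ac)
      have "\<bar>S j - hh j * a j\<bar> \<le> K * (\<Sum>i\<in>?J. a i) + K * a j"
      proof -
        have "\<bar>hh j * a j\<bar> \<le> K * a j"
          unfolding abs_mult using hb(2)[OF j] ab(1)[OF j] by (simp add: mult_right_mono)
        then show ?thesis using Sb[OF j] by linarith
      qed
      then have "\<bar>p j x * (S j - hh j * a j)\<bar> \<le> K * \<epsilon> * (K * (\<Sum>i\<in>?J. a i) + K * a j)"
        unfolding abs_mult using f(3) pb(1)[OF j x(1)] K \<epsilon> by (intro mult_mono) auto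
      also have "\<dots> = K * K * (\<epsilon> * (\<Sum>i\<in>?J. a i)) + K * K * (\<epsilon> * a j)" by (simp add: algebra_simps)
      also have "\<dots> \<le> K * K * T y + K * K * T y"
        using \<epsilon>sa \<epsilon>a[OF j] K by (intro add_mono mult_left_mono) auto
      finally have 3: "\<bar>p j x * (S j - hh j * a j)\<bar> \<le> 2 * (K * K) * T y" by simp
      show "\<bar>E j\<bar> \<le> (K + K * K * K ^ (n - 2) + 2 * (K * K)) * T y"
        unfolding e using 1 2 3 by (simp add: distrib_right abs_le_iff)
    qed
    ultimately show ?thesis by (simp add: C1_def mult.assoc)
  qed
  \<comment> \<open>The part of \<open>R\<close> that vanishes on the boundary of the hole \<open>k\<close>.\<close>
  define w2 where "w2 k x = Ge x y - gt k x - (p k x - 1) * (h k - hh k * a k + S k)" for k x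
  have inner: "\<bar>R x - w2 k x\<bar> \<le> C2 * 2 ^ (n - 2) * T x"
    if k: "k \<in> ?J" and x: "x \<in> D" "x \<noteq> y" and xk: "norm (x - c k) < 2 * \<epsilon>" for x k
  proof -
    have xb: "x \<in> ball (c k) (1 / K)" using xk \<epsilon>(4) by (simp add: dist_norm norm_minus_commute)
    have x\<Omega>: "x \<in> \<Omega>" using x D\<Omega> by blast
    have xc: "x \<noteq> c j" if "j \<in> ?J" for j using x cD[OF that] by blast
    have xf: "\<rho> / 2 \<le> norm (x - c j)" if "j \<in> ?J" "j \<noteq> k" for j
    proof -
      have "norm (c j - c k) \<le> norm (x - c k) + norm (x - c j)"
        using norm_triangle_ineq4[of "x - c k" "x - c j"] by simp
      then show ?thesis using sep[OF that(1) k that(2)] xk \<epsilon>(3) \<rho> by linarith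
    qed
    define hx where "hx j = ?F (x - c j) - G x (c j)" for j
    have hxH: "hx j = H x (c j)" if "j \<in> ?J" for j using Hoff[OF xc[OF that]] by (simp add: hx_def)
    have hxb: "\<bar>hx j\<bar> \<le> K" if "j \<in> ?J" for j
      unfolding hxH[OF that] by (rule H_bound[OF k c[OF that] xb])
    \<comment> \<open>The sum \<open>S k\<close> contained in the \<open>k\<close>-th term of the formula is distributed over the other holes: it
      cancels the values \<open>G(x,O\<^sub>j) P\<^sub>j(y)\<close> there, up to the variation of \<open>G(\<cdot>,O\<^sub>j)\<close> near \<open>O\<^sub>k\<close>.\<close>
    define E where "E j = A j x + G (c k) (c j) * a j" for j
    define E0 where "E0 = h k - H x y + (hx k - hh k) * a k - \<epsilon> ^ (n - 2) * cap k * hx k * h k"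
    have "R x - w2 k x = - (E0 + (\<Sum>j\<in>?J - {k}. E j))"
    proof -
      have "(\<Sum>j\<in>?J. A j x) = A k x + (\<Sum>j\<in>?J - {k}. A j x)" using k by (simp add: sum.remove)
      moreover have "(\<Sum>j\<in>?J - {k}. E j) = (\<Sum>j\<in>?J - {k}. A j x) + S k"
        unfolding E_def sum.distrib S_def ..
      moreover have "G x y = ?F (x - y) - H x y" using Hoff[OF x(2)] by simp
      ultimately show ?thesis
        unfolding R_def w2_def E0_def A_def[of k] q_def hx_def by (simp add: algebra_simps)
    qed
    moreover have "\<bar>E0\<bar> \<le> (4 * K + K * K * K) * \<epsilon>"
    proof -
      have "\<bar>h k - H x y\<bar> \<le> K * norm (x - c k)"
        using H_lip[OF k y\<Omega> xb] by (simp add: h_def abs_minus_commute)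
      also have "\<dots> \<le> K * (2 * \<epsilon>)" using xk K by (intro mult_left_mono) auto
      finally have 1: "\<bar>h k - H x y\<bar> \<le> 2 * K * \<epsilon>" by simp
      have "\<bar>hx k - hh k\<bar> \<le> K * norm (x - c k)"
        using H_lip[OF k c[OF k] xb] by (simp add: hxH[OF k] hh_def)
      also have "\<dots> \<le> K * (2 * \<epsilon>)" using xk K by (intro mult_left_mono) auto
      finally have "\<bar>(hx k - hh k) * a k\<bar> \<le> K * (2 * \<epsilon>) * 1"
        unfolding abs_mult using ab(1,2)[OF k] K \<epsilon> by (intro mult_mono) auto
      then have 2: "\<bar>(hx k - hh k) * a k\<bar> \<le> 2 * K * \<epsilon>" by simp
      have "\<bar>\<epsilon> ^ (n - 2) * cap k * hx k * h k\<bar> \<le> \<epsilon> * K * K * K"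
        unfolding abs_mult using \<epsilon>n \<epsilon> cap[OF k] hxb[OF k] hb(1)[OF k] K
        by (intro mult_mono) auto
      then have 3: "\<bar>\<epsilon> ^ (n - 2) * cap k * hx k * h k\<bar> \<le> K * K * K * \<epsilon>" by (simp add: mult_ac)
      show ?thesis unfolding E0_def using 1 2 3 by (simp add: distrib_right abs_le_iff)
    qed
    moreover have "\<bar>\<Sum>j\<in>?J - {k}. E j\<bar> \<le> real N * ((3 * K + K * (2 * K + real N * K) + K * K * K) * \<epsilon>)"
    proof -
      have "\<bar>\<Sum>j\<in>?J - {k}. E j\<bar> \<le> (\<Sum>j\<in>?J - {k}. (3 * K + K * (2 * K + real N * K) + K * K * K) * \<epsilon>)"
      proof (rule order_trans[OF sum_abs sum_mono])
        fix j assume "j \<in> ?J - {k}"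
        then have j: "j \<in> ?J" and jk: "j \<noteq> k" by auto
        note f = far'[OF j x xf[OF j jk]]
        have e: "E j = - (?F (x - y) - gt j x - ?F (x - c j) * a j) + (G (c k) (c j) - G x (c j)) * a j
            + p j x * (h j - hh j * a j + S j) - \<epsilon> ^ (n - 2) * cap j * hx j * h j"
          unfolding E_def A_def q_def hx_def by (simp add: algebra_simps)
        have "K * \<epsilon> * a j \<le> K * \<epsilon> * 1" using ab(2)[OF j] K \<epsilon> by (intro mult_left_mono) auto
        then have 1: "\<bar>?F (x - y) - gt j x - ?F (x - c j) * a j\<bar> \<le> K * \<epsilon>" using f(1) by linarith
        have "norm (x - c k) \<le> \<rho> / 2" using xk \<epsilon>(3) \<rho> by linarith
        then have "\<bar>G (c k) (c j) - G x (c j)\<bar> \<le> K * norm (x - c k)"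
          by (rule G_lip[OF j k jk xb xf[OF j jk]])
        also have "\<dots> \<le> K * (2 * \<epsilon>)" using xk K by (intro mult_left_mono) auto
        finally have "\<bar>(G (c k) (c j) - G x (c j)) * a j\<bar> \<le> K * (2 * \<epsilon>) * 1"
          unfolding abs_mult using ab(1,2)[OF j] K \<epsilon> by (intro mult_mono) auto
        then have 2: "\<bar>(G (c k) (c j) - G x (c j)) * a j\<bar> \<le> 2 * K * \<epsilon>" by simp
        have "\<bar>h j - hh j * a j + S j\<bar> \<le> 2 * K + real N * K"
        proof -
          have "\<bar>hh j * a j\<bar> \<le> K * 1"
            unfolding abs_mult using hb(2)[OF j] ab(1,2)[OF j] K by (intro mult_mono) auto
          then show ?thesis using hb(1)[OF j] Sb'[OF j] by (simp add: mult.commute)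
        qed
        then have "\<bar>p j x * (h j - hh j * a j + S j)\<bar> \<le> K * \<epsilon> * (2 * K + real N * K)"
          unfolding abs_mult using f(3) pb(1)[OF j x(1)] K \<epsilon> by (intro mult_mono) auto
        then have 3: "\<bar>p j x * (h j - hh j * a j + S j)\<bar> \<le> K * (2 * K + real N * K) * \<epsilon>" by (simp add: mult_ac)
        have "\<bar>\<epsilon> ^ (n - 2) * cap j * hx j * h j\<bar> \<le> \<epsilon> * K * K * K"
          unfolding abs_mult using \<epsilon>n \<epsilon> cap[OF j] hxb[OF j] hb(1)[OF j] K
          by (intro mult_mono) auto
        then have 4: "\<bar>\<epsilon> ^ (n - 2) * cap j * hx j * h j\<bar> \<le> K * K * K * \<epsilon>" by (simp add: mult_ac)
        have "\<bar>u1\<bar> \<le> b1 \<Longrightarrow> \<bar>u2\<bar> \<le> 2 * b1 \<Longrightarrow> \<bar>u3\<bar> \<le> b3 \<Longrightarrow> \<bar>u4\<bar> \<le> b4 \<Longrightarrow> \<bar>- u1 + u2 + u3 - u4\<bar> \<le> 3 * b1 + b3 + b4"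
          for u1 u2 u3 u4 b1 b3 b4 :: real by linarith
        from this[OF 1 _ 3 4, of "(G (c k) (c j) - G x (c j)) * a j"] 2
        have "\<bar>E j\<bar> \<le> 3 * (K * \<epsilon>) + K * (2 * K + real N * K) * \<epsilon> + K * K * K * \<epsilon>" unfolding e by simp
        then show "\<bar>E j\<bar> \<le> (3 * K + K * (2 * K + real N * K) + K * K * K) * \<epsilon>"
          by (simp only: distrib_right mult.assoc)
      qed
      also have "\<dots> = real (card (?J - {k})) * ((3 * K + K * (2 * K + real N * K) + K * K * K) * \<epsilon>)" by simp
      also have "\<dots> \<le> real N * ((3 * K + K * (2 * K + real N * K) + K * K * K) * \<epsilon>)"
        using k K \<epsilon> by (intro mult_right_mono) auto
      finally show ?thesis .
    qed
    ultimately have "\<bar>R x - w2 k x\<bar> \<le> (4 * K + K * K * K) * \<epsilon> + real N * ((3 * K + K * (2 * K + real N * K) + K * K * K) * \<epsilon>)"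
      by (simp only: abs_minus_cancel)
    also have "\<dots> = C2 * \<epsilon>" by (simp add: C2_def distrib_right)
    also have "\<dots> \<le> C2 * (2 ^ (n - 2) * T x)"
    proof (rule mult_left_mono[OF _ CC(3)])
      have pos: "norm (x - c k) > 0" using xc[OF k] by simp
      have "norm (x - c k) ^ (n - 2) \<le> (2 * \<epsilon>) ^ (n - 2)" using xk by (intro power_mono) auto
      then have "\<epsilon> ^ (n - 1) / (2 * \<epsilon>) ^ (n - 2) \<le> \<epsilon> ^ (n - 1) / norm (x - c k) ^ (n - 2)"
        using \<epsilon> pos by (intro divide_left_mono mult_pos_pos zero_less_power) auto
      also have "\<dots> \<le> T x" by (rule T_term[OF k])
      finally have "2 ^ (n - 2) * (\<epsilon> ^ (n - 1) / (2 * \<epsilon>) ^ (n - 2)) \<le> 2 ^ (n - 2) * T x"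
        by (intro mult_left_mono) auto
      moreover have "2 ^ (n - 2) * (\<epsilon> ^ (n - 1) / (2 * \<epsilon>) ^ (n - 2)) = \<epsilon>"
      proof -
        have "n - 1 = Suc (n - 2)" using n2 by simp
        then show ?thesis using \<epsilon> by (simp add: power_mult_distrib)
      qed
      ultimately show "\<epsilon> \<le> 2 ^ (n - 2) * T x" by simp
    qed
    finally show ?thesis by (simp add: mult.assoc)
  qed
  have oy: "open (D - {y})" using D by (simp add: open_delete)
  note gGe = green_functionD[OF Ge y D] and gG = green_functionD[OF G y\<Omega> \<Omega>(1)]
  have aff: "continuous_on UNIV (\<xi> j)" for j unfolding \<xi>_def by (intro continuous_intros)
  have \<xi>_ne: "\<xi> j x \<noteq> \<xi> j w" if "x \<noteq> w" for j x w using that \<epsilon> by (simp add: \<xi>_def)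
  have F_harm: "harmonic_in (D - {y}) (\<lambda>x. ?F (x - y))"
    by (rule fundamental_solution_harmonic_in[OF dim]) simp
  have Fc_harm: "harmonic_in D (\<lambda>x. ?F (x - c j))" if "j \<in> ?J" for j
    by (rule fundamental_solution_harmonic_in[OF dim cD[OF that]])
  have p_harm: "harmonic_in D (p j)" if j: "j \<in> ?J" for j
    unfolding p_def \<xi>_def
    by (rule harmonic_in_scale_shift[of "- closure (\<omega> j)"])
      (use P[OF j] \<xi>D[OF j] in \<open>auto simp: capacitary_potential_def \<xi>_def\<close>)
  have Gc_harm: "harmonic_in D (\<lambda>x. G x (c j))" if j: "j \<in> ?J" for j
    by (rule harmonic_in_subset[OF green_functionD(2)[OF G c[OF j] \<Omega>(1)]]) (use D\<Omega> cD[OF j] in auto)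
  have gt_harm: "harmonic_in (D - {y}) (gt j)" if j: "j \<in> ?J" for j
  proof -
    have o: "open (- closure (\<omega> j) - {\<xi> j y})" by (intro open_Diff) auto
    have "harmonic_in (D - {y}) (\<lambda>x. g j ((1 / \<epsilon>) *\<^sub>R (x - c j)) (\<xi> j y))"
    proof (rule harmonic_in_scale_shift[OF o, of "\<lambda>x. g j x (\<xi> j y)"])
      show "harmonic_in (- closure (\<omega> j) - {\<xi> j y}) (\<lambda>x. g j x (\<xi> j y))"
        by (rule green_functionD(2)[OF g[OF j]]) (use \<xi>D[OF j y] in auto)
      show "D - {y} \<subseteq> {x. (1 / \<epsilon>) *\<^sub>R (x - c j) \<in> - closure (\<omega> j) - {\<xi> j y}}"
        using \<xi>D[OF j] \<xi>_ne[of _ y j] by (auto simp: \<xi>_def)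
    qed
    from harmonic_in_cmult[OF oy this] show ?thesis unfolding gt_def \<xi>_def .
  qed
  have q_harm: "harmonic_in D (q j)" if j: "j \<in> ?J" for j
  proof -
    have "harmonic_in D (\<lambda>x. h j * p j x + a j * (?F (x - c j) - G x (c j)) - hh j * a j * p j x
      - \<epsilon> ^ (n - 2) * cap j * h j * (?F (x - c j) - G x (c j)) + S j * p j x)"
      by (intro harmonic_in_add harmonic_in_diff harmonic_in_cmult D p_harm Fc_harm Gc_harm j)
    moreover have "q j = (\<lambda>x. h j * p j x + a j * (?F (x - c j) - G x (c j)) - hh j * a j * p j x
      - \<epsilon> ^ (n - 2) * cap j * h j * (?F (x - c j) - G x (c j)) + S j * p j x)"
      by (simp add: q_def fun_eq_iff mult_ac)
    ultimately show ?thesis by simp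
  qed
  have R_harm: "harmonic_in (D - {y}) R"
    unfolding R_def A_def
    by (intro harmonic_in_diff harmonic_in_add harmonic_in_sum oy gGe(2) gt_harm F_harm
        harmonic_in_subset[OF gG(2)] harmonic_in_subset[OF q_harm]) (use D\<Omega> in auto)
  have T_harm: "harmonic_in (D - {y}) T"
    unfolding T_def
    by (intro harmonic_in_sum harmonic_in_cmult oy harmonic_in_subset[OF Fc_harm]) auto
  have R_pole: "\<exists>B. \<forall>\<^sub>F x in at y. \<bar>R x\<bar> \<le> B"
  proof -
    obtain B1 where B1: "\<forall>\<^sub>F x in at y. \<bar>Ge x y - ?F (x - y)\<bar> \<le> B1"
      using green_function_near_pole[OF dim D Ge y] by blast
    obtain B2 where B2: "\<forall>\<^sub>F x in at y. \<bar>G x y - ?F (x - y)\<bar> \<le> B2"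
      using green_function_near_pole[OF dim \<Omega>(1) G y\<Omega>] by blast
    have "\<exists>B. \<forall>\<^sub>F x in at y. \<bar>A j x\<bar> \<le> B" if j: "j \<in> ?J" for j
    proof -
      have \<eta>: "\<xi> j y \<in> - closure (\<omega> j)" using \<xi>D[OF j y] by simp
      have oj: "open (- closure (\<omega> j))" by auto
      obtain B3 where B3: "\<forall>\<^sub>F \<zeta> in at (\<xi> j y). \<bar>g j \<zeta> (\<xi> j y) - ?F (\<zeta> - \<xi> j y)\<bar> \<le> B3"
        using green_function_near_pole[OF dim oj g[OF j] \<eta>] by blast
      have "filterlim (\<xi> j) (at (\<xi> j y)) (at y)"
        unfolding filterlim_at using aff[of j] \<xi>_ne[of _ y j]
        by (auto simp: continuous_on_eq_continuous_within continuous_at eventually_at_filter)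
      from eventually_compose_filterlim[OF B3 this]
      have ev: "\<forall>\<^sub>F x in at y. \<bar>gt j x - ?F (x - y)\<bar> \<le> B3 / \<epsilon> ^ (n - 2)"
      proof eventually_elim
        case (elim x)
        have e: "\<xi> j x - \<xi> j y = (1 / \<epsilon>) *\<^sub>R (x - y)" by (simp add: \<xi>_def algebra_simps)
        have "?F (\<xi> j x - \<xi> j y) = \<epsilon> ^ (n - 2) * ?F (x - y)"
          unfolding e using \<epsilon> fundamental_solution_scale[of "1 / \<epsilon>" "x - y"] by (simp add: n_def power_divide)
        then have "gt j x - ?F (x - y) = (g j (\<xi> j x) (\<xi> j y) - ?F (\<xi> j x - \<xi> j y)) / \<epsilon> ^ (n - 2)"
          using \<epsilon> by (simp add: gt_def field_simps)
        then show ?case using elim \<epsilon> by (simp add: divide_right_mono)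
      qed
      have "isCont (q j) y" by (rule harmonic_in_isCont[OF D q_harm[OF j] y])
      then have "(q j \<longlongrightarrow> q j y) (at y)" by (simp add: isCont_def)
      then have "\<forall>\<^sub>F x in at y. dist (q j x) (q j y) < 1" by (rule tendstoD) simp
      with ev have "\<forall>\<^sub>F x in at y. \<bar>A j x\<bar> \<le> B3 / \<epsilon> ^ (n - 2) + (\<bar>q j y\<bar> + 1)"
        by eventually_elim (auto simp: A_def dist_real_def)
      then show ?thesis by blast
    qed
    then obtain BA where BA: "\<And>j. j \<in> ?J \<Longrightarrow> \<forall>\<^sub>F x in at y. \<bar>A j x\<bar> \<le> BA j" by metis
    then have "\<forall>\<^sub>F x in at y. \<forall>j\<in>?J. \<bar>A j x\<bar> \<le> BA j" by (intro eventually_ball_finite) auto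
    with B1 B2 have "\<forall>\<^sub>F x in at y. \<bar>R x\<bar> \<le> B1 + B2 + (\<Sum>j\<in>?J. BA j)"
    proof eventually_elim
      case (elim x)
      have "\<bar>\<Sum>j\<in>?J. A j x\<bar> \<le> (\<Sum>j\<in>?J. BA j)"
        by (rule order_trans[OF sum_abs sum_mono]) (use elim(3) in auto)
      then show ?case unfolding R_def using elim(1,2) by linarith
    qed
    then show ?thesis by blast
  qed
  have frD: "z \<in> frontier \<Omega> \<or> (\<exists>k\<in>?J. \<xi> k z \<in> frontier (- closure (\<omega> k)))" if z: "z \<in> frontier D" for z
  proof -
    have zc: "z \<in> closure D" and zn: "z \<notin> D" using z D by (auto simp: frontier_def interior_open)
    show ?thesis
    proof (cases "z \<in> \<Omega>")
      case False
      then show ?thesis using zc closure_mono[OF D\<Omega>] \<Omega>(1) by (auto simp: frontier_def interior_open)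
    next
      case True
      then obtain k where k: "k \<in> ?J" "\<xi> k z \<in> closure (\<omega> k)" using zn by (auto simp: D_def \<xi>_def)
      have "\<xi> k ` closure D \<subseteq> closure (\<xi> k ` D)"
        by (rule image_closure_subset[OF continuous_on_subset[OF aff]]) (auto simp: closure_subset)
      also have "\<dots> \<subseteq> closure (- closure (\<omega> k))" by (rule closure_mono) (use \<xi>D[OF k(1)] in auto)
      finally have "\<xi> k z \<in> closure (- closure (\<omega> k))" using zc by blast
      moreover have "interior (- closure (\<omega> k)) = - closure (\<omega> k)"
        by (rule interior_open) auto
      ultimately have "\<xi> k z \<in> frontier (- closure (\<omega> k))" using k(2) by (simp add: frontier_def)
      then show ?thesis using k(1) by blast
    qed
  qed
  have bound: "s * R x0 - C * T x0 \<le> C * T y" if s: "s = 1 \<or> s = -1" for s :: real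
  proof -
    obtain B where B: "\<forall>\<^sub>F x in at y. \<bar>R x\<bar> \<le> B" using R_pole by blast
    have sR: "s * r \<le> \<bar>r\<bar>" for r :: real using s by auto
    have CT: "0 \<le> C * T x" for x using CC T0[of x] by simp
    show ?thesis
    proof (rule maximum_principle_pole[OF dim D, where u = "\<lambda>x. s * R x - C * T x" and y = y and B = B])
      show "harmonic_in (D - {y}) (\<lambda>x. s * R x - C * T x)"
        by (intro harmonic_in_diff harmonic_in_cmult oy R_harm T_harm)
      show "\<forall>\<^sub>F x in inf at_infinity (principal D). s * R x - C * T x \<le> C * T y + e" for e
        by (rule eventually_bounded_domain[OF Db])
      have "\<forall>\<^sub>F x in at y within D. \<bar>R x\<bar> \<le> B" by (rule filter_leD[OF _ B]) (intro at_le subset_UNIV)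
      then show "\<forall>\<^sub>F x in at y within D. s * R x - C * T x \<le> B"
        by eventually_elim (use sR CT order_trans in \<open>smt (verit)\<close>)
      show "x0 \<in> D" "x0 \<noteq> y" by (fact x0, fact xy)
      fix z e assume z: "z \<in> frontier D" and e: "0 < (e::real)"
      have zy: "z \<noteq> y" using z y D by (auto simp: frontier_def interior_open)
      have inD: "\<forall>\<^sub>F x in at z within D. x \<in> D \<and> x \<noteq> y"
        using tendsto_imp_eventually_ne[OF tendsto_ident_at zy]
        by (auto simp: eventually_at_filter elim: eventually_mono)
      have restr: "(f \<longlongrightarrow> l) (at z within \<Omega>) \<Longrightarrow> (f \<longlongrightarrow> l) (at z within D)" for f :: "'a \<Rightarrow> real" and l
        by (rule tendsto_mono[OF at_le[OF D\<Omega>]])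
      have norm_lim: "((\<lambda>x. norm (x - c j)) \<longlongrightarrow> norm (z - c j)) (at z within D)" for j
        by (intro tendsto_intros)
      from frD[OF z] show "\<forall>\<^sub>F x in at z within D. s * R x - C * T x \<le> C * T y + e"
      proof
        assume z\<Omega>: "z \<in> frontier \<Omega>"
        have "(w1 \<longlongrightarrow> 0 - 0 + (\<Sum>j\<in>?J. 0 * a j - \<epsilon> ^ (n - 2) * cap j * 0 * h j)) (at z within D)"
          unfolding w1_def
          by (intro tendsto_intros gGe(3)[OF z] restr[OF gG(3)[OF z\<Omega>]]
              restr[OF green_functionD(3)[OF G c \<Omega>(1) z\<Omega>]])
        then have "(w1 \<longlongrightarrow> 0) (at z within D)" by simp
        from tendstoD[OF this e] have w: "\<forall>\<^sub>F x in at z within D. \<bar>w1 x\<bar> < e" by (simp add: dist_real_def)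
        have "\<forall>\<^sub>F x in at z within D. \<forall>j\<in>?J. \<rho> / 2 < norm (x - c j)"
        proof (intro eventually_ball_finite ballI)
          fix j assume j: "j \<in> ?J"
          have "\<rho> / 2 < norm (z - c j)" using bdry_dist[OF j z\<Omega>] \<rho> by linarith
          then show "\<forall>\<^sub>F x in at z within D. \<rho> / 2 < norm (x - c j)"
            by (rule order_tendstoD(1)[OF norm_lim])
        qed simp
        with w inD show ?thesis
        proof eventually_elim
          case (elim x)
          have "\<bar>R x - w1 x\<bar> \<le> C1 * T y" using elim(2,3) by (intro outer) (auto simp: less_imp_le)
          also have "C1 * T y \<le> C * T y" using CC T0[of y] by (intro mult_right_mono) auto
          finally have "\<bar>R x\<bar> \<le> C * T y + e" using elim(1) by linarith
          then show ?case using sR[of "R x"] CT[of x] by linarith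
        qed
      next
        assume "\<exists>k\<in>?J. \<xi> k z \<in> frontier (- closure (\<omega> k))"
        then obtain k where k: "k \<in> ?J" and zk: "\<xi> k z \<in> frontier (- closure (\<omega> k))" by blast
        have zf: "\<xi> k z \<in> frontier (\<omega> k)" using zk frontier_complement_closure by blast
        have fl: "filterlim (\<xi> k) (at (\<xi> k z) within - closure (\<omega> k)) (at z within D)"
          unfolding filterlim_at
        proof
          show "\<forall>\<^sub>F x in at z within D. \<xi> k x \<in> - closure (\<omega> k) \<and> \<xi> k x \<noteq> \<xi> k z"
            using \<xi>D[OF k] \<xi>_ne[of _ z k] by (auto simp: eventually_at_filter)
          show "(\<xi> k \<longlongrightarrow> \<xi> k z) (at z within D)" unfolding \<xi>_def by (intro tendsto_intros)
        qed
        have pl: "(P k \<longlongrightarrow> 1) (at (\<xi> k z) within - closure (\<omega> k))"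
          using P[OF k] zf unfolding capacitary_potential_def by blast
        have gl: "((\<lambda>\<zeta>. g k \<zeta> (\<xi> k y)) \<longlongrightarrow> 0) (at (\<xi> k z) within - closure (\<omega> k))"
          by (rule green_functionD(3)[OF g[OF k] _ _ zk]) (use \<xi>D[OF k y] in auto)
        have "(w2 k \<longlongrightarrow> 0 - 1 / \<epsilon> ^ (n - 2) * 0 - (1 - 1) * (h k - hh k * a k + S k)) (at z within D)"
          unfolding w2_def gt_def p_def
          by (intro tendsto_intros gGe(3)[OF z] filterlim_compose[OF pl fl] filterlim_compose[OF gl fl])
        then have "(w2 k \<longlongrightarrow> 0) (at z within D)" by simp
        from tendstoD[OF this e] have w: "\<forall>\<^sub>F x in at z within D. \<bar>w2 k x\<bar> < e" by (simp add: dist_real_def)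
        have "norm (\<xi> k z) \<le> 1" using zf fr\<omega>[OF k] by auto
        moreover have "norm (\<xi> k z) = norm (z - c k) / \<epsilon>" using \<epsilon> by (simp add: \<xi>_def)
        ultimately have "norm (z - c k) < 2 * \<epsilon>" using \<epsilon> by (simp add: divide_le_eq)
        then have "\<forall>\<^sub>F x in at z within D. norm (x - c k) < 2 * \<epsilon>" by (rule order_tendstoD(2)[OF norm_lim])
        with w inD show ?thesis
        proof eventually_elim
          case (elim x)
          have "\<bar>R x - w2 k x\<bar> \<le> C2 * 2 ^ (n - 2) * T x" using elim(2,3) by (intro inner k) auto
          also have "\<dots> \<le> C * T x" using CC T0[of x] by (intro mult_right_mono) auto
          finally have "\<bar>R x\<bar> \<le> C * T x + e" using elim(1) by linarith
          then show ?case using sR[of "R x"] CT[of y] by linarith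
        qed
      qed
    qed
  qed
  have x0c: "x0 \<noteq> c j" "y \<noteq> c j" if "j \<in> ?J" for j using x0 y cD[OF that] by auto
  have "R x0 = Ge x0 y - (G x0 y + (\<Sum>j=1..N. 1 / \<epsilon> ^ (n - 2) * g j ((1 / \<epsilon>) *\<^sub>R (x0 - c j)) ((1 / \<epsilon>) *\<^sub>R (y - c j))
       - fundamental_solution (x0 - y)
       + (H (c j) y * P j ((1 / \<epsilon>) *\<^sub>R (x0 - c j))
            + H x0 (c j) * P j ((1 / \<epsilon>) *\<^sub>R (y - c j))
            - H (c j) (c j) * P j ((1 / \<epsilon>) *\<^sub>R (x0 - c j)) * P j ((1 / \<epsilon>) *\<^sub>R (y - c j))
            - \<epsilon> ^ (n - 2) * cap j * H x0 (c j) * H (c j) y)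
       + (\<Sum>i\<in>{1..N} - {j}. G (c j) (c i) * P j ((1 / \<epsilon>) *\<^sub>R (x0 - c j)) * P i ((1 / \<epsilon>) *\<^sub>R (y - c i)))))"
    unfolding R_def
  proof (intro arg_cong2[of _ _ _ _ "(-)"] arg_cong2[of _ _ _ _ "(+)"] sum.cong refl)
    fix j assume j: "j \<in> ?J"
    have "p j x0 * S j = (\<Sum>i\<in>?J - {j}. G (c j) (c i) * p j x0 * a i)"
      unfolding S_def sum_distrib_left by (intro sum.cong refl) (simp add: mult_ac)
    then show "A j x0 = 1 / \<epsilon> ^ (n - 2) * g j ((1 / \<epsilon>) *\<^sub>R (x0 - c j)) ((1 / \<epsilon>) *\<^sub>R (y - c j))
       - fundamental_solution (x0 - y)
       + (H (c j) y * P j ((1 / \<epsilon>) *\<^sub>R (x0 - c j))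
            + H x0 (c j) * P j ((1 / \<epsilon>) *\<^sub>R (y - c j))
            - H (c j) (c j) * P j ((1 / \<epsilon>) *\<^sub>R (x0 - c j)) * P j ((1 / \<epsilon>) *\<^sub>R (y - c j))
            - \<epsilon> ^ (n - 2) * cap j * H x0 (c j) * H (c j) y)
       + (\<Sum>i\<in>{1..N} - {j}. G (c j) (c i) * P j ((1 / \<epsilon>) *\<^sub>R (x0 - c j)) * P i ((1 / \<epsilon>) *\<^sub>R (y - c i)))"
      unfolding A_def q_def Hoff[OF x0c(1)[OF j]] gt_def h_def hh_def p_def a_def \<xi>_def by simp
  qed
  moreover have "\<bar>R x0\<bar> \<le> C * T x0 + C * T y" using bound[of 1] bound[of "-1"] by (simp add: abs_le_iff)
  moreover have "C * T x0 + C * T y \<le> 2 * C * (\<Sum>j=1..N. \<epsilon> ^ (n - 1) / (min (norm (x0 - c j)) (norm (y - c j))) ^ (n - 2))"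
  proof -
    let ?M = "\<Sum>j=1..N. \<epsilon> ^ (n - 1) / (min (norm (x0 - c j)) (norm (y - c j))) ^ (n - 2)"
    have "T x0 \<le> ?M" "T y \<le> ?M"
      unfolding T_eq using \<epsilon> x0c
      by (intro sum_mono divide_left_mono power_mono mult_pos_pos zero_less_power; simp add: min_def)+
    then have "C * T x0 \<le> C * ?M" "C * T y \<le> C * ?M" using CC by (auto intro!: mult_left_mono)
    then show ?thesis by simp
  qed
  ultimately show ?thesis by linarith
qed

theorem theorem8:
  fixes \<Omega> :: "(real ^ 'n) set"
    and n N :: nat
    and c :: "nat \<Rightarrow> real ^ 'n"
    and \<omega> :: "nat \<Rightarrow> (real ^ 'n) set"
    and \<omega>\<epsilon> :: "real \<Rightarrow> nat \<Rightarrow> (real ^ 'n) set"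
    and \<Omega>\<epsilon> :: "real \<Rightarrow> (real ^ 'n) set"
    and G H :: "real ^ 'n \<Rightarrow> real ^ 'n \<Rightarrow> real"
    and G\<epsilon> A :: "real \<Rightarrow> real ^ 'n \<Rightarrow> real ^ 'n \<Rightarrow> real"
    and g :: "nat \<Rightarrow> real ^ 'n \<Rightarrow> real ^ 'n \<Rightarrow> real"
    and P :: "nat \<Rightarrow> real ^ 'n \<Rightarrow> real"
    and cap :: "nat \<Rightarrow> real"
  assumes n_def: "n = CARD('n)" and n_gt_2: "n > 2"
    and N_pos: "N \<ge> 1"
    and Omega_domain: "open \<Omega>" "connected \<Omega>" "\<Omega> \<noteq> {}" "bounded \<Omega>"
    and points: "\<And>j. j \<in> {1..N} \<Longrightarrow> c j \<in> \<Omega>" "inj_on c {1..N}"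
    and dist_Omega: "setdist (c ` {1..N}) (frontier \<Omega>) = 1"
    and omega_domain: "\<And>j. j \<in> {1..N} \<Longrightarrow>
          open (\<omega> j) \<and> connected (\<omega> j) \<and> bounded (\<omega> j) \<and> 0 \<in> \<omega> j"
    and dist_omega: "\<And>j \<xi>. j \<in> {1..N} \<Longrightarrow> \<xi> \<in> frontier (\<omega> j) \<Longrightarrow> dist 0 \<xi> \<le> 1"
    and omega_eps_def: "\<And>\<epsilon> j. \<omega>\<epsilon> \<epsilon> j = {x. (1 / \<epsilon>) *\<^sub>R (x - c j) \<in> \<omega> j}"
    and Omega_eps_def: "\<And>\<epsilon>. \<Omega>\<epsilon> \<epsilon> = \<Omega> - (\<Union>j\<in>{1..N}. closure (\<omega>\<epsilon> \<epsilon> j))"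
    and green_eps: "\<forall>\<^sub>F \<epsilon> in at_right 0. green_function (\<Omega>\<epsilon> \<epsilon>) (G\<epsilon> \<epsilon>)"
    and green_Omega: "green_function \<Omega> G"
    and green_ext: "\<And>j. j \<in> {1..N} \<Longrightarrow> green_function (- closure (\<omega> j)) (g j)"
    and H_def: "H = regular_part G"
    and potential: "\<And>j. j \<in> {1..N} \<Longrightarrow> capacitary_potential (\<omega> j) (P j)"
    and cap_def: "\<And>j. cap j = capacity_integral (\<omega> j) (P j)"
    and A_def: "\<And>\<epsilon> x y. A \<epsilon> x y =
          G x y
        + 1 / \<epsilon> ^ (n - 2) *
            (\<Sum>j=1..N. g j ((1 / \<epsilon>) *\<^sub>R (x - c j)) ((1 / \<epsilon>) *\<^sub>R (y - c j)))
        - real N / (real (n - 2) * sphere_measure (sphere (0 :: real ^ 'n) 1) * norm (x - y) ^ (n - 2))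
        + (\<Sum>j=1..N.
              H (c j) y * P j ((1 / \<epsilon>) *\<^sub>R (x - c j))
            + H x (c j) * P j ((1 / \<epsilon>) *\<^sub>R (y - c j))
            - H (c j) (c j) * P j ((1 / \<epsilon>) *\<^sub>R (x - c j)) * P j ((1 / \<epsilon>) *\<^sub>R (y - c j))
            - \<epsilon> ^ (n - 2) * cap j * H x (c j) * H (c j) y)
        + (\<Sum>j=1..N. \<Sum>i\<in>{1..N} - {j}.
              G (c j) (c i) * P j ((1 / \<epsilon>) *\<^sub>R (x - c j)) * P i ((1 / \<epsilon>) *\<^sub>R (y - c i)))"
  shows "\<exists>C>0. \<forall>\<^sub>F \<epsilon> in at_right 0.
           (\<forall>x\<in>\<Omega>\<epsilon> \<epsilon>. \<forall>y\<in>\<Omega>\<epsilon> \<epsilon>. x \<noteq> y \<longrightarrow>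
              \<bar>G\<epsilon> \<epsilon> x y - A \<epsilon> x y\<bar> \<le>
                C * (\<Sum>j=1..N. \<epsilon> ^ (n - 1) / (min (norm (x - c j)) (norm (y - c j))) ^ (n - 2)))
         \<and> (\<forall>z w. z \<in> frontier (\<Union>j\<in>{1..N}. \<omega>\<epsilon> \<epsilon> j) \<or> w \<in> frontier (\<Union>j\<in>{1..N}. \<omega>\<epsilon> \<epsilon> j) \<longrightarrow>
              (\<forall>\<^sub>F (x, y) in inf (nhds z) (principal (\<Omega>\<epsilon> \<epsilon>)) \<times>\<^sub>F inf (nhds w) (principal (\<Omega>\<epsilon> \<epsilon>)).
                 x \<noteq> y \<longrightarrow> \<bar>G\<epsilon> \<epsilon> x y - A \<epsilon> x y\<bar> \<le> C * \<epsilon>))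
         \<and> (\<forall>z\<in>frontier \<Omega>. \<forall>w\<in>frontier \<Omega>.
              (\<forall>\<^sub>F (x, y) in inf (nhds z) (principal (\<Omega>\<epsilon> \<epsilon>)) \<times>\<^sub>F inf (nhds w) (principal (\<Omega>\<epsilon> \<epsilon>)).
                 x \<noteq> y \<longrightarrow> \<bar>G\<epsilon> \<epsilon> x y - A \<epsilon> x y\<bar> \<le> C * \<epsilon> ^ (n - 1)))"
proof -
  let ?J = "{1..N}"
  let ?F = "fundamental_solution :: real ^ 'n \<Rightarrow> real"
  have n: "n = DIM(real ^ 'n)" using n_def by simp
  have dim: "DIM(real ^ 'n) > 2" using n n_gt_2 by simp
  have unit: "closure (\<omega> j) \<subseteq> cball 0 1" and zero: "0 \<in> interior (closure (\<omega> j))" if j: "j \<in> ?J" for j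
  proof -
    show "closure (\<omega> j) \<subseteq> cball 0 1"
      by (rule bounded_frontier_in_cball) (use omega_domain[OF j] dist_omega[OF j] in auto)
    show "0 \<in> interior (closure (\<omega> j))"
      using interior_maximal[OF closure_subset] omega_domain[OF j] by blast
  qed
  have bdry: "1 \<le> norm (z - c j)" if "j \<in> ?J" "z \<in> frontier \<Omega>" for j z
    using setdist_le_dist[of "c j" "c ` ?J" z "frontier \<Omega>"] that dist_Omega
    by (simp add: dist_norm norm_minus_commute)
  \<comment> \<open>Each condition on a constant \<open>K\<close> persists when \<open>K\<close> grows; so the finitely many holes can share
    one \<open>K\<close>. The distance \<open>\<rho>\<close> between the centres is therefore written as the inverse of a bound.\<close>
  have "\<exists>K. \<forall>jk\<in>?J \<times> ?J. fst jk \<noteq> snd jk \<longrightarrow> 1 \<le> K * norm (c (fst jk) - c (snd jk))"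
  proof (rule finite_uniform_bound)
    fix jk assume jk: "jk \<in> ?J \<times> ?J"
    show "\<exists>K. fst jk \<noteq> snd jk \<longrightarrow> 1 \<le> K * norm (c (fst jk) - c (snd jk))"
      using points(2) jk by (intro exI[of _ "1 / norm (c (fst jk) - c (snd jk))"]) (auto simp: inj_on_def)
  qed (auto elim!: order_trans intro!: mult_right_mono)
  then obtain K0 where K0: "\<And>j k. j \<in> ?J \<Longrightarrow> k \<in> ?J \<Longrightarrow> j \<noteq> k \<Longrightarrow> 1 \<le> K0 * norm (c j - c k)"
    by fastforce
  define \<rho> where "\<rho> = 1 / max K0 1"
  have \<rho>: "0 < \<rho>" "\<rho> \<le> 1" by (auto simp: \<rho>_def)
  have sep: "\<rho> \<le> norm (c j - c k)" if "j \<in> ?J" "k \<in> ?J" "j \<noteq> k" for j k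
  proof -
    have "1 \<le> max K0 1 * norm (c j - c k)"
      by (rule order_trans[OF K0[OF that]]) (auto intro!: mult_right_mono)
    then show ?thesis by (simp add: \<rho>_def divide_le_eq mult.commute)
  qed
  have "\<exists>K. \<forall>j\<in>?J. 0 < K \<and> (\<forall>y\<in>\<Omega>. \<forall>x\<in>ball (c j) (1 / K). \<bar>H x y\<bar> \<le> K \<and> \<bar>H x y - H (c j) y\<bar> \<le> K * norm (x - c j))"
  proof (rule finite_uniform_bound)
    fix j assume j: "j \<in> ?J"
    obtain r C where rC: "r > 0" "C > 0" "\<And>y x x'. y \<in> \<Omega> \<Longrightarrow> x \<in> ball (c j) r \<Longrightarrow> \<bar>H x y\<bar> \<le> C"
      "\<And>y x x'. y \<in> \<Omega> \<Longrightarrow> x \<in> ball (c j) r \<Longrightarrow> x' \<in> ball (c j) r \<Longrightarrow> \<bar>H x y - H x' y\<bar> \<le> C * norm (x - x')"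
      using regular_part_lipschitz[OF dim Omega_domain(1,4) green_Omega points(1)[OF j]] unfolding H_def by metis
    define K where "K = max C (1 / r)"
    have K: "K > 0" "C \<le> K" "1 / K \<le> r" using rC(1,2) by (auto simp: K_def field_simps max_def)
    have "\<bar>H x y\<bar> \<le> K \<and> \<bar>H x y - H (c j) y\<bar> \<le> K * norm (x - c j)"
      if "y \<in> \<Omega>" "x \<in> ball (c j) (1 / K)" for x y
    proof -
      have x: "x \<in> ball (c j) r" using that(2) K(3) by auto
      have "C * norm (x - c j) \<le> K * norm (x - c j)" using K(2) by (intro mult_right_mono) auto
      then show ?thesis using rC(3)[OF that(1) x] rC(4)[OF that(1) x, of "c j"] rC(1) K(2) by auto
    qed
    then show "\<exists>K>0. \<forall>y\<in>\<Omega>. \<forall>x\<in>ball (c j) (1 / K). \<bar>H x y\<bar> \<le> K \<and> \<bar>H x y - H (c j) y\<bar> \<le> K * norm (x - c j)"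
      using K(1) by blast
  next
    fix j and K K' :: real
    assume Q: "0 < K \<and> (\<forall>y\<in>\<Omega>. \<forall>x\<in>ball (c j) (1 / K). \<bar>H x y\<bar> \<le> K \<and> \<bar>H x y - H (c j) y\<bar> \<le> K * norm (x - c j))"
      and KK: "K \<le> K'"
    have "1 / K' \<le> 1 / K" using Q KK by (intro divide_left_mono) auto
    then have sub: "ball (c j) (1 / K') \<subseteq> ball (c j) (1 / K)" by (rule subset_ball)
    have "\<bar>H x y\<bar> \<le> K' \<and> \<bar>H x y - H (c j) y\<bar> \<le> K' * norm (x - c j)"
      if "y \<in> \<Omega>" "x \<in> ball (c j) (1 / K')" for x y
    proof -
      have "K * norm (x - c j) \<le> K' * norm (x - c j)" using KK by (intro mult_right_mono) auto
      moreover have "x \<in> ball (c j) (1 / K)" using sub that by blast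
      ultimately show ?thesis using Q KK that(1) by (meson order_trans)
    qed
    then show "0 < K' \<and> (\<forall>y\<in>\<Omega>. \<forall>x\<in>ball (c j) (1 / K'). \<bar>H x y\<bar> \<le> K' \<and> \<bar>H x y - H (c j) y\<bar> \<le> K' * norm (x - c j))"
      using Q KK by auto
  qed simp
  then obtain K1 where K1: "\<And>j. j \<in> ?J \<Longrightarrow> 0 < K1"
    "\<And>j x y. j \<in> ?J \<Longrightarrow> y \<in> \<Omega> \<Longrightarrow> x \<in> ball (c j) (1 / K1) \<Longrightarrow> \<bar>H x y\<bar> \<le> K1"
    "\<And>j x y. j \<in> ?J \<Longrightarrow> y \<in> \<Omega> \<Longrightarrow> x \<in> ball (c j) (1 / K1) \<Longrightarrow> \<bar>H x y - H (c j) y\<bar> \<le> K1 * norm (x - c j)"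
    by blast
  have K1pos: "0 < K1" using K1(1)[of 1] N_pos by simp
  have "\<exists>K. \<forall>jk\<in>?J \<times> ?J. \<bar>G (c (fst jk)) (c (snd jk))\<bar> \<le> K"
    by (rule finite_uniform_bound) auto
  then obtain K2 where K2: "\<And>j k. j \<in> ?J \<Longrightarrow> k \<in> ?J \<Longrightarrow> \<bar>G (c j) (c k)\<bar> \<le> K2" by fastforce
  have "\<exists>K. \<forall>j\<in>?J. \<bar>cap j\<bar> \<le> K" by (rule finite_uniform_bound) auto
  then obtain K3 where K3: "\<And>j. j \<in> ?J \<Longrightarrow> \<bar>cap j\<bar> \<le> K3" by blast
  have "\<exists>K. \<forall>j\<in>?J. \<forall>y\<in>\<Omega>. norm (y - c j) \<le> K"
  proof (rule finite_uniform_bound)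
    show "\<exists>K. \<forall>y\<in>\<Omega>. norm (y - c j) \<le> K" for j
      using Omega_domain(4) unfolding bounded_any_center[where a = "c j"] dist_norm by (simp add: norm_minus_commute)
  qed (auto intro: order_trans)
  then obtain K4 where K4: "\<And>j y. j \<in> ?J \<Longrightarrow> y \<in> \<Omega> \<Longrightarrow> norm (y - c j) \<le> K4" by blast
  have Ppos: "0 \<le> P j \<eta>" if "j \<in> ?J" "\<eta> \<notin> closure (\<omega> j)" for j \<eta>
    by (rule capacitary_potential_bounds(1)[OF dim potential[OF that(1)] _ zero[OF that(1)] that(2)])
      (use unit[OF that(1)] in \<open>auto simp: frontier_def\<close>)
  define Far where "Far j K \<longleftrightarrow> (\<forall>\<epsilon> b x y. 0 < \<epsilon> \<longrightarrow> \<epsilon> \<le> \<rho> / 12 \<longrightarrow> \<rho> / 2 \<le> norm (x - b) \<longrightarrow> x \<noteq> y \<longrightarrow>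
     (1 / \<epsilon>) *\<^sub>R (x - b) \<notin> closure (\<omega> j) \<longrightarrow> (1 / \<epsilon>) *\<^sub>R (y - b) \<notin> closure (\<omega> j) \<longrightarrow>
     \<bar>?F (x - y) - 1 / \<epsilon> ^ (n - 2) * g j ((1 / \<epsilon>) *\<^sub>R (x - b)) ((1 / \<epsilon>) *\<^sub>R (y - b))
        - ?F (x - b) * P j ((1 / \<epsilon>) *\<^sub>R (y - b))\<bar> \<le> K * \<epsilon> * P j ((1 / \<epsilon>) *\<^sub>R (y - b)) \<and>
     \<bar>P j ((1 / \<epsilon>) *\<^sub>R (x - b)) - \<epsilon> ^ (n - 2) * cap j * ?F (x - b)\<bar> \<le> K * \<epsilon> ^ (n - 1) \<and>
     P j ((1 / \<epsilon>) *\<^sub>R (x - b)) \<le> K * \<epsilon> ^ (n - 2))" for j K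
  have Far_mono: "Far j K'" if j: "j \<in> ?J" and "Far j K" "K \<le> K'" for j K K'
    unfolding Far_def
  proof (intro allI impI)
    fix \<epsilon> b x y
    assume h: "0 < \<epsilon>" "\<epsilon> \<le> \<rho> / 12" "\<rho> / 2 \<le> norm (x - b)" "x \<noteq> y"
     "(1 / \<epsilon>) *\<^sub>R (x - b) \<notin> closure (\<omega> j)" "(1 / \<epsilon>) *\<^sub>R (y - b) \<notin> closure (\<omega> j)"
    have "K * \<epsilon> * P j ((1 / \<epsilon>) *\<^sub>R (y - b)) \<le> K' * \<epsilon> * P j ((1 / \<epsilon>) *\<^sub>R (y - b))"
      "K * \<epsilon> ^ (n - 1) \<le> K' * \<epsilon> ^ (n - 1)" "K * \<epsilon> ^ (n - 2) \<le> K' * \<epsilon> ^ (n - 2)"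
      using that(3) h(1) Ppos[OF j h(6)] by (auto intro!: mult_right_mono)
    with that(2)[unfolded Far_def, rule_format, OF h]
    show "\<bar>?F (x - y) - 1 / \<epsilon> ^ (n - 2) * g j ((1 / \<epsilon>) *\<^sub>R (x - b)) ((1 / \<epsilon>) *\<^sub>R (y - b))
        - ?F (x - b) * P j ((1 / \<epsilon>) *\<^sub>R (y - b))\<bar> \<le> K' * \<epsilon> * P j ((1 / \<epsilon>) *\<^sub>R (y - b)) \<and>
     \<bar>P j ((1 / \<epsilon>) *\<^sub>R (x - b)) - \<epsilon> ^ (n - 2) * cap j * ?F (x - b)\<bar> \<le> K' * \<epsilon> ^ (n - 1) \<and>
     P j ((1 / \<epsilon>) *\<^sub>R (x - b)) \<le> K' * \<epsilon> ^ (n - 2)"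
      by (meson order_trans)
  qed
  have "\<exists>K. \<forall>j\<in>?J. Far j K"
  proof (rule finite_uniform_bound[OF _ _ Far_mono])
    show "\<exists>K. Far j K" if j: "j \<in> ?J" for j
      unfolding Far_def cap_def n
      by (rule small_hole_far[OF dim potential[OF j] green_ext[OF j] unit[OF j] zero[OF j] \<rho>(1)])
  qed auto
  then obtain K5 where K5: "\<And>j. j \<in> ?J \<Longrightarrow> Far j K5" by blast
  have "\<exists>K. \<forall>j\<in>?J. 0 < K \<and> ball 0 (1 / K) \<subseteq> \<omega> j"
  proof (rule finite_uniform_bound)
    fix j assume "j \<in> ?J"
    then obtain e where "e > 0" "ball 0 e \<subseteq> \<omega> j" using omega_domain openE by metis
    then show "\<exists>K>0. ball 0 (1 / K) \<subseteq> \<omega> j" by (intro exI[of _ "1 / e"]) auto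
  next
    fix j and K K' :: real assume "0 < K \<and> ball 0 (1 / K) \<subseteq> \<omega> j" "K \<le> K'"
    moreover from this have "1 / K' \<le> 1 / K" by (intro divide_left_mono) auto
    ultimately show "0 < K' \<and> ball 0 (1 / K') \<subseteq> \<omega> j" using subset_ball[of "1 / K'" "1 / K" 0] by fastforce
  qed simp
  then obtain K6 where K6: "\<And>j. j \<in> ?J \<Longrightarrow> 0 < K6 \<and> ball 0 (1 / K6) \<subseteq> \<omega> j" by blast
  have K6pos: "0 < K6" using K6[of 1] N_pos by simp
  define LF where "LF = (real n - 2) * fund_coeff n / (\<rho> / 2) ^ (n - 1)"
  have LF: "LF \<ge> 0" using n_gt_2 fund_coeff_pos[OF n_gt_2] \<rho> by (simp add: LF_def)
  define K where "K = 1 + K1 + LF + \<bar>K2\<bar> + \<bar>K3\<bar> + \<bar>K4\<bar> + \<bar>K5\<bar>"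
  have K: "K \<ge> 1" "K1 \<le> K" "K2 \<le> K" "K3 \<le> K" "K4 \<le> K" "K5 \<le> K" "K1 + LF \<le> K"
    using K1pos LF by (auto simp: K_def)
  have subK: "ball b (1 / K) \<subseteq> ball b (1 / K1)" for b :: "real ^ 'n"
    using K(2) K1pos by (intro subset_ball divide_left_mono) auto
  have H_bound: "\<bar>H x y\<bar> \<le> K" if "j \<in> ?J" "y \<in> \<Omega>" "x \<in> ball (c j) (1 / K)" for j x y
    using K1(2)[OF that(1,2) subsetD[OF subK that(3)]] K(2) by linarith
  have H_lip1: "\<bar>H x y - H (c j) y\<bar> \<le> K1 * norm (x - c j)" if "j \<in> ?J" "y \<in> \<Omega>" "x \<in> ball (c j) (1 / K)" for j x y
    by (rule K1(3)[OF that(1,2) subsetD[OF subK that(3)]])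
  have H_lip: "\<bar>H x y - H (c j) y\<bar> \<le> K * norm (x - c j)" if "j \<in> ?J" "y \<in> \<Omega>" "x \<in> ball (c j) (1 / K)" for j x y
    using H_lip1[OF that] mult_right_mono[OF K(2) norm_ge_zero[of "x - c j"]] by linarith
  have G_lip: "\<bar>G (c k) (c j) - G x (c j)\<bar> \<le> K * norm (x - c k)"
    if j: "j \<in> ?J" and k: "k \<in> ?J" and jk: "j \<noteq> k" and x: "x \<in> ball (c k) (1 / K)"
      and xj: "\<rho> / 2 \<le> norm (x - c j)" and xk: "norm (x - c k) \<le> \<rho> / 2" for j k x
  proof -
    have ne: "x \<noteq> c j" "c k \<noteq> c j" using xj \<rho> sep[OF j k jk] by auto
    have Hd: "H x (c j) = ?F (x - c j) - G x (c j)" "H (c k) (c j) = ?F (c k - c j) - G (c k) (c j)"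
      using ne by (simp_all add: H_def regular_part_def)
    have "\<bar>?F (c k - c j) - ?F (x - c j)\<bar> \<le> LF * norm ((c k - c j) - (x - c j))"
      unfolding LF_def n
    proof (rule fundamental_solution_lipschitz[OF dim])
      fix w assume w: "w \<in> closed_segment (c k - c j) (x - c j)"
      have "norm (w - (c k - c j)) \<le> norm ((x - c j) - (c k - c j))" by (rule segment_bound1[OF w])
      then have "norm (w - (c k - c j)) \<le> \<rho> / 2" using xk by simp
      then show "\<rho> / 2 \<le> norm w"
        using norm_triangle_ineq2[of "c k - c j" "(c k - c j) - w"] sep[OF k j] jk
        by (simp add: norm_minus_commute)
    qed (use \<rho> in simp)
    then have "\<bar>?F (c k - c j) - ?F (x - c j)\<bar> \<le> LF * norm (x - c k)" by (simp add: norm_minus_commute)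
    moreover have "\<bar>H x (c j) - H (c k) (c j)\<bar> \<le> K1 * norm (x - c k)"
      by (rule H_lip1[OF k points(1)[OF j] x])
    moreover have "G (c k) (c j) - G x (c j) = (?F (c k - c j) - ?F (x - c j)) + (H x (c j) - H (c k) (c j))"
      unfolding Hd by simp
    ultimately have "\<bar>G (c k) (c j) - G x (c j)\<bar> \<le> (K1 + LF) * norm (x - c k)"
      unfolding distrib_right by linarith
    also have "\<dots> \<le> K * norm (x - c k)" using K(7) by (intro mult_right_mono) auto
    finally show ?thesis .
  qed
  define C where "C = real N * (K + K * K * K ^ (n - 2) + 2 * (K * K))
        + (4 * K + K * K * K + real N * (3 * K + K * (2 * K + real N * K) + K * K * K)) * 2 ^ (n - 2)"
  have C0: "C \<ge> 0" unfolding C_def using K(1) by auto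
  define \<epsilon>0 where "\<epsilon>0 = min (\<rho> / 12) (1 / (4 * K))"
  have \<epsilon>0: "\<epsilon>0 > 0" using \<rho> K(1) by (simp add: \<epsilon>0_def)
  let ?S = "\<lambda>\<epsilon> x y. \<Sum>j=1..N. \<epsilon> ^ (n - 1) / (min (norm (x - c j)) (norm (y - c j))) ^ (n - 2)"
  have main: "\<bar>G\<epsilon> \<epsilon> x y - A \<epsilon> x y\<bar> \<le> 2 * C * ?S \<epsilon> x y"
    if \<epsilon>: "0 < \<epsilon>" "\<epsilon> < \<epsilon>0" and ge: "green_function (\<Omega>\<epsilon> \<epsilon>) (G\<epsilon> \<epsilon>)"
      and x: "x \<in> \<Omega>\<epsilon> \<epsilon>" and y: "y \<in> \<Omega>\<epsilon> \<epsilon>" and xy: "x \<noteq> y" for \<epsilon> x y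
  proof -
    have e: "\<epsilon> \<le> \<rho> / 12" "\<epsilon> < 1 / (4 * K)" using \<epsilon>(2) by (auto simp: \<epsilon>0_def)
    have e1: "\<epsilon> \<le> 1" using e(1) \<rho> by linarith
    have e2: "2 * \<epsilon> < 1 / K"
    proof -
      have "2 * \<epsilon> < 2 * (1 / (4 * K))" using e(2) by simp
      also have "\<dots> \<le> 1 / K" using K(1) by (simp add: field_simps)
      finally show ?thesis .
    qed
    have D_eq: "\<Omega>\<epsilon> \<epsilon> = \<Omega> - (\<Union>j\<in>?J. {x. (1 / \<epsilon>) *\<^sub>R (x - c j) \<in> closure (\<omega> j)})"
      unfolding Omega_eps_def omega_eps_def closure_scaled_set[OF \<epsilon>(1)] ..
    have A_eq: "A \<epsilon> x y = G x y + (\<Sum>j=1..N. 1 / \<epsilon> ^ (n - 2) * g j ((1 / \<epsilon>) *\<^sub>R (x - c j)) ((1 / \<epsilon>) *\<^sub>R (y - c j))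
       - ?F (x - y)
       + (H (c j) y * P j ((1 / \<epsilon>) *\<^sub>R (x - c j))
            + H x (c j) * P j ((1 / \<epsilon>) *\<^sub>R (y - c j))
            - H (c j) (c j) * P j ((1 / \<epsilon>) *\<^sub>R (x - c j)) * P j ((1 / \<epsilon>) *\<^sub>R (y - c j))
            - \<epsilon> ^ (n - 2) * cap j * H x (c j) * H (c j) y)
       + (\<Sum>i\<in>{1..N} - {j}. G (c j) (c i) * P j ((1 / \<epsilon>) *\<^sub>R (x - c j)) * P i ((1 / \<epsilon>) *\<^sub>R (y - c i))))"
    proof -
      have "real N / (real (n - 2) * sphere_measure (sphere (0 :: real ^ 'n) 1) * norm (x - y) ^ (n - 2))
          = (\<Sum>j=1..N. ?F (x - y))"
        by (simp add: fundamental_solution_def n)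
      then show ?thesis
        unfolding A_def by (simp only: sum.distrib sum_subtractf sum_distrib_left)
    qed
    have far: "\<bar>?F (x - y) - 1 / \<epsilon> ^ (n - 2) * g j ((1 / \<epsilon>) *\<^sub>R (x - c j)) ((1 / \<epsilon>) *\<^sub>R (y - c j))
        - ?F (x - c j) * P j ((1 / \<epsilon>) *\<^sub>R (y - c j))\<bar> \<le> K * \<epsilon> * P j ((1 / \<epsilon>) *\<^sub>R (y - c j)) \<and>
     \<bar>P j ((1 / \<epsilon>) *\<^sub>R (x - c j)) - \<epsilon> ^ (n - 2) * cap j * ?F (x - c j)\<bar> \<le> K * \<epsilon> ^ (n - 1) \<and>
     P j ((1 / \<epsilon>) *\<^sub>R (x - c j)) \<le> K * \<epsilon> ^ (n - 2)"
      if "j \<in> ?J" "\<rho> / 2 \<le> norm (x - c j)" "x \<noteq> y"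
       "(1 / \<epsilon>) *\<^sub>R (x - c j) \<notin> closure (\<omega> j)" "(1 / \<epsilon>) *\<^sub>R (y - c j) \<notin> closure (\<omega> j)" for j x y
      using Far_mono[OF that(1) K5[OF that(1)] K(6)] that(2-5) \<epsilon>(1) e(1) unfolding Far_def by blast
    have G_bound: "\<bar>G (c j) (c k)\<bar> \<le> K" if "j \<in> ?J" "k \<in> ?J" for j k
      by (rule order_trans[OF K2[OF that] K(3)])
    have cap_bound: "\<bar>cap j\<bar> \<le> K" if "j \<in> ?J" for j by (rule order_trans[OF K3[OF that] K(4)])
    have diam: "norm (y - c j) \<le> K" if "j \<in> ?J" "y \<in> \<Omega>" for j y by (rule order_trans[OF K4[OF that] K(5)])
    show ?thesis
      unfolding A_eq unfolding n
      by (rule perforated_green_estimate[OF dim Omega_domain(1,4) points(1) green_Omega unit zero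
            green_ext potential \<epsilon>(1) e1 e(1) e2 D_eq ge K(1) \<rho> sep bdry H_def H_bound H_lip G_bound G_lip
            cap_bound diam far[unfolded n] C_def[unfolded n] x y xy])
  qed
  \<comment> \<open>The summands serve the three claims: the sum of the error terms is at most \<open>N K6^(n-2) \<epsilon>\<close> in all of
    \<open>\<Omega>\<^sub>\<epsilon>\<close>, and at most \<open>N 2^(n-2) \<epsilon>^(n-1)\<close> near \<open>\<partial>\<Omega>\<close>.\<close>
  define C' where "C' = 2 * C * (1 + real N * K6 ^ (n - 2) + real N * 2 ^ (n - 2)) + 1"
  have C'0: "C' > 0" using C0 K6pos by (auto simp: C'_def intro!: add_nonneg_pos mult_nonneg_nonneg add_nonneg_nonneg)
  have S0: "0 \<le> ?S \<epsilon> x y" if "0 < \<epsilon>" for \<epsilon> x y using that by (intro sum_nonneg) auto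
  have C'_ge: "2 * C \<le> C'" "2 * C * (real N * K6 ^ (n - 2)) \<le> C'" "2 * C * (real N * 2 ^ (n - 2)) \<le> C'"
  proof -
    have "0 \<le> 2 * C" "0 \<le> 2 * C * (real N * K6 ^ (n - 2))" "0 \<le> 2 * C * (real N * 2 ^ (n - 2))"
      using C0 K6pos by auto
    then show "2 * C \<le> C'" "2 * C * (real N * K6 ^ (n - 2)) \<le> C'" "2 * C * (real N * 2 ^ (n - 2)) \<le> C'"
      unfolding C'_def distrib_left by linarith+
  qed
  have S_le: "?S \<epsilon> x y \<le> real N * (\<epsilon> ^ (n - 1) / m ^ (n - 2))"
    if "0 < \<epsilon>" "0 < m" "\<And>j. j \<in> ?J \<Longrightarrow> m \<le> norm (x - c j)" "\<And>j. j \<in> ?J \<Longrightarrow> m \<le> norm (y - c j)" for \<epsilon> m x y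
  proof -
    have "?S \<epsilon> x y \<le> (\<Sum>j=1..N. \<epsilon> ^ (n - 1) / m ^ (n - 2))"
    proof (rule sum_mono)
      fix j assume "j \<in> ?J"
      then have "m \<le> min (norm (x - c j)) (norm (y - c j))" using that by simp
      then show "\<epsilon> ^ (n - 1) / min (norm (x - c j)) (norm (y - c j)) ^ (n - 2) \<le> \<epsilon> ^ (n - 1) / m ^ (n - 2)"
        using that(1,2) by (intro divide_left_mono power_mono mult_pos_pos zero_less_power) auto
    qed
    then show ?thesis by simp
  qed
  have "\<forall>\<^sub>F \<epsilon> in at_right 0. 0 < \<epsilon> \<and> \<epsilon> < \<epsilon>0"
    unfolding eventually_at_right_field using \<epsilon>0 by blast
  then have "\<forall>\<^sub>F \<epsilon> in at_right 0.
           (\<forall>x\<in>\<Omega>\<epsilon> \<epsilon>. \<forall>y\<in>\<Omega>\<epsilon> \<epsilon>. x \<noteq> y \<longrightarrow> \<bar>G\<epsilon> \<epsilon> x y - A \<epsilon> x y\<bar> \<le> C' * ?S \<epsilon> x y)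
         \<and> (\<forall>z w. z \<in> frontier (\<Union>j\<in>{1..N}. \<omega>\<epsilon> \<epsilon> j) \<or> w \<in> frontier (\<Union>j\<in>{1..N}. \<omega>\<epsilon> \<epsilon> j) \<longrightarrow>
              (\<forall>\<^sub>F (x, y) in inf (nhds z) (principal (\<Omega>\<epsilon> \<epsilon>)) \<times>\<^sub>F inf (nhds w) (principal (\<Omega>\<epsilon> \<epsilon>)).
                 x \<noteq> y \<longrightarrow> \<bar>G\<epsilon> \<epsilon> x y - A \<epsilon> x y\<bar> \<le> C' * \<epsilon>))
         \<and> (\<forall>z\<in>frontier \<Omega>. \<forall>w\<in>frontier \<Omega>.
              (\<forall>\<^sub>F (x, y) in inf (nhds z) (principal (\<Omega>\<epsilon> \<epsilon>)) \<times>\<^sub>F inf (nhds w) (principal (\<Omega>\<epsilon> \<epsilon>)).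
                 x \<noteq> y \<longrightarrow> \<bar>G\<epsilon> \<epsilon> x y - A \<epsilon> x y\<bar> \<le> C' * \<epsilon> ^ (n - 1)))"
    using green_eps
  proof eventually_elim
    case (elim \<epsilon>)
    then have \<epsilon>: "0 < \<epsilon>" "\<epsilon> < \<epsilon>0" by auto
    note est = main[OF \<epsilon> elim(2)]
    have away: "\<epsilon> / K6 \<le> norm (x - c j)" if "x \<in> \<Omega>\<epsilon> \<epsilon>" "j \<in> ?J" for x j
    proof -
      have "x \<notin> closure (\<omega>\<epsilon> \<epsilon> j)" using that unfolding Omega_eps_def by blast
      then have "(1 / \<epsilon>) *\<^sub>R (x - c j) \<notin> \<omega> j"
        using closure_subset[of "\<omega>\<epsilon> \<epsilon> j"] unfolding omega_eps_def by blast
      then have "(1 / \<epsilon>) *\<^sub>R (x - c j) \<notin> ball 0 (1 / K6)" using K6[OF that(2)] by blast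
      moreover have "norm ((1 / \<epsilon>) *\<^sub>R (x - c j)) = norm (x - c j) / \<epsilon>" using \<epsilon> by simp
      ultimately have "1 / K6 \<le> norm (x - c j) / \<epsilon>" unfolding mem_ball_0 by linarith
      then show ?thesis using \<epsilon> K6pos by (simp add: field_simps)
    qed
    have 1: "\<bar>G\<epsilon> \<epsilon> x y - A \<epsilon> x y\<bar> \<le> C' * ?S \<epsilon> x y" if "x \<in> \<Omega>\<epsilon> \<epsilon>" "y \<in> \<Omega>\<epsilon> \<epsilon>" "x \<noteq> y" for x y
      by (rule order_trans[OF est[OF that] mult_right_mono[OF C'_ge(1) S0[OF \<epsilon>(1)]]])
    have 2: "\<bar>G\<epsilon> \<epsilon> x y - A \<epsilon> x y\<bar> \<le> C' * \<epsilon>" if "x \<in> \<Omega>\<epsilon> \<epsilon>" "y \<in> \<Omega>\<epsilon> \<epsilon>" "x \<noteq> y" for x y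
    proof -
      have "?S \<epsilon> x y \<le> real N * (\<epsilon> ^ (n - 1) / (\<epsilon> / K6) ^ (n - 2))"
        by (rule S_le) (use \<epsilon> K6pos away that in auto)
      also have "\<epsilon> ^ (n - 1) / (\<epsilon> / K6) ^ (n - 2) = K6 ^ (n - 2) * \<epsilon>"
      proof -
        have "n - 1 = Suc (n - 2)" using n_gt_2 by simp
        then show ?thesis using \<epsilon> by (simp add: power_divide)
      qed
      finally have "2 * C * ?S \<epsilon> x y \<le> 2 * C * (real N * (K6 ^ (n - 2) * \<epsilon>))"
        using C0 by (intro mult_left_mono) auto
      also have "\<dots> = 2 * C * (real N * K6 ^ (n - 2)) * \<epsilon>" by simp
      also have "\<dots> \<le> C' * \<epsilon>" using C'_ge(2) \<epsilon> by (intro mult_right_mono) auto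
      finally show ?thesis using est[OF that] by linarith
    qed
    have 3: "\<bar>G\<epsilon> \<epsilon> x y - A \<epsilon> x y\<bar> \<le> C' * \<epsilon> ^ (n - 1)"
      if "x \<in> \<Omega>\<epsilon> \<epsilon>" "y \<in> \<Omega>\<epsilon> \<epsilon>" "x \<noteq> y" "\<forall>j\<in>?J. 1 / 2 < norm (x - c j)" "\<forall>j\<in>?J. 1 / 2 < norm (y - c j)" for x y
    proof -
      have "?S \<epsilon> x y \<le> real N * (\<epsilon> ^ (n - 1) / (1 / 2) ^ (n - 2))"
        by (rule S_le) (use \<epsilon> that in \<open>auto simp: less_imp_le\<close>)
      also have "\<dots> = real N * 2 ^ (n - 2) * \<epsilon> ^ (n - 1)" by (simp add: power_divide)
      finally have "2 * C * ?S \<epsilon> x y \<le> 2 * C * (real N * 2 ^ (n - 2) * \<epsilon> ^ (n - 1))"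
        using C0 by (intro mult_left_mono) auto
      also have "\<dots> = 2 * C * (real N * 2 ^ (n - 2)) * \<epsilon> ^ (n - 1)" by simp
      also have "\<dots> \<le> C' * \<epsilon> ^ (n - 1)" using C'_ge(3) \<epsilon> by (intro mult_right_mono) auto
      finally show ?thesis using est[OF that(1-3)] by linarith
    qed
    have inD: "\<forall>\<^sub>F x in inf (nhds z) (principal (\<Omega>\<epsilon> \<epsilon>)). x \<in> \<Omega>\<epsilon> \<epsilon>" for z
      unfolding eventually_inf_principal by simp
    have bd: "\<forall>\<^sub>F x in inf (nhds z) (principal (\<Omega>\<epsilon> \<epsilon>)). x \<in> \<Omega>\<epsilon> \<epsilon> \<and> (\<forall>j\<in>?J. 1 / 2 < norm (x - c j))"
      if z: "z \<in> frontier \<Omega>" for z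
    proof -
      have "\<forall>\<^sub>F x in nhds z. \<forall>j\<in>?J. 1 / 2 < norm (x - c j)"
      proof (intro eventually_ball_finite ballI)
        fix j assume j: "j \<in> ?J"
        have "((\<lambda>x. norm (x - c j)) \<longlongrightarrow> norm (z - c j)) (nhds z)"
          by (intro tendsto_intros filterlim_ident)
        then show "\<forall>\<^sub>F x in nhds z. 1 / 2 < norm (x - c j)"
          by (rule order_tendstoD(1)) (use bdry[OF j z] in simp)
      qed simp
      then show ?thesis unfolding eventually_inf_principal by (auto elim: eventually_mono)
    qed
    show ?case
    proof (intro conjI ballI allI impI)
      show "\<bar>G\<epsilon> \<epsilon> x y - A \<epsilon> x y\<bar> \<le> C' * ?S \<epsilon> x y" if "x \<in> \<Omega>\<epsilon> \<epsilon>" "y \<in> \<Omega>\<epsilon> \<epsilon>" "x \<noteq> y" for x y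
        by (rule 1[OF that])
      show "\<forall>\<^sub>F (x, y) in inf (nhds z) (principal (\<Omega>\<epsilon> \<epsilon>)) \<times>\<^sub>F inf (nhds w) (principal (\<Omega>\<epsilon> \<epsilon>)).
                 x \<noteq> y \<longrightarrow> \<bar>G\<epsilon> \<epsilon> x y - A \<epsilon> x y\<bar> \<le> C' * \<epsilon>" for z w
        unfolding eventually_prod_filter
        by (intro exI[of _ "\<lambda>x. x \<in> \<Omega>\<epsilon> \<epsilon>"] conjI inD) (use 2 in auto)
      show "\<forall>\<^sub>F (x, y) in inf (nhds z) (principal (\<Omega>\<epsilon> \<epsilon>)) \<times>\<^sub>F inf (nhds w) (principal (\<Omega>\<epsilon> \<epsilon>)).
                 x \<noteq> y \<longrightarrow> \<bar>G\<epsilon> \<epsilon> x y - A \<epsilon> x y\<bar> \<le> C' * \<epsilon> ^ (n - 1)"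
        if "z \<in> frontier \<Omega>" "w \<in> frontier \<Omega>" for z w
        unfolding eventually_prod_filter
        by (intro exI[of _ "\<lambda>x. x \<in> \<Omega>\<epsilon> \<epsilon> \<and> (\<forall>j\<in>?J. 1 / 2 < norm (x - c j))"] conjI bd that) (use 3 in auto)
    qed
  qed
  with C'0 show ?thesis by blast
qed

end
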